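(* Let $0<\epsilon_0<1$, $\Omega_{\epsilon_0}=B_1(\boldsymbol{0})\setminus B_{\epsilon_0}(\boldsymbol{0})\subset\mathbb{R}^2$, $1<p<2$, and let $\boldsymbol{u}(\boldsymbol{x})=\frac{r(|\boldsymbol{x}|)}{|\boldsymbol{x}|}\boldsymbol{x}$ be the radially symmetric cavity deformation on $\Omega_{\epsilon_0}$. There are positive constants $C_1,C_2$ depending on $r$ (the orientation-preservation constants) such that, if $\Omega_h=\bigcup_{i=0}^m\Omega^{\mathcal{J}_h}_{(\epsilon_i,\tau_i)}$ is a mesh produced with far field mesh size $h$ by the meshing strategy described in the context with these $C_1,C_2$, and $\Pi\boldsymbol{u}$ is the elementwise quadratic iso-parametric interpolation function of $\boldsymbol{u}$ on this mesh, then $$\det\nabla\Pi\boldsymbol{u}(\boldsymbol{x})>0\quad\text{a.e. on }\Omega_h.$$ Moreover, the error of the elastic energy satisfies $$E(\Pi\boldsymbol{u};\Omega_h)=\sum_{i=0}^mE(\Pi\boldsymbol{u};\Omega^{\mathcal{J}_h}_{(\epsilon_i,\tau_i)})=E(\boldsymbol{u};\Omega_{\epsilon_0})(1+O(h^2)),$$ where the constant in $O(\cdot)$ is independent of $h$, $\epsilon_i$, $\tau_i$ and $N_i$.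
   Context: Energy: $E(\boldsymbol{v};S)=\int_S\big(\omega|\nabla\boldsymbol{v}|^p+g(\det\nabla\boldsymbol{v})\big)d\boldsymbol{x}$, where $\omega>0$, $1<p<2$, and $g:(0,\infty)\to(0,\infty)$ is continuously differentiable and strictly convex with $g(d)\to+\infty$ as $d\to0$ and $g(d)/d\to+\infty$ as $d\to+\infty$. Cavity deformation: $\boldsymbol{u}(\boldsymbol{x})=\frac{r(|\boldsymbol{x}|)}{|\boldsymbol{x}|}\boldsymbol{x}$, where $r$ is defined on $(0,1]$ and is smooth, positive, increasing and convex, with $r^{(j)}$ bounded for $j=0,1,2,3$, $\inf_{R\in(0,1]}r(R)>0$, and $mR\le r'(R)\le MR$ for some constants $0<m<M$. Reference element: $\hat T=\{(\hat x_1,\hat x_2):\hat x_1,\hat x_2\ge 0,\ \hat x_1+\hat x_2\le 1\}$, with barycentric coordinates $\hat\lambda_1=1-\hat x_1-\hat x_2$, $\hat\lambda_2=\hat x_1$, $\hat\lambda_3=\hat x_2$, and quadratic shape functions $\hat\mu_i=\hat\lambda_i(2\hat\lambda_i-1)$ ($1\le i\le 3$), $\hat\mu_{ij}=4\hat\lambda_i\hat\lambda_j$ ($1\le i<j\le 3$). Given points $\boldsymbol{a}_i,\boldsymbol{a}_{ij}\in\mathbb{R}^2$, the quadratic map is $F_T(\hat{\boldsymbol{x}})=\sum_{i=1}^3\boldsymbol{a}_i\hat\mu_i(\hat{\boldsymbol{x}})+\sum_{1\le i<j\le3}\boldsymbol{a}_{ij}\hat\mu_{ij}(\hat{\boldsymbol{x}})$,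 and $T=F_T(\hat T)$ is a curved triangular element. Interpolation: on each element $T$, for $\boldsymbol{x}=F_T(\hat{\boldsymbol{x}})$, $\Pi\boldsymbol{u}(\boldsymbol{x})=\sum_{i=1}^3\boldsymbol{u}(\boldsymbol{a}_i)\hat\mu_i(\hat{\boldsymbol{x}})+\sum_{1\le i<j\le3}\boldsymbol{u}(\boldsymbol{a}_{ij})\hat\mu_{ij}(\hat{\boldsymbol{x}})$. Representative elements with parameters $(\epsilon,\tau,N)$: for $t>0$ and $\alpha\in\mathbb{R}$ write $P(t,\alpha)=t(\cos\alpha,\sin\alpha)$, and put $t_0=\epsilon$, $t_{1/2}=\epsilon+\tau/2$, $t_1=\epsilon+\tau$. Type A: $\boldsymbol{a}_1=P(t_0,0)$, $\boldsymbol{a}_2=P(t_1,-\frac{\pi}{N})$, $\boldsymbol{a}_3=P(t_1,\frac{\pi}{N})$, $\boldsymbol{a}_{12}=P(t_{1/2},-\frac{\pi}{2N})$, $\boldsymbol{a}_{13}=P(t_{1/2},\frac{\pi}{2N})$, $\boldsymbol{a}_{23}=P(t_1,0)$. Type B: $\boldsymbol{a}_1=P(t_1,0)$, $\boldsymbol{a}_2=P(t_0,\frac{\pi}{N})$, $\boldsymbol{a}_3=P(t_0,-\frac{\pi}{N})$, $\boldsymbol{a}_{12}=P(t_{1/2},\frac{\pi}{2N})$, $\boldsymbol{a}_{13}=P(t_{1/2},-\frac{\pi}{2N})$, $\boldsymbol{a}_{23}=P(t_0,0)$. Type C: $\boldsymbol{a}_1=P(t_0,0)$, $\boldsymbol{a}_2=P(t_1,0)$,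 $\boldsymbol{a}_3=P(t_0,\frac{\pi}{N})$, $\boldsymbol{a}_{12}=P(t_{1/2},0)$, $\boldsymbol{a}_{13}=P(t_0,\frac{\pi}{2N})$, $\boldsymbol{a}_{23}=P(t_{1/2},\frac{\pi}{2N})$. Type D: $\boldsymbol{a}_1=P(t_0,0)$, $\boldsymbol{a}_2=P(t_0,-\frac{\pi}{N})$, $\boldsymbol{a}_3=P(t_1,0)$, $\boldsymbol{a}_{12}=P(t_0,-\frac{\pi}{2N})$, $\boldsymbol{a}_{13}=P(t_{1/2},0)$, $\boldsymbol{a}_{23}=P(t_{1/2},-\frac{\pi}{2N})$. Layers: a standard layer with parameters $(\epsilon,\tau,N)$ consists (up to a common rotation) of the $N$ rotations by $\frac{2\pi j}{N}$ of the representative A element and the $N$ rotations by $\frac{\pi}{N}+\frac{2\pi j}{N}$ of the representative B element, $j=0,\dots,N-1$. A conforming layer is the same with each B element replaced by the pair consisting of the C and the D element rotated by the same angle (i.e. B is split in the middle along the radial direction; the layer then has $2N$ vertices on its inner circle and $N$ on its outer circle). $\Omega^{\mathcal{J}_h}_{(\epsilon_i,\tau_i)}$ denotes the $i$-th layer, with parameters $(\epsilon_i,\tau_i,N_i)$ (also the union of its elements); successive layers are rotated so that their nodes on the common circle match. Meshing strategy. Define $d(x,h)=(x^{2-p}+Ch)^{\frac1{2-p}}-x$. Given positive constants $C_1,C_2$; $C\ge(2-p)2^{p-1}$; $0<h\le\min\{\frac{2-p}{2^{2-p}C},\frac{2-p}{2^{p-1}C}\}$; and $0<A_1<A_2$ with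 $[(A_2h)^{-1},(A_1h)^{-1}]\cap\mathbb{Z}_+\ne\emptyset$: (1) Set $\tau_0=\min\{C_1\epsilon_0^{1/2},d(\epsilon_0,h)\}$. Take $\tilde N_m\in[(A_2h)^{-1},(A_1h)^{-1}]\cap\mathbb{Z}_+$. Let $\bar N_0=\min\{N\in\mathbb{Z}_+:N^{-1}\le\min\{C_2(\epsilon_0\tau_0)^{1/4},(C^2\tau_0h^2)^{1/4}\}\}$. Set $k=\min\{j:2^j\tilde N_m\ge\bar N_0\}$ and $N_0=2^k\tilde N_m$. (2) Set $k_0=0$. For $i\ge1$, set $\epsilon_i=\epsilon_{i-1}+\tau_{i-1}$ and $\tau_i=\min\{1-\epsilon_i,C_1\epsilon_i^{1/2},d(\epsilon_i,h)\}$. If $\tau_i=1-\epsilon_i$, set $m=i$ (the last layer). $N_i$ is determined as follows. If $k_{i-1}<k$, set $\bar N_i=N_{i-1}/2$; if $\bar N_i^{-1}\le\min\{C_2(\epsilon_i\tau_i)^{1/4},(C^2\tau_ih^2)^{1/4}\}$, set $k_i=k_{i-1}+1$, $N_i=\bar N_i$; otherwise set $k_i=k_{i-1}$, $N_i=N_{i-1}$. If $k_{i-1}=k$, set $k_i=k_{i-1}$, $N_i=N_{i-1}$. (3) All layers are standard, except that whenever $N_i=2N_{i+1}$ occurs, each type B element in the layer with parameters $(\epsilon_{i+1},\tau_{i+1},N_{i+1})$ is divided into a pair of elements of types C and D (so that this layer is a conforming layer).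
   Formalization: The last layer is also required to satisfy N_m^{-1} ≤ C_2(ε_mτ_m)^{1/4}, since a very thin truncated last layer can make det∇Πu negative; all τ_i are required positive, which excludes ε_0+τ_0>1, where the strategy yields no mesh. *)

theory Defs
  imports "HOL-Analysis.Analysis"
begin

section \<open>Elastic energy\<close>

definition strictly_convex_on :: "real set \<Rightarrow> (real \<Rightarrow> real) \<Rightarrow> bool" where
  "strictly_convex_on S f \<longleftrightarrow> convex S \<and>
     (\<forall>x\<in>S. \<forall>y\<in>S. \<forall>t. x \<noteq> y \<and> 0 < t \<and> t < 1 \<longrightarrow>
        f ((1 - t) * x + t * y) < (1 - t) * f x + t * f y)"

text \<open>Only the values of \<open>g\<close> on the positive half line are constrained.\<close>

definition stored_energy_function :: "(real \<Rightarrow> real) \<Rightarrow> bool" where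
  "stored_energy_function g \<longleftrightarrow>
     (\<forall>d>0. g d > 0) \<and>
     (\<exists>g'. (\<forall>d>0. (g has_real_derivative g' d) (at d)) \<and> continuous_on {0<..} g') \<and>
     strictly_convex_on {0<..} g \<and>
     filterlim g at_top (at_right 0) \<and>
     filterlim (\<lambda>d. g d / d) at_top at_top"

text \<open>The norm of the Jacobian matrix is the norm of type \<open>real ^ 2 ^ 2\<close>, i.e. the
  Frobenius norm.\<close>

definition energy_density ::
    "real \<Rightarrow> real \<Rightarrow> (real \<Rightarrow> real) \<Rightarrow> (real ^ 2 \<Rightarrow> real ^ 2) \<Rightarrow> real ^ 2 \<Rightarrow> real" where
  "energy_density p \<omega> g v x =
     \<omega> * norm (jacobian v (at x)) powr p + g (det (jacobian v (at x)))"

definition energy ::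
    "real \<Rightarrow> real \<Rightarrow> (real \<Rightarrow> real) \<Rightarrow> (real ^ 2 \<Rightarrow> real ^ 2) \<Rightarrow> (real ^ 2) set \<Rightarrow> real" where
  "energy p \<omega> g v S = (LINT x:S|lebesgue. energy_density p \<omega> g v x)"

definition finite_energy ::
    "real \<Rightarrow> real \<Rightarrow> (real \<Rightarrow> real) \<Rightarrow> (real ^ 2 \<Rightarrow> real ^ 2) \<Rightarrow> (real ^ 2) set \<Rightarrow> bool" where
  "finite_energy p \<omega> g v S \<longleftrightarrow> set_integrable lebesgue S (energy_density p \<omega> g v)"


section \<open>The cavity deformation\<close>

text \<open>\<open>D j\<close> is the \<open>j\<close>-th derivative of \<open>r\<close> on \<open>(0,1]\<close>; at the end point \<open>1\<close> it is one-sided,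
  since \<open>r\<close> is only given on \<open>(0,1]\<close>.\<close>

definition cavity_profile :: "(real \<Rightarrow> real) \<Rightarrow> bool" where
  "cavity_profile r \<longleftrightarrow>
     (\<exists>D :: nat \<Rightarrow> real \<Rightarrow> real.
        (\<forall>R\<in>{0<..1}. D 0 R = r R) \<and>
        (\<forall>j. \<forall>R\<in>{0<..1}. (D j has_real_derivative D (Suc j) R) (at R within {0<..1})) \<and>
        (\<forall>j\<le>3. bounded (D j ` {0<..1})) \<and>
        (\<exists>m M. 0 < m \<and> m < M \<and> (\<forall>R\<in>{0<..1}. m * R \<le> D 1 R \<and> D 1 R \<le> M * R))) \<and>
     (\<forall>R\<in>{0<..1}. 0 < r R) \<and>
     mono_on {0<..1} r \<and>
     convex_on {0<..1} r \<and>
     (INF R\<in>{0<..1}. r R) > 0"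

definition cavity_deformation :: "(real \<Rightarrow> real) \<Rightarrow> real ^ 2 \<Rightarrow> real ^ 2" where
  "cavity_deformation r x = (r (norm x) / norm x) *\<^sub>R x"

definition annulus :: "real \<Rightarrow> (real ^ 2) set" where
  "annulus \<epsilon> = ball 0 1 - ball 0 \<epsilon>"


section \<open>Quadratic iso-parametric elements\<close>

text \<open>An element is given by its six nodes: the vertices \<open>a1, a2, a3\<close> and the edge nodes
  \<open>a12, a13, a23\<close>. The type parameter provides \<open>map_element\<close>, which applies a function
  to every node.\<close>

datatype 'p element =
  Element (a1: 'p) (a2: 'p) (a3: 'p) (a12: 'p) (a13: 'p) (a23: 'p)

definition ref_triangle :: "(real ^ 2) set" where
  "ref_triangle = {\<xi>. 0 \<le> \<xi> $ 1 \<and> 0 \<le> \<xi> $ 2 \<and> \<xi> $ 1 + \<xi> $ 2 \<le> 1}"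

definition bary :: "nat \<Rightarrow> real ^ 2 \<Rightarrow> real" where
  "bary i \<xi> = (if i = 1 then 1 - \<xi> $ 1 - \<xi> $ 2 else if i = 2 then \<xi> $ 1 else \<xi> $ 2)"

definition vertex_shape :: "nat \<Rightarrow> real ^ 2 \<Rightarrow> real" where
  "vertex_shape i \<xi> = bary i \<xi> * (2 * bary i \<xi> - 1)"

definition edge_shape :: "nat \<Rightarrow> nat \<Rightarrow> real ^ 2 \<Rightarrow> real" where
  "edge_shape i j \<xi> = 4 * bary i \<xi> * bary j \<xi>"

definition quad_map :: "(real ^ 2) element \<Rightarrow> real ^ 2 \<Rightarrow> real ^ 2" where
  "quad_map T \<xi> =
     vertex_shape 1 \<xi> *\<^sub>R a1 T + vertex_shape 2 \<xi> *\<^sub>R a2 T + vertex_shape 3 \<xi> *\<^sub>R a3 T +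
     edge_shape 1 2 \<xi> *\<^sub>R a12 T + edge_shape 1 3 \<xi> *\<^sub>R a13 T + edge_shape 2 3 \<xi> *\<^sub>R a23 T"

definition element_region :: "(real ^ 2) element \<Rightarrow> (real ^ 2) set" where
  "element_region T = quad_map T ` ref_triangle"

definition region :: "(real ^ 2) element set \<Rightarrow> (real ^ 2) set" where
  "region \<T> = (\<Union>T\<in>\<T>. element_region T)"

text \<open>The choice only matters at points with several representations \<open>x = F\<^sub>T(\<xi>)\<close>; in a
  conforming mesh these lie on element edges, where the interpolants agree.\<close>

definition iso_interp ::
    "(real ^ 2) element set \<Rightarrow> (real ^ 2 \<Rightarrow> real ^ 2) \<Rightarrow> real ^ 2 \<Rightarrow> real ^ 2" where
  "iso_interp \<T> u x =
     (SOME y. \<exists>T\<in>\<T>. \<exists>\<xi>\<in>ref_triangle. x = quad_map T \<xi> \<and> y = quad_map (map_element u T) \<xi>)"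


section \<open>Representative elements and layers\<close>

definition polar :: "real \<Rightarrow> real \<Rightarrow> real ^ 2" where
  "polar t \<alpha> = t *\<^sub>R vector [cos \<alpha>, sin \<alpha>]"

definition type_A :: "real \<Rightarrow> real \<Rightarrow> nat \<Rightarrow> (real ^ 2) element" where
  "type_A \<epsilon> \<tau> N = (let \<theta> = pi / real N; t0 = \<epsilon>; th = \<epsilon> + \<tau> / 2; t1 = \<epsilon> + \<tau> in
     Element (polar t0 0) (polar t1 (- \<theta>)) (polar t1 \<theta>)
             (polar th (- \<theta> / 2)) (polar th (\<theta> / 2)) (polar t1 0))"

definition type_B :: "real \<Rightarrow> real \<Rightarrow> nat \<Rightarrow> (real ^ 2) element" where
  "type_B \<epsilon> \<tau> N = (let \<theta> = pi / real N; t0 = \<epsilon>; th = \<epsilon> + \<tau> / 2; t1 = \<epsilon> + \<tau> in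
     Element (polar t1 0) (polar t0 \<theta>) (polar t0 (- \<theta>))
             (polar th (\<theta> / 2)) (polar th (- \<theta> / 2)) (polar t0 0))"

definition type_C :: "real \<Rightarrow> real \<Rightarrow> nat \<Rightarrow> (real ^ 2) element" where
  "type_C \<epsilon> \<tau> N = (let \<theta> = pi / real N; t0 = \<epsilon>; th = \<epsilon> + \<tau> / 2; t1 = \<epsilon> + \<tau> in
     Element (polar t0 0) (polar t1 0) (polar t0 \<theta>)
             (polar th 0) (polar t0 (\<theta> / 2)) (polar th (\<theta> / 2)))"

definition type_D :: "real \<Rightarrow> real \<Rightarrow> nat \<Rightarrow> (real ^ 2) element" where
  "type_D \<epsilon> \<tau> N = (let \<theta> = pi / real N; t0 = \<epsilon>; th = \<epsilon> + \<tau> / 2; t1 = \<epsilon> + \<tau> in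
     Element (polar t0 0) (polar t0 (- \<theta>)) (polar t1 0)
             (polar t0 (- \<theta> / 2)) (polar th 0) (polar th (- \<theta> / 2)))"

definition rotate_point :: "real \<Rightarrow> real ^ 2 \<Rightarrow> real ^ 2" where
  "rotate_point \<phi> x =
     vector [cos \<phi> * x $ 1 - sin \<phi> * x $ 2, sin \<phi> * x $ 1 + cos \<phi> * x $ 2]"

definition rotate_element :: "real \<Rightarrow> (real ^ 2) element \<Rightarrow> (real ^ 2) element" where
  "rotate_element \<phi> = map_element (rotate_point \<phi>)"

text \<open>The last argument \<open>\<rho>\<close> is the common rotation of the layer.\<close>

definition standard_layer :: "real \<Rightarrow> real \<Rightarrow> nat \<Rightarrow> real \<Rightarrow> (real ^ 2) element set" where
  "standard_layer \<epsilon> \<tau> N \<rho> =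
     (\<Union>j<N. {rotate_element (\<rho> + 2 * pi * real j / real N) (type_A \<epsilon> \<tau> N),
             rotate_element (\<rho> + pi / real N + 2 * pi * real j / real N) (type_B \<epsilon> \<tau> N)})"

definition conforming_layer :: "real \<Rightarrow> real \<Rightarrow> nat \<Rightarrow> real \<Rightarrow> (real ^ 2) element set" where
  "conforming_layer \<epsilon> \<tau> N \<rho> =
     (\<Union>j<N. {rotate_element (\<rho> + 2 * pi * real j / real N) (type_A \<epsilon> \<tau> N),
             rotate_element (\<rho> + pi / real N + 2 * pi * real j / real N) (type_C \<epsilon> \<tau> N),
             rotate_element (\<rho> + pi / real N + 2 * pi * real j / real N) (type_D \<epsilon> \<tau> N)})"

definition mesh_layer ::
    "(nat \<Rightarrow> real) \<Rightarrow> (nat \<Rightarrow> real) \<Rightarrow> (nat \<Rightarrow> nat) \<Rightarrow> (nat \<Rightarrow> real) \<Rightarrow> nat \<Rightarrow> (real ^ 2) element set"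
  where
  "mesh_layer \<epsilon> \<tau> N \<rho> i =
     (if 0 < i \<and> N (i - 1) = 2 * N i
      then conforming_layer (\<epsilon> i) (\<tau> i) (N i) (\<rho> i)
      else standard_layer (\<epsilon> i) (\<tau> i) (N i) (\<rho> i))"

definition vertices_on_circle :: "(real ^ 2) element set \<Rightarrow> real \<Rightarrow> (real ^ 2) set" where
  "vertices_on_circle \<T> t = {a. norm a = t \<and> (\<exists>T\<in>\<T>. a \<in> {a1 T, a2 T, a3 T})}"


section \<open>The meshing strategy\<close>

definition far_step :: "real \<Rightarrow> real \<Rightarrow> real \<Rightarrow> real \<Rightarrow> real" where
  "far_step p C x h = (x powr (2 - p) + C * h) powr (1 / (2 - p)) - x"

definition angular_bound :: "real \<Rightarrow> real \<Rightarrow> real \<Rightarrow> real \<Rightarrow> real \<Rightarrow> real" where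
  "angular_bound C C2 h \<epsilon> \<tau> =
     min (C2 * (\<epsilon> * \<tau>) powr (1 / 4)) ((C\<^sup>2 * \<tau> * h\<^sup>2) powr (1 / 4))"

text \<open>The data \<open>m, \<epsilon>, \<tau>, N\<close> are produced by the strategy from \<open>\<epsilon>0\<close> and \<open>h\<close>. Here
  \<open>Nm\<close> is the far field angular number, \<open>k\<close> the number of prescribed halvings and
  \<open>\<kappa> i\<close> the number of halvings performed up to layer \<open>i\<close>. The division by \<open>2\<close>
  is exact, because it is only performed while \<open>\<kappa> (i - 1) < k\<close>.

  The last two lines concern the validity of the result. If \<open>\<epsilon>0 + \<tau> 0 > 1\<close>, the rules
  produce no mesh of the annulus (\<open>\<tau> 1\<close> is negative). The rules test the orientation
  preservation bound \<open>1 / N \<le> C2 (\<epsilon> \<tau>)\<^bsup>1/4\<^esup>\<close> for the first layer and whenever \<open>N\<close> is halved, and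
  it persists as \<open>\<epsilon>\<close> and \<open>\<tau>\<close> grow. Only the last layer, which is truncated at radius \<open>1\<close>,
  can be so thin that it escapes, with \<open>N\<close> inherited from the previous layer; its elements
  may then fold over, and the interpolant does not preserve orientation. Hence the bound is
  required for this layer too, in addition to the rules proper.\<close>

definition strategy_parameters ::
    "real \<Rightarrow> real \<Rightarrow> real \<Rightarrow> real \<Rightarrow> real \<Rightarrow> real \<Rightarrow> real \<Rightarrow> real \<Rightarrow>
     nat \<Rightarrow> (nat \<Rightarrow> real) \<Rightarrow> (nat \<Rightarrow> real) \<Rightarrow> (nat \<Rightarrow> nat) \<Rightarrow> bool" where
  "strategy_parameters p C C1 C2 A1 A2 h \<epsilon>0 m \<epsilon> \<tau> N \<longleftrightarrow>
     (\<exists>Nm k \<kappa>.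
        \<epsilon> 0 = \<epsilon>0 \<and>
        \<tau> 0 = min (C1 * sqrt \<epsilon>0) (far_step p C \<epsilon>0 h) \<and>
        0 < Nm \<and> real Nm \<in> {1 / (A2 * h)..1 / (A1 * h)} \<and>
        k = (LEAST j. (LEAST n. 0 < n \<and> 1 / real n \<le> angular_bound C C2 h \<epsilon>0 (\<tau> 0)) \<le> 2 ^ j * Nm) \<and>
        N 0 = 2 ^ k * Nm \<and> \<kappa> 0 = (0 :: nat) \<and>
        (\<forall>i\<in>{1..m}.
           \<epsilon> i = \<epsilon> (i - 1) + \<tau> (i - 1) \<and>
           \<tau> i = min (1 - \<epsilon> i) (min (C1 * sqrt (\<epsilon> i)) (far_step p C (\<epsilon> i) h)) \<and>
           (if \<kappa> (i - 1) < k \<and>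
               1 / real (N (i - 1) div 2) \<le> angular_bound C C2 h (\<epsilon> i) (\<tau> i)
            then \<kappa> i = \<kappa> (i - 1) + 1 \<and> N i = N (i - 1) div 2
            else \<kappa> i = \<kappa> (i - 1) \<and> N i = N (i - 1))) \<and>
        (\<forall>i<m. \<tau> i \<noteq> 1 - \<epsilon> i) \<and> \<tau> m = 1 - \<epsilon> m) \<and>
     (\<forall>i\<le>m. 0 < \<tau> i) \<and>
     1 / real (N m) \<le> C2 * (\<epsilon> m * \<tau> m) powr (1 / 4)"

text \<open>Matching is expressed by the vertices only: if the vertices of two successive layers
  coincide on the common circle, so do the edge nodes, whereas the sets of all nodes could
  also coincide with vertices and edge nodes interchanged.\<close>

definition strategy_mesh ::
    "real \<Rightarrow> real \<Rightarrow> real \<Rightarrow> real \<Rightarrow> real \<Rightarrow> real \<Rightarrow> real \<Rightarrow> real \<Rightarrow>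
     nat \<Rightarrow> (nat \<Rightarrow> real) \<Rightarrow> (nat \<Rightarrow> real) \<Rightarrow> (nat \<Rightarrow> nat) \<Rightarrow> (nat \<Rightarrow> real) \<Rightarrow> bool" where
  "strategy_mesh p C C1 C2 A1 A2 h \<epsilon>0 m \<epsilon> \<tau> N \<rho> \<longleftrightarrow>
     strategy_parameters p C C1 C2 A1 A2 h \<epsilon>0 m \<epsilon> \<tau> N \<and>
     (\<forall>i<m. vertices_on_circle (mesh_layer \<epsilon> \<tau> N \<rho> i) (\<epsilon> (Suc i)) =
            vertices_on_circle (mesh_layer \<epsilon> \<tau> N \<rho> (Suc i)) (\<epsilon> (Suc i)))"

end

theory Submission
  imports Defs
begin

text \<open>Each mesh element is a quadratic Lagrange interpolant of polar coordinates. Use strip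
  coordinates (s, \<sigma>) with s in [0, 1] and put \<theta> = pi / N. The types A, B, C, D are
  straight triangles in this strip, with nodes at vertices and edge midpoints. The element map F is
  an affine map onto such a triangle followed by quadratic interpolation of
  \<open>polar (t0 + \<tau> * s) (\<phi> + \<theta> * \<sigma>)\<close>; the interpolant of u,
  composed with F, interpolates
  \<open>polar (r (t0 + \<tau> * s)) (\<phi> + \<theta> * \<sigma>)\<close> on the same triangle.
  Quadratic interpolation is exact on quadratic polynomials and stable, so Taylor expansion in the
  angle and of r yields explicit errors (\<open>element_estimates\<close>). With t = t0 + \<tau> s,
  and after division by \<tau> \<theta>, the determinant of the element map is close to t, that of
  the interpolant is close to r'(t) r(t), and the squared norm of the matrix product that gives the
  gradient is close to (t r'(t))^2 + r(t)^2. If C1 and C2 are small compared with constants of r,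
  these errors are at most half of the lower bounds of the determinants, and orientation is
  preserved.

  For this to say something about the interpolant on the mesh, interior points of elements must have
  only one representation (\<open>mesh_unique\<close>). The radius and the lifted angle of F differ
  from \<tau> s and \<theta> \<sigma> by functions with Lipschitz constants \<tau> / 8 and \<theta>
  / 8. Adjacent elements agree on their common edge, so the bound continues along segments through a
  whole layer, seen as a periodic chain of triangles on the universal cover
  (\<open>chain_lipschitz\<close>, \<open>layer_lipschitz\<close>). Hence a layer is injective up to
  full turns, and on each ray the radius increases with s. Since the vertices match, successive
  layers share a boundary curve made of quadratic arcs; points of different layers on one ray lie on
  different sides of such a curve.

  A change of variables now turns the energy of the interpolant into a sum of integrals of
  \<open>ref_density\<close> over the reference triangle. Pointwise this density is that of the
  exact deformation, a function of t alone, up to a multiple of \<open>layer_error\<close>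
  (\<open>density_estimate\<close>). Integrals of functions of t over the triangles of a layer add
  up exactly to 2 pi times a radial integral (\<open>element_integral\<close>), and the exact energy
  is such a radial integral too (\<open>cavity_energy\<close>). Only the integrals of
  \<open>layer_error\<close> are left.

  The strategy gives \<tau> = O(h), \<theta> = O(h) and \<theta>^4 / \<tau> = O(h^2), which settles
  all terms but two. The last layer may have inherited N, and then its term is charged to the layer
  before it. In a layer with \<epsilon> < \<tau> the weight t^(-p) is not dominated by t^(1-p) /
  \<tau>; there \<tau>^(2-p) = O(h), \<theta>^2 = O(sqrt (\<epsilon> \<tau>)) and \<tau>^2 \<le>
  \<epsilon> help (\<open>thick_layer_error\<close>). The total error is O(h^2 (1 - \<epsilon>0)) by
  \<open>layer_error_sum\<close>, whereas the exact energy is at least a constant times 1 -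
  \<epsilon>0. The quotient is O(h^2) uniformly in \<epsilon>0 and the mesh.\<close>

section \<open>Integration in the plane: change of variables, slices, polar coordinates\<close>

lemma has_absolute_integral_change_of_variables_real:
  fixes f :: "real ^ 2 \<Rightarrow> real" and g :: "real ^ 2 \<Rightarrow> real ^ 2"
  assumes S: "S \<in> sets lebesgue"
    and der: "\<And>x. x \<in> S \<Longrightarrow> (g has_derivative g' x) (at x within S)"
    and inj: "inj_on g S"
    and int: "set_integrable lebesgue S (\<lambda>x. \<bar>det (matrix (g' x))\<bar> * f (g x))"
  shows "set_integrable lebesgue (g ` S) f"
    and "(LINT x:g ` S|lebesgue. f x) = (LINT x:S|lebesgue. \<bar>det (matrix (g' x))\<bar> * f (g x))"
proof -
  let ?h = "\<lambda>x. \<bar>det (matrix (g' x))\<bar> * f (g x)"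
  \<comment> \<open>Real-valued functions are identified with functions into
    \<open>real ^ 1\<close>, so that the vector-valued formula applies.\<close>
  have "(\<lambda>x. \<bar>det (matrix (g' x))\<bar> *\<^sub>R (vec (f (g x)) :: real ^ 1)) absolutely_integrable_on S"
    using int by (subst absolutely_integrable_on_1_iff) simp
  moreover have "integral S (\<lambda>x. \<bar>det (matrix (g' x))\<bar> *\<^sub>R (vec (f (g x)) :: real ^ 1)) = vec (integral S ?h)"
    by (subst integral_on_1_eq) simp
  ultimately have "(\<lambda>x. vec (f x) :: real ^ 1) absolutely_integrable_on (g ` S) \<and>
      integral (g ` S) (\<lambda>x. vec (f x) :: real ^ 1) = vec (integral S ?h)"
    using has_absolute_integral_change_of_variables[OF S der inj, of "\<lambda>x. vec (f x) :: real ^ 1"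
        "vec (integral S ?h)"] by blast
  then have *: "f absolutely_integrable_on (g ` S)" "integral (g ` S) f = integral S ?h"
    by (simp_all add: absolutely_integrable_on_1_iff integral_on_1_eq)
  then show "set_integrable lebesgue (g ` S) f" by simp
  show "(LINT x:g ` S|lebesgue. f x) = (LINT x:S|lebesgue. ?h x)"
    using * int by (simp add: set_lebesgue_integral_eq_integral)
qed

lemma det_matrix_2:
  "det (matrix f :: real ^ 2 ^ 2) = f (axis 1 1) $ 1 * f (axis 2 1) $ 2 - f (axis 2 1) $ 1 * f (axis 1 1) $ 2"
  by (simp add: det_2 matrix_def)

definition pair_of_vec :: "real ^ 2 \<Rightarrow> real \<times> real" where
  "pair_of_vec x = (x $ 1, x $ 2)"

lemma pair_of_vec_measurable [measurable]: "pair_of_vec \<in> borel_measurable borel"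
  unfolding pair_of_vec_def by (intro borel_measurable_continuous_onI continuous_intros)

text \<open>Lebesgue measure is determined by the volumes of boxes, and the coordinate map preserves
  these. This is what gives access to Fubini on \<open>real ^ 2\<close>.\<close>

lemma distr_pair_of_vec: "distr lborel lborel pair_of_vec = (lborel :: (real \<times> real) measure)"
proof (rule lborel_eqI[symmetric])
  fix l u :: "real \<times> real" assume le: "\<And>b. b \<in> Basis \<Longrightarrow> l \<bullet> b \<le> u \<bullet> b"
  obtain l1 l2 u1 u2 where lu: "l = (l1, l2)" "u = (u1, u2)" by (cases l, cases u) auto
  have le': "l1 \<le> u1" "l2 \<le> u2"
    using le[of "(1, 0)"] le[of "(0, 1)"] by (auto simp: lu Basis_prod_def)
  have "pair_of_vec -` box l u = box (vector [l1, l2]) (vector [u1, u2])"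
    by (auto simp: pair_of_vec_def lu mem_box_cart mem_box Basis_prod_def forall_2)
  then have "emeasure (distr lborel lborel pair_of_vec) (box l u) =
      emeasure lborel (box (vector [l1, l2]) (vector [u1, u2]) :: (real ^ 2) set)"
    by (subst emeasure_distr) auto
  also have "\<dots> = ennreal (\<Prod>b\<in>Basis. (u - l) \<bullet> b)"
    using le' by (subst emeasure_lborel_box)
      (auto simp: Basis_vec_def inner_axis lu Basis_prod_def axis_eq_axis UNION_singleton_eq_range
        prod.reindex inj_on_def UNIV_2 exhaust_2 forall_2)
  finally show "emeasure (distr lborel lborel pair_of_vec) (box l u) = ennreal (\<Prod>b\<in>Basis. (u - l) \<bullet> b)" .
qed simp


lemma set_integrable_lebesgue_continuous:
  fixes h :: "real ^ 2 \<Rightarrow> real"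
  assumes "continuous_on UNIV h" "bounded S" "S \<in> sets borel"
  shows "set_integrable lebesgue S h" "set_integrable lborel S h"
proof -
  have "compact (closure S)" using assms by (simp add: compact_closure)
  then have "set_integrable lborel (closure S) h"
    using borel_integrable_compact[of "closure S" h] assms
    by (simp add: set_integrable_def continuous_on_subset)
  then show *: "set_integrable lborel S h"
    by (rule set_integrable_subset) (use assms closure_subset in auto)
  then have "integrable lebesgue (\<lambda>x. indicator S x *\<^sub>R h x)"
    unfolding set_integrable_def by (rule integrable_completion[THEN iffD2, rotated]) (use * in \<open>auto simp: set_integrable_def\<close>)
  then show "set_integrable lebesgue S h" by (simp add: set_integrable_def)
qed

text \<open>Fubini for an integrand that depends on the first coordinate only: \<open>l a\<close> is
  the length of the slice of \<open>S\<close> over \<open>a\<close>, and the inner integral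
  contributes just this factor. It serves the reference triangle and the parameter rectangle of
  polar coordinates.\<close>

lemma set_integral_slices:
  fixes h :: "real \<Rightarrow> real"
  assumes cont: "continuous_on UNIV h" and S: "bounded S" "S \<in> sets borel"
    and sl: "\<And>a. (LINT b|lborel. indicator S (vector [a, b] :: real ^ 2)) = l a"
  shows "(LINT x:S|lebesgue. h (x $ 1)) = (LINT a|lborel. l a * h a)"
proof -
  let ?v = "\<lambda>z :: real \<times> real. vector [fst z, snd z] :: real ^ 2"
  have v_eq: "?v z = fst z *\<^sub>R axis 1 1 + snd z *\<^sub>R axis 2 1" for z
    by (simp add: vec_eq_iff forall_2 axis_def)
  have vm [measurable]: "?v \<in> borel_measurable borel"
    unfolding v_eq by (intro borel_measurable_continuous_onI continuous_intros)
  have vp: "?v (pair_of_vec x) = x" for x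
    by (simp add: pair_of_vec_def vec_eq_iff forall_2)
  have [measurable]: "h \<in> borel_measurable borel" "S \<in> sets borel"
    using cont S by (auto intro: borel_measurable_continuous_onI)
  let ?F = "\<lambda>z. indicator S (?v z) *\<^sub>R h (fst z)"
  have ch: "continuous_on UNIV (\<lambda>x :: real ^ 2. h (x $ 1))"
    by (intro continuous_on_compose2[OF cont] continuous_intros) auto
  have i1: "integrable lborel (\<lambda>x. indicator S x *\<^sub>R h (x $ 1))"
    using set_integrable_lebesgue_continuous(2)[OF ch S] by (simp add: set_integrable_def)
  have eq: "(\<lambda>x. indicator S x *\<^sub>R h (x $ 1)) = (\<lambda>x. ?F (pair_of_vec x))"
    by (intro ext) (simp only: vp, simp add: pair_of_vec_def)
  have "(\<lambda>x. indicator S x *\<^sub>R h (x $ 1)) \<in> borel_measurable borel"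
    by (intro borel_measurable_scaleR borel_measurable_indicator borel_measurable_continuous_onI ch) fact
  from measurable_compose[OF vm this] have Fm: "?F \<in> borel_measurable borel"
    by simp
  have i2: "integrable (distr lborel lborel pair_of_vec) ?F"
    using i1 Fm unfolding eq by (subst integrable_distr_eq) auto
  have "(LINT x:S|lebesgue. h (x $ 1)) = (LINT x|lborel. indicator S x *\<^sub>R h (x $ 1))"
    unfolding set_lebesgue_integral_def using i1 by (subst integral_completion) auto
  also have "\<dots> = (LINT z|distr lborel lborel pair_of_vec. ?F z)"
    unfolding eq using Fm by (subst integral_distr) auto
  also have "\<dots> = (LINT z|(lborel \<Otimes>\<^sub>M lborel). ?F z)"
    by (simp add: distr_pair_of_vec lborel_prod)
  also have "\<dots> = (LINT a|lborel. LINT b|lborel. ?F (a, b))"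
    using i2 by (subst lborel_pair.integral_fst') (simp_all add: distr_pair_of_vec lborel_prod)
  also have "\<dots> = (LINT a|lborel. l a * h a)"
    by (simp add: sl)
  finally show ?thesis .
qed

lemma ref_triangle_compact: "compact ref_triangle"
proof -
  have "closed ref_triangle" unfolding ref_triangle_def
    by (intro closed_Collect_conj closed_Collect_le continuous_intros)
  moreover have "ref_triangle \<subseteq> cbox 0 (vector [1, 1])"
    by (auto simp: ref_triangle_def mem_box_cart forall_2)
  ultimately show ?thesis
    by (meson bounded_cbox bounded_subset compact_eq_bounded_closed)
qed

lemma ref_triangle_borel [measurable]: "ref_triangle \<in> sets borel"
  using ref_triangle_compact by (simp add: borel_compact)

lemma set_integral_ref_triangle:
  fixes f :: "real \<Rightarrow> real"
  assumes "continuous_on UNIV f"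
  shows "(LINT x:ref_triangle|lebesgue. f (x $ 1)) = (LINT s:{0..1}|lborel. (1 - s) * f s)"
proof -
  have "(LINT b|lborel. indicator ref_triangle (vector [a, b] :: real ^ 2)) = indicator {0..1} a * (1 - a)" for a
  proof (cases "a \<in> {0..1}")
    case True
    then have "(\<lambda>b. indicator ref_triangle (vector [a, b] :: real ^ 2)) = (indicator {0..1 - a} :: real \<Rightarrow> real)"
      by (intro ext) (auto simp: indicator_def ref_triangle_def)
    then show ?thesis using True by simp
  next
    case False
    then have "(\<lambda>b. indicator ref_triangle (vector [a, b] :: real ^ 2)) = (\<lambda>b. 0 :: real)"
      by (intro ext) (auto simp: indicator_def ref_triangle_def)
    then show ?thesis using False by simp
  qed
  from set_integral_slices[OF assms _ _ this] show ?thesis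
    using ref_triangle_compact by (simp add: compact_imp_bounded set_lebesgue_integral_def mult.assoc)
qed

lemma polar_inj:
  assumes "0 < t" "0 < t'" "polar t \<alpha> = polar t' \<alpha>'"
  shows "t = t'" "\<exists>k::int. \<alpha> = \<alpha>' + 2 * pi * k"
proof -
  have e: "t * cos \<alpha> = t' * cos \<alpha>'" "t * sin \<alpha> = t' * sin \<alpha>'"
    using assms(3) by (auto simp: polar_def vec_eq_iff forall_2)
  have "t\<^sup>2 = (t * cos \<alpha>)\<^sup>2 + (t * sin \<alpha>)\<^sup>2"
    by (simp add: power_mult_distrib flip: distrib_left)
  also have "\<dots> = t'\<^sup>2"
    unfolding e by (simp add: power_mult_distrib flip: distrib_left)
  finally show tt: "t = t'" using assms by simp
  then have "cos \<alpha> = cos \<alpha>'" "sin \<alpha> = sin \<alpha>'" using e assms by auto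
  then show "\<exists>k::int. \<alpha> = \<alpha>' + 2 * pi * k"
    using sin_cos_eq_iff[of \<alpha> \<alpha>'] by (metis mult.commute mult.left_commute)
qed

lemma norm_polar [simp]: "norm (polar t \<alpha>) = \<bar>t\<bar>"
proof -
  have "norm (polar t \<alpha>) = sqrt ((t * cos \<alpha>)\<^sup>2 + (t * sin \<alpha>)\<^sup>2)"
    by (simp add: polar_def norm_vec_def L2_set_def sum_2)
  also have "(t * cos \<alpha>)\<^sup>2 + (t * sin \<alpha>)\<^sup>2 = t\<^sup>2"
    by (simp add: power_mult_distrib flip: distrib_left)
  finally show ?thesis by simp
qed

lemma polar_surj:
  obtains \<alpha> where "0 \<le> \<alpha>" "\<alpha> < 2 * pi" "x = polar (norm x) \<alpha>"
proof (cases "x = 0")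
  case True
  then show ?thesis using that[of 0] by (simp add: polar_def)
next
  case False
  then have n: "norm x > 0" by simp
  have "(x $ 1 / norm x)\<^sup>2 + (x $ 2 / norm x)\<^sup>2 = 1"
  proof -
    have nx: "(norm x)\<^sup>2 = (x $ 1)\<^sup>2 + (x $ 2)\<^sup>2"
      by (simp add: norm_vec_def L2_set_def sum_2)
    have "(x $ 1 / norm x)\<^sup>2 + (x $ 2 / norm x)\<^sup>2 = ((x $ 1)\<^sup>2 + (x $ 2)\<^sup>2) / (norm x)\<^sup>2"
      by (simp add: power_divide add_divide_distrib)
    also have "\<dots> = (norm x)\<^sup>2 / (norm x)\<^sup>2"
      using nx by simp
    also have "\<dots> = 1" using False by simp
    finally show ?thesis .
  qed
  then obtain \<alpha> where a: "0 \<le> \<alpha>" "\<alpha> < 2 * pi" "x $ 1 / norm x = cos \<alpha>" "x $ 2 / norm x = sin \<alpha>"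
    using sincos_total_2pi by metis
  have "x $ 1 = norm x * cos \<alpha>" "x $ 2 = norm x * sin \<alpha>"
    using n by (simp_all flip: a(3,4))
  then have "x = polar (norm x) \<alpha>"
    unfolding polar_def vec_eq_iff forall_2 by simp
  with a that show ?thesis by blast
qed

lemma has_derivative_vec_nth_ident:
  "((\<lambda>x. x $ i) has_derivative (\<lambda>h. h $ i)) F"
  by (rule bounded_linear_imp_has_derivative) (rule bounded_linear_vec_nth)

lemma has_derivative_polar:
  "((\<lambda>a. polar (a $ 1) (a $ 2)) has_derivative
     (\<lambda>h. (h $ 1) *\<^sub>R polar 1 (a $ 2) + (h $ 2) *\<^sub>R polar (a $ 1) (a $ 2 + pi / 2))) (at a within S)"
proof -
  have p: "polar t \<alpha> = (t * cos \<alpha>) *\<^sub>R axis 1 1 + (t * sin \<alpha>) *\<^sub>R axis 2 1" for t \<alpha>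
    by (simp add: polar_def vec_eq_iff forall_2 axis_def)
  show ?thesis
    unfolding p
    by (rule has_derivative_eq_rhs, (rule has_derivative_vec_nth_ident derivative_intros refl)+)
       (simp add: fun_eq_iff cos_add sin_add vec_eq_iff forall_2 axis_def algebra_simps)
qed

lemma set_integral_annulus:
  fixes f :: "real \<Rightarrow> real"
  assumes f: "continuous_on UNIV f" and eps: "0 < \<epsilon>" "\<epsilon> < 1"
  shows "set_integrable lebesgue (annulus \<epsilon>) (\<lambda>x. f (norm x))"
    and "(LINT x:annulus \<epsilon>|lebesgue. f (norm x)) = 2 * pi * (LINT t:{\<epsilon>..1}|lborel. t * f t)"
proof -
  \<comment> \<open>Half-open in both coordinates, so that polar coordinates are a bijection onto
    the annulus, which contains its inner circle and omits its outer one.\<close>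
  define S :: "(real ^ 2) set" where "S = {a. \<epsilon> \<le> a $ 1 \<and> a $ 1 < 1 \<and> 0 \<le> a $ 2 \<and> a $ 2 < 2 * pi}"
  let ?P = "\<lambda>a :: real ^ 2. polar (a $ 1) (a $ 2)"
  have im: "?P ` S = annulus \<epsilon>"
  proof (intro equalityI subsetI)
    fix x assume "x \<in> ?P ` S"
    then show "x \<in> annulus \<epsilon>" using eps by (auto simp: S_def annulus_def dist_norm)
  next
    fix x assume x: "x \<in> annulus \<epsilon>"
    obtain \<alpha> where a: "0 \<le> \<alpha>" "\<alpha> < 2 * pi" "x = polar (norm x) \<alpha>" by (rule polar_surj)
    then have "x = ?P (vector [norm x, \<alpha>])" by simp
    moreover have "vector [norm x, \<alpha>] \<in> S" using a x by (auto simp: S_def annulus_def)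
    ultimately show "x \<in> ?P ` S" by blast
  qed
  have inj: "inj_on ?P S"
  proof (rule inj_onI)
    fix a b assume ab: "a \<in> S" "b \<in> S" "?P a = ?P b"
    then have p: "0 < a $ 1" "0 < b $ 1" using eps by (auto simp: S_def)
    obtain k :: int where k: "a $ 2 = b $ 2 + 2 * pi * k" and e: "a $ 1 = b $ 1"
      using polar_inj[OF p ab(3)] by blast
    have "\<bar>2 * pi * k\<bar> < 2 * pi" using k ab by (auto simp: S_def)
    then have "\<bar>real_of_int k\<bar> < 1" by (simp add: abs_mult)
    then have "k = 0" by linarith
    then show "a = b" using k e by (simp add: vec_eq_iff forall_2)
  qed
  have Sb: "S \<in> sets borel"
    unfolding S_def by measurable
  have bS: "bounded S"
    by (rule bounded_subset[of "cbox 0 (vector [1, 2 * pi])"]) (use eps in \<open>auto simp: S_def mem_box_cart forall_2\<close>)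
  let ?D = "\<lambda>a h :: real ^ 2. (h $ 1) *\<^sub>R polar 1 (a $ 2) + (h $ 2) *\<^sub>R polar (a $ 1) (a $ 2 + pi / 2)"
  have det: "det (matrix (?D a)) = a $ 1" for a
  proof -
    have "a $ 1 * (cos (a $ 2) * cos (a $ 2)) + a $ 1 * (sin (a $ 2) * sin (a $ 2)) = a $ 1"
      using sin_cos_squared_add3[of "a $ 2"] by (metis distrib_left mult.right_neutral)
    then show ?thesis
      by (simp add: det_matrix_2 axis_def polar_def cos_add sin_add algebra_simps)
  qed
  let ?h = "\<lambda>t. t * f t"
  have ch: "continuous_on UNIV ?h" using f by (intro continuous_intros)
  then have ch': "continuous_on UNIV (\<lambda>x :: real ^ 2. ?h (x $ 1))"
    by (rule continuous_on_compose2) (auto intro!: continuous_intros)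
  have S0: "\<bar>det (matrix (?D a))\<bar> * f (norm (?P a)) = ?h (a $ 1)" if "a \<in> S" for a
    using that eps by (auto simp: det S_def)
  have int: "set_integrable lebesgue S (\<lambda>a. ?h (a $ 1))"
    by (rule set_integrable_lebesgue_continuous(1)[OF ch' bS Sb])
  have int': "set_integrable lebesgue S (\<lambda>a. \<bar>det (matrix (?D a))\<bar> * f (norm (?P a)))"
    by (rule set_integrable_cong[THEN iffD1, OF refl _ _ int]) (use S0 in auto)
  have Sl: "S \<in> sets lebesgue" using Sb by simp
  note cv = has_absolute_integral_change_of_variables_real[OF Sl has_derivative_polar inj, of "\<lambda>x. f (norm x)", unfolded im]
  show "set_integrable lebesgue (annulus \<epsilon>) (\<lambda>x. f (norm x))" using cv(1) int' by simp
  have "(LINT x:annulus \<epsilon>|lebesgue. f (norm x)) = (LINT a:S|lebesgue. ?h (a $ 1))"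
    using cv(2)[OF int'] by (subst (asm) set_lebesgue_integral_cong[OF Sl, of _ "\<lambda>a. ?h (a $ 1)"]) (use S0 in auto)
  also have "\<dots> = (LINT t|lborel. (indicator {\<epsilon>..<1} t * (2 * pi)) * ?h t)"
  proof (rule set_integral_slices[OF ch bS Sb])
    fix t
    have "(\<lambda>b. indicator S (vector [t, b] :: real ^ 2)) = (\<lambda>b. indicator {\<epsilon>..<1} t * indicator {0..<2 * pi} b :: real)"
      by (intro ext) (auto simp: indicator_def S_def)
    then show "(LINT b|lborel. indicator S (vector [t, b] :: real ^ 2)) = indicator {\<epsilon>..<1} t * (2 * pi)"
      by simp
  qed
  also have "\<dots> = 2 * pi * (LINT t:{\<epsilon>..<1}|lborel. t * f t)"
    unfolding set_lebesgue_integral_def by (subst integral_mult_right_zero[symmetric]) (simp add: mult_ac)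
  also have "(LINT t:{\<epsilon>..<1}|lborel. t * f t) = (LINT t:{\<epsilon>..1}|lborel. t * f t)"
  proof (rule set_integral_cong_set)
    have "?h \<in> borel_measurable borel" using ch by (rule borel_measurable_continuous_onI)
    then show "set_borel_measurable lborel {\<epsilon>..<1} ?h" "set_borel_measurable lborel {\<epsilon>..1} ?h"
      by (simp_all add: set_borel_measurable_def)
    show "AE t in lborel. (t \<in> {\<epsilon>..1}) = (t \<in> {\<epsilon>..<1})"
      using AE_lborel_singleton[of 1] by eventually_elim auto
  qed
  finally show "(LINT x:annulus \<epsilon>|lebesgue. f (norm x)) = 2 * pi * (LINT t:{\<epsilon>..1}|lborel. t * f t)" .
qed

section \<open>Quadratic interpolation on one element: gradient and energy of the
  interpolant\<close>

text \<open>The quadratic Lagrange interpolant of the nodal values of \<open>f\<close> at the point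
  with barycentric coordinates (1 - a - b, a, b); \<open>interp_a\<close> and
  \<open>interp_b\<close> are its partial derivatives. With nodes of any type and scalar
  \<open>f\<close>, one formula serves both the components of \<open>quad_map\<close> and functions
  on the strip.\<close>

definition interp :: "('a \<Rightarrow> real) \<Rightarrow> 'a element \<Rightarrow> real \<Rightarrow> real \<Rightarrow> real" where
  "interp f E a b =
     f (a1 E) * ((1 - a - b) * (1 - 2 * a - 2 * b)) + f (a2 E) * (a * (2 * a - 1)) + f (a3 E) * (b * (2 * b - 1)) +
     f (a12 E) * (4 * (1 - a - b) * a) + f (a13 E) * (4 * (1 - a - b) * b) + f (a23 E) * (4 * a * b)"

definition interp_a :: "('a \<Rightarrow> real) \<Rightarrow> 'a element \<Rightarrow> real \<Rightarrow> real \<Rightarrow> real" where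
  "interp_a f E a b = f (a1 E) * (4 * a + 4 * b - 3) + f (a2 E) * (4 * a - 1) +
     f (a12 E) * (4 * (1 - 2 * a - b)) + f (a13 E) * (- 4 * b) + f (a23 E) * (4 * b)"

definition interp_b :: "('a \<Rightarrow> real) \<Rightarrow> 'a element \<Rightarrow> real \<Rightarrow> real \<Rightarrow> real" where
  "interp_b f E a b = f (a1 E) * (4 * a + 4 * b - 3) + f (a3 E) * (4 * b - 1) +
     f (a12 E) * (- 4 * a) + f (a13 E) * (4 * (1 - a - 2 * b)) + f (a23 E) * (4 * a)"

lemma quad_map_nth: "quad_map T \<xi> $ i = interp (\<lambda>v. v $ i) T (\<xi> $ 1) (\<xi> $ 2)"
  by (simp add: quad_map_def interp_def vertex_shape_def edge_shape_def bary_def algebra_simps)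

definition quad_der :: "(real ^ 2) element \<Rightarrow> real ^ 2 \<Rightarrow> real ^ 2 \<Rightarrow> real ^ 2" where
  "quad_der T \<xi> h = (\<chi> i. interp_a (\<lambda>v. v $ i) T (\<xi> $ 1) (\<xi> $ 2) * h $ 1 +
     interp_b (\<lambda>v. v $ i) T (\<xi> $ 1) (\<xi> $ 2) * h $ 2)"

lemma has_derivative_quad_map: "(quad_map T has_derivative quad_der T \<xi>) (at \<xi> within S)"
proof -
  have *: "quad_map T = (\<lambda>\<xi>. ((1 - \<xi> $ 1 - \<xi> $ 2) * (2 * (1 - \<xi> $ 1 - \<xi> $ 2) - 1)) *\<^sub>R a1 T +
      (\<xi> $ 1 * (2 * \<xi> $ 1 - 1)) *\<^sub>R a2 T + (\<xi> $ 2 * (2 * \<xi> $ 2 - 1)) *\<^sub>R a3 T +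
      (4 * (1 - \<xi> $ 1 - \<xi> $ 2) * \<xi> $ 1) *\<^sub>R a12 T + (4 * (1 - \<xi> $ 1 - \<xi> $ 2) * \<xi> $ 2) *\<^sub>R a13 T +
      (4 * \<xi> $ 1 * \<xi> $ 2) *\<^sub>R a23 T)"
    by (simp add: fun_eq_iff quad_map_def vertex_shape_def edge_shape_def bary_def)
  show ?thesis
    unfolding *
    by (rule has_derivative_eq_rhs, (rule has_derivative_vec_nth_ident derivative_intros refl)+)
       (simp add: fun_eq_iff vec_eq_iff quad_der_def interp_a_def interp_b_def algebra_simps)
qed

lemma continuous_on_quad_map: "continuous_on S (quad_map T)"
  using has_derivative_quad_map by (rule has_derivative_continuous_on)

definition quad_det :: "(real ^ 2) element \<Rightarrow> real ^ 2 \<Rightarrow> real" where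
  "quad_det T \<xi> = interp_a (\<lambda>v. v $ 1) T (\<xi> $ 1) (\<xi> $ 2) * interp_b (\<lambda>v. v $ 2) T (\<xi> $ 1) (\<xi> $ 2) -
     interp_b (\<lambda>v. v $ 1) T (\<xi> $ 1) (\<xi> $ 2) * interp_a (\<lambda>v. v $ 2) T (\<xi> $ 1) (\<xi> $ 2)"

text \<open>The squared Frobenius norm of \<open>DG adj(DF)\<close>, where \<open>F\<close> and \<open>G\<close> are the quadratic
  maps of the elements \<open>T\<close> and \<open>U\<close>.\<close>

definition quad_num :: "(real ^ 2) element \<Rightarrow> (real ^ 2) element \<Rightarrow> real ^ 2 \<Rightarrow> real" where
  "quad_num T U \<xi> = (let a = \<lambda>V i. interp_a (\<lambda>v. v $ i) V (\<xi> $ 1) (\<xi> $ 2);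
     b = \<lambda>V i. interp_b (\<lambda>v. v $ i) V (\<xi> $ 1) (\<xi> $ 2) in
     (a U 1 * b T 2 - b U 1 * a T 2)\<^sup>2 + (b U 1 * a T 1 - a U 1 * b T 1)\<^sup>2 +
     (a U 2 * b T 2 - b U 2 * a T 2)\<^sup>2 + (b U 2 * a T 1 - a U 2 * b T 1)\<^sup>2)"

lemma det_quad_der: "det (matrix (quad_der T \<xi>)) = quad_det T \<xi>"
  by (simp add: det_matrix_2 quad_der_def quad_det_def axis_def)

lemma continuous_on_quad_det: "continuous_on S (quad_det T)"
  unfolding quad_det_def interp_a_def interp_b_def by (intro continuous_intros)

lemma continuous_on_quad_num: "continuous_on S (quad_num T U)"
  unfolding quad_num_def Let_def interp_a_def interp_b_def by (intro continuous_intros)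

lemma quad_num_nonneg: "0 \<le> quad_num T U \<xi>"
  by (simp add: quad_num_def Let_def)

lemma ref_triangle_convex: "convex ref_triangle"
proof -
  have "ref_triangle = {x. (- axis 1 1) \<bullet> x \<le> 0} \<inter> {x. (- axis 2 1) \<bullet> x \<le> 0} \<inter> {x. (axis 1 1 + axis 2 1) \<bullet> x \<le> 1}"
    by (auto simp: ref_triangle_def inner_left_distrib inner_axis' )
  then show ?thesis by (metis convex_Int convex_halfspace_le)
qed

text \<open>The triangle is convex, so its boundary is a null set, and differentiable maps of the
  plane preserve null sets. This image is the exceptional set of all almost-everywhere claims on an
  element.\<close>

lemma negligible_quad_map_boundary: "negligible (quad_map T ` (ref_triangle - interior ref_triangle))"
proof (rule negligible_differentiable_image_negligible)
  have "ref_triangle - interior ref_triangle \<subseteq> frontier ref_triangle"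
    using closure_subset by (auto simp: frontier_def)
  then show "negligible (ref_triangle - interior ref_triangle)"
    using negligible_convex_frontier[OF ref_triangle_convex] negligible_subset by blast
  show "quad_map T differentiable_on ref_triangle - interior ref_triangle"
    unfolding differentiable_on_def differentiable_def using has_derivative_quad_map by blast
qed simp

text \<open>The energy density of the interpolant pulled back to the reference triangle, with the
  volume factor. If F is the element map and G the interpolant on the reference triangle, the
  gradient is DG adj(DF) / det DF; this gives the argument of the power and the quotient of
  determinants.\<close>

definition ref_density ::
    "(real ^ 2 \<Rightarrow> real ^ 2) \<Rightarrow> (real ^ 2) element \<Rightarrow> real \<Rightarrow> real \<Rightarrow> (real \<Rightarrow> real) \<Rightarrow> real ^ 2 \<Rightarrow> real" where
  "ref_density u T p \<omega> g \<xi> = quad_det T \<xi> * (\<omega> * (sqrt (quad_num T (map_element u T) \<xi>) / quad_det T \<xi>) powr p +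
     g (quad_det (map_element u T) \<xi> / quad_det T \<xi>))"

context
  fixes \<T> :: "(real ^ 2) element set" and u :: "real ^ 2 \<Rightarrow> real ^ 2" and T :: "(real ^ 2) element"
  assumes T: "T \<in> \<T>"
    and unique: "\<And>T' \<xi> \<xi>'. T' \<in> \<T> \<Longrightarrow> \<xi> \<in> interior ref_triangle \<Longrightarrow> \<xi>' \<in> ref_triangle \<Longrightarrow>
      quad_map T \<xi> = quad_map T' \<xi>' \<Longrightarrow> T' = T \<and> \<xi>' = \<xi>"
    and det_nz: "\<And>\<xi>. \<xi> \<in> ref_triangle \<Longrightarrow> quad_det T \<xi> > 0"
begin

text \<open>At images of interior points the representation is unique, which pins down the choice in
  \<open>iso_interp\<close>.\<close>

lemma iso_interp_quad_map:
  assumes "\<xi> \<in> interior ref_triangle"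
  shows "iso_interp \<T> u (quad_map T \<xi>) = quad_map (map_element u T) \<xi>"
  unfolding iso_interp_def
proof (rule some_equality)
  have "\<xi> \<in> ref_triangle" using assms interior_subset by blast
  then show "\<exists>T'\<in>\<T>. \<exists>\<xi>'\<in>ref_triangle. quad_map T \<xi> = quad_map T' \<xi>' \<and>
      quad_map (map_element u T) \<xi> = quad_map (map_element u T') \<xi>'"
    using T by blast
qed (use unique assms in blast)

lemma inj_on_quad_map_interior: "inj_on (quad_map T) (interior ref_triangle)"
  by (rule inj_onI) (use unique T interior_subset in blast)

text \<open>Near the image of an interior point the interpolant is G composed with the inverse of F.
  The image of the open triangle is open by invariance of domain, and the inverse is differentiable
  with derivative adj(DF) / J.\<close>

lemma has_derivative_iso_interp:
  assumes \<xi>: "\<xi> \<in> interior ref_triangle"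
  defines "J \<equiv> quad_det T \<xi>"
    and "a \<equiv> \<lambda>i. interp_a (\<lambda>v. v $ i) T (\<xi> $ 1) (\<xi> $ 2)"
    and "b \<equiv> \<lambda>i. interp_b (\<lambda>v. v $ i) T (\<xi> $ 1) (\<xi> $ 2)"
  shows "(iso_interp \<T> u has_derivative
    (\<lambda>k. quad_der (map_element u T) \<xi> (vector [(b 2 * k $ 1 - b 1 * k $ 2) / J, (a 1 * k $ 2 - a 2 * k $ 1) / J])))
      (at (quad_map T \<xi>))"
proof -
  let ?U = "interior ref_triangle" and ?F = "quad_map T" and ?G = "quad_map (map_element u T)"
  let ?g = "inv_into ?U ?F"
  let ?g' = "\<lambda>k :: real ^ 2. vector [(b 2 * k $ 1 - b 1 * k $ 2) / J, (a 1 * k $ 2 - a 2 * k $ 1) / J] :: real ^ 2"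
  have J: "J > 0" "J = a 1 * b 2 - b 1 * a 2"
    using det_nz \<xi> interior_subset unfolding J_def a_def b_def quad_det_def by (blast, simp)
  have gF: "?g (?F x) = x" if "x \<in> ?U" for x
    using that inj_on_quad_map_interior by (rule inv_into_f_f[rotated])
  have "quad_der T \<xi> \<circ> ?g' = id"
  proof
    fix k :: "real ^ 2"
    have "a i * ((b 2 * k $ 1 - b 1 * k $ 2) / J) + b i * ((a 1 * k $ 2 - a 2 * k $ 1) / J) = k $ i" for i
    proof -
      have "a i * ((b 2 * k $ 1 - b 1 * k $ 2) / J) + b i * ((a 1 * k $ 2 - a 2 * k $ 1) / J) =
          (a i * (b 2 * k $ 1 - b 1 * k $ 2) + b i * (a 1 * k $ 2 - a 2 * k $ 1)) / J"
        by (simp add: add_divide_distrib)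
      also have "a i * (b 2 * k $ 1 - b 1 * k $ 2) + b i * (a 1 * k $ 2 - a 2 * k $ 1) = J * k $ i"
        using exhaust_2[of i] by (auto simp: J(2) algebra_simps)
      finally show ?thesis using J(1) by simp
    qed
    then show "(quad_der T \<xi> \<circ> ?g') k = id k"
      by (simp add: quad_der_def vec_eq_iff a_def b_def)
  qed
  then have dg: "(?g has_derivative ?g') (at (?F \<xi>))"
    by (intro has_derivative_inverse_strong[OF open_interior \<xi> continuous_on_quad_map gF has_derivative_quad_map])
  have "((?G \<circ> ?g) has_derivative (quad_der (map_element u T) \<xi> \<circ> ?g')) (at (?F \<xi>))"
    by (rule diff_chain_at[OF dg]) (use gF[OF \<xi>] has_derivative_quad_map in metis)
  moreover have "open (?F ` ?U)"
    by (rule invariance_of_domain[OF continuous_on_quad_map open_interior inj_on_quad_map_interior])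
  moreover have "(?G \<circ> ?g) y = iso_interp \<T> u y" if "y \<in> ?F ` ?U" for y
    using that gF iso_interp_quad_map by auto
  ultimately have "(iso_interp \<T> u has_derivative (quad_der (map_element u T) \<xi> \<circ> ?g')) (at (?F \<xi>))"
    using has_derivative_transform_within_open[of "?G \<circ> ?g" _ "?F \<xi>" UNIV "?F ` ?U" "iso_interp \<T> u"] \<xi> by blast
  then show ?thesis by (simp add: o_def)
qed

lemma jacobian_iso_interp:
  assumes \<xi>: "\<xi> \<in> interior ref_triangle"
  shows "iso_interp \<T> u differentiable at (quad_map T \<xi>)"
    and "det (jacobian (iso_interp \<T> u) (at (quad_map T \<xi>))) = quad_det (map_element u T) \<xi> / quad_det T \<xi>"
    and "norm (jacobian (iso_interp \<T> u) (at (quad_map T \<xi>))) =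
      sqrt (quad_num T (map_element u T) \<xi>) / quad_det T \<xi>"
proof -
  define J where "J = quad_det T \<xi>"
  define a :: "(real ^ 2) element \<Rightarrow> 2 \<Rightarrow> real" where "a = (\<lambda>T i. interp_a (\<lambda>v. v $ i) T (\<xi> $ 1) (\<xi> $ 2))"
  define b :: "(real ^ 2) element \<Rightarrow> 2 \<Rightarrow> real" where "b = (\<lambda>T i. interp_b (\<lambda>v. v $ i) T (\<xi> $ 1) (\<xi> $ 2))"
  let ?U = "map_element u T"
  note d = has_derivative_iso_interp[OF \<xi>, folded J_def]
  show "iso_interp \<T> u differentiable at (quad_map T \<xi>)"
    using d unfolding differentiable_def by blast
  have J: "J > 0" "J = a T 1 * b T 2 - b T 1 * a T 2"
    using det_nz \<xi> interior_subset unfolding J_def a_def b_def quad_det_def by (blast, simp)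
  have M: "jacobian (iso_interp \<T> u) (at (quad_map T \<xi>)) $ i = (\<chi> j. if j = 1
      then (a ?U i * b T 2 - b ?U i * a T 2) / J else (b ?U i * a T 1 - a ?U i * b T 1) / J)" for i
    unfolding jacobian_def frechet_derivative_at[OF d, symmetric]
    by (simp add: vec_eq_iff forall_2 matrix_def quad_der_def axis_def a_def b_def diff_divide_distrib algebra_simps)
  have D: "a ?U 1 * b ?U 2 - b ?U 1 * a ?U 2 = quad_det ?U \<xi>"
    by (simp add: quad_det_def a_def b_def)
  have "det (jacobian (iso_interp \<T> u) (at (quad_map T \<xi>))) =
      (a ?U 1 * b ?U 2 - b ?U 1 * a ?U 2) * (a T 1 * b T 2 - b T 1 * a T 2) / (J * J)"
    by (simp add: det_2 M algebra_simps diff_divide_distrib add_divide_distrib)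
  then show "det (jacobian (iso_interp \<T> u) (at (quad_map T \<xi>))) = quad_det ?U \<xi> / quad_det T \<xi>"
    unfolding D J(2)[symmetric] using J(1) by (simp add: J_def)
  have "norm (jacobian (iso_interp \<T> u) (at (quad_map T \<xi>))) =
      sqrt (quad_num T ?U \<xi> / J\<^sup>2)"
    by (simp add: norm_vec_def L2_set_def sum_2 M quad_num_def Let_def power_divide add_divide_distrib
        a_def b_def)
  then show "norm (jacobian (iso_interp \<T> u) (at (quad_map T \<xi>))) = sqrt (quad_num T ?U \<xi>) / quad_det T \<xi>"
    using J(1) by (simp add: real_sqrt_divide J_def)
qed

context
  assumes det_pos: "\<And>\<xi>. \<xi> \<in> ref_triangle \<Longrightarrow> quad_det (map_element u T) \<xi> > 0"
begin

lemma AE_iso_interp: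
  "AE x in lebesgue. x \<in> element_region T \<longrightarrow>
     iso_interp \<T> u differentiable (at x) \<and> 0 < det (jacobian (iso_interp \<T> u) (at x))"
proof (rule AE_I')
  show "quad_map T ` (ref_triangle - interior ref_triangle) \<in> null_sets lebesgue"
    using negligible_quad_map_boundary by (simp add: negligible_iff_null_sets)
  show "{x \<in> space lebesgue. \<not> (x \<in> element_region T \<longrightarrow>
     iso_interp \<T> u differentiable (at x) \<and> 0 < det (jacobian (iso_interp \<T> u) (at x)))}
    \<subseteq> quad_map T ` (ref_triangle - interior ref_triangle)"
    using jacobian_iso_interp det_nz det_pos by (auto simp: element_region_def)
qed

text \<open>Change of variables along F on the open triangle, where F is injective; the boundary is
  a null set both in the reference triangle and in the image.\<close>

lemma energy_element:
  assumes g: "continuous_on {0<..} g" and p: "0 < p"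
  shows "continuous_on ref_triangle (ref_density u T p \<omega> g)"
    and "finite_energy p \<omega> g (iso_interp \<T> u) (element_region T)"
    and "energy p \<omega> g (iso_interp \<T> u) (element_region T) = (LINT \<xi>:ref_triangle|lebesgue. ref_density u T p \<omega> g \<xi>)"
proof -
  let ?U = "interior ref_triangle" and ?F = "quad_map T" and ?e = "energy_density p \<omega> g (iso_interp \<T> u)"
  show cont: "continuous_on ref_triangle (ref_density u T p \<omega> g)"
    unfolding ref_density_def
    by (intro continuous_intros continuous_on_quad_det continuous_on_quad_num continuous_on_powr'
        continuous_on_compose2[OF g]) (use det_nz det_pos p quad_num_nonneg in \<open>fastforce simp: less_imp_le\<close>)+
  then have "integrable lborel (\<lambda>x. indicator ref_triangle x *\<^sub>R ref_density u T p \<omega> g x)"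
    by (intro borel_integrable_compact ref_triangle_compact)
  then have int: "ref_density u T p \<omega> g absolutely_integrable_on ref_triangle"
    unfolding set_integrable_def by (subst integrable_completion) auto
  have neg: "negligible (ref_triangle - ?U)"
    by (rule negligible_subset[OF negligible_convex_frontier[OF ref_triangle_convex]])
       (use closure_subset in \<open>auto simp: frontier_def\<close>)
  have intU: "ref_density u T p \<omega> g absolutely_integrable_on ?U"
    by (rule set_integrable_subset[OF int]) (auto simp: interior_subset)
  have eq: "\<bar>det (matrix (quad_der T \<xi>))\<bar> * ?e (?F \<xi>) = ref_density u T p \<omega> g \<xi>" if "\<xi> \<in> ?U" for \<xi>
    using that det_nz[of \<xi>] interior_subset[of ref_triangle]
    by (auto simp: det_quad_der energy_density_def jacobian_iso_interp ref_density_def)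
  have intU': "(\<lambda>\<xi>. \<bar>det (matrix (quad_der T \<xi>))\<bar> * ?e (?F \<xi>)) absolutely_integrable_on ?U"
    by (rule set_integrable_cong[THEN iffD1, OF refl _ _ intU]) (use eq in auto)
  note cv = has_absolute_integral_change_of_variables_real[OF _ has_derivative_quad_map
      inj_on_quad_map_interior intU']
  have neg1: "negligible (?F ` ?U - element_region T)" "negligible (element_region T - ?F ` ?U)"
    by (rule negligible_subset[OF negligible_quad_map_boundary[of T]],
        use interior_subset in \<open>auto simp: element_region_def\<close>)+
  have spike: "negligible {x \<in> ?F ` ?U - element_region T. ?e x \<noteq> 0}" "negligible {x \<in> element_region T - ?F ` ?U. ?e x \<noteq> 0}"
    by (rule negligible_subset[OF neg1(1)], blast, rule negligible_subset[OF neg1(2)], blast)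
  have i1: "?e absolutely_integrable_on ?F ` ?U" using cv(1) by simp
  then show fin: "finite_energy p \<omega> g (iso_interp \<T> u) (element_region T)"
    unfolding finite_energy_def by (rule absolutely_integrable_spike_set[OF _ spike])
  have "energy p \<omega> g (iso_interp \<T> u) (element_region T) = integral (element_region T) ?e"
    using fin by (simp add: energy_def finite_energy_def set_lebesgue_integral_eq_integral)
  also have "\<dots> = integral (?F ` ?U) ?e"
    by (rule integral_spike_set[symmetric, OF spike])
  also have "\<dots> = (LINT x:?F ` ?U|lebesgue. ?e x)"
    using i1 by (simp add: set_lebesgue_integral_eq_integral)
  also have "\<dots> = (LINT \<xi>:?U|lebesgue. \<bar>det (matrix (quad_der T \<xi>))\<bar> * ?e (?F \<xi>))"
    using cv(2) by simp
  also have "\<dots> = (LINT \<xi>:?U|lebesgue. ref_density u T p \<omega> g \<xi>)"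
    by (rule set_lebesgue_integral_cong) (use eq in auto)
  also have "\<dots> = integral ?U (ref_density u T p \<omega> g)"
    using intU by (simp add: set_lebesgue_integral_eq_integral)
  also have "\<dots> = integral ref_triangle (ref_density u T p \<omega> g)"
    by (rule integral_spike_set)
      (rule negligible_subset[OF neg], use interior_subset in blast)+
  also have "\<dots> = (LINT \<xi>:ref_triangle|lebesgue. ref_density u T p \<omega> g \<xi>)"
    using int by (simp add: set_lebesgue_integral_eq_integral)
  finally show "energy p \<omega> g (iso_interp \<T> u) (element_region T) = \<dots>" .
qed

end

end

section \<open>Interpolation of polar coordinates on the model triangles of the strip\<close>

lemma abs_sin_minus_self_le: "\<bar>sin x - x\<bar> \<le> \<bar>x\<bar> ^ 3 / (6 :: real)"
proof -
  have s: "(\<Sum>m<3. sin_coeff m * x ^ m) = x" by (simp add: numeral_3_eq_3 sin_coeff_def)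
  show ?thesis
    using Maclaurin_sin_bound[of x 3] unfolding s by (simp add: numeral_3_eq_3 fact_reduce field_simps)
qed

lemma abs_cos_minus_one_le: "\<bar>cos x - 1\<bar> \<le> x\<^sup>2 / (2 :: real)"
proof -
  have "cos x - 1 = - 2 * (sin (x / 2))\<^sup>2"
    using cos_double_sin[of "x / 2"] by simp
  moreover have "(sin (x / 2))\<^sup>2 \<le> (x / 2)\<^sup>2"
    using abs_sin_x_le_abs_x[of "x / 2"] by (simp only: abs_le_square_iff)
  ultimately show ?thesis by (simp add: power_divide)
qed

text \<open>With cos x = 1 - 2 sin(x/2)^2 the left-hand side factors into x/2 - sin(x/2) and x/2 +
  sin(x/2), so the cubic bound for the sine suffices.\<close>

lemma abs_cos_minus_quad_le: "\<bar>cos x - 1 + x\<^sup>2 / 2\<bar> \<le> x ^ 4 / (24 :: real)"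
proof -
  have "cos x - 1 + x\<^sup>2 / 2 = 2 * ((x / 2 - sin (x / 2)) * (x / 2 + sin (x / 2)))"
    using cos_double_sin[of "x / 2"] by (simp add: algebra_simps power2_eq_square)
  also have "\<bar>\<dots>\<bar> \<le> 2 * ((\<bar>x / 2\<bar> ^ 3 / 6) * \<bar>x\<bar>)"
    unfolding abs_mult
    using abs_sin_minus_self_le[of "x / 2"] abs_sin_x_le_abs_x[of "x / 2"] abs_triangle_ineq[of "x / 2" "sin (x / 2)"]
    by (intro mult_mono) (auto simp: abs_minus_commute)
  also have "\<dots> = x ^ 4 / 24"
  proof -
    have "\<bar>x\<bar> ^ 3 * \<bar>x\<bar> = x ^ 4"
      by (simp flip: power_Suc2)
    then show ?thesis by (simp add: power_divide)
  qed
  finally show ?thesis .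
qed

text \<open>The triangles in the (s, \<sigma>) plane that the polar map sends to the element nodes:
  s is the radial coordinate scaled to [0, 1], \<sigma> the angle in units of pi / N. The edge nodes
  are midpoints, so interpolation reproduces s and \<sigma> as affine functions of the reference
  coordinates.\<close>

definition elem_A :: "(real \<times> real) element" where
  "elem_A = Element (0, 0) (1, - 1) (1, 1) (1 / 2, - 1 / 2) (1 / 2, 1 / 2) (1, 0)"

definition elem_B :: "(real \<times> real) element" where
  "elem_B = Element (1, 0) (0, 1) (0, - 1) (1 / 2, 1 / 2) (1 / 2, - 1 / 2) (0, 0)"

text \<open>The halves of \<open>elem_B\<close> are centred, like \<open>elem_A\<close> and \<open>elem_B\<close>, at the midpoint of
  their angular range.\<close>

definition elem_C :: "(real \<times> real) element" where
  "elem_C = Element (0, - 1 / 2) (1, - 1 / 2) (0, 1 / 2) (1 / 2, - 1 / 2) (0, 0) (1 / 2, 0)"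

definition elem_D :: "(real \<times> real) element" where
  "elem_D = Element (0, 1 / 2) (0, - 1 / 2) (1, 1 / 2) (0, 0) (1 / 2, 1 / 2) (1 / 2, 0)"

definition elems :: "(real \<times> real) element set" where
  "elems = {elem_A, elem_B, elem_C, elem_D}"

lemmas elem_defs = elem_A_def elem_B_def elem_C_def elem_D_def

text \<open>Twice the signed area, that is, the determinant of the affine map from the reference
  triangle to \<open>E\<close>.\<close>

definition area2 :: "(real \<times> real) element \<Rightarrow> real" where
  "area2 E = (fst (a2 E) - fst (a1 E)) * (snd (a3 E) - snd (a1 E)) -
     (fst (a3 E) - fst (a1 E)) * (snd (a2 E) - snd (a1 E))"

text \<open>Together with \<open>deriv_\<sigma>\<close>: the partial derivatives of the interpolant
  in s and \<sigma>, obtained from those in a and b by Cramer's rule for the affine coordinate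
  change.\<close>

definition deriv_s :: "(real \<times> real \<Rightarrow> real) \<Rightarrow> (real \<times> real) element \<Rightarrow> real \<Rightarrow> real \<Rightarrow> real" where
  "deriv_s f E a b = ((snd (a3 E) - snd (a1 E)) * interp_a f E a b -
     (snd (a2 E) - snd (a1 E)) * interp_b f E a b) / area2 E"

definition deriv_\<sigma> :: "(real \<times> real \<Rightarrow> real) \<Rightarrow> (real \<times> real) element \<Rightarrow> real \<Rightarrow> real \<Rightarrow> real" where
  "deriv_\<sigma> f E a b = ((fst (a2 E) - fst (a1 E)) * interp_b f E a b -
     (fst (a3 E) - fst (a1 E)) * interp_a f E a b) / area2 E"

definition nodes :: "'a element \<Rightarrow> 'a set" where
  "nodes E = {a1 E, a2 E, a3 E, a12 E, a13 E, a23 E}"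

lemma area2_elems: "E \<in> elems \<Longrightarrow> area2 E \<in> {1, 2}"
  by (auto simp: elems_def elem_defs area2_def)

lemma nodes_elems: "E \<in> elems \<Longrightarrow> x \<in> nodes E \<Longrightarrow> fst x \<in> {0, 1 / 2, 1} \<and> \<bar>snd x\<bar> \<le> 1"
  by (auto simp: elems_def elem_defs nodes_def)

lemma interp_cong:
  assumes "\<And>x. x \<in> nodes E \<Longrightarrow> f x = g x"
  shows "interp f E a b = interp g E a b" "interp_a f E a b = interp_a g E a b"
    "interp_b f E a b = interp_b g E a b"
  using assms by (simp_all add: interp_def interp_a_def interp_b_def nodes_def)

lemma deriv_cong:
  assumes "\<And>x. x \<in> nodes E \<Longrightarrow> f x = g x"
  shows "deriv_s f E a b = deriv_s g E a b" "deriv_\<sigma> f E a b = deriv_\<sigma> g E a b"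
  using interp_cong[of E f g, OF assms] by (simp_all add: deriv_s_def deriv_\<sigma>_def)

lemma interp_linear:
  "interp (\<lambda>x. f x + g x) E a b = interp f E a b + interp g E a b"
  "interp (\<lambda>x. c * f x) E a b = c * interp f E a b"
  "interp_a (\<lambda>x. f x + g x) E a b = interp_a f E a b + interp_a g E a b"
  "interp_a (\<lambda>x. c * f x) E a b = c * interp_a f E a b"
  "interp_b (\<lambda>x. f x + g x) E a b = interp_b f E a b + interp_b g E a b"
  "interp_b (\<lambda>x. c * f x) E a b = c * interp_b f E a b"
  by (simp_all add: interp_def interp_a_def interp_b_def algebra_simps)

lemma deriv_linear:
  "deriv_s (\<lambda>x. f x + g x) E a b = deriv_s f E a b + deriv_s g E a b"
  "deriv_s (\<lambda>x. c * f x) E a b = c * deriv_s f E a b"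
  "deriv_\<sigma> (\<lambda>x. f x + g x) E a b = deriv_\<sigma> f E a b + deriv_\<sigma> g E a b"
  "deriv_\<sigma> (\<lambda>x. c * f x) E a b = c * deriv_\<sigma> f E a b"
  by (simp_all add: deriv_s_def deriv_\<sigma>_def interp_linear algebra_simps add_divide_distrib diff_divide_distrib)

text \<open>All nodes have s in {0, 1/2, 1}. A function of s alone is therefore interpolated by its
  one-dimensional quadratic interpolant at these three points, composed with s; its derivative
  appears in \<open>deriv_s_fst\<close>.\<close>

lemma deriv_\<sigma>_fst: "E \<in> elems \<Longrightarrow> deriv_\<sigma> (\<lambda>x. h (fst x)) E a b = 0"
  by (auto simp: elems_def elem_defs deriv_\<sigma>_def interp_a_def interp_b_def area2_def algebra_simps)

lemma deriv_s_fst: "E \<in> elems \<Longrightarrow> deriv_s (\<lambda>x. h (fst x)) E a b =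
    h 0 * (4 * interp fst E a b - 3) + h (1 / 2) * (4 - 8 * interp fst E a b) + h 1 * (4 * interp fst E a b - 1)"
  by (auto simp: elems_def elem_defs deriv_s_def interp_a_def interp_b_def interp_def area2_def field_simps)

text \<open>Instances of the exactness of quadratic interpolation on polynomials of degree two in s
  and \<sigma>.\<close>

lemma deriv_quadratic:
  assumes "E \<in> elems"
  shows "deriv_s (\<lambda>x. fst x * snd x) E a b = interp snd E a b"
    "deriv_\<sigma> (\<lambda>x. fst x * snd x) E a b = interp fst E a b"
    "deriv_s snd E a b = 0" "deriv_\<sigma> snd E a b = 1"
    "deriv_s (\<lambda>x. (snd x)\<^sup>2) E a b = 0" "deriv_\<sigma> (\<lambda>x. (snd x)\<^sup>2) E a b = 2 * interp snd E a b"
  using assms by (auto simp: elems_def elem_defs deriv_s_def deriv_\<sigma>_def interp_a_def interp_b_def interp_def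
      area2_def field_simps power2_eq_square)

lemma interp_quadratic:
  assumes "E \<in> elems"
  shows "interp (\<lambda>x. fst x * snd x) E a b = interp fst E a b * interp snd E a b"
  using assms by (auto simp: elems_def elem_defs interp_def field_simps)

lemma interp_affine:
  assumes "E \<in> elems"
  shows "interp fst E a b = fst (a1 E) * (1 - a - b) + fst (a2 E) * a + fst (a3 E) * b"
    "interp snd E a b = snd (a1 E) * (1 - a - b) + snd (a2 E) * a + snd (a3 E) * b"
  using assms by (auto simp: elems_def elem_defs interp_def field_simps)

lemma interp_range:
  assumes "E \<in> elems" "0 \<le> a" "0 \<le> b" "a + b \<le> 1"
  shows "0 \<le> interp fst E a b" "interp fst E a b \<le> 1" "\<bar>interp snd E a b\<bar> \<le> 1"
  using assms unfolding interp_affine[OF assms(1)] by (auto simp: elems_def elem_defs abs_le_iff field_simps)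

lemma abs_mult_le: "\<bar>x\<bar> \<le> a \<Longrightarrow> \<bar>y\<bar> \<le> b \<Longrightarrow> \<bar>x * y\<bar> \<le> a * (b :: real)"
  unfolding abs_mult by (rule mult_mono) auto

lemma interp_ab_bound:
  assumes ab: "0 \<le> a" "0 \<le> b" "a + b \<le> 1" and f: "\<And>x. x \<in> nodes E \<Longrightarrow> \<bar>f x\<bar> \<le> M"
  shows "\<bar>interp_a f E a b\<bar> \<le> 18 * M" "\<bar>interp_b f E a b\<bar> \<le> 18 * M"
proof -
  have n: "\<bar>f (a1 E)\<bar> \<le> M" "\<bar>f (a2 E)\<bar> \<le> M" "\<bar>f (a3 E)\<bar> \<le> M" "\<bar>f (a12 E)\<bar> \<le> M" "\<bar>f (a13 E)\<bar> \<le> M" "\<bar>f (a23 E)\<bar> \<le> M"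
    using f by (auto simp: nodes_def)
  have c: "\<bar>4 * a + 4 * b - 3\<bar> \<le> 3" "\<bar>4 * a - 1\<bar> \<le> 3" "\<bar>4 * b - 1\<bar> \<le> 3" "\<bar>4 * (1 - 2 * a - b)\<bar> \<le> 4"
     "\<bar>4 * (1 - a - 2 * b)\<bar> \<le> 4" "\<bar>- 4 * b\<bar> \<le> 4" "\<bar>4 * b\<bar> \<le> 4" "\<bar>- 4 * a\<bar> \<le> 4" "\<bar>4 * a\<bar> \<le> 4"
    using ab by (auto simp: abs_le_iff)
  show "\<bar>interp_a f E a b\<bar> \<le> 18 * M"
    unfolding interp_a_def
    using abs_mult_le[OF n(1) c(1)] abs_mult_le[OF n(2) c(2)] abs_mult_le[OF n(4) c(4)] abs_mult_le[OF n(5) c(6)]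
      abs_mult_le[OF n(6) c(7)] by linarith
  show "\<bar>interp_b f E a b\<bar> \<le> 18 * M"
    unfolding interp_b_def
    using abs_mult_le[OF n(1) c(1)] abs_mult_le[OF n(3) c(3)] abs_mult_le[OF n(5) c(5)] abs_mult_le[OF n(4) c(8)]
      abs_mult_le[OF n(6) c(9)] by linarith
qed

text \<open>Stability: the shape functions have bounded derivatives, and the four triangles have
  \<open>area2\<close> at least 1 and bounded edge vectors. The constant only has to be absolute and
  is not sharp.\<close>

lemma deriv_bound:
  assumes E: "E \<in> elems" and ab: "0 \<le> a" "0 \<le> b" "a + b \<le> 1" and f: "\<And>x. x \<in> nodes E \<Longrightarrow> \<bar>f x\<bar> \<le> M"
  shows "\<bar>deriv_s f E a b\<bar> \<le> 100 * M" "\<bar>deriv_\<sigma> f E a b\<bar> \<le> 100 * M"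
proof -
  have M: "0 \<le> M" using f[of "a1 E"] by (auto simp: nodes_def)
  show "\<bar>deriv_s f E a b\<bar> \<le> 100 * M" "\<bar>deriv_\<sigma> f E a b\<bar> \<le> 100 * M"
    using E interp_ab_bound[of a b E f, OF ab f] M unfolding deriv_s_def deriv_\<sigma>_def
    by (auto simp: elems_def elem_defs area2_def abs_le_iff)
qed

text \<open>The second bound keeps the factor s: nodes with s = 0 contribute nothing, and the shape
  functions of the others are controlled by the barycentric coordinates that make up s. It renders
  the errors in \<open>polar_value_bounds\<close> proportional to the actual radius t0 + \<tau>
  s.\<close>

lemma interp_bound:
  assumes E: "E \<in> elems" and ab: "0 \<le> a" "0 \<le> b" "a + b \<le> 1" and f: "\<And>x. x \<in> nodes E \<Longrightarrow> \<bar>f x\<bar> \<le> M"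
  shows "\<bar>interp f E a b\<bar> \<le> 12 * M"
    "\<bar>interp (\<lambda>x. fst x * f x) E a b\<bar> \<le> 12 * M * interp fst E a b"
proof -
  have M: "0 \<le> M" using f[of "a1 E"] by (auto simp: nodes_def)
  have n: "\<bar>f (a1 E)\<bar> \<le> M" "\<bar>f (a2 E)\<bar> \<le> M" "\<bar>f (a3 E)\<bar> \<le> M" "\<bar>f (a12 E)\<bar> \<le> M" "\<bar>f (a13 E)\<bar> \<le> M" "\<bar>f (a23 E)\<bar> \<le> M"
    using f by (auto simp: nodes_def)
  let ?c = "1 - a - b"
  have c0: "0 \<le> ?c" using ab by simp
  have p: "0 \<le> x * y" "x * y \<le> x" "x * y \<le> y" if "0 \<le> x" "0 \<le> y" "x \<le> 1" "y \<le> 1" for x y :: real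
    using that by (auto simp: mult_left_le mult_left_le_one_le)
  have v: "\<bar>x * (2 * x - 1)\<bar> \<le> x" if "0 \<le> x" "x \<le> 1" for x :: real
    unfolding abs_mult using that mult_left_le[of "\<bar>2 * x - 1\<bar>" x] by auto
  have v1: "\<bar>?c * (1 - 2 * a - 2 * b)\<bar> \<le> ?c" using v[of ?c] ab by (simp add: algebra_simps)
  have v2: "\<bar>a * (2 * a - 1)\<bar> \<le> a" "\<bar>b * (2 * b - 1)\<bar> \<le> b" using v ab by auto
  have e: "\<bar>4 * ?c * a\<bar> \<le> 4 * ?c" "\<bar>4 * ?c * a\<bar> \<le> 4 * a" "\<bar>4 * ?c * b\<bar> \<le> 4 * ?c" "\<bar>4 * ?c * b\<bar> \<le> 4 * b"
     "\<bar>4 * a * b\<bar> \<le> 4 * a" "\<bar>4 * a * b\<bar> \<le> 4 * b"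
    using p[OF c0 ab(1)] p[OF c0 ab(2)] p[OF ab(1,2)] ab by - ((rule abs_leI; argo)+)
  have MM: "M * x \<le> M" if "x \<le> 1" for x using mult_left_mono[OF that M] by simp
  have lin: "M * (x + y) = M * x + M * y" "M * (x - y) = M * x - M * y" "M * (4 * x) = 4 * (M * x)" for x y
    by (simp_all add: algebra_simps)
  have nonneg: "0 \<le> M * a" "0 \<le> M * b" "0 \<le> M * ?c" using M ab by auto
  have Mab: "M * a + M * b \<le> M"
    using mult_left_mono[OF ab(3) M] by (simp add: algebra_simps)
  note p = abs_mult_le[OF n(1) v1] abs_mult_le[OF n(2) v2(1)] abs_mult_le[OF n(3) v2(2)]
    abs_mult_le[OF n(4) e(2)] abs_mult_le[OF n(5) e(4)] abs_mult_le[OF n(6) e(6)]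
  show "\<bar>interp f E a b\<bar> \<le> 12 * M"
    unfolding interp_def
    by (rule abs_leI; insert p[THEN abs_le_D1] p[THEN abs_le_D2] Mab nonneg; simp only: lin; linarith)
  show "\<bar>interp (\<lambda>x. fst x * f x) E a b\<bar> \<le> 12 * M * interp fst E a b"
    unfolding interp_affine(1)[OF E]
    using E abs_mult_le[OF n(1) v1] abs_mult_le[OF n(2) v2(1)] abs_mult_le[OF n(3) v2(2)]
      abs_mult_le[OF n(4) e(1)] abs_mult_le[OF n(5) e(3)] abs_mult_le[OF n(6) e(5)]
      abs_mult_le[OF n(4) e(2)] abs_mult_le[OF n(5) e(4)] abs_mult_le[OF n(6) e(6)] nonneg
    unfolding interp_def
    by (auto simp: elems_def elem_defs lin abs_le_iff algebra_simps)
qed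

definition polar_x :: "(real \<Rightarrow> real) \<Rightarrow> real \<Rightarrow> real \<times> real \<Rightarrow> real" where
  "polar_x q \<theta> v = q (fst v) * cos (\<theta> * snd v)"

definition polar_y :: "(real \<Rightarrow> real) \<Rightarrow> real \<Rightarrow> real \<times> real \<Rightarrow> real" where
  "polar_y q \<theta> v = q (fst v) * sin (\<theta> * snd v)"

text \<open>Carried along as a function instead of being estimated at once. It enters the
  derivatives for the identity and for r with the factors t0 and r(t0), and this proportionality
  produces a cancellation in \<open>element_estimates\<close>.\<close>

definition sin_rem :: "real \<Rightarrow> real \<times> real \<Rightarrow> real" where
  "sin_rem \<theta> v = sin (\<theta> * snd v) - \<theta> * snd v"

lemma angle_bounds:
  fixes \<theta> \<sigma> :: real
  assumes "0 \<le> \<theta>" "\<bar>\<sigma>\<bar> \<le> 1"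
  shows "\<bar>sin (\<theta> * \<sigma>) - \<theta> * \<sigma>\<bar> \<le> \<theta> ^ 3" "\<bar>cos (\<theta> * \<sigma>) - 1\<bar> \<le> \<theta>\<^sup>2"
    "\<bar>cos (\<theta> * \<sigma>) - 1 + (\<theta> * \<sigma>)\<^sup>2 / 2\<bar> \<le> \<theta> ^ 4"
proof -
  have le: "\<bar>\<theta> * \<sigma>\<bar> \<le> \<theta>" using mult_left_mono[of "\<bar>\<sigma>\<bar>" 1 \<theta>] assms by (simp add: abs_mult)
  have pw: "\<bar>\<theta> * \<sigma>\<bar> ^ n \<le> \<theta> ^ n" for n by (rule power_mono[OF le]) simp
  have "\<bar>\<theta> * \<sigma>\<bar> ^ 3 / 6 \<le> \<theta> ^ 3" "\<bar>\<theta> * \<sigma>\<bar> ^ 2 / 2 \<le> \<theta> ^ 2" "\<bar>\<theta> * \<sigma>\<bar> ^ 4 / 24 \<le> \<theta> ^ 4"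
    using pw[of 3] pw[of 2] pw[of 4] zero_le_power[OF assms(1), of 3] zero_le_power[OF assms(1), of 2]
      zero_le_power[OF assms(1), of 4] by linarith+
  then show "\<bar>sin (\<theta> * \<sigma>) - \<theta> * \<sigma>\<bar> \<le> \<theta> ^ 3" "\<bar>cos (\<theta> * \<sigma>) - 1\<bar> \<le> \<theta>\<^sup>2"
    "\<bar>cos (\<theta> * \<sigma>) - 1 + (\<theta> * \<sigma>)\<^sup>2 / 2\<bar> \<le> \<theta> ^ 4"
    using abs_sin_minus_self_le[of "\<theta> * \<sigma>"] abs_cos_minus_one_le[of "\<theta> * \<sigma>"] abs_cos_minus_quad_le[of "\<theta> * \<sigma>"]
    by simp_all
qed

text \<open>Each component is split into parts that are interpolated exactly and a remainder to
  which stability applies. q(s) cos(\<theta> \<sigma>) is q(s) - q(0) \<theta>^2 \<sigma>^2 / 2 up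
  to |q(0)| \<theta>^4 + d \<theta>^2. q(s) sin(\<theta> \<sigma>) is \<theta> \<sigma> times the
  linear interpolant of q plus q(0) \<open>sin_rem\<close>, up to \<theta> e + d \<theta>^3. Here
  \<open>d\<close> bounds the variation of q over the nodes and \<open>e\<close> its deviation from
  a linear function at the midpoint.\<close>

lemma deriv_polar_bounds:
  assumes E: "E \<in> elems" and ab: "0 \<le> a" "0 \<le> b" "a + b \<le> 1"
    and \<theta>: "0 \<le> \<theta>"
    and q: "\<bar>q (1 / 2) - q 0\<bar> \<le> d" "\<bar>q 1 - q 0\<bar> \<le> d" "\<bar>q (1 / 2) - (q 0 + q 1) / 2\<bar> \<le> e"
  defines "s \<equiv> interp fst E a b" and "\<sigma> \<equiv> interp snd E a b"
  shows
    "\<bar>deriv_s (polar_x q \<theta>) E a b - (q 0 * (4 * s - 3) + q (1 / 2) * (4 - 8 * s) + q 1 * (4 * s - 1))\<bar>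
       \<le> 100 * (\<bar>q 0\<bar> * \<theta> ^ 4 + d * \<theta>\<^sup>2)"
    "\<bar>deriv_\<sigma> (polar_x q \<theta>) E a b + q 0 * \<theta>\<^sup>2 * \<sigma>\<bar> \<le> 100 * (\<bar>q 0\<bar> * \<theta> ^ 4 + d * \<theta>\<^sup>2)"
    "\<bar>deriv_s (polar_y q \<theta>) E a b - \<theta> * (q 1 - q 0) * \<sigma> - q 0 * deriv_s (sin_rem \<theta>) E a b\<bar>
       \<le> 100 * (\<theta> * e + d * \<theta> ^ 3)"
    "\<bar>deriv_\<sigma> (polar_y q \<theta>) E a b - \<theta> * (q 0 + (q 1 - q 0) * s) - q 0 * deriv_\<sigma> (sin_rem \<theta>) E a b\<bar>
       \<le> 100 * (\<theta> * e + d * \<theta> ^ 3)"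
    "\<bar>deriv_s (sin_rem \<theta>) E a b\<bar> \<le> 100 * \<theta> ^ 3" "\<bar>deriv_\<sigma> (sin_rem \<theta>) E a b\<bar> \<le> 100 * \<theta> ^ 3"
proof -
  have d: "0 \<le> d" and e: "0 \<le> e" using q by auto
  have n: "fst v \<in> {0, 1 / 2, 1}" "\<bar>snd v\<bar> \<le> 1" if "v \<in> nodes E" for v
    using nodes_elems[OF E that] by auto
  have qd: "\<bar>q (fst v) - q 0\<bar> \<le> d" if "v \<in> nodes E" for v
  proof -
    consider "fst v = 0" | "fst v = 1 / 2" | "fst v = 1" using n(1)[OF \<open>v \<in> nodes E\<close>] by blast
    then show ?thesis by cases (use q d in \<open>simp_all only: diff_self abs_zero\<close>)
  qed
  let ?R1 = "\<lambda>v. cos (\<theta> * snd v) - 1 + (\<theta> * snd v)\<^sup>2 / 2"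
  let ?R2 = "\<lambda>v. (q (fst v) - q 0) * (cos (\<theta> * snd v) - 1)"
  let ?RX = "\<lambda>v. q 0 * ?R1 v + ?R2 v"
  have RX: "\<bar>?RX v\<bar> \<le> \<bar>q 0\<bar> * \<theta> ^ 4 + d * \<theta>\<^sup>2" if "v \<in> nodes E" for v
  proof -
    have "\<bar>q 0 * ?R1 v\<bar> \<le> \<bar>q 0\<bar> * \<theta> ^ 4" "\<bar>?R2 v\<bar> \<le> d * \<theta>\<^sup>2"
      using angle_bounds[OF \<theta> n(2)[OF that]] qd[OF that] by (intro abs_mult_le; simp)+
    then show ?thesis by linarith
  qed
  have X: "polar_x q \<theta> v = q (fst v) + ((- q 0 * \<theta>\<^sup>2 / 2) * (snd v)\<^sup>2 + ?RX v)" for v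
    by (simp add: polar_x_def algebra_simps power_mult_distrib)
  have X': "polar_x q \<theta> = (\<lambda>v. q (fst v) + ((- q 0 * \<theta>\<^sup>2 / 2) * (snd v)\<^sup>2 + ?RX v))"
    using X by blast
  note bX = deriv_bound[where f = ?RX, OF E ab RX]
  show "\<bar>deriv_s (polar_x q \<theta>) E a b - (q 0 * (4 * s - 3) + q (1 / 2) * (4 - 8 * s) + q 1 * (4 * s - 1))\<bar>
       \<le> 100 * (\<bar>q 0\<bar> * \<theta> ^ 4 + d * \<theta>\<^sup>2)"
    using bX(1) unfolding X' deriv_linear(1)[of "\<lambda>v. q (fst v)"] deriv_linear(1)[of "\<lambda>v. (- q 0 * \<theta>\<^sup>2 / 2) * (snd v)\<^sup>2"]
      deriv_linear(2)[of "- q 0 * \<theta>\<^sup>2 / 2"] deriv_quadratic[OF E] deriv_s_fst[OF E] s_def by simp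
  show "\<bar>deriv_\<sigma> (polar_x q \<theta>) E a b + q 0 * \<theta>\<^sup>2 * \<sigma>\<bar> \<le> 100 * (\<bar>q 0\<bar> * \<theta> ^ 4 + d * \<theta>\<^sup>2)"
    using bX(2) unfolding X' deriv_linear(3)[of "\<lambda>v. q (fst v)"] deriv_linear(3)[of "\<lambda>v. (- q 0 * \<theta>\<^sup>2 / 2) * (snd v)\<^sup>2"]
      deriv_linear(4)[of "- q 0 * \<theta>\<^sup>2 / 2"] deriv_quadratic[OF E] deriv_\<sigma>_fst[OF E] \<sigma>_def by simp
  let ?S1 = "\<lambda>v. \<theta> * (q (fst v) - (q 0 + (q 1 - q 0) * fst v)) * snd v"
  let ?S2 = "\<lambda>v. (q (fst v) - q 0) * sin_rem \<theta> v"
  let ?SY = "\<lambda>v. ?S1 v + ?S2 v"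
  have SY: "\<bar>?SY v\<bar> \<le> \<theta> * e + d * \<theta> ^ 3" if "v \<in> nodes E" for v
  proof -
    have "\<bar>q (fst v) - (q 0 + (q 1 - q 0) * fst v)\<bar> \<le> e"
    proof -
      consider "fst v = 0" | "fst v = 1 / 2" | "fst v = 1" using n(1)[OF \<open>v \<in> nodes E\<close>] by blast
      then show ?thesis by cases (use q e in \<open>simp_all only:\<close>, auto simp: field_simps)
    qed
    from abs_mult_le[OF abs_mult_le[of \<theta> \<theta>, OF _ this] n(2)[OF that]] \<theta>
    have "\<bar>?S1 v\<bar> \<le> \<theta> * e" by simp
    moreover have "\<bar>?S2 v\<bar> \<le> d * \<theta> ^ 3"
      using angle_bounds[OF \<theta> n(2)[OF that]] qd[OF that] by (intro abs_mult_le) (auto simp: sin_rem_def)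
    ultimately show ?thesis by linarith
  qed
  have Y: "polar_y q \<theta> v = (\<theta> * q 0) * snd v + ((\<theta> * (q 1 - q 0)) * (fst v * snd v) + (q 0 * sin_rem \<theta> v + ?SY v))" for v
    by (simp add: polar_y_def sin_rem_def algebra_simps)
  have Y': "polar_y q \<theta> = (\<lambda>v. (\<theta> * q 0) * snd v + ((\<theta> * (q 1 - q 0)) * (fst v * snd v) + (q 0 * sin_rem \<theta> v + ?SY v)))"
    using Y by blast
  note bY = deriv_bound[where f = ?SY, OF E ab SY]
  show "\<bar>deriv_s (polar_y q \<theta>) E a b - \<theta> * (q 1 - q 0) * \<sigma> - q 0 * deriv_s (sin_rem \<theta>) E a b\<bar>
       \<le> 100 * (\<theta> * e + d * \<theta> ^ 3)"
    using bY(1) unfolding Y' deriv_linear(1)[of "\<lambda>v. (\<theta> * q 0) * snd v"]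
      deriv_linear(1)[of "\<lambda>v. (\<theta> * (q 1 - q 0)) * (fst v * snd v)"] deriv_linear(1)[of "\<lambda>v. q 0 * sin_rem \<theta> v"]
      deriv_linear(2)[of "\<theta> * q 0"] deriv_linear(2)[of "\<theta> * (q 1 - q 0)"] deriv_linear(2)[of "q 0" "sin_rem \<theta>"]
      deriv_quadratic[OF E] \<sigma>_def by simp
  show "\<bar>deriv_\<sigma> (polar_y q \<theta>) E a b - \<theta> * (q 0 + (q 1 - q 0) * s) - q 0 * deriv_\<sigma> (sin_rem \<theta>) E a b\<bar>
       \<le> 100 * (\<theta> * e + d * \<theta> ^ 3)"
    using bY(2) unfolding Y' deriv_linear(3)[of "\<lambda>v. (\<theta> * q 0) * snd v"]
      deriv_linear(3)[of "\<lambda>v. (\<theta> * (q 1 - q 0)) * (fst v * snd v)"] deriv_linear(3)[of "\<lambda>v. q 0 * sin_rem \<theta> v"]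
      deriv_linear(4)[of "\<theta> * q 0"] deriv_linear(4)[of "\<theta> * (q 1 - q 0)"] deriv_linear(4)[of "q 0" "sin_rem \<theta>"]
      deriv_quadratic[OF E] s_def by (simp add: algebra_simps)
  have "\<bar>sin_rem \<theta> v\<bar> \<le> \<theta> ^ 3" if "v \<in> nodes E" for v
    using angle_bounds(1)[OF \<theta> n(2)[OF that]] by (simp add: sin_rem_def)
  from deriv_bound[where f = "sin_rem \<theta>", OF E ab this]
  show "\<bar>deriv_s (sin_rem \<theta>) E a b\<bar> \<le> 100 * \<theta> ^ 3" "\<bar>deriv_\<sigma> (sin_rem \<theta>) E a b\<bar> \<le> 100 * \<theta> ^ 3"
    by auto
qed

lemma polar_value_bounds:
  assumes E: "E \<in> elems" and ab: "0 \<le> a" "0 \<le> b" "a + b \<le> 1"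
    and \<theta>: "0 \<le> \<theta>" and t: "0 \<le> t0" "0 \<le> \<tau>"
  defines "s \<equiv> interp fst E a b" and "\<sigma> \<equiv> interp snd E a b"
  defines "q \<equiv> \<lambda>s. t0 + \<tau> * s"
  shows "\<bar>interp (polar_x q \<theta>) E a b - (t0 + \<tau> * s)\<bar> \<le> 12 * (t0 + \<tau> * s) * \<theta>\<^sup>2"
    "\<bar>interp (polar_y q \<theta>) E a b - (t0 + \<tau> * s) * \<theta> * \<sigma>\<bar> \<le> 12 * (t0 + \<tau> * s) * \<theta> ^ 3"
proof -
  have n: "fst v \<in> {0, 1 / 2, 1}" "\<bar>snd v\<bar> \<le> 1" if "v \<in> nodes E" for v
    using nodes_elems[OF E that] by auto
  let ?c = "\<lambda>v :: real \<times> real. cos (\<theta> * snd v) - 1"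
  have c: "\<bar>?c v\<bar> \<le> \<theta>\<^sup>2" and sr: "\<bar>sin_rem \<theta> v\<bar> \<le> \<theta> ^ 3" if "v \<in> nodes E" for v
    using angle_bounds[OF \<theta> n(2)[OF that]] by (simp_all add: sin_rem_def)
  have one: "interp (\<lambda>v. 1) E a b = 1" by (simp add: interp_def algebra_simps)
  have X: "polar_x q \<theta> = (\<lambda>v. t0 * 1 + (\<tau> * fst v + (t0 * ?c v + \<tau> * (fst v * ?c v))))"
    by (auto simp: fun_eq_iff polar_x_def q_def algebra_simps)
  have "interp (polar_x q \<theta>) E a b - (t0 + \<tau> * s) = t0 * interp ?c E a b + \<tau> * interp (\<lambda>v. fst v * ?c v) E a b"
    unfolding X interp_linear one s_def by simp
  moreover have "\<bar>t0 * interp ?c E a b\<bar> \<le> t0 * (12 * \<theta>\<^sup>2)"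
    using interp_bound(1)[where f = ?c, OF E ab c] t by (intro abs_mult_le) auto
  moreover have "\<bar>\<tau> * interp (\<lambda>v. fst v * ?c v) E a b\<bar> \<le> \<tau> * (12 * \<theta>\<^sup>2 * s)"
    using interp_bound(2)[where f = ?c, OF E ab c] t unfolding s_def by (intro abs_mult_le) auto
  ultimately show "\<bar>interp (polar_x q \<theta>) E a b - (t0 + \<tau> * s)\<bar> \<le> 12 * (t0 + \<tau> * s) * \<theta>\<^sup>2"
    by (simp add: algebra_simps)
  have Y: "polar_y q \<theta> = (\<lambda>v. (t0 * \<theta>) * snd v + ((\<tau> * \<theta>) * (fst v * snd v) + (t0 * sin_rem \<theta> v + \<tau> * (fst v * sin_rem \<theta> v))))"
    by (auto simp: fun_eq_iff polar_y_def q_def sin_rem_def algebra_simps)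
  have "interp (polar_y q \<theta>) E a b - (t0 + \<tau> * s) * \<theta> * \<sigma> = t0 * interp (sin_rem \<theta>) E a b + \<tau> * interp (\<lambda>v. fst v * sin_rem \<theta> v) E a b"
    unfolding Y interp_linear interp_quadratic[OF E] s_def \<sigma>_def by (simp add: algebra_simps)
  moreover have "\<bar>t0 * interp (sin_rem \<theta>) E a b\<bar> \<le> t0 * (12 * \<theta> ^ 3)"
    using interp_bound(1)[where f = "sin_rem \<theta>", OF E ab sr] t by (intro abs_mult_le) auto
  moreover have "\<bar>\<tau> * interp (\<lambda>v. fst v * sin_rem \<theta> v) E a b\<bar> \<le> \<tau> * (12 * \<theta> ^ 3 * s)"
    using interp_bound(2)[where f = "sin_rem \<theta>", OF E ab sr] t unfolding s_def by (intro abs_mult_le) auto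
  ultimately show "\<bar>interp (polar_y q \<theta>) E a b - (t0 + \<tau> * s) * \<theta> * \<sigma>\<bar> \<le> 12 * (t0 + \<tau> * s) * \<theta> ^ 3"
    by (simp add: algebra_simps)
qed

section \<open>Perturbation of two-by-two minors\<close>

lemma abs_prod_diff_le:
  fixes x y :: real
  assumes "\<bar>x - x0\<bar> \<le> e" "\<bar>y - y0\<bar> \<le> f"
  shows "\<bar>x * y - x0 * y0\<bar> \<le> e * f + e * \<bar>y0\<bar> + \<bar>x0\<bar> * f"
proof -
  have "x * y - x0 * y0 = (x - x0) * (y - y0) + (x - x0) * y0 + x0 * (y - y0)" by (simp add: algebra_simps)
  moreover have "\<bar>(x - x0) * (y - y0)\<bar> \<le> e * f" "\<bar>(x - x0) * y0\<bar> \<le> e * \<bar>y0\<bar>" "\<bar>x0 * (y - y0)\<bar> \<le> \<bar>x0\<bar> * f"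
    using assms by (intro abs_mult_le; simp)+
  ultimately show ?thesis by linarith
qed

text \<open>In the following four estimates \<open>p, Q, R, P\<close> and \<open>a, c, d, b\<close> are the scaled partial
  derivatives of the element map and of the interpolant, with \<open>u = \<theta>\<^sup>2\<close>,
  \<open>z = t0 \<theta>\<^sup>2 / \<tau>\<close>, \<open>y = \<theta>\<^sup>2 / \<tau>\<close>.\<close>

lemma det_element_estimate:
  fixes p P Q R t t1 u z :: real
  assumes "\<bar>p - 1\<bar> \<le> 100 * (z * u + u)" "\<bar>P - t\<bar> \<le> 100 * (t1 * u)" "\<bar>Q\<bar> \<le> 101 * (t1 * u)" "\<bar>R\<bar> \<le> 101 + 100 * z"
    and "0 \<le> u" "u \<le> 1" "0 \<le> z" "z * u \<le> 1" "0 \<le> t" "t \<le> t1" "t1 \<le> 1"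
  shows "\<bar>p * P - Q * R - t\<bar> \<le> 21000 * (t1 * (u + z * u))"
proof -
  let ?k = "t1 * (u + z * u)"
  have nn: "0 \<le> t1" "0 \<le> z * u" "0 \<le> t1 * u" "0 \<le> t1 * (z * u)" using assms by auto
  have a: "(100 * (z * u + u)) * (100 * (t1 * u)) \<le> 10000 * ?k"
  proof -
    have "u * ?k \<le> 1 * ?k" using assms nn by (intro mult_right_mono) (auto intro: add_nonneg_nonneg)
    then show ?thesis by (simp add: algebra_simps)
  qed
  have b: "(100 * (z * u + u)) * \<bar>t\<bar> \<le> 100 * ?k"
    using assms nn mult_left_mono[of t t1 "z * u + u"] by (simp add: algebra_simps)
  have c: "t1 * u \<le> ?k" using nn by (simp add: algebra_simps)
  have d: "\<bar>Q * R\<bar> \<le> (101 * (t1 * u)) * (101 + 100 * z)" by (rule abs_mult_le) fact+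
  have e: "(101 * (t1 * u)) * (101 + 100 * z) \<le> 10201 * ?k" using nn by (simp add: algebra_simps)
  show ?thesis
    using abs_prod_diff_le[OF assms(1,2), unfolded mult_1 abs_one] a b c order_trans[OF d e] nn by linarith
qed

lemma det_interp_estimate:
  fixes a b c d r r' t t1 \<tau> u y B :: real
  assumes ae: "\<bar>a - r'\<bar> \<le> 100 * B * (\<tau>\<^sup>2 + y * u + t1 * u)" and be: "\<bar>b - r\<bar> \<le> 200 * B * (\<tau>\<^sup>2 + u)"
    and ce: "\<bar>c\<bar> \<le> 201 * B * u" and de: "\<bar>d\<bar> \<le> 300 * B * (t1 + y)"
    and r: "\<bar>r\<bar> \<le> B" "\<bar>r'\<bar> \<le> B * t1"
    and "0 \<le> u" "u \<le> 1" "0 \<le> y" "y * u \<le> 1" "0 \<le> t1" "t1 \<le> 1" "0 \<le> \<tau>" "\<tau> \<le> t1" "0 \<le> B"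
  shows "\<bar>a * b - c * d - r' * r\<bar> \<le> 110000 * B\<^sup>2 * (\<tau>\<^sup>2 + y * u + t1 * u)"
proof -
  let ?k = "\<tau>\<^sup>2 + y * u + t1 * u"
  have k0: "0 \<le> y * u" "0 \<le> t1 * u" "0 \<le> ?k" using assms by auto
  have B2: "0 \<le> B\<^sup>2" by simp
  have t2: "\<tau>\<^sup>2 \<le> 1" using assms power_le_one[of \<tau> 2] by simp
  have 1: "(100 * B * ?k) * (200 * B * (\<tau>\<^sup>2 + u)) \<le> 40000 * B\<^sup>2 * ?k"
  proof -
    have "(100 * B * ?k) * (200 * B * (\<tau>\<^sup>2 + u)) = 20000 * B\<^sup>2 * ?k * (\<tau>\<^sup>2 + u)" by (simp add: power2_eq_square algebra_simps)
    also have "\<dots> \<le> 20000 * B\<^sup>2 * ?k * 2" using t2 assms k0 by (intro mult_left_mono) auto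
    finally show ?thesis by simp
  qed
  have 2: "(100 * B * ?k) * \<bar>r\<bar> \<le> 100 * B\<^sup>2 * ?k"
    using mult_left_mono[OF r(1), of "100 * B * ?k"] k0 assms by (simp add: power2_eq_square algebra_simps)
  have 3: "\<bar>r'\<bar> * (200 * B * (\<tau>\<^sup>2 + u)) \<le> 200 * B\<^sup>2 * ?k"
  proof -
    have "\<bar>r'\<bar> * (200 * B * (\<tau>\<^sup>2 + u)) \<le> (B * t1) * (200 * B * (\<tau>\<^sup>2 + u))"
      using r assms by (intro mult_right_mono) auto
    also have "\<dots> = 200 * B\<^sup>2 * (t1 * (\<tau>\<^sup>2 + u))" by (simp add: power2_eq_square algebra_simps)
    also have "t1 * (\<tau>\<^sup>2 + u) \<le> ?k"
      using mult_right_mono[OF \<open>t1 \<le> 1\<close> zero_le_power2[of \<tau>]] k0(1) unfolding distrib_left by linarith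
    finally show ?thesis by (simp add: mult_left_mono)
  qed
  have 4: "\<bar>c * d\<bar> \<le> (201 * B * u) * (300 * B * (t1 + y))" by (rule abs_mult_le) fact+
  have 5: "(201 * B * u) * (300 * B * (t1 + y)) \<le> 60300 * B\<^sup>2 * ?k"
  proof -
    have "(201 * B * u) * (300 * B * (t1 + y)) = 60300 * B\<^sup>2 * (t1 * u + y * u)" by (simp add: power2_eq_square algebra_simps)
    also have "\<dots> \<le> 60300 * B\<^sup>2 * ?k" by (intro mult_left_mono) auto
    finally show ?thesis .
  qed
  have nn: "0 \<le> B\<^sup>2 * ?k" using k0 by simp
  show ?thesis
    using abs_prod_diff_le[OF ae be] 1 2 3 order_trans[OF 4 5] nn by linarith
qed

lemma square_diff_le:
  fixes x x0 :: real
  assumes "\<bar>x - x0\<bar> \<le> e" "\<bar>x0\<bar> \<le> m"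
  shows "\<bar>x\<^sup>2 - x0\<^sup>2\<bar> \<le> e * (e + 2 * m)"
proof -
  have "x\<^sup>2 - x0\<^sup>2 = (x - x0) * (x + x0)" by (simp add: power2_eq_square algebra_simps)
  moreover have "\<bar>x + x0\<bar> \<le> e + 2 * m" using assms by linarith
  ultimately show ?thesis using abs_mult_le[OF assms(1)] by metis
qed

lemma norm_estimate:
  fixes a b c d p P Q R r r' t t1 \<tau> u y B z q12 q21 \<theta> :: real
  assumes ae: "\<bar>a - r'\<bar> \<le> 100 * B * (\<tau>\<^sup>2 + y * u + t1 * u)" and be: "\<bar>b - r\<bar> \<le> 200 * B * (\<tau>\<^sup>2 + u)"
    and ce: "\<bar>c\<bar> \<le> 201 * B * u" and de: "\<bar>d\<bar> \<le> 300 * B * (t1 + y)"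
    and pe: "\<bar>p - 1\<bar> \<le> 100 * (z * u + u)" and Pe: "\<bar>P - t\<bar> \<le> 100 * (t1 * u)"
    and Qe: "\<bar>Q\<bar> \<le> 101 * (t1 * u)" and Re: "\<bar>R\<bar> \<le> 101 + 100 * z"
    and r: "\<bar>r\<bar> \<le> B" "\<bar>r'\<bar> \<le> B * t1"
    and u: "0 \<le> u" "u \<le> 1" and y: "0 \<le> y" "y * u \<le> 1" and t: "0 \<le> t" "t \<le> t1" "t1 \<le> 1" "0 \<le> \<tau>" "\<tau> \<le> t1" "1 \<le> B"
    and z: "0 \<le> z" "z \<le> y"
    and q: "\<bar>q12\<bar> \<le> 71000 * B * \<theta>" "\<bar>q21\<bar> \<le> 92000 * B * \<theta>" and \<theta>: "\<theta>\<^sup>2 = u"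
  shows "\<bar>((a * P - c * R)\<^sup>2 + q12\<^sup>2 + q21\<^sup>2 + (b * p - d * Q)\<^sup>2) - ((t * r')\<^sup>2 + r\<^sup>2)\<bar> \<le>
    40000000000 * B\<^sup>2 * (\<tau>\<^sup>2 + u + y * u)"
proof -
  let ?n = "\<tau>\<^sup>2 + u + y * u"
  have t2: "\<tau>\<^sup>2 \<le> 1" using t power_le_one[of \<tau> 2] by simp
  have zu: "z * u \<le> y * u" using z u by (intro mult_right_mono)
  have n: "0 \<le> y * u" "0 \<le> ?n" "?n \<le> 3" "0 \<le> z * u" using y u t2 z by auto
  have t1u: "t1 * u \<le> u" "0 \<le> t1 * u" using t u mult_right_mono[of t1 1 u] by auto
  have B0: "0 \<le> B" using t by simp
  have ae': "\<bar>a - r'\<bar> \<le> 100 * B * ?n"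
    by (rule order_trans[OF ae]) (use t1u B0 in \<open>auto intro!: mult_left_mono\<close>)
  have be': "\<bar>b - r\<bar> \<le> 200 * B * ?n" "\<bar>b - r\<bar> \<le> 400 * B"
  proof -
    show "\<bar>b - r\<bar> \<le> 200 * B * ?n" by (rule order_trans[OF be]) (use n B0 in \<open>auto intro!: mult_left_mono\<close>)
    have "200 * B * (\<tau>\<^sup>2 + u) \<le> 200 * B * 2" using t2 u B0 by (intro mult_left_mono) auto
    then show "\<bar>b - r\<bar> \<le> 400 * B" using be by simp
  qed
  have pe': "\<bar>p - 1\<bar> \<le> 100 * ?n" "\<bar>p - 1\<bar> \<le> 200"
  proof -
    show "\<bar>p - 1\<bar> \<le> 100 * ?n" using pe zu zero_le_power2[of \<tau>] by argo
    show "\<bar>p - 1\<bar> \<le> 200" using pe zu y u by argo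
  qed
  have Pe': "\<bar>P - t\<bar> \<le> 100 * ?n" "\<bar>P - t\<bar> \<le> 100"
    using Pe t1u n u zero_le_power2[of \<tau>] by (argo, linarith)
  have Bn: "B * ?n = B * \<tau>\<^sup>2 + B * u + B * (y * u)" by (simp add: algebra_simps)
  have Bn0: "0 \<le> B * ?n" "?n \<le> B * ?n" using n B0 t mult_right_mono[of 1 B ?n] by auto
  \<comment> \<open>\<open>A11\<close> and \<open>A22\<close> are the diagonal entries, close to t
    r' and r. The off-diagonal entries \<open>q12\<close> and \<open>q21\<close> are of order
    \<theta>, hence of order u after squaring.\<close>
  have A11: "\<bar>(a * P - c * R) - t * r'\<bar> \<le> 51000 * (B * ?n)"
  proof -
    have "\<bar>a * P - r' * t\<bar> \<le> 100 * B * ?n * 100 + 100 * B * ?n * \<bar>t\<bar> + \<bar>r'\<bar> * (100 * ?n)"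
      using abs_prod_diff_le[OF ae' Pe'(2)] abs_prod_diff_le[OF ae' Pe'(2)] 
        mult_left_mono[OF order_refl, of "100 * ?n" "\<bar>r'\<bar>"] 
    proof -
      have "a * P - r' * t = (a - r') * (P - t) + (a - r') * t + r' * (P - t)" by (simp add: algebra_simps)
      moreover have "\<bar>(a - r') * (P - t)\<bar> \<le> 100 * B * ?n * 100" "\<bar>(a - r') * t\<bar> \<le> 100 * B * ?n * \<bar>t\<bar>"
        "\<bar>r' * (P - t)\<bar> \<le> \<bar>r'\<bar> * (100 * ?n)"
        using ae' Pe' by (intro abs_mult_le; simp)+
      ultimately show ?thesis by linarith
    qed
    moreover have "100 * B * ?n * \<bar>t\<bar> \<le> 100 * B * ?n * 1" using n B0 t by (intro mult_left_mono) auto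
    moreover have "\<bar>r'\<bar> * (100 * ?n) \<le> B * (100 * ?n)"
      using order_trans[OF r(2) mult_left_mono[OF \<open>t1 \<le> 1\<close> B0]] n by (intro mult_right_mono) auto
    moreover have "\<bar>c * R\<bar> \<le> (201 * B * u) * (101 + 100 * z)" by (rule abs_mult_le) fact+
    moreover have "(201 * B * u) * (101 + 100 * z) \<le> 40401 * (B * ?n)"
    proof -
      have "(201 * B * u) * (101 + 100 * z) = 20301 * (B * u) + 20100 * (B * (z * u))" by (simp add: algebra_simps)
      moreover have "B * u \<le> B * ?n" "B * (z * u) \<le> B * ?n"
      proof -
        have "u \<le> ?n" "z * u \<le> ?n" using n zu u zero_le_power2[of \<tau>] by linarith+
        then show "B * u \<le> B * ?n" "B * (z * u) \<le> B * ?n" using B0 by (simp_all only: mult_left_mono)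
      qed
      ultimately show ?thesis by linarith
    qed
    ultimately show ?thesis using Bn0 by (simp only: mult.assoc mult.commute[of r' t] mult.left_commute[of B 100])
  qed
  have A22: "\<bar>(b * p - d * Q) - r\<bar> \<le> 71000 * (B * ?n)"
  proof -
    have "b * p - r = (b - r) * (p - 1) + (b - r) + r * (p - 1)" by (simp add: algebra_simps)
    moreover have "\<bar>(b - r) * (p - 1)\<bar> \<le> (400 * B) * (100 * ?n)" "\<bar>r * (p - 1)\<bar> \<le> B * (100 * ?n)"
      using be' pe' r by (intro abs_mult_le; simp)+
    moreover have "\<bar>d * Q\<bar> \<le> (300 * B * (t1 + y)) * (101 * (t1 * u))" by (rule abs_mult_le) fact+
    moreover have "(300 * B * (t1 + y)) * (101 * (t1 * u)) \<le> 30300 * (B * ?n)"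
    proof -
      have "(300 * B * (t1 + y)) * (101 * (t1 * u)) = 30300 * (B * (t1 * (t1 * u) + t1 * (y * u)))" by (simp add: algebra_simps)
      also have "t1 * (t1 * u) + t1 * (y * u) \<le> u + y * u"
        using t1u t n mult_right_mono[of t1 1 "t1 * u"] mult_right_mono[of t1 1 "y * u"] by linarith
      also have "\<dots> \<le> ?n" by simp
      finally show ?thesis using B0 by (simp add: mult_left_mono)
    qed
    ultimately show ?thesis using be'(1) Bn0 by (simp only: mult.assoc mult.left_commute[of B 100])
  qed
  have sq1: "\<bar>(a * P - c * R)\<^sup>2 - (t * r')\<^sup>2\<bar> \<le> 8000000000 * (B\<^sup>2 * ?n)"
  proof -
    have "\<bar>t * r'\<bar> \<le> 1 * (B * 1)"
    proof (rule abs_mult_le)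
      show "\<bar>r'\<bar> \<le> B * 1" using r(2) mult_left_mono[of t1 1 B] t B0 by linarith
    qed (use t in auto)
    then have "\<bar>t * r'\<bar> \<le> B" by simp
    from square_diff_le[OF A11 this]
    have "\<bar>(a * P - c * R)\<^sup>2 - (t * r')\<^sup>2\<bar> \<le> 51000 * (B * ?n) * (51000 * (B * ?n) + 2 * B)" .
    also have "\<dots> \<le> 51000 * (B * ?n) * (51000 * (B * 3) + 2 * B)"
      using n B0 Bn0 by (intro mult_left_mono add_right_mono) auto
    also have "\<dots> = 7803102000 * (B\<^sup>2 * ?n)" by (simp add: power2_eq_square algebra_simps)
    also have "\<dots> \<le> 8000000000 * (B\<^sup>2 * ?n)" using n by (intro mult_right_mono mult_nonneg_nonneg) auto
    finally show ?thesis .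
  qed
  have sq2: "\<bar>(b * p - d * Q)\<^sup>2 - r\<^sup>2\<bar> \<le> 16000000000 * (B\<^sup>2 * ?n)"
  proof -
    from square_diff_le[OF A22 r(1)]
    have "\<bar>(b * p - d * Q)\<^sup>2 - r\<^sup>2\<bar> \<le> 71000 * (B * ?n) * (71000 * (B * ?n) + 2 * B)" .
    also have "\<dots> \<le> 71000 * (B * ?n) * (71000 * (B * 3) + 2 * B)"
      using n B0 Bn0 by (intro mult_left_mono add_right_mono) auto
    also have "\<dots> = 15123142000 * (B\<^sup>2 * ?n)" by (simp add: power2_eq_square algebra_simps)
    also have "\<dots> \<le> 16000000000 * (B\<^sup>2 * ?n)" using n by (intro mult_right_mono mult_nonneg_nonneg) auto
    finally show ?thesis .
  qed
  have un: "B\<^sup>2 * u \<le> B\<^sup>2 * ?n" using n by (intro mult_left_mono) auto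
  have sq3: "q12\<^sup>2 \<le> 6000000000 * (B\<^sup>2 * ?n)"
  proof -
    have "q12\<^sup>2 \<le> (71000 * B * \<theta>)\<^sup>2" using q(1) by (metis abs_le_square_iff abs_ge_self order_trans)
    also have "\<dots> = 5041000000 * (B\<^sup>2 * u)" using \<theta> by (simp add: power_mult_distrib)
    also have "\<dots> \<le> 6000000000 * (B\<^sup>2 * ?n)" using un mult_nonneg_nonneg[OF zero_le_power2[of B] u(1)] by linarith
    finally show ?thesis .
  qed
  have sq4: "q21\<^sup>2 \<le> 9000000000 * (B\<^sup>2 * ?n)"
  proof -
    have "q21\<^sup>2 \<le> (92000 * B * \<theta>)\<^sup>2" using q(2) by (metis abs_le_square_iff abs_ge_self order_trans)
    also have "\<dots> = 8464000000 * (B\<^sup>2 * u)" using \<theta> by (simp add: power_mult_distrib)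
    also have "\<dots> \<le> 9000000000 * (B\<^sup>2 * ?n)" using un mult_nonneg_nonneg[OF zero_le_power2[of B] u(1)] by linarith
    finally show ?thesis .
  qed
  have "0 \<le> q12\<^sup>2" "0 \<le> q21\<^sup>2" "0 \<le> B\<^sup>2 * ?n" using n by auto
  with sq1 sq2 sq3 sq4 show ?thesis by (simp only: mult.assoc)
qed

section \<open>Taylor and interpolation bounds for the cavity profile\<close>

text \<open>Everything used about the profile. The last four estimates concern an interval
  [t0, t0 + \<tau>]: the derivative in s of the quadratic interpolant against that of r, the
  deviation of r from its chord at the midpoint and elsewhere, and the increment of r.\<close>

definition profile_bounds :: "(real \<Rightarrow> real) \<Rightarrow> (real \<Rightarrow> real) \<Rightarrow> real \<Rightarrow> real \<Rightarrow> real \<Rightarrow> bool" where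
  "profile_bounds r r' B c m \<longleftrightarrow> 1 \<le> B \<and> 0 < c \<and> 0 < m \<and> continuous_on {0<..1} r' \<and>
     (\<forall>t\<in>{0<..1}. (r has_real_derivative r' t) (at t within {0<..1}) \<and>
        c \<le> r t \<and> r t \<le> B \<and> m * t \<le> r' t \<and> r' t \<le> B * t) \<and>
     (\<forall>t0 \<tau> s. 0 < t0 \<longrightarrow> 0 < \<tau> \<longrightarrow> t0 + \<tau> \<le> 1 \<longrightarrow> 0 \<le> s \<longrightarrow> s \<le> 1 \<longrightarrow>
        \<bar>r t0 * (4 * s - 3) + r (t0 + \<tau> / 2) * (4 - 8 * s) + r (t0 + \<tau>) * (4 * s - 1) - \<tau> * r' (t0 + \<tau> * s)\<bar> \<le> 12 * B * \<tau> ^ 3 \<and>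
        \<bar>r (t0 + \<tau> / 2) - (r t0 + r (t0 + \<tau>)) / 2\<bar> \<le> B * \<tau>\<^sup>2 \<and>
        \<bar>r (t0 + \<tau> * s) - (r t0 + (r (t0 + \<tau>) - r t0) * s)\<bar> \<le> 3 * B * \<tau>\<^sup>2 \<and>
        \<bar>r (t0 + \<tau> * s) - r t0\<bar> \<le> B * (t0 + \<tau>) * \<tau>)"

lemma derivative_remainder_bound:
  fixes f f' :: "real \<Rightarrow> real"
  assumes der: "\<And>x. x \<in> {0<..1} \<Longrightarrow> (f has_real_derivative f' x) (at x within {0<..1})"
    and xy: "x \<in> {0<..1}" "y \<in> {0<..1}"
    and bnd: "\<And>z. z \<in> closed_segment y x \<Longrightarrow> \<bar>f' z\<bar> \<le> K"
  shows "\<bar>f x - f y\<bar> \<le> K * \<bar>x - y\<bar>"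
proof -
  have sub: "closed_segment y x \<subseteq> {0<..1}"
    using xy by (auto simp: closed_segment_eq_real_ivl split: if_splits)
  have "norm (f x - f y) \<le> K * norm (x - y)"
    by (rule field_differentiable_bound[OF convex_closed_segment])
       (use sub bnd der DERIV_subset in \<open>auto, blast\<close>)
  then show ?thesis by simp
qed

text \<open>The mean value inequality is applied three times, starting from the bound on
  \<open>D 3\<close>: to \<open>D 2\<close>, to \<open>D 1\<close> minus its tangent, and to
  \<open>D 0\<close> minus its second-order polynomial. The factors 1/2 and 1/6 are given
  away.\<close>

lemma taylor_bounds:
  fixes D :: "nat \<Rightarrow> real \<Rightarrow> real"
  assumes der: "\<And>j x. x \<in> {0<..1} \<Longrightarrow> (D j has_real_derivative D (Suc j) x) (at x within {0<..1})"
    and B: "\<And>x. x \<in> {0<..1} \<Longrightarrow> \<bar>D 3 x\<bar> \<le> B"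
    and xy: "x \<in> {0<..1}" "y \<in> {0<..1}"
  shows "\<bar>D 1 x - D 1 y - D 2 y * (x - y)\<bar> \<le> B * \<bar>x - y\<bar> ^ 2"
    and "\<bar>D 0 x - D 0 y - D 1 y * (x - y) - D 2 y * (x - y)\<^sup>2 / 2\<bar> \<le> B * \<bar>x - y\<bar> ^ 3"
proof -
  have sub: "closed_segment y x \<subseteq> {0<..1}"
    using xy by (auto simp: closed_segment_eq_real_ivl split: if_splits)
  have seg: "\<bar>z - y\<bar> \<le> \<bar>x - y\<bar>" if "z \<in> closed_segment y x" for z
    using that by (auto simp: closed_segment_eq_real_ivl split: if_splits)
  have B0: "0 \<le> B" using B[OF xy(1)] by linarith
  have d2: "\<bar>D 2 z - D 2 y\<bar> \<le> B * \<bar>z - y\<bar>" if "z \<in> {0<..1}" for z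
  proof (rule derivative_remainder_bound[where f' = "D 3"])
    show "(D 2 has_real_derivative D 3 x) (at x within {0<..1})" if "x \<in> {0<..1}" for x
      using der[OF that, of 2] by (simp add: eval_nat_numeral)
  next
    fix w assume "w \<in> closed_segment y z"
    then have "w \<in> {0<..1}" using that xy by (auto simp: closed_segment_eq_real_ivl split: if_splits)
    then show "\<bar>D 3 w\<bar> \<le> B" by (rule B)
  qed (use that xy in auto)
  have d1: "\<bar>D 1 x - D 1 y - D 2 y * (x - y)\<bar> \<le> B * \<bar>x - y\<bar> ^ 2" if "x \<in> {0<..1}" for x
  proof -
    have "\<bar>(D 1 x - D 2 y * x) - (D 1 y - D 2 y * y)\<bar> \<le> (B * \<bar>x - y\<bar>) * \<bar>x - y\<bar>"
    proof (rule derivative_remainder_bound[where f = "\<lambda>x. D 1 x - D 2 y * x" and f' = "\<lambda>x. D 2 x - D 2 y"])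
      fix w assume w: "w \<in> closed_segment y x"
      then have "w \<in> {0<..1}" "\<bar>w - y\<bar> \<le> \<bar>x - y\<bar>"
        using that xy by (auto simp: closed_segment_eq_real_ivl split: if_splits)
      then show "\<bar>D 2 w - D 2 y\<bar> \<le> B * \<bar>x - y\<bar>"
        using d2[of w] B0 mult_left_mono[of "\<bar>w - y\<bar>" "\<bar>x - y\<bar>" B] by linarith
    next
      fix z :: real assume z: "z \<in> {0<..1}"
      have "(D 1 has_real_derivative D 2 z) (at z within {0<..1})" using der[OF z, of 1] by (simp add: eval_nat_numeral)
      then show "((\<lambda>x. D 1 x - D 2 y * x) has_real_derivative D 2 z - D 2 y) (at z within {0<..1})"
        by (auto intro!: derivative_eq_intros)
    qed (use that xy in auto)
    then show ?thesis by (simp add: algebra_simps power2_eq_square)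
  qed
  then show "\<bar>D 1 x - D 1 y - D 2 y * (x - y)\<bar> \<le> B * \<bar>x - y\<bar> ^ 2" using xy by blast
  have "\<bar>(D 0 x - D 1 y * x - D 2 y * (x - y)\<^sup>2 / 2) - (D 0 y - D 1 y * y - D 2 y * (y - y)\<^sup>2 / 2)\<bar> \<le> (B * \<bar>x - y\<bar> ^ 2) * \<bar>x - y\<bar>"
  proof (rule derivative_remainder_bound[where f = "\<lambda>x. D 0 x - D 1 y * x - D 2 y * (x - y)\<^sup>2 / 2" and f' = "\<lambda>x. D 1 x - D 1 y - D 2 y * (x - y)"])
    fix w assume w: "w \<in> closed_segment y x"
    then have "w \<in> {0<..1}" using sub by auto
    moreover have "\<bar>w - y\<bar> ^ 2 \<le> \<bar>x - y\<bar> ^ 2" using seg[OF w] by (intro power_mono) auto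
    ultimately show "\<bar>D 1 w - D 1 y - D 2 y * (w - y)\<bar> \<le> B * \<bar>x - y\<bar> ^ 2"
      using d1[of w] B0 mult_left_mono[of "\<bar>w - y\<bar> ^ 2" "\<bar>x - y\<bar> ^ 2" B] by linarith
  next
    fix z :: real assume z: "z \<in> {0<..1}"
    have "(D 0 has_real_derivative D 1 z) (at z within {0<..1})" using der[OF z, of 0] by (simp add: eval_nat_numeral)
    then show "((\<lambda>x. D 0 x - D 1 y * x - D 2 y * (x - y)\<^sup>2 / 2) has_real_derivative D 1 z - D 1 y - D 2 y * (z - y)) (at z within {0<..1})"
      by (auto intro!: derivative_eq_intros)
  qed (use xy in auto)
  then show "\<bar>D 0 x - D 0 y - D 1 y * (x - y) - D 2 y * (x - y)\<^sup>2 / 2\<bar> \<le> B * \<bar>x - y\<bar> ^ 3"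
    by (simp add: algebra_simps power3_eq_cube power2_eq_square)
qed

lemma cavity_profile_bounds:
  assumes "cavity_profile r"
  obtains r' B c m where "profile_bounds r r' B c m"
proof -
  obtain D m M where D0: "\<And>R. R \<in> {0<..1} \<Longrightarrow> D 0 R = r R"
    and der: "\<And>j R. R \<in> {0<..1} \<Longrightarrow> (D j has_real_derivative D (Suc j) R) (at R within {0<..1})"
    and bd: "\<And>j. j \<le> 3 \<Longrightarrow> bounded (D j ` {0<..1})" and mM: "0 < m" "m < M"
    and D1: "\<And>R. R \<in> {0<..1} \<Longrightarrow> m * R \<le> D 1 R \<and> D 1 R \<le> M * R"
    and pos: "\<And>R. R \<in> {0<..1} \<Longrightarrow> 0 < r R" and inf: "(INF R\<in>{0<..1}. r R) > 0"
    using assms unfolding cavity_profile_def by blast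
  have "\<exists>b. \<forall>R\<in>{0<..1}. \<bar>D j R\<bar> \<le> b" if "j \<le> 3" for j
    using bd[OF that] by (auto simp: bounded_iff)
  then obtain b0 b2 b3 where b: "\<And>R. R \<in> {0<..1} \<Longrightarrow> \<bar>D 0 R\<bar> \<le> b0" "\<And>R. R \<in> {0<..1} \<Longrightarrow> \<bar>D 2 R\<bar> \<le> b2"
    "\<And>R. R \<in> {0<..1} \<Longrightarrow> \<bar>D 3 R\<bar> \<le> b3"
    by (metis le0 le_refl numeral_le_iff semiring_norm(69,72) one_le_numeral order_trans eval_nat_numeral(2) nat_le_linear semiring_norm(71))
  \<comment> \<open>A single constant for all upper bounds; \<open>1 \<le> B\<close> lets absolute
    constants be absorbed as well.\<close>
  define B where "B = Max {1, M, b0, b2, b3}"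
  have B: "1 \<le> B" "M \<le> B" "b0 \<le> B" "b2 \<le> B" "b3 \<le> B" by (simp_all add: B_def)
  define c where "c = (INF R\<in>{0<..1}. r R)"
  have c: "c \<le> r t" if "t \<in> {0<..1}" for t
    unfolding c_def using that pos by (intro cINF_lower bdd_belowI2[where m = 0]) (auto simp: less_imp_le)
  have D3: "\<bar>D 3 R\<bar> \<le> B" "\<bar>D 2 R\<bar> \<le> B" if "R \<in> {0<..1}" for R using b that B by force+
  have rder: "(r has_real_derivative D 1 t) (at t within {0<..1})" if "t \<in> {0<..1}" for t
    by (rule has_field_derivative_transform_within[where f = "D 0" and d = 1])
      (use der[OF that, of 0] D0 that in auto)
  have cont: "continuous_on {0<..1} (D 1)"
    using der DERIV_continuous_on by blast
  have "profile_bounds r (D 1) B c m"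
    unfolding profile_bounds_def
  proof (intro conjI ballI allI impI)
    fix t :: real assume t: "t \<in> {0<..1}"
    show "r t \<le> B" using b(1)[OF t] D0[OF t] B by simp
    show "D 1 t \<le> B * t" by (rule order_trans[OF conjunct2[OF D1[OF t]] mult_right_mono[OF B(2)]]) (use t in simp)
  next
    fix t0 \<tau> s :: real assume h: "0 < t0" "0 < \<tau>" "t0 + \<tau> \<le> 1" "0 \<le> s" "s \<le> 1"
    have \<tau>s: "0 \<le> \<tau> * s" "\<tau> * s \<le> \<tau>" using h by (auto simp: mult_left_le)
    have in1: "t0 \<in> {0<..1}" "t0 + \<tau> / 2 \<in> {0<..1}" "t0 + \<tau> \<in> {0<..1}" "t0 + \<tau> * s \<in> {0<..1}"
      using h \<tau>s unfolding greaterThanAtMost_iff by linarith+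
    have B0: "0 \<le> B" using B by simp
    \<comment> \<open>The remainder after the second-order Taylor polynomial at \<open>t0\<close>.
      Interpolation at 0, 1/2, 1 reproduces that polynomial, so the error of the derivative involves
      only \<open>e\<close> at the nodes and the Taylor remainder of r'.\<close>
    define e where "e = (\<lambda>x. D 0 (t0 + x) - D 0 t0 - D 1 t0 * x - D 2 t0 * x\<^sup>2 / 2)"
    have e: "\<bar>e x\<bar> \<le> B * x ^ 3" if "0 \<le> x" "x \<le> \<tau>" for x
      using taylor_bounds(2)[of D B "t0 + x" t0, OF der D3(1)] that h by (simp add: e_def)
    have re: "r (t0 + x) = r t0 + D 1 t0 * x + D 2 t0 * x\<^sup>2 / 2 + e x" if "0 \<le> x" "x \<le> \<tau>" for x
      using D0[of "t0 + x"] D0[OF in1(1)] that h by (simp add: e_def)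
    have rh: "r (t0 + \<tau> / 2) = r t0 + D 1 t0 * (\<tau> / 2) + D 2 t0 * \<tau>\<^sup>2 / 8 + e (\<tau> / 2)"
      and r1: "r (t0 + \<tau>) = r t0 + D 1 t0 * \<tau> + D 2 t0 * \<tau>\<^sup>2 / 2 + e \<tau>"
      and rs: "r (t0 + \<tau> * s) = r t0 + D 1 t0 * (\<tau> * s) + D 2 t0 * (\<tau> * s)\<^sup>2 / 2 + e (\<tau> * s)"
      using re[of "\<tau> / 2"] re[of \<tau>] re[OF \<tau>s] h by (simp_all add: power_divide)
    have t3: "0 \<le> \<tau> ^ 3" "\<tau> ^ 3 \<le> \<tau>\<^sup>2" "0 \<le> \<tau>\<^sup>2"
      using h power_decreasing[of 2 3 \<tau>] by auto
    have eh: "\<bar>e (\<tau> / 2)\<bar> \<le> B * \<tau> ^ 3 / 8" using e[of "\<tau> / 2"] h by (simp add: power_divide)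
    have e1: "\<bar>e \<tau>\<bar> \<le> B * \<tau> ^ 3" using e[of \<tau>] h by simp
    have es: "\<bar>e (\<tau> * s)\<bar> \<le> B * \<tau> ^ 3"
    proof -
      have "(\<tau> * s) ^ 3 \<le> \<tau> ^ 3" using \<tau>s by (intro power_mono)
      then show ?thesis using e[OF \<tau>s] mult_left_mono[of "(\<tau> * s) ^ 3" "\<tau> ^ 3" B] B0 by linarith
    qed
    have Bt: "0 \<le> B * \<tau> ^ 3" "B * \<tau> ^ 3 \<le> B * \<tau>\<^sup>2" using B0 t3 by (auto intro: mult_left_mono)
    have d2: "\<bar>D 2 t0\<bar> \<le> B" using D3[OF in1(1)] by simp
    have d2t: "\<bar>D 2 t0 * \<tau>\<^sup>2\<bar> \<le> B * \<tau>\<^sup>2" using d2 t3 by (intro abs_mult_le) auto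
    have d1: "\<bar>D 1 (t0 + \<tau> * s) - D 1 t0 - D 2 t0 * (\<tau> * s)\<bar> \<le> B * \<tau>\<^sup>2"
    proof -
      have "\<bar>D 1 (t0 + \<tau> * s) - D 1 t0 - D 2 t0 * (t0 + \<tau> * s - t0)\<bar> \<le> B * \<bar>t0 + \<tau> * s - t0\<bar> ^ 2"
        by (rule taylor_bounds(1)[OF der D3(1) in1(4) in1(1)])
      moreover have "(\<tau> * s)\<^sup>2 \<le> \<tau>\<^sup>2" using \<tau>s by (intro power_mono)
      ultimately show ?thesis using mult_left_mono[of "(\<tau> * s)\<^sup>2" "\<tau>\<^sup>2" B] B0 by simp
    qed
    have td1: "\<bar>\<tau> * (D 1 (t0 + \<tau> * s) - D 1 t0 - D 2 t0 * (\<tau> * s))\<bar> \<le> B * \<tau> ^ 3"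
      using abs_mult_le[of \<tau> \<tau>, OF _ d1] h by (simp add: power3_eq_cube power2_eq_square mult_ac)
    have p1: "\<bar>e (\<tau> / 2) * (4 - 8 * s)\<bar> \<le> (B * \<tau> ^ 3 / 8) * 4" "\<bar>e \<tau> * (4 * s - 1)\<bar> \<le> (B * \<tau> ^ 3) * 3"
      using eh e1 h by (intro abs_mult_le; simp add: abs_le_iff)+
    have "r t0 * (4 * s - 3) + r (t0 + \<tau> / 2) * (4 - 8 * s) + r (t0 + \<tau>) * (4 * s - 1) - \<tau> * D 1 (t0 + \<tau> * s)
      = e (\<tau> / 2) * (4 - 8 * s) + e \<tau> * (4 * s - 1) - \<tau> * (D 1 (t0 + \<tau> * s) - D 1 t0 - D 2 t0 * (\<tau> * s))"
      unfolding rh r1 by (simp add: power2_eq_square field_simps)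
    then show "\<bar>r t0 * (4 * s - 3) + r (t0 + \<tau> / 2) * (4 - 8 * s) + r (t0 + \<tau>) * (4 * s - 1) - \<tau> * D 1 (t0 + \<tau> * s)\<bar> \<le> 12 * B * \<tau> ^ 3"
      using p1 td1 Bt by linarith
    have "r (t0 + \<tau> / 2) - (r t0 + r (t0 + \<tau>)) / 2 = e (\<tau> / 2) - e \<tau> / 2 - D 2 t0 * \<tau>\<^sup>2 / 8"
      unfolding rh r1 by (simp add: field_simps)
    then show "\<bar>r (t0 + \<tau> / 2) - (r t0 + r (t0 + \<tau>)) / 2\<bar> \<le> B * \<tau>\<^sup>2"
      using eh e1 d2t Bt by linarith
    have "r (t0 + \<tau> * s) - (r t0 + (r (t0 + \<tau>) - r t0) * s) = e (\<tau> * s) - e \<tau> * s + D 2 t0 * \<tau>\<^sup>2 * (s * (s - 1) / 2)"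
      unfolding rs r1 by (simp add: power2_eq_square field_simps)
    moreover have "\<bar>e \<tau> * s\<bar> \<le> B * \<tau> ^ 3 * 1" using e1 h by (intro abs_mult_le) auto
    moreover have "\<bar>D 2 t0 * \<tau>\<^sup>2 * (s * (s - 1) / 2)\<bar> \<le> B * \<tau>\<^sup>2 * 1"
    proof -
      have "\<bar>s * (s - 1)\<bar> \<le> 1 * 1" using h by (intro abs_mult_le) auto
      then show ?thesis by (intro abs_mult_le[OF d2t]) simp
    qed
    ultimately show "\<bar>r (t0 + \<tau> * s) - (r t0 + (r (t0 + \<tau>) - r t0) * s)\<bar> \<le> 3 * B * \<tau>\<^sup>2"
      using es Bt by linarith
    have "\<bar>r (t0 + \<tau> * s) - r t0\<bar> \<le> (B * (t0 + \<tau>)) * \<bar>t0 + \<tau> * s - t0\<bar>"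
    proof (rule derivative_remainder_bound[where f' = "D 1", OF rder in1(4) in1(1)])
      fix z assume "z \<in> closed_segment t0 (t0 + \<tau> * s)"
      then have "t0 \<le> z" "z \<le> t0 + \<tau> * s"
        using \<tau>s(1) by (auto simp: closed_segment_eq_real_ivl split: if_splits)
      then have z: "t0 \<le> z" "z \<le> t0 + \<tau>" "z \<in> {0<..1}"
        using h \<tau>s unfolding greaterThanAtMost_iff by linarith+
      have "0 \<le> D 1 z" using D1[OF z(3)] mM z by (meson greaterThanAtMost_iff less_imp_le mult_nonneg_nonneg order_trans)
      moreover have "D 1 z \<le> B * (t0 + \<tau>)"
      proof -
        have "D 1 z \<le> M * z" using D1[OF z(3)] by simp
        also have "\<dots> \<le> B * (t0 + \<tau>)" using z h B mM by (intro mult_mono) auto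
        finally show ?thesis .
      qed
      ultimately show "\<bar>D 1 z\<bar> \<le> B * (t0 + \<tau>)" by simp
    qed
    also have "\<dots> \<le> (B * (t0 + \<tau>)) * \<tau>" using \<tau>s h B0 by (intro mult_left_mono) auto
    finally show "\<bar>r (t0 + \<tau> * s) - r t0\<bar> \<le> B * (t0 + \<tau>) * \<tau>" .
  qed (use B c cont rder D1 mM inf in \<open>auto simp: c_def\<close>)
  with that show ?thesis by blast
qed

section \<open>Determinants and gradient norm on one element\<close>

definition strip_det :: "(real \<times> real \<Rightarrow> real) \<Rightarrow> (real \<times> real \<Rightarrow> real) \<Rightarrow> (real \<times> real) element \<Rightarrow> real \<Rightarrow> real \<Rightarrow> real" where
  "strip_det f g E a b = deriv_s f E a b * deriv_\<sigma> g E a b - deriv_\<sigma> f E a b * deriv_s g E a b"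

definition element_data :: "real \<Rightarrow> real \<Rightarrow> real \<Rightarrow> bool" where
  "element_data t0 \<tau> \<theta> \<longleftrightarrow> 0 < t0 \<and> 0 < \<tau> \<and> t0 + \<tau> \<le> 1 \<and> 0 < \<theta> \<and> \<theta> \<le> 1 \<and> \<theta> ^ 4 \<le> t0 * \<tau>"

lemma id_deriv_bounds:
  assumes el: "element_data t0 \<tau> \<theta>" and E: "E \<in> elems" and ab: "0 \<le> a" "0 \<le> b" "a + b \<le> 1"
  defines "s \<equiv> interp fst E a b" and "\<sigma> \<equiv> interp snd E a b"
  defines "x \<equiv> polar_x (\<lambda>s. t0 + \<tau> * s) \<theta>" and "y \<equiv> polar_y (\<lambda>s. t0 + \<tau> * s) \<theta>"
  shows "\<bar>deriv_s x E a b - \<tau>\<bar> \<le> 100 * (t0 * \<theta> ^ 4 + \<tau> * \<theta>\<^sup>2)"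
    "\<bar>deriv_\<sigma> x E a b + t0 * \<theta>\<^sup>2 * \<sigma>\<bar> \<le> 100 * (t0 * \<theta> ^ 4 + \<tau> * \<theta>\<^sup>2)"
    "\<bar>deriv_s y E a b - \<theta> * \<tau> * \<sigma> - t0 * deriv_s (sin_rem \<theta>) E a b\<bar> \<le> 100 * (\<tau> * \<theta> ^ 3)"
    "\<bar>deriv_\<sigma> y E a b - \<theta> * (t0 + \<tau> * s) - t0 * deriv_\<sigma> (sin_rem \<theta>) E a b\<bar> \<le> 100 * (\<tau> * \<theta> ^ 3)"
    "\<bar>deriv_s y E a b - \<theta> * \<tau> * \<sigma>\<bar> \<le> 100 * ((t0 + \<tau>) * \<theta> ^ 3)"
    "\<bar>deriv_\<sigma> y E a b - \<theta> * (t0 + \<tau> * s)\<bar> \<le> 100 * ((t0 + \<tau>) * \<theta> ^ 3)"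
proof -
  have el': "0 < t0" "0 < \<tau>" "0 \<le> \<theta>" using el by (auto simp: element_data_def)
  let ?q = "\<lambda>s. t0 + \<tau> * s"
  have h: "\<bar>?q (1 / 2) - ?q 0\<bar> \<le> \<tau>" "\<bar>?q 1 - ?q 0\<bar> \<le> \<tau>" "\<bar>?q (1 / 2) - (?q 0 + ?q 1) / 2\<bar> \<le> 0"
    using el' by (auto simp: field_simps)
  note d = deriv_polar_bounds[OF E ab el'(3) h, folded s_def \<sigma>_def x_def y_def]
  show 1: "\<bar>deriv_s y E a b - \<theta> * \<tau> * \<sigma> - t0 * deriv_s (sin_rem \<theta>) E a b\<bar> \<le> 100 * (\<tau> * \<theta> ^ 3)"
    and 2: "\<bar>deriv_\<sigma> y E a b - \<theta> * (t0 + \<tau> * s) - t0 * deriv_\<sigma> (sin_rem \<theta>) E a b\<bar> \<le> 100 * (\<tau> * \<theta> ^ 3)"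
    using d(3,4) by simp_all
  show "\<bar>deriv_s x E a b - \<tau>\<bar> \<le> 100 * (t0 * \<theta> ^ 4 + \<tau> * \<theta>\<^sup>2)"
    "\<bar>deriv_\<sigma> x E a b + t0 * \<theta>\<^sup>2 * \<sigma>\<bar> \<le> 100 * (t0 * \<theta> ^ 4 + \<tau> * \<theta>\<^sup>2)"
    using d(1,2) el' by (simp_all add: field_simps)
  have 3: "\<bar>t0 * deriv_s (sin_rem \<theta>) E a b\<bar> \<le> t0 * (100 * \<theta> ^ 3)" "\<bar>t0 * deriv_\<sigma> (sin_rem \<theta>) E a b\<bar> \<le> t0 * (100 * \<theta> ^ 3)"
    using d(5,6) el' by (intro abs_mult_le; simp)+
  show "\<bar>deriv_s y E a b - \<theta> * \<tau> * \<sigma>\<bar> \<le> 100 * ((t0 + \<tau>) * \<theta> ^ 3)"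
    using 1 3(1) by (simp add: distrib_right abs_le_iff)
  show "\<bar>deriv_\<sigma> y E a b - \<theta> * (t0 + \<tau> * s)\<bar> \<le> 100 * ((t0 + \<tau>) * \<theta> ^ 3)"
    using 2 3(2) by (simp add: distrib_right abs_le_iff)
qed

lemma abs_triangle_le: "\<bar>x - y\<bar> \<le> a \<Longrightarrow> \<bar>y\<bar> \<le> b \<Longrightarrow> \<bar>x\<bar> \<le> a + (b :: real)"
  by linarith

lemma abs_diff_scale: "0 < k \<Longrightarrow> \<bar>x - y\<bar> * k = \<bar>x * k - k * (y :: real)\<bar>"
  by (metis abs_mult_pos left_diff_distrib less_imp_le mult.commute)

text \<open>The derivatives are scaled so that the minors, divided by \<tau> \<theta>, become p P -
  Q R and a' b' - c' d': the s-derivative of x is divided by \<tau>, the \<sigma>-derivative of y by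
  \<theta>, the s-derivative of y by \<tau> \<theta>, and the \<sigma>-derivative of x is left
  alone. The critical products are Q R and c' d', where a factor of order \<theta>^2 meets one that
  may be as large as \<theta>^2 / \<tau>; \<open>element_data\<close> bounds \<theta>^4 / \<tau> by
  t0.\<close>

lemma element_estimates:
  assumes el: "element_data t0 \<tau> \<theta>" and r: "profile_bounds r r' B c m"
    and E: "E \<in> elems" and ab: "0 \<le> a" "0 \<le> b" "a + b \<le> 1"
  defines "t \<equiv> t0 + \<tau> * interp fst E a b"
    and "x \<equiv> polar_x (\<lambda>s. t0 + \<tau> * s) \<theta>" and "y \<equiv> polar_y (\<lambda>s. t0 + \<tau> * s) \<theta>"
    and "X \<equiv> polar_x (\<lambda>s. r (t0 + \<tau> * s)) \<theta>" and "Y \<equiv> polar_y (\<lambda>s. r (t0 + \<tau> * s)) \<theta>"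
  shows "\<bar>strip_det x y E a b / (\<tau> * \<theta>) - t\<bar> \<le> 21000 * ((t0 + \<tau>) * (\<theta>\<^sup>2 + t0 * \<theta> ^ 4 / \<tau>))"
    and "\<bar>strip_det X Y E a b / (\<tau> * \<theta>) - r' t * r t\<bar> \<le> 110000 * B\<^sup>2 * (\<tau>\<^sup>2 + \<theta> ^ 4 / \<tau> + (t0 + \<tau>) * \<theta>\<^sup>2)"
    and "\<bar>((strip_det X y E a b)\<^sup>2 + (strip_det x X E a b)\<^sup>2 + (strip_det Y y E a b)\<^sup>2 + (strip_det x Y E a b)\<^sup>2) / (\<tau> * \<theta>)\<^sup>2 -
      ((t * r' t)\<^sup>2 + (r t)\<^sup>2)\<bar> \<le> 40000000000 * B\<^sup>2 * (\<tau>\<^sup>2 + \<theta>\<^sup>2 + \<theta> ^ 4 / \<tau>)"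
proof -
  have el': "0 < t0" "0 < \<tau>" "t0 + \<tau> \<le> 1" "0 < \<theta>" "\<theta> \<le> 1" "\<theta> ^ 4 \<le> t0 * \<tau>"
    using el by (auto simp: element_data_def)
  define s where "s = interp fst E a b"
  define \<sigma> where "\<sigma> = interp snd E a b"
  define t1 where "t1 = t0 + \<tau>"
  have s: "0 \<le> s" "s \<le> 1" "\<bar>\<sigma>\<bar> \<le> 1" using interp_range[OF E ab] by (auto simp: s_def \<sigma>_def)
  have ts: "t = t0 + \<tau> * s" by (simp add: t_def s_def)
  have \<tau>s: "0 \<le> \<tau> * s" "\<tau> * s \<le> \<tau>" using el' s by (auto simp: mult_left_le)
  have t: "t0 \<le> t" "t \<le> t1" "t1 \<le> 1" "0 < t" "0 \<le> t1" "\<tau> \<le> t1" "t \<in> {0<..1}"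
    using el' \<tau>s unfolding ts t1_def greaterThanAtMost_iff by linarith+
  define u where "u = \<theta>\<^sup>2"
  define yy where "yy = \<theta>\<^sup>2 / \<tau>"
  define z where "z = t0 * \<theta>\<^sup>2 / \<tau>"
  have u: "0 < u" "u \<le> 1" using el' by (auto simp: u_def power_le_one)
  have u2: "u * u = \<theta> ^ 4" by (simp add: u_def flip: power_add)
  have yu: "yy * u = \<theta> ^ 4 / \<tau>" "z * u = t0 * \<theta> ^ 4 / \<tau>"
    using u2 by (auto simp: yy_def z_def u_def[symmetric])
  have y0: "0 \<le> yy" "0 \<le> z" "z \<le> yy" using el' t by (auto simp: yy_def z_def divide_right_mono)
  have "\<theta> ^ 4 \<le> 1 * \<tau>" using el'(6) mult_right_mono[of t0 1 \<tau>] el' by linarith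
  then have yy1: "yy * u \<le> 1" using el' unfolding yu by simp
  have zu1: "z * u \<le> 1" using yy1 y0 u mult_right_mono[of z yy u] by linarith
  have \<theta>3: "\<theta> ^ 3 = u * \<theta>" by (simp add: u_def power2_eq_square power3_eq_cube)
  note di = id_deriv_bounds[OF el E ab, folded s_def \<sigma>_def x_def y_def, folded ts]
  define p where "p = deriv_s x E a b / \<tau>"
  define P where "P = deriv_\<sigma> y E a b / \<theta>"
  define Q where "Q = deriv_\<sigma> x E a b"
  define R where "R = deriv_s y E a b / (\<tau> * \<theta>)"
  define a' where "a' = deriv_s X E a b / \<tau>"
  define b' where "b' = deriv_\<sigma> Y E a b / \<theta>"
  define c' where "c' = deriv_\<sigma> X E a b"
  define d' where "d' = deriv_s Y E a b / (\<tau> * \<theta>)"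
  have xs: "deriv_s x E a b = p * \<tau>" "deriv_\<sigma> y E a b = P * \<theta>" "deriv_\<sigma> x E a b = Q" "deriv_s y E a b = R * (\<tau> * \<theta>)"
    "deriv_s X E a b = a' * \<tau>" "deriv_\<sigma> Y E a b = b' * \<theta>" "deriv_\<sigma> X E a b = c'" "deriv_s Y E a b = d' * (\<tau> * \<theta>)"
    using el' by (simp_all add: p_def P_def Q_def R_def a'_def b'_def c'_def d'_def)
  have pe: "\<bar>p - 1\<bar> \<le> 100 * (z * u + u)"
  proof -
    have "\<bar>p - 1\<bar> * \<tau> = \<bar>p * \<tau> - \<tau>\<bar>" using el' by (simp add: abs_mult_pos left_diff_distrib)
    also have "\<dots> \<le> 100 * (t0 * \<theta> ^ 4 + \<tau> * \<theta>\<^sup>2)" using di(1) unfolding xs .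
    also have "\<dots> = 100 * (z * u + u) * \<tau>" using el' unfolding yu(2) by (simp add: field_simps u_def)
    finally show ?thesis using el' by simp
  qed
  have Pe: "\<bar>P - t\<bar> \<le> 100 * (t1 * u)"
  proof -
    have "\<bar>P - t\<bar> * \<theta> = \<bar>P * \<theta> - \<theta> * t\<bar>" using el' by (intro abs_diff_scale)
    also have "\<dots> \<le> 100 * (t1 * u) * \<theta>" using di(6) unfolding xs \<theta>3 t1_def by (simp add: mult_ac)
    finally show ?thesis using el' by simp
  qed
  have t0u: "\<bar>t0 * u * \<sigma>\<bar> \<le> t0 * u" using abs_mult_le[of "t0 * u" "t0 * u" \<sigma> 1] s el' u by simp
  have Qe: "\<bar>Q\<bar> \<le> 101 * (t1 * u)"
  proof -
    have "\<bar>Q + t0 * u * \<sigma>\<bar> \<le> 100 * (t0 * (u * u) + \<tau> * u)" using di(2) unfolding xs u2[symmetric] u_def[symmetric] .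
    moreover have "t0 * (u * u) \<le> t0 * (u * 1)" using el' u by (intro mult_left_mono) auto
    moreover have "0 \<le> \<tau> * u" using el' u by simp
    ultimately show ?thesis using t0u unfolding t1_def distrib_right mult_1_right by argo
  qed
  have Re: "\<bar>R\<bar> \<le> 101 + 100 * z"
  proof -
    have "\<bar>R\<bar> * (\<tau> * \<theta>) = \<bar>R * (\<tau> * \<theta>)\<bar>" using el' by (simp add: abs_mult)
    also have "\<dots> \<le> \<tau> * \<theta> + 100 * ((t0 + \<tau>) * (u * \<theta>))"
    proof -
      have "\<bar>\<theta> * \<tau> * \<sigma>\<bar> \<le> \<theta> * \<tau> * 1" using s el' by (intro abs_mult_le) auto
      then show ?thesis using di(5) unfolding xs \<theta>3 by (simp only: mult_1_right mult.commute[of \<theta> \<tau>])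
    qed
    also have "\<dots> \<le> (101 + 100 * z) * (\<tau> * \<theta>)"
    proof -
      have "z * \<tau> = t0 * u" using el' by (simp add: z_def u_def)
      then have "(101 + 100 * z) * (\<tau> * \<theta>) = 101 * (\<tau> * \<theta>) + 100 * (t0 * u * \<theta>)"
        by (simp add: distrib_right flip: mult.assoc)
      moreover have "\<tau> * (u * \<theta>) \<le> \<tau> * (1 * \<theta>)" using el' u by (intro mult_left_mono mult_right_mono) auto
      moreover have "(t0 + \<tau>) * (u * \<theta>) = t0 * u * \<theta> + \<tau> * (u * \<theta>)" by (simp add: algebra_simps)
      ultimately show ?thesis by simp
    qed
    finally show ?thesis using el' by simp
  qed
  have B: "1 \<le> B" and rt: "\<And>t. t \<in> {0<..1} \<Longrightarrow> c \<le> r t \<and> r t \<le> B \<and> m * t \<le> r' t \<and> r' t \<le> B * t" and c: "0 < c" "0 < m"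
    using r by (auto simp: profile_bounds_def)
  have rB: "\<bar>r t\<bar> \<le> B" "\<bar>r' t\<bar> \<le> B * t1" "\<bar>r t0\<bar> \<le> B"
  proof -
    show "\<bar>r t\<bar> \<le> B" "\<bar>r t0\<bar> \<le> B" using rt[OF t(7)] rt[of t0] el' c by auto
    have "0 \<le> r' t" using rt[OF t(7)] c t by (smt (verit) mult_nonneg_nonneg)
    moreover have "r' t \<le> B * t1" using rt[OF t(7)] t B mult_left_mono[of t t1 B] by linarith
    ultimately show "\<bar>r' t\<bar> \<le> B * t1" by simp
  qed
  let ?q = "\<lambda>s. r (t0 + \<tau> * s)"
  have pb: "\<bar>?q 0 * (4 * s - 3) + ?q (1 / 2) * (4 - 8 * s) + ?q 1 * (4 * s - 1) - \<tau> * r' t\<bar> \<le> 12 * B * \<tau> ^ 3"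
     "\<bar>?q (1 / 2) - (?q 0 + ?q 1) / 2\<bar> \<le> B * \<tau>\<^sup>2"
     "\<bar>r t - (?q 0 + (?q 1 - ?q 0) * s)\<bar> \<le> 3 * B * \<tau>\<^sup>2"
     "\<And>s. 0 \<le> s \<Longrightarrow> s \<le> 1 \<Longrightarrow> \<bar>?q s - ?q 0\<bar> \<le> B * t1 * \<tau>"
    using r s el' unfolding profile_bounds_def ts t1_def by simp_all
  have q0: "?q 0 = r t0" by simp
  have pb4: "\<bar>?q (1 / 2) - ?q 0\<bar> \<le> B * t1 * \<tau>" "\<bar>?q 1 - ?q 0\<bar> \<le> B * t1 * \<tau>"
    by (rule pb(4); simp)+
  note dr = deriv_polar_bounds[OF E ab less_imp_le[OF el'(4)], of ?q, OF pb4 pb(2),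
      folded s_def \<sigma>_def X_def Y_def, unfolded q0]
  have dr': "\<bar>deriv_s X E a b - \<tau> * r' t\<bar> \<le> 12 * B * \<tau> ^ 3 + 100 * (\<bar>r t0\<bar> * \<theta> ^ 4 + B * t1 * \<tau> * \<theta>\<^sup>2)"
    using dr(1) pb(1) unfolding q0 by simp
  have B0: "0 \<le> B" using B by simp
  have r4: "\<bar>r t0\<bar> * \<theta> ^ 4 \<le> B * (u * u)" unfolding u2 using rB by (intro mult_right_mono) auto
  have ae: "\<bar>a' - r' t\<bar> \<le> 100 * B * (\<tau>\<^sup>2 + yy * u + t1 * u)"
  proof -
    have "\<bar>a' - r' t\<bar> * \<tau> = \<bar>a' * \<tau> - \<tau> * r' t\<bar>" using el' by (intro abs_diff_scale)
    also have "\<dots> \<le> 12 * B * \<tau> ^ 3 + 100 * (B * (u * u) + B * t1 * \<tau> * u)"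
      using dr' r4 unfolding xs by (simp add: u_def)
    also have "\<dots> \<le> 100 * B * (\<tau>\<^sup>2 + yy * u + t1 * u) * \<tau>"
    proof -
      have "yy * u * \<tau> = u * u" using el' by (simp add: yy_def u_def)
      then have "100 * B * (\<tau>\<^sup>2 + yy * u + t1 * u) * \<tau> = 100 * (B * \<tau> ^ 3) + 100 * (B * (u * u) + B * t1 * \<tau> * u)"
        by (simp add: power2_eq_square power3_eq_cube algebra_simps)
      moreover have "0 \<le> B * \<tau> ^ 3" using B0 el' by simp
      ultimately show ?thesis by linarith
    qed
    finally show ?thesis using el' by simp
  qed
  have e1: "100 * (\<theta> * (B * \<tau>\<^sup>2) + B * t1 * \<tau> * \<theta> ^ 3) \<le> 100 * (B * \<tau>\<^sup>2 * \<theta> + B * u * \<theta>)"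
    "100 * (\<theta> * (B * \<tau>\<^sup>2) + B * t1 * \<tau> * \<theta> ^ 3) \<le> 200 * (B * \<tau> * \<theta>)"
    "100 * (\<theta> * (B * \<tau>\<^sup>2) + B * t1 * \<tau> * \<theta> ^ 3) \<le> 100 * (B * t1 * \<tau> * \<theta>) + 100 * (B * t1 * \<tau> * \<theta>)"
  proof -
    have "t1 * \<tau> * (u * \<theta>) \<le> 1 * (u * \<theta>)"
      using t el' u mult_le_one[of t1 \<tau>] by (intro mult_right_mono) auto
    from mult_left_mono[OF this B0]
    show "100 * (\<theta> * (B * \<tau>\<^sup>2) + B * t1 * \<tau> * \<theta> ^ 3) \<le> 100 * (B * \<tau>\<^sup>2 * \<theta> + B * u * \<theta>)"
      unfolding \<theta>3 by (simp add: mult_ac)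
    have a: "\<tau>\<^sup>2 * \<theta> \<le> t1 * \<tau> * \<theta>" using t el' by (simp add: power2_eq_square mult_right_mono)
    have b: "t1 * \<tau> * (u * \<theta>) \<le> t1 * \<tau> * (1 * \<theta>)" using t el' u by (intro mult_left_mono mult_right_mono) auto
    from mult_left_mono[OF a B0] mult_left_mono[OF b B0]
    show 3: "100 * (\<theta> * (B * \<tau>\<^sup>2) + B * t1 * \<tau> * \<theta> ^ 3) \<le> 100 * (B * t1 * \<tau> * \<theta>) + 100 * (B * t1 * \<tau> * \<theta>)"
      unfolding \<theta>3 by (simp add: mult_ac)
    have "B * \<tau> * \<theta> * t1 \<le> B * \<tau> * \<theta> * 1" using t el' B0 by (intro mult_left_mono) auto
    with 3 show "100 * (\<theta> * (B * \<tau>\<^sup>2) + B * t1 * \<tau> * \<theta> ^ 3) \<le> 200 * (B * \<tau> * \<theta>)"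
      by (simp add: mult_ac)
  qed
  have be: "\<bar>b' - r t\<bar> \<le> 200 * B * (\<tau>\<^sup>2 + u)"
  proof -
    define v1 where "v1 = deriv_\<sigma> Y E a b - \<theta> * (r t0 + (?q 1 - r t0) * s) - r t0 * deriv_\<sigma> (sin_rem \<theta>) E a b"
    define v2 where "v2 = r t0 * deriv_\<sigma> (sin_rem \<theta>) E a b"
    define v3 where "v3 = \<theta> * (r t - (r t0 + (?q 1 - r t0) * s))"
    have "\<bar>b' - r t\<bar> * \<theta> = \<bar>b' * \<theta> - \<theta> * r t\<bar>" using el' by (intro abs_diff_scale)
    also have "b' * \<theta> - \<theta> * r t = v1 + v2 - v3"
      by (simp add: v1_def v2_def v3_def xs algebra_simps)
    also have "\<bar>v1 + v2 - v3\<bar> \<le> 100 * (B * \<tau>\<^sup>2 * \<theta> + B * u * \<theta>) + B * (100 * (u * \<theta>)) + \<theta> * (3 * B * \<tau>\<^sup>2)"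
    proof -
      have "\<bar>v1\<bar> \<le> 100 * (B * \<tau>\<^sup>2 * \<theta> + B * u * \<theta>)"
        unfolding v1_def by (rule order_trans[OF dr(4) e1(1)])
      moreover have "\<bar>v3\<bar> \<le> \<theta> * (3 * B * \<tau>\<^sup>2)"
        unfolding v3_def using pb(3) el' unfolding q0 by (intro abs_mult_le) auto
      moreover have "\<bar>v2\<bar> \<le> B * (100 * (u * \<theta>))"
        unfolding v2_def using dr(6) rB unfolding \<theta>3 by (intro abs_mult_le) auto
      ultimately show ?thesis by argo
    qed
    finally have "\<bar>b' - r t\<bar> * \<theta> \<le> 3 * (B * \<tau>\<^sup>2 * \<theta>) + 100 * (B * u * \<theta>) + 100 * (B * \<tau>\<^sup>2 * \<theta> + B * u * \<theta>)"
      by (simp add: mult_ac)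
    also have "\<dots> \<le> 200 * B * (\<tau>\<^sup>2 + u) * \<theta>"
    proof -
      have "0 \<le> B * \<tau>\<^sup>2 * \<theta>" using B0 el' by simp
      then show ?thesis by (simp add: algebra_simps)
    qed
    finally show ?thesis using el' by simp
  qed
  have ce: "\<bar>c'\<bar> \<le> 201 * B * u"
  proof -
    have "\<bar>r t0 * \<theta>\<^sup>2 * \<sigma>\<bar> \<le> B * u * 1" using rB s u unfolding u_def[symmetric] by (intro abs_mult_le) auto
    moreover have "B * (u * u) \<le> B * (u * 1)" using B0 u by (intro mult_left_mono) auto
    moreover have "B * t1 * \<tau> * u \<le> B * u"
    proof -
      have "t1 * \<tau> * (B * u) \<le> 1 * (B * u)" using t el' B0 u mult_le_one[of t1 \<tau>] by (intro mult_right_mono) auto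
      then show ?thesis by (simp add: mult_ac)
    qed
    ultimately show ?thesis using dr(2) r4 unfolding xs u_def[symmetric] by (simp add: mult.assoc) 
  qed
  have qs: "\<bar>?q 1 - r t0\<bar> \<le> B * t1 * \<tau>" using pb(4)[of 1] by simp
  have ys': "\<bar>deriv_s Y E a b - r t0 * deriv_s (sin_rem \<theta>) E a b\<bar> \<le> B * t1 * \<tau> * \<theta> + 100 * (\<theta> * (B * \<tau>\<^sup>2) + B * t1 * \<tau> * \<theta> ^ 3)"
  proof -
    have "\<bar>\<theta> * (?q 1 - r t0) * \<sigma>\<bar> \<le> \<theta> * (B * t1 * \<tau>) * 1" using qs s el' by (intro abs_mult_le) auto
    then show ?thesis using dr(3) by (simp add: mult_ac)
  qed
  have Rs: "\<bar>r t0 * deriv_s (sin_rem \<theta>) E a b\<bar> \<le> B * (100 * (u * \<theta>))"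
    using dr(5) rB unfolding \<theta>3 by (intro abs_mult_le) auto
  have de: "\<bar>d'\<bar> \<le> 300 * B * (t1 + yy)"
  proof -
    have "\<bar>d'\<bar> * (\<tau> * \<theta>) = \<bar>d' * (\<tau> * \<theta>)\<bar>" using el' by (simp add: abs_mult)
    also have "\<dots> \<le> 201 * (B * t1 * \<tau> * \<theta>) + 100 * (B * u * \<theta>)" 
    proof -
      have "\<bar>deriv_s Y E a b - r t0 * deriv_s (sin_rem \<theta>) E a b\<bar> \<le> 201 * (B * t1 * \<tau> * \<theta>)"
        using order_trans[OF ys' add_left_mono[OF e1(3)]] by (simp add: mult_ac)
      from abs_triangle_le[OF this Rs] show ?thesis unfolding xs by (simp add: mult_ac)
    qed
    also have "\<dots> \<le> 300 * B * (t1 + yy) * (\<tau> * \<theta>)"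
    proof -
      have "yy * \<tau> = u" using el' by (simp add: yy_def u_def)
      then have "300 * B * (t1 + yy) * (\<tau> * \<theta>) = 300 * (B * t1 * \<tau> * \<theta>) + 300 * (B * u * \<theta>)" by (simp add: algebra_simps)
      moreover have "0 \<le> B * t1 * \<tau> * \<theta>" "0 \<le> B * u * \<theta>" using B0 t el' u by auto
      ultimately show ?thesis by linarith
    qed
    finally show ?thesis using el' by simp
  qed
  have ut: "0 \<le> u" "u \<le> 1" "0 \<le> t" "0 \<le> \<tau>" using u t el' by auto
  have "strip_det x y E a b / (\<tau> * \<theta>) = p * P - Q * R"
    using el' by (simp add: strip_det_def xs field_simps)
  with det_element_estimate[OF pe Pe Qe Re ut(1,2) y0(2) zu1 ut(3) t(2,3)]
  show "\<bar>strip_det x y E a b / (\<tau> * \<theta>) - t\<bar> \<le> 21000 * ((t0 + \<tau>) * (\<theta>\<^sup>2 + t0 * \<theta> ^ 4 / \<tau>))"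
    by (simp add: yu[unfolded u_def] u_def t1_def)
  have "strip_det X Y E a b / (\<tau> * \<theta>) = a' * b' - c' * d'"
    using el' by (simp add: strip_det_def xs field_simps)
  with det_interp_estimate[OF ae be ce de rB(1,2) ut(1,2) y0(1) yy1 t(5,3) ut(4) t(6) B0]
  show "\<bar>strip_det X Y E a b / (\<tau> * \<theta>) - r' t * r t\<bar> \<le> 110000 * B\<^sup>2 * (\<tau>\<^sup>2 + \<theta> ^ 4 / \<tau> + (t0 + \<tau>) * \<theta>\<^sup>2)"
    by (simp add: yu[unfolded u_def] u_def t1_def)
  define q12 where "q12 = strip_det x X E a b / (\<tau> * \<theta>)"
  define q21 where "q21 = strip_det Y y E a b / (\<tau> * \<theta>)"
  have t1u: "t1 * u \<le> u" using t u by simp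
  have t2: "\<tau>\<^sup>2 \<le> 1" using el' power_le_one[of \<tau> 2] by simp
  have aB: "\<bar>a'\<bar> \<le> 301 * B"
  proof -
    have "\<tau>\<^sup>2 + yy * u + t1 * u \<le> 3" using t2 yy1 t1u u by linarith
    then have "100 * B * (\<tau>\<^sup>2 + yy * u + t1 * u) \<le> 100 * B * 3" using B0 by (intro mult_left_mono) auto
    moreover have "\<bar>r' t\<bar> \<le> B" using order_trans[OF rB(2) mult_left_mono[OF t(3) B0]] by simp
    ultimately show ?thesis using ae by linarith
  qed
  have pB: "\<bar>p\<bar> \<le> 201" using pe zu1 u by argo
  have q12e: "\<bar>q12\<bar> \<le> 71000 * B * \<theta>"
  proof -
    have "q12 = (p * c' - Q * a') / \<theta>" using el' by (simp add: q12_def strip_det_def xs field_simps)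
    moreover have "\<bar>p * c' - Q * a'\<bar> \<le> 71000 * (B * u)"
    proof -
    have "\<bar>p * c'\<bar> \<le> 201 * (201 * B * u)" "\<bar>Q * a'\<bar> \<le> (101 * (t1 * u)) * (301 * B)"
      using pB ce Qe aB by (intro abs_mult_le; simp)+
    moreover have "(101 * (t1 * u)) * (301 * B) \<le> (101 * u) * (301 * B)" using t1u B0 by (intro mult_right_mono mult_left_mono) auto
    moreover have "201 * (201 * B * u) = 40401 * (B * u)" "(101 * u) * (301 * B) = 30401 * (B * u)" "0 \<le> B * u"
      using B0 u by simp_all
    ultimately show ?thesis by linarith
    qed
    ultimately have "\<bar>q12\<bar> \<le> 71000 * (B * u) / \<theta>" using el' B0 u by (simp add: divide_right_mono)
    then show ?thesis using el' by (simp add: u_def power2_eq_square)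
  qed
  have q21e: "\<bar>q21\<bar> \<le> 92000 * B * \<theta>"
  proof -
    define ys yt Ys Yt \<rho> where "ys = deriv_s y E a b" and "yt = deriv_\<sigma> y E a b" and "Ys = deriv_s Y E a b" and "Yt = deriv_\<sigma> Y E a b"
      and "\<rho> = deriv_s (sin_rem \<theta>) E a b"
    \<comment> \<open>The derivative \<rho> of the sine remainder is only of order \<theta>^3, which
      need not be small compared with \<tau> \<theta>. It enters \<open>Ys\<close> and
      \<open>ys\<close> with the factors \<open>r t0\<close> and \<open>t0\<close>; after regrouping
      it survives only in front of \<open>r t0 * yt - t0 * Yt\<close>, which is itself of order
      \<tau> \<theta>.\<close>
    have id: "Ys * yt - Yt * ys = (Ys - r t0 * \<rho>) * yt - Yt * (ys - t0 * \<rho>) + \<rho> * (r t0 * yt - t0 * Yt)"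
      by (simp add: algebra_simps)
    have b1: "\<bar>Ys - r t0 * \<rho>\<bar> \<le> 201 * (B * \<tau> * \<theta>)"
    proof -
      have "B * \<tau> * \<theta> * t1 \<le> B * \<tau> * \<theta> * 1" using t el' B0 by (intro mult_left_mono) auto
      then show ?thesis using ys' e1(2) unfolding Ys_def \<rho>_def by (simp add: mult_ac)
    qed
    have b2: "\<bar>yt\<bar> \<le> 101 * \<theta>"
    proof -
      have "\<theta> * t \<le> \<theta> * 1" using t el' by (intro mult_left_mono) auto
      moreover have "0 \<le> \<theta> * t" using t el' by simp
      moreover have "(t0 + \<tau>) * \<theta> ^ 3 \<le> 1 * \<theta>"
      proof -
        have "(t0 + \<tau>) * u \<le> 1" using t1u u unfolding t1_def by linarith
        from mult_right_mono[OF this less_imp_le[OF el'(4)]] show ?thesis unfolding \<theta>3 by (simp add: mult.assoc)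
      qed
      ultimately show ?thesis using di(6) unfolding yt_def by linarith
    qed
    have b3: "\<bar>ys - t0 * \<rho>\<bar> \<le> 101 * (\<tau> * \<theta>)"
    proof -
      have "\<bar>\<theta> * \<tau> * \<sigma>\<bar> \<le> \<theta> * \<tau> * 1" using s el' by (intro abs_mult_le) auto
      moreover have "\<tau> * \<theta> ^ 3 \<le> \<tau> * (1 * \<theta>)" unfolding \<theta>3 using el' u by (intro mult_left_mono mult_right_mono) auto
      ultimately show ?thesis using di(3) unfolding ys_def \<rho>_def by (simp add: mult.commute)
    qed
    have b4: "\<bar>Yt\<bar> \<le> 401 * (B * \<theta>)"
    proof -
      have "200 * B * (\<tau>\<^sup>2 + u) \<le> 200 * B * 2" using t2 u B0 by (intro mult_left_mono) auto
      then have "\<bar>b'\<bar> \<le> 401 * B" using be rB(1) by linarith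
      then show ?thesis using el' unfolding Yt_def xs by (simp add: abs_mult)
    qed
    have b5: "\<bar>r t0 * yt - t0 * Yt\<bar> \<le> 302 * (B * \<tau> * \<theta>)"
    proof -
      define e4 where "e4 = yt - \<theta> * t - t0 * deriv_\<sigma> (sin_rem \<theta>) E a b"
      define e4' where "e4' = Yt - \<theta> * (r t0 + (?q 1 - r t0) * s) - r t0 * deriv_\<sigma> (sin_rem \<theta>) E a b"
      have "r t0 * yt - t0 * Yt = \<theta> * (r t0 * (\<tau> * s)) - \<theta> * (t0 * ((?q 1 - r t0) * s)) + r t0 * e4 - t0 * e4'"
        unfolding e4_def e4'_def ts by (simp add: algebra_simps)
      moreover have "\<bar>\<theta> * (r t0 * (\<tau> * s))\<bar> \<le> \<theta> * (B * (\<tau> * 1))"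
        using rB s el' by (intro abs_mult_le) auto
      moreover have "\<bar>\<theta> * (t0 * ((?q 1 - r t0) * s))\<bar> \<le> \<theta> * (1 * ((B * t1 * \<tau>) * 1))"
        using qs s el' by (intro abs_mult_le) auto
      moreover have "\<theta> * (1 * ((B * t1 * \<tau>) * 1)) \<le> \<theta> * (1 * ((B * 1 * \<tau>) * 1))"
        using t el' B0 by (intro mult_left_mono mult_right_mono) auto
      moreover have "\<bar>r t0 * e4\<bar> \<le> B * (100 * (\<tau> * \<theta>))"
      proof (rule abs_mult_le[OF rB(3)])
        have "\<tau> * \<theta> ^ 3 \<le> \<tau> * (1 * \<theta>)" unfolding \<theta>3 using el' u by (intro mult_left_mono mult_right_mono) auto
        then show "\<bar>e4\<bar> \<le> 100 * (\<tau> * \<theta>)" using di(4) unfolding e4_def yt_def by simp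
      qed
      moreover have "\<bar>t0 * e4'\<bar> \<le> 1 * (200 * (B * \<tau> * \<theta>))"
        using dr(4) e1(2) el' unfolding e4'_def Yt_def by (intro abs_mult_le) auto
      ultimately show ?thesis by (simp add: mult_ac)
    qed
    have b6: "\<bar>\<rho>\<bar> \<le> 100 * \<theta>"
    proof -
      have "\<theta> ^ 3 \<le> 1 * \<theta>" unfolding \<theta>3 using u el' by (intro mult_right_mono) auto
      then show ?thesis using dr(5) unfolding \<rho>_def by linarith
    qed
    have "\<bar>(Ys - r t0 * \<rho>) * yt\<bar> \<le> (201 * (B * \<tau> * \<theta>)) * (101 * \<theta>)" "\<bar>Yt * (ys - t0 * \<rho>)\<bar> \<le> (401 * (B * \<theta>)) * (101 * (\<tau> * \<theta>))"
      "\<bar>\<rho> * (r t0 * yt - t0 * Yt)\<bar> \<le> (100 * \<theta>) * (302 * (B * \<tau> * \<theta>))"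
      using b1 b2 b3 b4 b5 b6 by (intro abs_mult_le; simp)+
    then have "\<bar>Ys * yt - Yt * ys\<bar> \<le> 91002 * (B * \<theta> * (\<tau> * \<theta>))"
      unfolding id by (simp add: mult_ac)
    then have "\<bar>q21\<bar> \<le> 91002 * (B * \<theta>)"
      using el' unfolding q21_def strip_det_def Ys_def yt_def Yt_def ys_def by (simp add: divide_le_eq abs_mult mult_ac)
    moreover have "0 \<le> B * \<theta>" using B0 el' by simp
    ultimately show ?thesis by simp
  qed
  have "((strip_det X y E a b)\<^sup>2 + (strip_det x X E a b)\<^sup>2 + (strip_det Y y E a b)\<^sup>2 + (strip_det x Y E a b)\<^sup>2) / (\<tau> * \<theta>)\<^sup>2 =
     (strip_det X y E a b / (\<tau> * \<theta>))\<^sup>2 + q12\<^sup>2 + q21\<^sup>2 + (strip_det x Y E a b / (\<tau> * \<theta>))\<^sup>2"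
    by (simp only: q12_def q21_def power_divide add_divide_distrib)
  also have "strip_det X y E a b / (\<tau> * \<theta>) = a' * P - c' * R"
    using el' by (simp_all add: strip_det_def xs field_simps)
  also have "strip_det x Y E a b / (\<tau> * \<theta>) = b' * p - d' * Q"
    using el' by (simp_all add: strip_det_def xs field_simps)
  finally have n: "((strip_det X y E a b)\<^sup>2 + (strip_det x X E a b)\<^sup>2 + (strip_det Y y E a b)\<^sup>2 + (strip_det x Y E a b)\<^sup>2) / (\<tau> * \<theta>)\<^sup>2 =
     (a' * P - c' * R)\<^sup>2 + q12\<^sup>2 + q21\<^sup>2 + (b' * p - d' * Q)\<^sup>2" .
  show "\<bar>((strip_det X y E a b)\<^sup>2 + (strip_det x X E a b)\<^sup>2 + (strip_det Y y E a b)\<^sup>2 + (strip_det x Y E a b)\<^sup>2) / (\<tau> * \<theta>)\<^sup>2 -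
      ((t * r' t)\<^sup>2 + (r t)\<^sup>2)\<bar> \<le> 40000000000 * B\<^sup>2 * (\<tau>\<^sup>2 + \<theta>\<^sup>2 + \<theta> ^ 4 / \<tau>)"
    using norm_estimate[OF ae be ce de pe Pe Qe Re rB(1,2) ut(1,2) y0(1) yy1 ut(3) t(2,3) ut(4) t(6) B y0(2,3) q12e q21e u_def[symmetric]]
    unfolding n by (simp add: yu[unfolded u_def] u_def)
qed

section \<open>Mesh elements as rotated images of the model triangles\<close>

text \<open>A linear \<open>q\<close> gives a mesh element, and \<open>q\<close> composed with
  \<open>r\<close> gives its image under the deformation (\<open>cavity_strip_elem\<close>), with
  the same rotation \<phi> and the same triangle \<open>E\<close>.\<close>

definition strip_elem :: "(real \<Rightarrow> real) \<Rightarrow> real \<Rightarrow> real \<Rightarrow> (real \<times> real) element \<Rightarrow> (real ^ 2) element" where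
  "strip_elem q \<phi> \<theta> E = map_element (\<lambda>v. polar (q (fst v)) (\<phi> + \<theta> * snd v)) E"

lemma interp_map_element:
  "interp f (map_element g E) a b = interp (\<lambda>v. f (g v)) E a b"
  "interp_a f (map_element g E) a b = interp_a (\<lambda>v. f (g v)) E a b"
  "interp_b f (map_element g E) a b = interp_b (\<lambda>v. f (g v)) E a b"
  by (cases E; simp add: interp_def interp_a_def interp_b_def)+

lemma polar_nth: "polar t \<alpha> $ 1 = t * cos \<alpha>" "polar t \<alpha> $ 2 = t * sin \<alpha>"
  by (simp_all add: polar_def)

lemma polar_add_nth:
  "polar (q (fst v)) (\<phi> + \<theta> * snd v) $ 1 = cos \<phi> * polar_x q \<theta> v + (- sin \<phi>) * polar_y q \<theta> v"
  "polar (q (fst v)) (\<phi> + \<theta> * snd v) $ 2 = sin \<phi> * polar_x q \<theta> v + cos \<phi> * polar_y q \<theta> v"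
  by (simp_all add: polar_nth polar_x_def polar_y_def cos_add sin_add algebra_simps)

lemma interp_strip_elem:
  "interp (\<lambda>v. v $ 1) (strip_elem q \<phi> \<theta> E) a b = cos \<phi> * interp (polar_x q \<theta>) E a b + (- sin \<phi>) * interp (polar_y q \<theta>) E a b"
  "interp (\<lambda>v. v $ 2) (strip_elem q \<phi> \<theta> E) a b = sin \<phi> * interp (polar_x q \<theta>) E a b + cos \<phi> * interp (polar_y q \<theta>) E a b"
  "interp_a (\<lambda>v. v $ 1) (strip_elem q \<phi> \<theta> E) a b = cos \<phi> * interp_a (polar_x q \<theta>) E a b + (- sin \<phi>) * interp_a (polar_y q \<theta>) E a b"
  "interp_a (\<lambda>v. v $ 2) (strip_elem q \<phi> \<theta> E) a b = sin \<phi> * interp_a (polar_x q \<theta>) E a b + cos \<phi> * interp_a (polar_y q \<theta>) E a b"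
  "interp_b (\<lambda>v. v $ 1) (strip_elem q \<phi> \<theta> E) a b = cos \<phi> * interp_b (polar_x q \<theta>) E a b + (- sin \<phi>) * interp_b (polar_y q \<theta>) E a b"
  "interp_b (\<lambda>v. v $ 2) (strip_elem q \<phi> \<theta> E) a b = sin \<phi> * interp_b (polar_x q \<theta>) E a b + cos \<phi> * interp_b (polar_y q \<theta>) E a b"
  unfolding strip_elem_def interp_map_element polar_add_nth interp_linear by (rule refl)+

lemma quad_map_strip_elem:
  assumes "interp (polar_x q \<theta>) E (\<xi> $ 1) (\<xi> $ 2) = \<rho> * cos \<alpha>" "interp (polar_y q \<theta>) E (\<xi> $ 1) (\<xi> $ 2) = \<rho> * sin \<alpha>"
  shows "quad_map (strip_elem q \<phi> \<theta> E) \<xi> = polar \<rho> (\<phi> + \<alpha>)"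
  by (simp add: vec_eq_iff forall_2 quad_map_nth interp_strip_elem assms polar_nth cos_add sin_add algebra_simps)

lemma rotation_minor:
  fixes a1 a2 b1 b2 :: real
  shows "(cos \<phi> * a1 + (- sin \<phi>) * a2) * (sin \<phi> * b1 + cos \<phi> * b2) - (cos \<phi> * b1 + (- sin \<phi>) * b2) * (sin \<phi> * a1 + cos \<phi> * a2)
    = a1 * b2 - b1 * a2"
proof -
  have "(cos \<phi> * a1 + (- sin \<phi>) * a2) * (sin \<phi> * b1 + cos \<phi> * b2) - (cos \<phi> * b1 + (- sin \<phi>) * b2) * (sin \<phi> * a1 + cos \<phi> * a2)
    = (a1 * b2 - b1 * a2) * ((cos \<phi>)\<^sup>2 + (sin \<phi>)\<^sup>2)" by algebra
  then show ?thesis by simp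
qed

lemma deriv_inverse:
  assumes "E \<in> elems"
  shows "interp_a f E a b = (fst (a2 E) - fst (a1 E)) * deriv_s f E a b + (snd (a2 E) - snd (a1 E)) * deriv_\<sigma> f E a b"
    "interp_b f E a b = (fst (a3 E) - fst (a1 E)) * deriv_s f E a b + (snd (a3 E) - snd (a1 E)) * deriv_\<sigma> f E a b"
  using assms by (auto simp: elems_def elem_defs deriv_s_def deriv_\<sigma>_def area2_def field_simps)

lemma interp_minor:
  assumes "E \<in> elems"
  shows "interp_a f E a b * interp_b g E a b - interp_b f E a b * interp_a g E a b = area2 E * strip_det f g E a b"
  unfolding deriv_inverse[OF assms] strip_det_def area2_def by (simp add: algebra_simps)

lemma quad_det_strip_elem:
  assumes "E \<in> elems"
  shows "quad_det (strip_elem q \<phi> \<theta> E) \<xi> = area2 E * strip_det (polar_x q \<theta>) (polar_y q \<theta>) E (\<xi> $ 1) (\<xi> $ 2)"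
  unfolding quad_det_def interp_strip_elem rotation_minor interp_minor[OF assms, symmetric] by simp

lemma rotation_conjugation_norm:
  fixes P Q R S :: real
  shows "(cos \<phi> * (sin \<phi> * P + cos \<phi> * Q) - sin \<phi> * (sin \<phi> * R + cos \<phi> * S))\<^sup>2 +
      (cos \<phi> * (cos \<phi> * P - sin \<phi> * Q) - sin \<phi> * (cos \<phi> * R - sin \<phi> * S))\<^sup>2 +
      (sin \<phi> * (sin \<phi> * P + cos \<phi> * Q) + cos \<phi> * (sin \<phi> * R + cos \<phi> * S))\<^sup>2 +
      (sin \<phi> * (cos \<phi> * P - sin \<phi> * Q) + cos \<phi> * (cos \<phi> * R - sin \<phi> * S))\<^sup>2 = P\<^sup>2 + Q\<^sup>2 + R\<^sup>2 + S\<^sup>2"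
    (is "?l = _")
proof -
  have "?l = (P\<^sup>2 + Q\<^sup>2 + R\<^sup>2 + S\<^sup>2) * ((cos \<phi>)\<^sup>2 + (sin \<phi>)\<^sup>2)\<^sup>2" by algebra
  then show ?thesis by simp
qed

text \<open>Element and image are rotated by the same angle, so the matrix DG adj(DF) is conjugated
  by a rotation and keeps its Frobenius norm. The affine map A from the reference triangle to the
  strip contributes A adj(A), the scalar \<open>area2 E\<close>, to the matrix and its square
  here.\<close>

lemma quad_num_strip_elem:
  fixes q Q :: "real \<Rightarrow> real" and \<theta> :: real
  assumes E: "E \<in> elems"
  defines "x \<equiv> polar_x q \<theta>" and "y \<equiv> polar_y q \<theta>" and "X \<equiv> polar_x Q \<theta>" and "Y \<equiv> polar_y Q \<theta>"
  shows "quad_num (strip_elem q \<phi> \<theta> E) (strip_elem Q \<phi> \<theta> E) \<xi> = (area2 E)\<^sup>2 *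
    ((strip_det X y E (\<xi> $ 1) (\<xi> $ 2))\<^sup>2 + (strip_det x X E (\<xi> $ 1) (\<xi> $ 2))\<^sup>2 +
     (strip_det Y y E (\<xi> $ 1) (\<xi> $ 2))\<^sup>2 + (strip_det x Y E (\<xi> $ 1) (\<xi> $ 2))\<^sup>2)"
proof -
  define c s where "c = cos \<phi>" and "s = sin \<phi>"
  define A where "A = (\<lambda>f. interp_a f E (\<xi> $ 1) (\<xi> $ 2))"
  define B where "B = (\<lambda>f. interp_b f E (\<xi> $ 1) (\<xi> $ 2))"
  define d where "d = (\<lambda>f g. A f * B g - B f * A g)"
  have d: "area2 E * strip_det f g E (\<xi> $ 1) (\<xi> $ 2) = d f g" for f g
    unfolding interp_minor[OF E, symmetric] d_def A_def B_def by simp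
  let ?P = "d X x" and ?Q = "d X y" and ?R = "d Y x" and ?S = "d Y y"
  have 1: "(c * A X + (- s) * A Y) * (s * B x + c * B y) - (c * B X + (- s) * B Y) * (s * A x + c * A y) =
      c * (s * ?P + c * ?Q) - s * (s * ?R + c * ?S)"
    unfolding d_def by algebra
  have 2: "(c * B X + (- s) * B Y) * (c * A x + (- s) * A y) - (c * A X + (- s) * A Y) * (c * B x + (- s) * B y) =
      - (c * (c * ?P - s * ?Q) - s * (c * ?R - s * ?S))"
    unfolding d_def by algebra
  have 3: "(s * A X + c * A Y) * (s * B x + c * B y) - (s * B X + c * B Y) * (s * A x + c * A y) =
      s * (s * ?P + c * ?Q) + c * (s * ?R + c * ?S)"
    unfolding d_def by algebra
  have 4: "(s * B X + c * B Y) * (c * A x + (- s) * A y) - (s * A X + c * A Y) * (c * B x + (- s) * B y) =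
      - (s * (c * ?P - s * ?Q) + c * (c * ?R - s * ?S))"
    unfolding d_def by algebra
  have "quad_num (strip_elem q \<phi> \<theta> E) (strip_elem Q \<phi> \<theta> E) \<xi> = ?P\<^sup>2 + ?Q\<^sup>2 + ?R\<^sup>2 + ?S\<^sup>2"
    unfolding quad_num_def Let_def interp_strip_elem x_def[symmetric] y_def[symmetric] X_def[symmetric] Y_def[symmetric]
      fun_cong[OF A_def, symmetric] fun_cong[OF B_def, symmetric] c_def[symmetric] s_def[symmetric] 1 2 3 4 power2_minus
    unfolding c_def s_def rotation_conjugation_norm by (rule refl)
  also have "\<dots> = (d X y)\<^sup>2 + (d x X)\<^sup>2 + (d Y y)\<^sup>2 + (d x Y)\<^sup>2"
    by (simp add: d_def power2_eq_square algebra_simps)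
  finally show ?thesis unfolding d[symmetric] power_mult_distrib distrib_left .
qed

lemma cavity_strip_elem:
  assumes "E \<in> elems" "0 < t0" "0 < \<tau>"
  shows "map_element (cavity_deformation r) (strip_elem (\<lambda>s. t0 + \<tau> * s) \<phi> \<theta> E) = strip_elem (\<lambda>s. r (t0 + \<tau> * s)) \<phi> \<theta> E"
proof -
  have c: "cavity_deformation r (polar t \<alpha>) = polar (r t) \<alpha>" if "0 < t" for t \<alpha>
    using that by (simp add: cavity_deformation_def vec_eq_iff forall_2 polar_nth)
  show ?thesis using assms by (auto simp: elems_def elem_defs strip_elem_def c add_pos_pos)
qed

lemma rotate_polar: "rotate_point \<phi> (polar t \<alpha>) = polar t (\<phi> + \<alpha>)"
  by (simp add: rotate_point_def vec_eq_iff forall_2 polar_nth cos_add sin_add algebra_simps)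

text \<open>Types C and D are given from the cut of B, while their model triangles are centred in
  the angular range; this accounts for the shifts by \<theta> / 2.\<close>

lemma rotate_types:
  fixes \<theta> :: real and N :: nat
  defines "\<theta> \<equiv> pi / real N"
  shows "rotate_element \<phi> (type_A \<epsilon> \<tau> N) = strip_elem (\<lambda>s. \<epsilon> + \<tau> * s) \<phi> \<theta> elem_A"
    "rotate_element \<phi> (type_B \<epsilon> \<tau> N) = strip_elem (\<lambda>s. \<epsilon> + \<tau> * s) \<phi> \<theta> elem_B"
    "rotate_element \<phi> (type_C \<epsilon> \<tau> N) = strip_elem (\<lambda>s. \<epsilon> + \<tau> * s) (\<phi> + \<theta> / 2) \<theta> elem_C"
    "rotate_element \<phi> (type_D \<epsilon> \<tau> N) = strip_elem (\<lambda>s. \<epsilon> + \<tau> * s) (\<phi> - \<theta> / 2) \<theta> elem_D"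
  by (simp_all add: rotate_element_def type_A_def type_B_def type_C_def type_D_def strip_elem_def elem_defs
      Let_def rotate_polar \<theta>_def[symmetric] add.commute)

section \<open>The polar lift of one element is close to a linear map\<close>

text \<open>Smallness of the element relative to its inner radius, with a single parameter \<kappa>.
  The constants C1 and C2 of the strategy enforce it, see \<open>fine\<close> in the context
  \<open>strategy\<close>.\<close>

definition fine_element :: "real \<Rightarrow> real \<Rightarrow> real \<Rightarrow> real \<Rightarrow> bool" where
  "fine_element \<kappa> t0 \<tau> \<theta> \<longleftrightarrow> 0 < t0 \<and> 0 < \<tau> \<and> t0 + \<tau> \<le> 1 \<and> 0 < \<theta> \<and>
     \<theta>\<^sup>2 \<le> \<kappa> \<and> (t0 + \<tau>) * \<theta>\<^sup>2 \<le> \<kappa> * t0 \<and> \<theta> ^ 4 \<le> \<kappa> * (t0 * \<tau>) \<and> \<tau>\<^sup>2 \<le> \<kappa> * t0"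

lemma fine_element_data: "fine_element \<kappa> t0 \<tau> \<theta> \<Longrightarrow> \<kappa> \<le> 1 \<Longrightarrow> element_data t0 \<tau> \<theta>"
proof -
  assume f: "fine_element \<kappa> t0 \<tau> \<theta>" and k: "\<kappa> \<le> 1"
  have "\<theta>\<^sup>2 \<le> 1" using f k by (simp add: fine_element_def)
  then have "\<theta> \<le> 1" using power2_le_imp_le[of \<theta> 1] by simp
  moreover have "\<kappa> * (t0 * \<tau>) \<le> 1 * (t0 * \<tau>)" using f k by (intro mult_right_mono) (auto simp: fine_element_def)
  ultimately show ?thesis using f unfolding element_data_def fine_element_def by linarith
qed

text \<open>With (X, Y) the point of the element before rotation, the four quantities are the
  partial derivatives in s and \<sigma> of its radius and of its angle arctan(Y / X); their matrix
  is close to diag(\<tau>, \<theta>). Errors are measured in multiples of \<open>k\<close>,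
  \<open>w\<close> and \<open>K\<close>, which are \<kappa> t, \<kappa> \<tau> and \<kappa> \<theta>
  t^2, and the bound on \<kappa> absorbs the accumulated constants.\<close>

lemma lift_derivative_bounds:
  assumes f: "fine_element \<kappa> t0 \<tau> \<theta>" and \<kappa>: "\<kappa> \<le> 1 / 30000" and E: "E \<in> elems" and ab: "0 \<le> a" "0 \<le> b" "a + b \<le> 1"
  defines "x \<equiv> polar_x (\<lambda>s. t0 + \<tau> * s) \<theta>" and "y \<equiv> polar_y (\<lambda>s. t0 + \<tau> * s) \<theta>"
  defines "X \<equiv> interp x E a b" and "Y \<equiv> interp y E a b"
  defines "\<rho> \<equiv> sqrt (X\<^sup>2 + Y\<^sup>2)"
  shows "0 < X" "0 < \<rho>"
    "\<bar>(X * deriv_s x E a b + Y * deriv_s y E a b) / \<rho> - \<tau>\<bar> \<le> \<tau> / 8"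
    "\<bar>(X * deriv_\<sigma> x E a b + Y * deriv_\<sigma> y E a b) / \<rho>\<bar> \<le> \<tau> / 8"
    "\<bar>(X * deriv_s y E a b - Y * deriv_s x E a b) / (X\<^sup>2 + Y\<^sup>2)\<bar> \<le> \<theta> / 8"
    "\<bar>(X * deriv_\<sigma> y E a b - Y * deriv_\<sigma> x E a b) / (X\<^sup>2 + Y\<^sup>2) - \<theta>\<bar> \<le> \<theta> / 8"
proof -
  have el: "element_data t0 \<tau> \<theta>" using fine_element_data[OF f] \<kappa> by simp
  define s where "s = interp fst E a b"
  define \<sigma> where "\<sigma> = interp snd E a b"
  define t where "t = t0 + \<tau> * s"
  define t1 where "t1 = t0 + \<tau>"
  define u where "u = \<theta>\<^sup>2"
  have f': "0 < t0" "0 < \<tau>" "t1 \<le> 1" "0 < \<theta>" "u \<le> \<kappa>" "t1 * u \<le> \<kappa> * t0" "u * u \<le> \<kappa> * (t0 * \<tau>)"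
    using f by (auto simp: fine_element_def t1_def u_def power2_eq_square power4_eq_xxxx mult.assoc)
  have u: "0 < u" using f' by (simp add: u_def)
  have \<kappa>0: "0 < \<kappa>" using f' u by linarith
  have s: "0 \<le> s" "s \<le> 1" "\<bar>\<sigma>\<bar> \<le> 1" using interp_range[OF E ab] by (auto simp: s_def \<sigma>_def)
  have \<tau>s: "0 \<le> \<tau> * s" "\<tau> * s \<le> \<tau>" using f' s by (auto simp: mult_left_le)
  have t: "t0 \<le> t" "t \<le> t1" "0 < t" using f' \<tau>s unfolding t_def t1_def by linarith+
  have u1: "u \<le> 1" using f' \<kappa> by linarith
  have \<theta>3: "\<theta> ^ 3 = u * \<theta>" and \<theta>4: "\<theta> ^ 4 = u * u" by (simp_all add: u_def power2_eq_square power3_eq_cube power4_eq_xxxx)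
  have uu: "\<theta> * \<theta> = u" by (simp add: u_def power2_eq_square)
  define k where "k = \<kappa> * t"
  have kt: "\<kappa> * t0 \<le> k" using t \<kappa>0 by (simp add: k_def)
  have k0: "0 < k" using t \<kappa>0 by (simp add: k_def)
  have tu: "t * u \<le> k" using mult_left_mono[OF f'(5), of t] t by (simp add: k_def mult.commute)
  have t1u: "t1 * u \<le> k" "t0 * u \<le> k" "\<tau> * u \<le> k"
  proof -
    have "t1 * u = t0 * u + \<tau> * u" "0 \<le> t0 * u" "0 \<le> \<tau> * u" using f' u by (auto simp: t1_def algebra_simps)
    then show "t1 * u \<le> k" "t0 * u \<le> k" "\<tau> * u \<le> k" using f'(6) kt by linarith+
  qed
  define w where "w = \<kappa> * \<tau>"
  have w0: "0 < w" using \<kappa>0 f' by (simp add: w_def)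
  have \<tau>uw: "\<tau> * u \<le> w" using mult_left_mono[OF f'(5), of \<tau>] f' by (simp add: w_def mult.commute)
  have t0u2: "t0 * (u * u) \<le> w"
  proof -
    have "t0 * (u * u) \<le> 1 * (u * u)" using f' t u by (intro mult_right_mono) auto
    also have "\<dots> \<le> 1 * (\<kappa> * (t0 * \<tau>))" using f'(7) by simp
    also have "\<dots> \<le> \<kappa> * (1 * \<tau>)" unfolding mult_1 using f' \<kappa>0 t by (intro mult_left_mono mult_right_mono) auto
    finally show ?thesis by (simp add: w_def)
  qed
  have t1u2: "t1 * (u * u) \<le> 2 * w"
  proof -
    have "\<tau> * u * u \<le> w * 1" using \<tau>uw u u1 w0 by (intro mult_mono) auto
    then show ?thesis using t0u2 by (simp add: t1_def algebra_simps)
  qed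
  have tu2: "t * (u * u) \<le> 2 * w" by (rule order_trans[OF mult_right_mono[OF t(2)] t1u2]) (use u in simp)
  note v = polar_value_bounds[OF E ab, of \<theta> t0 \<tau>, folded x_def y_def X_def Y_def s_def \<sigma>_def, folded t_def]
  have v1: "\<bar>X - t\<bar> \<le> 12 * (t * u)" and v2: "\<bar>Y - t * \<theta> * \<sigma>\<bar> \<le> 12 * (t * u * \<theta>)"
    using v f' unfolding \<theta>3 u_def by (simp_all add: mult.assoc)
  note di = id_deriv_bounds[OF el E ab, folded x_def y_def s_def \<sigma>_def, folded t_def u_def t1_def, unfolded \<theta>3 \<theta>4]
  define xs xt ys yt where "xs = deriv_s x E a b" and "xt = deriv_\<sigma> x E a b" and "ys = deriv_s y E a b" and "yt = deriv_\<sigma> y E a b"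
  define e1 e2 where "e1 = X - t" and "e2 = Y - t * \<theta> * \<sigma>"
  define f1 f2 f3 f4 where "f1 = xs - \<tau>" and "f2 = xt + t0 * u * \<sigma>" and "f3 = ys - \<theta> * \<tau> * \<sigma>" and "f4 = yt - \<theta> * t"
  have e: "\<bar>e1\<bar> \<le> 12 * (t * u)" "\<bar>e2\<bar> \<le> 12 * (t * u * \<theta>)" using v1 v2 by (simp_all add: e1_def e2_def)
  have ff: "\<bar>f1\<bar> \<le> 100 * (t0 * (u * u) + \<tau> * u)" "\<bar>f2\<bar> \<le> 100 * (t0 * (u * u) + \<tau> * u)"
    "\<bar>f3\<bar> \<le> 100 * (t1 * u * \<theta>)" "\<bar>f4\<bar> \<le> 100 * (t1 * u * \<theta>)"
    using di(1,2,5,6) by (simp_all add: f1_def f2_def f3_def f4_def xs_def xt_def ys_def yt_def mult.assoc)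
  have fw: "\<bar>f1\<bar> \<le> 200 * w" "\<bar>f2\<bar> \<le> 200 * w" using ff(1,2) t0u2 \<tau>uw by argo+
  have "t0 * (u * u) \<le> t0 * u" using f' u u1 by simp
  then have fk: "\<bar>f1\<bar> \<le> 200 * k" "\<bar>f2\<bar> \<le> 200 * k" using ff(1,2) t1u by argo+
  have fk3: "\<bar>f3\<bar> \<le> 100 * (k * \<theta>)" "\<bar>f4\<bar> \<le> 100 * (k * \<theta>)"
    using ff(3,4) mult_right_mono[OF t1u(1), of \<theta>] f' by linarith+
  have ek: "\<bar>e1\<bar> \<le> 12 * k" "\<bar>e2\<bar> \<le> 12 * (k * \<theta>)"
    using e tu mult_right_mono[OF tu, of \<theta>] f' by linarith+
  have kt': "30000 * k \<le> t" using mult_right_mono[OF \<kappa> less_imp_le[OF t(3)]] unfolding k_def by linarith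
  have X: "t / 2 \<le> X" "X \<le> 2 * t" using ek(1) kt' k0 unfolding e1_def by (simp_all add: abs_le_iff)
  then show X0: "0 < X" using t by simp
  have Yb: "\<bar>Y\<bar> \<le> 2 * t * \<theta>"
  proof -
    have "\<bar>t * \<theta> * \<sigma>\<bar> \<le> t * \<theta> * 1" using s t f' by (intro abs_mult_le) auto
    moreover have "12 * (k * \<theta>) \<le> t * \<theta>" using kt' k0 f' mult_right_mono[of "12 * k" t \<theta>] by simp
    ultimately show ?thesis using ek(2) unfolding e2_def by (simp add: mult.assoc)
  qed
  have Y2: "Y\<^sup>2 \<le> 4 * t\<^sup>2 * u"
  proof -
    have "Y\<^sup>2 \<le> (2 * t * \<theta>)\<^sup>2" using Yb by (metis abs_le_square_iff abs_ge_self order_trans)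
    then show ?thesis by (simp add: power_mult_distrib u_def)
  qed
  have \<rho>2: "\<rho>\<^sup>2 = X\<^sup>2 + Y\<^sup>2" by (simp add: \<rho>_def)
  have \<rho>X: "X \<le> \<rho>" unfolding \<rho>_def by (rule real_le_rsqrt) simp
  then show \<rho>0: "0 < \<rho>" using X0 by simp
  have t\<rho>: "t \<le> 2 * \<rho>" using X(1) \<rho>X by linarith
  have \<rho>X': "\<rho> - X \<le> 4 * k"
  proof -
    have "(\<rho> - X) * t \<le> (\<rho> - X) * (\<rho> + X)" using \<rho>X X by (intro mult_left_mono) auto
    also have "\<dots> = Y\<^sup>2" using \<rho>2 by (simp add: power2_eq_square algebra_simps)
    also have "\<dots> \<le> 4 * k * t"
    proof -
      have "(t * u) * (4 * t) \<le> k * (4 * t)" using tu t by (intro mult_right_mono) auto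
      moreover have "4 * t\<^sup>2 * u = (t * u) * (4 * t)" by (simp add: power2_eq_square)
      ultimately show ?thesis using Y2 by linarith
    qed
    finally show ?thesis using t by simp
  qed
  have \<rho>t: "\<rho> * w * 2 \<ge> t * w" using mult_right_mono[OF t\<rho> less_imp_le[OF w0]] by linarith
  have k\<tau>: "k * \<tau> = t * w" by (simp add: k_def w_def)
  have w\<tau>: "30000 * (\<rho> * w) \<le> \<rho> * \<tau>" using mult_left_mono[OF mult_right_mono[OF \<kappa> less_imp_le[OF f'(2)]] less_imp_le[OF \<rho>0]] unfolding w_def by linarith
  have X\<rho>: "\<bar>X\<bar> \<le> \<rho>" using X0 \<rho>X by simp
  have ysb: "\<bar>Y * ys\<bar> \<le> 402 * (t * w)"
  proof -
    have "\<bar>\<theta> * \<tau> * \<sigma>\<bar> \<le> \<theta> * \<tau> * 1" using s f' by (intro abs_mult_le) auto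
    then have "\<bar>ys\<bar> \<le> \<theta> * (\<tau> + 100 * (t1 * u))" using ff(3) unfolding f3_def by (simp add: algebra_simps)
    then have "\<bar>Y * ys\<bar> \<le> (2 * t * \<theta>) * (\<theta> * (\<tau> + 100 * (t1 * u)))" using Yb by (intro abs_mult_le)
    also have "\<dots> = 2 * t * (\<tau> * u + 100 * (t1 * (u * u)))" by (simp add: uu[symmetric] algebra_simps)
    also have "\<dots> \<le> 2 * t * (w + 100 * (2 * w))" using \<tau>uw t1u2 t by (intro mult_left_mono) auto
    finally show ?thesis by simp
  qed
  have "\<bar>X * xs + Y * ys - \<tau> * \<rho>\<bar> \<le> 1100 * (\<rho> * w)"
  proof -
    have "X * xs + Y * ys - \<tau> * \<rho> = X * f1 - (\<rho> - X) * \<tau> + Y * ys" by (simp add: f1_def algebra_simps)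
    moreover have "\<bar>X * f1\<bar> \<le> \<rho> * (200 * w)" using X\<rho> fw by (intro abs_mult_le)
    moreover have "\<bar>(\<rho> - X) * \<tau>\<bar> \<le> (4 * k) * \<tau>" using \<rho>X \<rho>X' f' by (intro abs_mult_le) auto
    moreover have "(4 * k) * \<tau> = 4 * (t * w)" using k\<tau> by simp
    moreover have "0 \<le> \<rho> * w" using \<rho>0 w0 by simp
    ultimately show ?thesis using ysb \<rho>t by linarith
  qed
  then have "\<bar>X * xs + Y * ys - \<tau> * \<rho>\<bar> \<le> \<rho> * \<tau> / 8"
    using w\<tau> mult_pos_pos[OF \<rho>0 w0] by linarith
  then show "\<bar>(X * deriv_s x E a b + Y * deriv_s y E a b) / \<rho> - \<tau>\<bar> \<le> \<tau> / 8"
    using \<rho>0 by (simp add: xs_def ys_def abs_le_iff field_simps)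
  have "\<bar>X * xt + Y * yt\<bar> \<le> 1200 * (\<rho> * w)"
  proof -
    \<comment> \<open>The leading parts - t t0 u \<sigma> of \<open>X * xt\<close> and t^2 u
      \<sigma> of \<open>Y * yt\<close> nearly cancel. What remains has the factor t - t0 = \<tau>
      s, so it is small relative to \<tau> and not only relative to t.\<close>
    have "X * xt + Y * yt = t * u * \<sigma> * (\<tau> * s) - t0 * u * \<sigma> * e1 + X * f2 + e2 * \<theta> * t + Y * f4"
    proof -
      have "X * xt + Y * yt = (t + e1) * (- (t0 * u * \<sigma>)) + X * f2 + (t * \<theta> * \<sigma> + e2) * (\<theta> * t) + Y * f4"
        by (simp add: e1_def e2_def f2_def f4_def algebra_simps)
      also have "\<dots> = t * u * \<sigma> * (t - t0) - t0 * u * \<sigma> * e1 + X * f2 + e2 * \<theta> * t + Y * f4"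
        by (simp add: uu[symmetric] algebra_simps)
      finally show ?thesis by (simp add: t_def)
    qed
    moreover have "\<bar>t * u * \<sigma> * (\<tau> * s)\<bar> \<le> t * u * 1 * (\<tau> * 1)" using t u s f' by (intro abs_mult_le) (auto simp: abs_mult)
    moreover have "t * u * 1 * (\<tau> * 1) \<le> t * w" using mult_left_mono[OF \<tau>uw, of t] t by (simp add: mult_ac)
    moreover have "\<bar>t0 * u * \<sigma> * e1\<bar> \<le> t0 * u * 1 * (12 * (t * u))" using e f' u s by (intro abs_mult_le) auto
    moreover have "t0 * u * 1 * (12 * (t * u)) \<le> 12 * (t * w)" using mult_left_mono[OF t0u2, of t] t by (simp add: mult_ac)
    moreover have "\<bar>X * f2\<bar> \<le> \<rho> * (200 * w)" using X\<rho> fw by (intro abs_mult_le)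
    moreover have "\<bar>e2 * \<theta> * t\<bar> \<le> 12 * (t * u * \<theta>) * \<theta> * t" using e f' t by (intro abs_mult_le) auto
    moreover have "12 * (t * u * \<theta>) * \<theta> * t \<le> 24 * (t * w)" using mult_left_mono[OF tu2, of t] t by (simp add: uu[symmetric] mult_ac)
    moreover have "\<bar>Y * f4\<bar> \<le> (2 * t * \<theta>) * (100 * (t1 * u * \<theta>))" using Yb ff by (intro abs_mult_le)
    moreover have "(2 * t * \<theta>) * (100 * (t1 * u * \<theta>)) \<le> 400 * (t * w)" using mult_left_mono[OF t1u2, of t] t by (simp add: uu[symmetric] mult_ac)
    moreover have "0 \<le> \<rho> * w" using \<rho>0 w0 by simp
    ultimately show ?thesis using \<rho>t by ((simp only:; fail) | argo | linarith)
  qed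
  then have "\<bar>X * xt + Y * yt\<bar> \<le> \<rho> * \<tau> / 8"
    using w\<tau> mult_pos_pos[OF \<rho>0 w0] by linarith
  then show "\<bar>(X * deriv_\<sigma> x E a b + Y * deriv_\<sigma> y E a b) / \<rho>\<bar> \<le> \<tau> / 8"
    using \<rho>0 by (simp add: xt_def yt_def abs_le_iff field_simps)
  define K where "K = k * \<theta> * t"
  have K0: "0 < K" using k0 f' t by (simp add: K_def)
  have t2: "t * t \<le> 4 * \<rho>\<^sup>2" using mult_mono[OF t\<rho> t\<rho>] t \<rho>0 by (simp add: power2_eq_square)
  have K\<theta>: "7500 * K \<le> \<theta> * \<rho>\<^sup>2"
  proof -
    have "30000 * K \<le> \<theta> * (t * t)" using mult_right_mono[OF kt' less_imp_le[OF mult_pos_pos[OF f'(4) t(3)]]] unfolding K_def by (simp only: mult_ac)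
    also have "\<dots> \<le> \<theta> * (4 * \<rho>\<^sup>2)" using t2 f' by (intro mult_left_mono) auto
    finally show ?thesis by simp
  qed
  have k2: "k * k \<le> t * k" using kt' k0 by (intro mult_right_mono) auto
  have "\<bar>X * ys - Y * xs\<bar> \<le> 600 * K"
  proof -
    have "X * ys - Y * xs = t * f3 + e1 * \<theta> * \<tau> * \<sigma> + e1 * f3 - t * \<theta> * \<sigma> * f1 - e2 * \<tau> - e2 * f1"
      by (simp add: e1_def e2_def f1_def f3_def algebra_simps)
    moreover have "\<bar>t * f3\<bar> \<le> t * (100 * (k * \<theta>))" using t fk3 by (intro abs_mult_le) auto
    moreover have "\<bar>e1 * \<theta> * \<tau> * \<sigma>\<bar> \<le> 12 * (t * u) * \<theta> * \<tau> * 1" using e f' s by (intro abs_mult_le) auto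
    moreover have "12 * (t * u) * \<theta> * \<tau> * 1 \<le> 12 * K" using mult_left_mono[OF t1u(3), of "t * \<theta>"] t f' by (simp add: K_def mult_ac)
    moreover have "\<bar>e1 * f3\<bar> \<le> (12 * k) * (100 * (k * \<theta>))" using ek fk3 by (intro abs_mult_le)
    moreover have "(12 * k) * (100 * (k * \<theta>)) \<le> K"
      using mult_right_mono[OF mult_right_mono[OF kt', of k], of \<theta>] k0 f' by (simp add: K_def mult_ac)
    moreover have "\<bar>t * \<theta> * \<sigma> * f1\<bar> \<le> t * \<theta> * 1 * (200 * k)" using t f' s fk by (intro abs_mult_le) auto
    moreover have "\<bar>e2 * \<tau>\<bar> \<le> 12 * (t * u * \<theta>) * \<tau>" using e f' by (intro abs_mult_le) auto
    moreover have "12 * (t * u * \<theta>) * \<tau> \<le> 12 * K" using mult_left_mono[OF t1u(3), of "t * \<theta>"] t f' by (simp add: K_def mult_ac)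
    moreover have "\<bar>e2 * f1\<bar> \<le> (12 * (k * \<theta>)) * (200 * k)" using ek fk by (intro abs_mult_le)
    moreover have "(12 * (k * \<theta>)) * (200 * k) \<le> K"
      using mult_right_mono[OF mult_right_mono[OF kt', of k], of \<theta>] k0 f' by (simp add: K_def mult_ac)
    moreover have "t * (100 * (k * \<theta>)) = 100 * K" "t * \<theta> * 1 * (200 * k) = 200 * K" by (simp_all add: K_def mult_ac)
    ultimately show ?thesis using K0 by ((simp only:; fail) | argo | linarith)
  qed
  then have "\<bar>X * ys - Y * xs\<bar> \<le> \<theta> * \<rho>\<^sup>2 / 8" using K\<theta> K0 by linarith
  then show "\<bar>(X * deriv_s y E a b - Y * deriv_s x E a b) / (X\<^sup>2 + Y\<^sup>2)\<bar> \<le> \<theta> / 8"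
    using \<rho>0 unfolding \<rho>2[symmetric] by (simp add: xs_def ys_def abs_le_iff field_simps)
  have "\<bar>X * yt - Y * xt - \<theta> * \<rho>\<^sup>2\<bar> \<le> 600 * K + 30 * K"
  proof -
    have "X * yt - Y * xt - \<theta> * \<rho>\<^sup>2 = - (\<theta> * X * e1) + X * f4 - Y * xt - \<theta> * Y * Y"
      unfolding \<rho>2 by (simp add: e1_def f4_def power2_eq_square algebra_simps)
    moreover have "\<bar>\<theta> * X * e1\<bar> \<le> \<theta> * (2 * t) * (12 * k)" using X X0 ek f' by (intro abs_mult_le) auto
    moreover have "\<bar>X * f4\<bar> \<le> (2 * t) * (100 * (k * \<theta>))" using X X0 fk3 by (intro abs_mult_le) auto
    moreover have "\<bar>Y * xt\<bar> \<le> (2 * t * \<theta>) * (201 * k) "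
    proof (rule abs_mult_le[OF Yb])
      have "\<bar>t0 * u * \<sigma>\<bar> \<le> t0 * u * 1" using f' u s by (intro abs_mult_le) auto
      then show "\<bar>xt\<bar> \<le> 201 * k" using fk(2) t1u unfolding f2_def by linarith
    qed
    moreover have "\<bar>\<theta> * Y * Y\<bar> \<le> \<theta> * (2 * t * \<theta>) * (2 * t * \<theta>)" using Yb f' by (intro abs_mult_le) auto
    moreover have "\<theta> * (2 * t * \<theta>) * (2 * t * \<theta>) \<le> 4 * K"
      using mult_left_mono[OF tu, of "t * \<theta>"] t f' by (simp add: K_def uu[symmetric] mult_ac)
    moreover have "\<theta> * (2 * t) * (12 * k) = 24 * K" "(2 * t) * (100 * (k * \<theta>)) = 200 * K" "(2 * t * \<theta>) * (201 * k) = 402 * K"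
      by (simp_all add: K_def mult_ac)
    ultimately show ?thesis using K0 by ((simp only:; fail) | argo | linarith)
  qed
  then have "\<bar>X * yt - Y * xt - \<theta> * \<rho>\<^sup>2\<bar> \<le> \<theta> * \<rho>\<^sup>2 / 8" using K\<theta> K0 by linarith
  then show "\<bar>(X * deriv_\<sigma> y E a b - Y * deriv_\<sigma> x E a b) / (X\<^sup>2 + Y\<^sup>2) - \<theta>\<bar> \<le> \<theta> / 8"
    using \<rho>0 unfolding \<rho>2[symmetric] by (simp add: xt_def yt_def abs_le_iff field_simps)
qed

text \<open>Over s in [0, 1] a model triangle lies between the lines \<sigma> =
  \<open>strip_l E s\<close> and \<sigma> = \<open>strip_r E s\<close>; \<open>strip_a\<close> and
  \<open>strip_b\<close> recover the reference coordinates from (s, \<sigma>). The final case of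
  each definition is \<open>elem_D\<close>.\<close>

definition strip_l :: "(real \<times> real) element \<Rightarrow> real \<Rightarrow> real" where
  "strip_l E s = (if E = elem_A then - s else if E = elem_B then s - 1 else if E = elem_C then - 1 / 2 else s - 1 / 2)"

definition strip_r :: "(real \<times> real) element \<Rightarrow> real \<Rightarrow> real" where
  "strip_r E s = (if E = elem_A then s else if E = elem_B then 1 - s else if E = elem_C then 1 / 2 - s else 1 / 2)"

definition strip_a :: "(real \<times> real) element \<Rightarrow> real \<Rightarrow> real \<Rightarrow> real" where
  "strip_a E s \<sigma> = (if E = elem_A then (s - \<sigma>) / 2 else if E = elem_B then (1 - s + \<sigma>) / 2 else
     if E = elem_C then s else 1 / 2 - \<sigma>)"

definition strip_b :: "(real \<times> real) element \<Rightarrow> real \<Rightarrow> real \<Rightarrow> real" where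
  "strip_b E s \<sigma> = (if E = elem_A then (s + \<sigma>) / 2 else if E = elem_B then (1 - s - \<sigma>) / 2 else
     if E = elem_C then \<sigma> + 1 / 2 else s)"

lemma elem_neq [simp]: "elem_A \<noteq> elem_B" "elem_A \<noteq> elem_C" "elem_A \<noteq> elem_D" "elem_B \<noteq> elem_A" "elem_B \<noteq> elem_C"
  "elem_B \<noteq> elem_D" "elem_C \<noteq> elem_A" "elem_C \<noteq> elem_B" "elem_C \<noteq> elem_D" "elem_D \<noteq> elem_A" "elem_D \<noteq> elem_B" "elem_D \<noteq> elem_C"
  by (simp_all add: elem_defs)

lemma elems_cases [consumes 1, case_names A B C D]:
  assumes "E \<in> elems"
  obtains "E = elem_A" | "E = elem_B" | "E = elem_C" | "E = elem_D"
  using assms by (auto simp: elems_def)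

lemma strip_ab:
  assumes "E \<in> elems" "0 \<le> s" "s \<le> 1" "strip_l E s \<le> \<sigma>" "\<sigma> \<le> strip_r E s"
  shows "0 \<le> strip_a E s \<sigma>" "0 \<le> strip_b E s \<sigma>" "strip_a E s \<sigma> + strip_b E s \<sigma> \<le> 1"
    "interp fst E (strip_a E s \<sigma>) (strip_b E s \<sigma>) = s" "interp snd E (strip_a E s \<sigma>) (strip_b E s \<sigma>) = \<sigma>"
  using assms(1)
  by (cases rule: elems_cases;
      use assms(2-) in \<open>simp add: strip_l_def strip_r_def strip_a_def strip_b_def interp_affine field_simps\<close>;
      simp add: elem_defs field_simps)+

lemma strip_coords:
  assumes "E \<in> elems" "0 \<le> a" "0 \<le> b" "a + b \<le> 1"
  defines "s \<equiv> interp fst E a b" and "\<sigma> \<equiv> interp snd E a b"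
  shows "strip_l E s \<le> \<sigma>" "\<sigma> \<le> strip_r E s" "strip_a E s \<sigma> = a" "strip_b E s \<sigma> = b"
    "0 < a \<Longrightarrow> 0 < b \<Longrightarrow> a + b < 1 \<Longrightarrow> 0 < s \<and> s < 1 \<and> strip_l E s < \<sigma> \<and> \<sigma> < strip_r E s"
  using assms(1) unfolding s_def \<sigma>_def
  by (cases rule: elems_cases;
      use assms(2-4) in \<open>simp add: strip_l_def strip_r_def strip_a_def strip_b_def interp_affine\<close>;
      simp add: elem_defs field_simps)+

definition lift_\<rho> :: "real \<Rightarrow> real \<Rightarrow> real \<Rightarrow> (real \<times> real) element \<Rightarrow> real \<Rightarrow> real \<Rightarrow> real" where
  "lift_\<rho> t0 \<tau> \<theta> E a b = sqrt ((interp (polar_x (\<lambda>s. t0 + \<tau> * s) \<theta>) E a b)\<^sup>2 + (interp (polar_y (\<lambda>s. t0 + \<tau> * s) \<theta>) E a b)\<^sup>2)"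

text \<open>The branch given by arctan is the right one because the first component of the unrotated
  point is positive.\<close>

definition lift_\<phi> :: "real \<Rightarrow> real \<Rightarrow> real \<Rightarrow> (real \<times> real) element \<Rightarrow> real \<Rightarrow> real \<Rightarrow> real" where
  "lift_\<phi> t0 \<tau> \<theta> E a b = arctan (interp (polar_y (\<lambda>s. t0 + \<tau> * s) \<theta>) E a b / interp (polar_x (\<lambda>s. t0 + \<tau> * s) \<theta>) E a b)"

lemma polar_arctan:
  assumes "0 < (X :: real)"
  shows "X = sqrt (X\<^sup>2 + Y\<^sup>2) * cos (arctan (Y / X))" "Y = sqrt (X\<^sup>2 + Y\<^sup>2) * sin (arctan (Y / X))"
proof -
  have "sqrt (X\<^sup>2 + Y\<^sup>2) = X * sqrt (1 + (Y / X)\<^sup>2)"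
  proof -
    have "X\<^sup>2 + Y\<^sup>2 = X\<^sup>2 * (1 + (Y / X)\<^sup>2)" using assms by (simp add: field_simps power2_eq_square)
    then show ?thesis using assms by (simp add: real_sqrt_mult)
  qed
  moreover have "0 < sqrt (1 + (Y / X)\<^sup>2)" by (simp add: add_pos_nonneg)
  ultimately show "X = sqrt (X\<^sup>2 + Y\<^sup>2) * cos (arctan (Y / X))" "Y = sqrt (X\<^sup>2 + Y\<^sup>2) * sin (arctan (Y / X))"
    using assms by (simp_all add: cos_arctan sin_arctan)
qed

lemma quad_map_lift:
  assumes f: "fine_element \<kappa> t0 \<tau> \<theta>" "\<kappa> \<le> 1 / 30000" and E: "E \<in> elems"
    and ab: "0 \<le> \<xi> $ 1" "0 \<le> \<xi> $ 2" "\<xi> $ 1 + \<xi> $ 2 \<le> 1"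
  shows "quad_map (strip_elem (\<lambda>s. t0 + \<tau> * s) \<phi> \<theta> E) \<xi> =
      polar (lift_\<rho> t0 \<tau> \<theta> E (\<xi> $ 1) (\<xi> $ 2)) (\<phi> + lift_\<phi> t0 \<tau> \<theta> E (\<xi> $ 1) (\<xi> $ 2))"
    "0 < lift_\<rho> t0 \<tau> \<theta> E (\<xi> $ 1) (\<xi> $ 2)"
proof -
  note b = lift_derivative_bounds[OF f E ab]
  show "quad_map (strip_elem (\<lambda>s. t0 + \<tau> * s) \<phi> \<theta> E) \<xi> =
      polar (lift_\<rho> t0 \<tau> \<theta> E (\<xi> $ 1) (\<xi> $ 2)) (\<phi> + lift_\<phi> t0 \<tau> \<theta> E (\<xi> $ 1) (\<xi> $ 2))"
    unfolding lift_\<rho>_def lift_\<phi>_def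
    by (rule quad_map_strip_elem) (rule polar_arctan(1)[OF b(1)], rule polar_arctan(2)[OF b(1)])
  show "0 < lift_\<rho> t0 \<tau> \<theta> E (\<xi> $ 1) (\<xi> $ 2)" using b(2) by (simp add: lift_\<rho>_def)
qed

lemma has_real_derivative_interp_path:
  assumes "E \<in> elems"
  shows "((\<lambda>l. interp f E (a + l * da) (b + l * db)) has_real_derivative
     deriv_s f E (a + l * da) (b + l * db) * (interp fst E (a + da) (b + db) - interp fst E a b) +
     deriv_\<sigma> f E (a + l * da) (b + l * db) * (interp snd E (a + da) (b + db) - interp snd E a b)) (at l)"
proof -
  have "((\<lambda>l. interp f E (a + l * da) (b + l * db)) has_real_derivative
     interp_a f E (a + l * da) (b + l * db) * da + interp_b f E (a + l * da) (b + l * db) * db) (at l)"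
    unfolding interp_def interp_a_def interp_b_def by (auto intro!: derivative_eq_intros simp: algebra_simps)
  then show ?thesis
    unfolding deriv_inverse[OF assms] interp_affine[OF assms] by (simp add: algebra_simps)
qed

text \<open>The mean value theorem along the segment between the two points, which stays in the
  convex triangle, combined with \<open>lift_derivative_bounds\<close>.\<close>

lemma lift_lipschitz:
  assumes f: "fine_element \<kappa> t0 \<tau> \<theta>" "\<kappa> \<le> 1 / 30000" and E: "E \<in> elems"
    and ab: "0 \<le> a" "0 \<le> b" "a + b \<le> 1" and ab': "0 \<le> a'" "0 \<le> b'" "a' + b' \<le> 1"
  defines "ds \<equiv> interp fst E a' b' - interp fst E a b" and "d\<sigma> \<equiv> interp snd E a' b' - interp snd E a b"
  shows "\<bar>lift_\<rho> t0 \<tau> \<theta> E a' b' - lift_\<rho> t0 \<tau> \<theta> E a b - \<tau> * ds\<bar> \<le> \<tau> / 8 * (\<bar>ds\<bar> + \<bar>d\<sigma>\<bar>)"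
    "\<bar>lift_\<phi> t0 \<tau> \<theta> E a' b' - lift_\<phi> t0 \<tau> \<theta> E a b - \<theta> * d\<sigma>\<bar> \<le> \<theta> / 8 * (\<bar>ds\<bar> + \<bar>d\<sigma>\<bar>)"
proof -
  define da db where "da = a' - a" and "db = b' - b"
  have path: "0 \<le> a + l * da" "0 \<le> b + l * db" "(a + l * da) + (b + l * db) \<le> 1" if "0 \<le> l" "l \<le> 1" for l
  proof -
    have "a + l * da = (1 - l) * a + l * a'" "b + l * db = (1 - l) * b + l * b'"
      by (simp_all add: da_def db_def algebra_simps)
    moreover have "(1 - l) * (a + b) + l * (a' + b') \<le> (1 - l) * 1 + l * 1"
      using that ab ab' by (intro add_mono mult_left_mono) auto
    moreover have "(1 - l) * (a + b) + l * (a' + b') = ((1 - l) * a + l * a') + ((1 - l) * b + l * b')"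
      by (simp add: algebra_simps)
    ultimately show "0 \<le> a + l * da" "0 \<le> b + l * db" "(a + l * da) + (b + l * db) \<le> 1"
      using that ab ab' by auto
  qed
  let ?x = "polar_x (\<lambda>s. t0 + \<tau> * s) \<theta>" and ?y = "polar_y (\<lambda>s. t0 + \<tau> * s) \<theta>"
  define X Y where "X = (\<lambda>l. interp ?x E (a + l * da) (b + l * db))" and "Y = (\<lambda>l. interp ?y E (a + l * da) (b + l * db))"
  define xs where "xs = (\<lambda>l. deriv_s ?x E (a + l * da) (b + l * db))"
  define xt where "xt = (\<lambda>l. deriv_\<sigma> ?x E (a + l * da) (b + l * db))"
  define ys where "ys = (\<lambda>l. deriv_s ?y E (a + l * da) (b + l * db))"
  define yt where "yt = (\<lambda>l. deriv_\<sigma> ?y E (a + l * da) (b + l * db))"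
  have dd: "a + da = a'" "b + db = b'" by (simp_all add: da_def db_def)
  have dX: "(X has_real_derivative xs l * ds + xt l * d\<sigma>) (at l)" and dY: "(Y has_real_derivative ys l * ds + yt l * d\<sigma>) (at l)" for l
    using has_real_derivative_interp_path[OF E, of ?x a da b db l] has_real_derivative_interp_path[OF E, of ?y a da b db l]
    unfolding dd ds_def[symmetric] d\<sigma>_def[symmetric] X_def Y_def xs_def xt_def ys_def yt_def by auto
  have X0: "0 < X l" and R: "0 < sqrt ((X l)\<^sup>2 + (Y l)\<^sup>2)"
    and b: "\<bar>(X l * xs l + Y l * ys l) / sqrt ((X l)\<^sup>2 + (Y l)\<^sup>2) - \<tau>\<bar> \<le> \<tau> / 8"
      "\<bar>(X l * xt l + Y l * yt l) / sqrt ((X l)\<^sup>2 + (Y l)\<^sup>2)\<bar> \<le> \<tau> / 8"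
      "\<bar>(X l * ys l - Y l * xs l) / ((X l)\<^sup>2 + (Y l)\<^sup>2)\<bar> \<le> \<theta> / 8"
      "\<bar>(X l * yt l - Y l * xt l) / ((X l)\<^sup>2 + (Y l)\<^sup>2) - \<theta>\<bar> \<le> \<theta> / 8" if "0 \<le> l" "l \<le> 1" for l
    using lift_derivative_bounds[OF f E path[OF that]] unfolding X_def Y_def xs_def xt_def ys_def yt_def by auto
  have comb: "\<bar>p * ds + q * d\<sigma>\<bar> \<le> K * (\<bar>ds\<bar> + \<bar>d\<sigma>\<bar>)" if "\<bar>p\<bar> \<le> K" "\<bar>q\<bar> \<le> K" for p q K
  proof -
    have "\<bar>p * ds\<bar> \<le> K * \<bar>ds\<bar>" "\<bar>q * d\<sigma>\<bar> \<le> K * \<bar>d\<sigma>\<bar>" using that by (intro abs_mult_le; simp)+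
    then show ?thesis unfolding distrib_left by linarith
  qed
  have "\<exists>z::real. z > 0 \<and> z < 1 \<and> sqrt ((X 1)\<^sup>2 + (Y 1)\<^sup>2) - sqrt ((X 0)\<^sup>2 + (Y 0)\<^sup>2) =
      (1 - 0) * ((X z * (xs z * ds + xt z * d\<sigma>) + Y z * (ys z * ds + yt z * d\<sigma>)) / sqrt ((X z)\<^sup>2 + (Y z)\<^sup>2))"
  proof (rule MVT2)
    fix l :: real assume l: "0 \<le> l" "l \<le> 1"
    have "0 < (X l)\<^sup>2 + (Y l)\<^sup>2" using X0[OF l] by (simp add: add_pos_nonneg)
    have d: "((\<lambda>l. (X l)\<^sup>2 + (Y l)\<^sup>2) has_real_derivative
        2 * (X l * (xs l * ds + xt l * d\<sigma>) + Y l * (ys l * ds + yt l * d\<sigma>))) (at l)"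
      by (auto intro!: derivative_eq_intros dX dY simp: algebra_simps)
    show "((\<lambda>l. sqrt ((X l)\<^sup>2 + (Y l)\<^sup>2)) has_real_derivative
        ((X l * (xs l * ds + xt l * d\<sigma>) + Y l * (ys l * ds + yt l * d\<sigma>)) / sqrt ((X l)\<^sup>2 + (Y l)\<^sup>2))) (at l)"
    proof (rule DERIV_cong[OF DERIV_chain2[OF _ d]])
      show "DERIV sqrt ((X l)\<^sup>2 + (Y l)\<^sup>2) :> inverse (sqrt ((X l)\<^sup>2 + (Y l)\<^sup>2)) / 2"
        by (rule DERIV_real_sqrt) fact
    qed (simp only: divide_inverse, simp)
  qed simp
  then obtain z where z: "0 < z" "z < 1" and e: "sqrt ((X 1)\<^sup>2 + (Y 1)\<^sup>2) - sqrt ((X 0)\<^sup>2 + (Y 0)\<^sup>2) =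
      (X z * (xs z * ds + xt z * d\<sigma>) + Y z * (ys z * ds + yt z * d\<sigma>)) / sqrt ((X z)\<^sup>2 + (Y z)\<^sup>2)" by auto
  have "sqrt ((X 1)\<^sup>2 + (Y 1)\<^sup>2) - sqrt ((X 0)\<^sup>2 + (Y 0)\<^sup>2) - \<tau> * ds =
      ((X z * xs z + Y z * ys z) / sqrt ((X z)\<^sup>2 + (Y z)\<^sup>2) - \<tau>) * ds + (X z * xt z + Y z * yt z) / sqrt ((X z)\<^sup>2 + (Y z)\<^sup>2) * d\<sigma>"
    unfolding e by (simp add: algebra_simps add_divide_distrib)
  then show "\<bar>lift_\<rho> t0 \<tau> \<theta> E a' b' - lift_\<rho> t0 \<tau> \<theta> E a b - \<tau> * ds\<bar> \<le> \<tau> / 8 * (\<bar>ds\<bar> + \<bar>d\<sigma>\<bar>)"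
    using comb[OF b(1,2)[of z]] z by (simp add: lift_\<rho>_def X_def Y_def dd)
  have "\<exists>z::real. z > 0 \<and> z < 1 \<and> arctan (Y 1 / X 1) - arctan (Y 0 / X 0) =
      (1 - 0) * ((X z * (ys z * ds + yt z * d\<sigma>) - Y z * (xs z * ds + xt z * d\<sigma>)) / ((X z)\<^sup>2 + (Y z)\<^sup>2))"
  proof (rule MVT2)
    fix l :: real assume l: "0 \<le> l" "l \<le> 1"
    have Xl: "0 < X l" by (rule X0[OF l])
    have S: "1 + (Y l / X l)\<^sup>2 = ((X l)\<^sup>2 + (Y l)\<^sup>2) / (X l)\<^sup>2" using X0[OF l] by (simp add: field_simps)
    have "0 < (X l)\<^sup>2 + (Y l)\<^sup>2" using X0[OF l] by (simp add: add_pos_nonneg)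
    have d: "((\<lambda>l. Y l / X l) has_real_derivative
        ((ys l * ds + yt l * d\<sigma>) * X l - Y l * (xs l * ds + xt l * d\<sigma>)) / (X l * X l)) (at l)"
      using Xl by (intro DERIV_divide dX dY) simp
    show "((\<lambda>l. arctan (Y l / X l)) has_real_derivative
        ((X l * (ys l * ds + yt l * d\<sigma>) - Y l * (xs l * ds + xt l * d\<sigma>)) / ((X l)\<^sup>2 + (Y l)\<^sup>2))) (at l)"
    proof (rule DERIV_cong[OF DERIV_chain2[OF DERIV_arctan d]])
      show "inverse (1 + (Y l / X l)\<^sup>2) * (((ys l * ds + yt l * d\<sigma>) * X l - Y l * (xs l * ds + xt l * d\<sigma>)) / (X l * X l)) =
        (X l * (ys l * ds + yt l * d\<sigma>) - Y l * (xs l * ds + xt l * d\<sigma>)) / ((X l)\<^sup>2 + (Y l)\<^sup>2)"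
        unfolding S using Xl by (simp add: power2_eq_square mult.commute)
    qed
  qed simp
  then obtain z where z: "0 < z" "z < 1" and e: "arctan (Y 1 / X 1) - arctan (Y 0 / X 0) =
      (X z * (ys z * ds + yt z * d\<sigma>) - Y z * (xs z * ds + xt z * d\<sigma>)) / ((X z)\<^sup>2 + (Y z)\<^sup>2)" by auto
  have "arctan (Y 1 / X 1) - arctan (Y 0 / X 0) - \<theta> * d\<sigma> =
      (X z * ys z - Y z * xs z) / ((X z)\<^sup>2 + (Y z)\<^sup>2) * ds + ((X z * yt z - Y z * xt z) / ((X z)\<^sup>2 + (Y z)\<^sup>2) - \<theta>) * d\<sigma>"
    unfolding e by (simp add: algebra_simps add_divide_distrib diff_divide_distrib)
  then show "\<bar>lift_\<phi> t0 \<tau> \<theta> E a' b' - lift_\<phi> t0 \<tau> \<theta> E a b - \<theta> * d\<sigma>\<bar> \<le> \<theta> / 8 * (\<bar>ds\<bar> + \<bar>d\<sigma>\<bar>)"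
    using comb[OF b(3,4)[of z]] z by (simp add: lift_\<phi>_def X_def Y_def dd)
qed

section \<open>A whole layer on the universal cover\<close>

text \<open>The regions between consecutive lines \<open>l n\<close> lie side by side. A segment
  from region n to a later one is cut where it meets the line \<open>l (n + 1)\<close>; there
  \<open>f n\<close> and \<open>f (n + 1)\<close> agree, and induction takes over from that point.
  The norm |ds| + |d\<sigma>| is additive under cutting a segment, so the constant \<open>K\<close>
  does not grow.\<close>

lemma chain_lipschitz:
  fixes f :: "int \<Rightarrow> real \<Rightarrow> real \<Rightarrow> real" and l :: "int \<Rightarrow> real \<Rightarrow> real"
  assumes aff: "\<And>n s. l n s = l n 0 + (l n 1 - l n 0) * s"
    and mono: "\<And>n s. 0 \<le> s \<Longrightarrow> s \<le> 1 \<Longrightarrow> l n s \<le> l (n + 1) s"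
    and lip: "\<And>n s \<sigma> s' \<sigma>'. s \<in> {0..1} \<Longrightarrow> s' \<in> {0..1} \<Longrightarrow> \<sigma> \<in> {l n s..l (n + 1) s} \<Longrightarrow> \<sigma>' \<in> {l n s'..l (n + 1) s'} \<Longrightarrow>
      \<bar>f n s' \<sigma>' - f n s \<sigma>\<bar> \<le> K * (\<bar>s' - s\<bar> + \<bar>\<sigma>' - \<sigma>\<bar>)"
    and agree: "\<And>n s. 0 \<le> s \<Longrightarrow> s \<le> 1 \<Longrightarrow> f n s (l (n + 1) s) = f (n + 1) s (l (n + 1) s)"
    and s: "s \<in> {0..1}" "s' \<in> {0..1}"
    and \<sigma>: "\<sigma> \<in> {l n s..l (n + 1) s}" "\<sigma>' \<in> {l (n + int k) s'..l (n + int k + 1) s'}"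
  shows "\<bar>f (n + int k) s' \<sigma>' - f n s \<sigma>\<bar> \<le> K * (\<bar>s' - s\<bar> + \<bar>\<sigma>' - \<sigma>\<bar>)"
  using s \<sigma>
proof (induction k arbitrary: n s \<sigma>)
  case 0
  then show ?case using lip by simp
next
  case (Suc k)
  have le: "l n' x \<le> l (n' + int j) x" if "0 \<le> x" "x \<le> 1" for n' x j
  proof (induction j)
    case (Suc j)
    have "l (n' + int j) x \<le> l (n' + int j + 1) x" by (rule mono) fact+
    with Suc show ?case by (simp add: ac_simps)
  qed simp
  have e: "n + 1 + int k = n + int (Suc k)" by simp
  define h0 where "h0 = \<sigma> - l (n + 1) s"
  define h1 where "h1 = \<sigma>' - l (n + 1) s'"
  have h: "h0 \<le> 0" "0 \<le> h1"
    using Suc.prems le[of s' "n + 1" k] unfolding h0_def h1_def e by auto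
  \<comment> \<open>The parameter of the crossing point. \<open>h0\<close> and \<open>h1\<close> are
    the \<sigma>-offsets of the end points from the line and vary affinely along the segment;
    \<open>h0 = h1\<close> forces both to vanish, so the start point is then on the line.\<close>
  define \<mu> where "\<mu> = (if h0 = h1 then 0 else h0 / (h0 - h1))"
  have \<mu>: "0 \<le> \<mu>" "\<mu> \<le> 1" "h0 + \<mu> * (h1 - h0) = 0"
  proof -
    show "0 \<le> \<mu>" using h by (auto simp: \<mu>_def divide_nonpos_neg divide_simps)
    show "\<mu> \<le> 1" using h by (auto simp: \<mu>_def divide_simps)
    show "h0 + \<mu> * (h1 - h0) = 0" using h by (auto simp: \<mu>_def field_simps)
  qed
  have split: "\<bar>\<mu> * d\<bar> + \<bar>(1 - \<mu>) * d\<bar> = \<bar>d\<bar>" for d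
  proof -
    have "\<bar>\<mu> * d\<bar> = \<mu> * \<bar>d\<bar>" "\<bar>(1 - \<mu>) * d\<bar> = (1 - \<mu>) * \<bar>d\<bar>" using \<mu>(1,2) by (simp_all add: abs_mult)
    then show ?thesis by (simp only: left_diff_distrib)
  qed
  define x where "x = s + \<mu> * (s' - s)"
  define z where "z = \<sigma> + \<mu> * (\<sigma>' - \<sigma>)"
  have x: "x \<in> {0..1}"
  proof -
    have "x = (1 - \<mu>) * s + \<mu> * s'" by (simp add: x_def algebra_simps)
    moreover have "(1 - \<mu>) * s + \<mu> * s' \<le> (1 - \<mu>) * 1 + \<mu> * 1"
      using Suc.prems \<mu> by (intro add_mono mult_left_mono) auto
    ultimately show ?thesis using Suc.prems \<mu> by auto
  qed
  have z: "z = l (n + 1) x"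
  proof -
    have "z - l (n + 1) x = h0 + \<mu> * (h1 - h0)"
      unfolding h0_def h1_def z_def x_def aff[of "n + 1" s] aff[of "n + 1" s'] aff[of "n + 1" "s + \<mu> * (s' - s)"]
      by (simp add: algebra_simps)
    then show ?thesis using \<mu> by simp
  qed
  have "\<bar>f n x z - f n s \<sigma>\<bar> \<le> K * (\<bar>x - s\<bar> + \<bar>z - \<sigma>\<bar>)"
    using mono[of x n] x z Suc.prems by (intro lip) auto
  moreover have "\<bar>f (n + 1 + int k) s' \<sigma>' - f (n + 1) x z\<bar> \<le> K * (\<bar>s' - x\<bar> + \<bar>\<sigma>' - z\<bar>)"
    using mono[of x "n + 1"] x z Suc.prems by (intro Suc.IH) (auto simp: ac_simps)
  moreover have "f n x z = f (n + 1) x z" using agree[of x n] x z by simp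
  moreover have dx: "\<bar>x - s\<bar> + \<bar>s' - x\<bar> = \<bar>s' - s\<bar>"
  proof -
    have "x - s = \<mu> * (s' - s)" "s' - x = (1 - \<mu>) * (s' - s)" by (simp_all add: x_def algebra_simps)
    then show ?thesis by (simp only: split)
  qed
  moreover have dz: "\<bar>z - \<sigma>\<bar> + \<bar>\<sigma>' - z\<bar> = \<bar>\<sigma>' - \<sigma>\<bar>"
  proof -
    have "z - \<sigma> = \<mu> * (\<sigma>' - \<sigma>)" "\<sigma>' - z = (1 - \<mu>) * (\<sigma>' - \<sigma>)" by (simp_all add: z_def algebra_simps)
    then show ?thesis by (simp only: split)
  qed
  moreover have "K * (\<bar>s' - s\<bar> + \<bar>\<sigma>' - \<sigma>\<bar>) = K * (\<bar>x - s\<bar> + \<bar>z - \<sigma>\<bar>) + K * (\<bar>s' - x\<bar> + \<bar>\<sigma>' - z\<bar>)"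
    unfolding dx[symmetric] dz[symmetric] by (simp only: distrib_left)
  ultimately show ?case unfolding e[symmetric] by linarith
qed

text \<open>The elements of a layer are numbered by all integers in angular order, on the universal
  cover of the annulus: A and B alternate in a standard layer, and A, D, C repeat in a conforming
  one, D being the half of B at smaller angles. \<open>layer_center\<close> is the centre of the
  element in units of \<theta>, and one \<open>layer_period\<close> advances it by 2.\<close>

definition layer_elem :: "bool \<Rightarrow> int \<Rightarrow> (real \<times> real) element" where
  "layer_elem cf n = (if cf then (if n mod 3 = 0 then elem_A else if n mod 3 = 1 then elem_D else elem_C)
     else if even n then elem_A else elem_B)"

definition layer_center :: "bool \<Rightarrow> int \<Rightarrow> real" where
  "layer_center cf n = (if cf then 2 * real_of_int (n div 3) + (if n mod 3 = 0 then 0 else if n mod 3 = 1 then 1 / 2 else 3 / 2)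
     else real_of_int n)"

definition layer_period :: "bool \<Rightarrow> int" where
  "layer_period cf = (if cf then 3 else 2)"

definition mesh_elem :: "bool \<Rightarrow> real \<Rightarrow> real \<Rightarrow> real \<Rightarrow> real \<Rightarrow> int \<Rightarrow> (real ^ 2) element" where
  "mesh_elem cf t0 \<tau> \<theta> \<omega> n = strip_elem (\<lambda>s. t0 + \<tau> * s) (\<omega> + \<theta> * layer_center cf n) \<theta> (layer_elem cf n)"

lemma layer_elem_elems [simp]: "layer_elem cf n \<in> elems"
  by (auto simp: layer_elem_def elems_def)

lemma mod3_cases:
  fixes n :: int
  obtains j where "n = 3 * j" | j where "n = 3 * j + 1" | j where "n = 3 * j + 2"
proof -
  have "n = 3 * (n div 3) + n mod 3" by simp
  moreover have "n mod 3 = 0 \<or> n mod 3 = 1 \<or> n mod 3 = 2" by presburger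
  ultimately show ?thesis using that by (metis add.right_neutral)
qed

lemma layer_conf [simp]:
  "layer_elem True (3 * j) = elem_A" "layer_elem True (3 * j + 1) = elem_D" "layer_elem True (3 * j + 2) = elem_C"
  "layer_center True (3 * j) = 2 * real_of_int j" "layer_center True (3 * j + 1) = 2 * real_of_int j + 1 / 2" "layer_center True (3 * j + 2) = 2 * real_of_int j + 3 / 2"
proof -
  have "(3 * j) mod 3 = 0" "(3 * j + 1) mod 3 = 1" "(3 * j + 2) mod 3 = 2"
    "(3 * j) div 3 = j" "(3 * j + 1) div 3 = j" "(3 * j + 2) div 3 = j" by simp_all
  then show "layer_elem True (3 * j) = elem_A" "layer_elem True (3 * j + 1) = elem_D" "layer_elem True (3 * j + 2) = elem_C"
    "layer_center True (3 * j) = 2 * real_of_int j" "layer_center True (3 * j + 1) = 2 * real_of_int j + 1 / 2" "layer_center True (3 * j + 2) = 2 * real_of_int j + 3 / 2"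
    by (simp_all add: layer_elem_def layer_center_def)
qed

lemma layer_std [simp]:
  "layer_elem False (2 * j) = elem_A" "layer_elem False (2 * j + 1) = elem_B"
  "layer_center False n = n"
  by (simp_all add: layer_elem_def layer_center_def)

lemma layer_shift:
  "layer_elem cf (n + layer_period cf * k) = layer_elem cf n"
  "layer_center cf (n + layer_period cf * k) = layer_center cf n + 2 * k"
proof -
  have "(n + 3 * k) mod 3 = n mod 3" "(n + 3 * k) div 3 = n div 3 + k" by simp_all
  then show "layer_elem cf (n + layer_period cf * k) = layer_elem cf n"
    "layer_center cf (n + layer_period cf * k) = layer_center cf n + 2 * k"
    by (simp_all add: layer_elem_def layer_center_def layer_period_def)
qed

definition layer_line :: "bool \<Rightarrow> int \<Rightarrow> real \<Rightarrow> real" where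
  "layer_line cf n s = layer_center cf n + strip_l (layer_elem cf n) s"

lemma layer_adjacent:
  "layer_center cf n + strip_r (layer_elem cf n) s = layer_line cf (n + 1) s"
  "\<bar>layer_center cf (n + 1) - layer_center cf n\<bar> \<le> 1"
proof -
  have "layer_center cf n + strip_r (layer_elem cf n) s = layer_line cf (n + 1) s \<and> \<bar>layer_center cf (n + 1) - layer_center cf n\<bar> \<le> 1"
  proof (cases cf)
    case True
    then have cf: "cf = True" by simp
    show ?thesis
    proof (cases n rule: mod3_cases)
      case (1 j)
      show ?thesis unfolding 1 cf layer_conf layer_line_def by (simp add: strip_l_def strip_r_def)
    next
      case (2 j)
      have e: "3 * j + 1 + 1 = 3 * j + 2" by simp
      show ?thesis unfolding 2 cf e layer_conf layer_line_def by (simp add: strip_l_def strip_r_def)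
    next
      case (3 j)
      have e: "3 * j + 2 + 1 = 3 * (j + 1)" by simp
      show ?thesis unfolding 3 cf e layer_conf layer_line_def by (simp add: strip_l_def strip_r_def)
    qed
  next
    case False
    then have cf: "cf = False" by simp
    show ?thesis
    proof (cases "even n")
      case True
      then obtain j where n: "n = 2 * j" by (rule evenE)
      show ?thesis unfolding n cf layer_std layer_line_def by (simp add: strip_l_def strip_r_def)
    next
      case f: False
      then obtain j where n: "n = 2 * j + 1" by (rule oddE)
      have e: "2 * j + 1 + 1 = 2 * (j + 1)" by simp
      show ?thesis unfolding n cf e layer_std layer_line_def by (simp add: strip_l_def strip_r_def)
    qed
  qed
  then show "layer_center cf n + strip_r (layer_elem cf n) s = layer_line cf (n + 1) s"
    "\<bar>layer_center cf (n + 1) - layer_center cf n\<bar> \<le> 1" by auto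
qed

lemma layer_line_affine: "layer_line cf n s = layer_line cf n 0 + (layer_line cf n 1 - layer_line cf n 0) * s"
  by (simp add: layer_line_def strip_l_def algebra_simps)

lemma strip_l_le_r: "E \<in> elems \<Longrightarrow> 0 \<le> s \<Longrightarrow> s \<le> 1 \<Longrightarrow> strip_l E s \<le> strip_r E s"
  by (cases E rule: elems_cases) (simp_all add: strip_l_def strip_r_def)

lemma layer_line_mono: "0 \<le> s \<Longrightarrow> s \<le> 1 \<Longrightarrow> layer_line cf n s \<le> layer_line cf (n + 1) s"
  unfolding layer_adjacent(1)[symmetric] using strip_l_le_r[of "layer_elem cf n" s] by (simp add: layer_line_def)

lemma layer_line_mono_less:
  assumes "0 \<le> s" "s \<le> 1" "n \<le> n'"
  shows "layer_line cf n s \<le> layer_line cf n' s"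
  using assms(3)
proof (induction n' rule: int_ge_induct)
  case (step i)
  then show ?case using layer_line_mono[OF assms(1,2), of cf i] by simp
qed simp

text \<open>An edge of a quadratic element depends only on the three nodes on it. Parametrised by s
  it is the same curve for both elements that share the edge.\<close>

definition edge_curve :: "(real \<Rightarrow> real) \<Rightarrow> real \<Rightarrow> real \<Rightarrow> (real \<Rightarrow> real) \<Rightarrow> real \<Rightarrow> real ^ 2" where
  "edge_curve q \<omega> \<theta> l s = ((1 - s) * (1 - 2 * s)) *\<^sub>R polar (q 0) (\<omega> + \<theta> * l 0) +
     (4 * s * (1 - s)) *\<^sub>R polar (q (1 / 2)) (\<omega> + \<theta> * l (1 / 2)) + (s * (2 * s - 1)) *\<^sub>R polar (q 1) (\<omega> + \<theta> * l 1)"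

lemma quad_map_vector:
  "quad_map T (vector [a, b]) = ((1 - a - b) * (1 - 2 * a - 2 * b)) *\<^sub>R a1 T + (a * (2 * a - 1)) *\<^sub>R a2 T + (b * (2 * b - 1)) *\<^sub>R a3 T +
     (4 * (1 - a - b) * a) *\<^sub>R a12 T + (4 * (1 - a - b) * b) *\<^sub>R a13 T + (4 * a * b) *\<^sub>R a23 T"
  by (simp add: quad_map_def vertex_shape_def edge_shape_def bary_def algebra_simps)

lemma quad_map_edges:
  "quad_map T (vector [s, 0]) = ((1 - s) * (1 - 2 * s)) *\<^sub>R a1 T + (4 * s * (1 - s)) *\<^sub>R a12 T + (s * (2 * s - 1)) *\<^sub>R a2 T"
  "quad_map T (vector [0, s]) = ((1 - s) * (1 - 2 * s)) *\<^sub>R a1 T + (4 * s * (1 - s)) *\<^sub>R a13 T + (s * (2 * s - 1)) *\<^sub>R a3 T"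
  "quad_map T (vector [1 - s, 0]) = ((1 - s) * (1 - 2 * s)) *\<^sub>R a2 T + (4 * s * (1 - s)) *\<^sub>R a12 T + (s * (2 * s - 1)) *\<^sub>R a1 T"
  "quad_map T (vector [0, 1 - s]) = ((1 - s) * (1 - 2 * s)) *\<^sub>R a3 T + (4 * s * (1 - s)) *\<^sub>R a13 T + (s * (2 * s - 1)) *\<^sub>R a1 T"
  "quad_map T (vector [s, 1 - s]) = ((1 - s) * (1 - 2 * s)) *\<^sub>R a3 T + (4 * s * (1 - s)) *\<^sub>R a23 T + (s * (2 * s - 1)) *\<^sub>R a2 T"
  "quad_map T (vector [1 - s, s]) = ((1 - s) * (1 - 2 * s)) *\<^sub>R a2 T + (4 * s * (1 - s)) *\<^sub>R a23 T + (s * (2 * s - 1)) *\<^sub>R a3 T"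
  unfolding quad_map_vector vec_eq_iff forall_2 vector_add_component vector_scaleR_component real_scaleR_def
  by (intro conjI; algebra)+

lemma strip_ab_edges:
  "strip_a elem_A s (strip_l elem_A s) = s" "strip_b elem_A s (strip_l elem_A s) = 0"
  "strip_a elem_A s (strip_r elem_A s) = 0" "strip_b elem_A s (strip_r elem_A s) = s"
  "strip_a elem_B s (strip_l elem_B s) = 0" "strip_b elem_B s (strip_l elem_B s) = 1 - s"
  "strip_a elem_B s (strip_r elem_B s) = 1 - s" "strip_b elem_B s (strip_r elem_B s) = 0"
  "strip_a elem_C s (strip_l elem_C s) = s" "strip_b elem_C s (strip_l elem_C s) = 0"
  "strip_a elem_C s (strip_r elem_C s) = s" "strip_b elem_C s (strip_r elem_C s) = 1 - s"
  "strip_a elem_D s (strip_l elem_D s) = 1 - s" "strip_b elem_D s (strip_l elem_D s) = s"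
  "strip_a elem_D s (strip_r elem_D s) = 0" "strip_b elem_D s (strip_r elem_D s) = s"
  by (simp_all add: strip_a_def strip_b_def strip_l_def strip_r_def)

lemma strip_elem_nodes:
  "a1 (strip_elem q \<phi> \<theta> E) = polar (q (fst (a1 E))) (\<phi> + \<theta> * snd (a1 E))"
  "a2 (strip_elem q \<phi> \<theta> E) = polar (q (fst (a2 E))) (\<phi> + \<theta> * snd (a2 E))"
  "a3 (strip_elem q \<phi> \<theta> E) = polar (q (fst (a3 E))) (\<phi> + \<theta> * snd (a3 E))"
  "a12 (strip_elem q \<phi> \<theta> E) = polar (q (fst (a12 E))) (\<phi> + \<theta> * snd (a12 E))"
  "a13 (strip_elem q \<phi> \<theta> E) = polar (q (fst (a13 E))) (\<phi> + \<theta> * snd (a13 E))"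
  "a23 (strip_elem q \<phi> \<theta> E) = polar (q (fst (a23 E))) (\<phi> + \<theta> * snd (a23 E))"
  by (cases E; simp add: strip_elem_def)+

lemma quad_map_edge:
  assumes "E \<in> elems"
  shows "quad_map (strip_elem q (\<omega> + \<theta> * c) \<theta> E) (vector [strip_a E s (strip_l E s), strip_b E s (strip_l E s)]) =
      edge_curve q \<omega> \<theta> (\<lambda>s. c + strip_l E s) s"
    "quad_map (strip_elem q (\<omega> + \<theta> * c) \<theta> E) (vector [strip_a E s (strip_r E s), strip_b E s (strip_r E s)]) =
      edge_curve q \<omega> \<theta> (\<lambda>s. c + strip_r E s) s"
proof -
  have angle: "\<omega> + \<theta> * c + \<theta> * x = \<omega> + \<theta> * (c + x)" for x by (simp add: distrib_left)
  show "quad_map (strip_elem q (\<omega> + \<theta> * c) \<theta> E) (vector [strip_a E s (strip_l E s), strip_b E s (strip_l E s)]) =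
      edge_curve q \<omega> \<theta> (\<lambda>s. c + strip_l E s) s"
    using assms by (cases rule: elems_cases; simp only: strip_ab_edges quad_map_edges strip_elem_nodes angle edge_curve_def;
      simp add: elem_defs strip_l_def)
  show "quad_map (strip_elem q (\<omega> + \<theta> * c) \<theta> E) (vector [strip_a E s (strip_r E s), strip_b E s (strip_r E s)]) =
      edge_curve q \<omega> \<theta> (\<lambda>s. c + strip_r E s) s"
    using assms by (cases rule: elems_cases; simp only: strip_ab_edges quad_map_edges strip_elem_nodes angle edge_curve_def;
      simp add: elem_defs strip_r_def)
qed

text \<open>With \<open>layer_\<phi>\<close>: the polar lift of the n-th element in the strip
  coordinates of the whole layer, where \<sigma> runs over the real line.\<close>

definition layer_\<rho> :: "bool \<Rightarrow> real \<Rightarrow> real \<Rightarrow> real \<Rightarrow> int \<Rightarrow> real \<Rightarrow> real \<Rightarrow> real" where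
  "layer_\<rho> cf t0 \<tau> \<theta> n s \<sigma> = lift_\<rho> t0 \<tau> \<theta> (layer_elem cf n)
     (strip_a (layer_elem cf n) s (\<sigma> - layer_center cf n)) (strip_b (layer_elem cf n) s (\<sigma> - layer_center cf n))"

definition layer_\<phi> :: "bool \<Rightarrow> real \<Rightarrow> real \<Rightarrow> real \<Rightarrow> real \<Rightarrow> int \<Rightarrow> real \<Rightarrow> real \<Rightarrow> real" where
  "layer_\<phi> cf t0 \<tau> \<theta> \<omega> n s \<sigma> = \<omega> + \<theta> * layer_center cf n + lift_\<phi> t0 \<tau> \<theta> (layer_elem cf n)
     (strip_a (layer_elem cf n) s (\<sigma> - layer_center cf n)) (strip_b (layer_elem cf n) s (\<sigma> - layer_center cf n))"

lemma polar_lift_unique: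
  assumes "0 < \<rho>" "0 < \<rho>'" "polar \<rho> \<phi> = polar \<rho>' \<phi>'" "\<bar>\<phi> - \<phi>'\<bar> < 2 * pi"
  shows "\<rho> = \<rho>'" "\<phi> = \<phi>'"
proof -
  show "\<rho> = \<rho>'" using polar_inj(1)[OF assms(1-3)] .
  obtain k :: int where k: "\<phi> = \<phi>' + 2 * pi * k" using polar_inj(2)[OF assms(1-3)] by blast
  then have "\<bar>2 * pi * k\<bar> < 2 * pi" using assms(4) by simp
  then have "\<bar>real_of_int k\<bar> < 1" by (simp add: abs_mult)
  then have "k = 0" by linarith
  then show "\<phi> = \<phi>'" using k by simp
qed

context
  fixes cf :: bool and \<kappa> t0 \<tau> \<theta> \<omega> :: real
  assumes fine: "fine_element \<kappa> t0 \<tau> \<theta>" and \<kappa>: "\<kappa> \<le> 1 / 30000"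
begin

private abbreviation "LE \<equiv> layer_elem cf"
private abbreviation "LC \<equiv> layer_center cf"
private abbreviation "LL \<equiv> layer_line cf"
private abbreviation "P \<equiv> layer_\<rho> cf t0 \<tau> \<theta>"
private abbreviation "A \<equiv> layer_\<phi> cf t0 \<tau> \<theta> \<omega>"

lemma pos: "0 < t0" "0 < \<tau>" "0 < \<theta>" "\<theta> \<le> 1"
  using fine fine_element_data[OF fine] \<kappa> by (auto simp: fine_element_def element_data_def)

lemma in_strip:
  assumes "s \<in> {0..1}" "\<sigma> \<in> {LL n s..LL (n + 1) s}"
  shows "0 \<le> strip_a (LE n) s (\<sigma> - LC n)" "0 \<le> strip_b (LE n) s (\<sigma> - LC n)"
    "strip_a (LE n) s (\<sigma> - LC n) + strip_b (LE n) s (\<sigma> - LC n) \<le> 1"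
    "interp fst (LE n) (strip_a (LE n) s (\<sigma> - LC n)) (strip_b (LE n) s (\<sigma> - LC n)) = s"
    "interp snd (LE n) (strip_a (LE n) s (\<sigma> - LC n)) (strip_b (LE n) s (\<sigma> - LC n)) = \<sigma> - LC n"
proof -
  have "strip_l (LE n) s \<le> \<sigma> - LC n" "\<sigma> - LC n \<le> strip_r (LE n) s"
    using assms(2) layer_adjacent(1)[of cf n s] by (auto simp: layer_line_def)
  from strip_ab[OF layer_elem_elems _ _ this] assms(1)
  show "0 \<le> strip_a (LE n) s (\<sigma> - LC n)" "0 \<le> strip_b (LE n) s (\<sigma> - LC n)"
    "strip_a (LE n) s (\<sigma> - LC n) + strip_b (LE n) s (\<sigma> - LC n) \<le> 1"
    "interp fst (LE n) (strip_a (LE n) s (\<sigma> - LC n)) (strip_b (LE n) s (\<sigma> - LC n)) = s"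
    "interp snd (LE n) (strip_a (LE n) s (\<sigma> - LC n)) (strip_b (LE n) s (\<sigma> - LC n)) = \<sigma> - LC n" by auto
qed

lemma mesh_elem_polar:
  assumes "s \<in> {0..1}" "\<sigma> \<in> {LL n s..LL (n + 1) s}"
  shows "quad_map (mesh_elem cf t0 \<tau> \<theta> \<omega> n) (vector [strip_a (LE n) s (\<sigma> - LC n), strip_b (LE n) s (\<sigma> - LC n)]) = polar (P n s \<sigma>) (A n s \<sigma>)"
    "0 < P n s \<sigma>"
proof -
  let ?\<xi> = "vector [strip_a (LE n) s (\<sigma> - LC n), strip_b (LE n) s (\<sigma> - LC n)] :: real ^ 2"
  have \<xi>: "0 \<le> ?\<xi> $ 1" "0 \<le> ?\<xi> $ 2" "?\<xi> $ 1 + ?\<xi> $ 2 \<le> 1" using in_strip[OF assms] by simp_all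
  show "quad_map (mesh_elem cf t0 \<tau> \<theta> \<omega> n) ?\<xi> = polar (P n s \<sigma>) (A n s \<sigma>)"
    using quad_map_lift(1)[OF fine \<kappa> layer_elem_elems \<xi>, of "\<omega> + \<theta> * LC n" cf n]
    by (simp add: mesh_elem_def layer_\<rho>_def layer_\<phi>_def)
  show "0 < P n s \<sigma>"
    using quad_map_lift(2)[OF fine \<kappa> layer_elem_elems \<xi>, of cf n] by (simp add: layer_\<rho>_def)
qed

lemma layer_lipschitz_element:
  assumes s: "s \<in> {0..1}" "s' \<in> {0..1}" and \<sigma>: "\<sigma> \<in> {LL n s..LL (n + 1) s}" "\<sigma>' \<in> {LL n s'..LL (n + 1) s'}"
  shows "\<bar>(P n s' \<sigma>' - \<tau> * s') - (P n s \<sigma> - \<tau> * s)\<bar> \<le> \<tau> / 8 * (\<bar>s' - s\<bar> + \<bar>\<sigma>' - \<sigma>\<bar>)"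
    "\<bar>(A n s' \<sigma>' - \<theta> * \<sigma>') - (A n s \<sigma> - \<theta> * \<sigma>)\<bar> \<le> \<theta> / 8 * (\<bar>s' - s\<bar> + \<bar>\<sigma>' - \<sigma>\<bar>)"
proof -
  note i = in_strip[OF s(1) \<sigma>(1)] and i' = in_strip[OF s(2) \<sigma>(2)]
  note l = lift_lipschitz[where E = "LE n", OF fine \<kappa> layer_elem_elems i(1-3) i'(1-3), unfolded i i', folded layer_\<rho>_def]
  have e: "(P n s' \<sigma>' - \<tau> * s') - (P n s \<sigma> - \<tau> * s) = P n s' \<sigma>' - P n s \<sigma> - \<tau> * (s' - s)" by (simp add: algebra_simps)
  show "\<bar>(P n s' \<sigma>' - \<tau> * s') - (P n s \<sigma> - \<tau> * s)\<bar> \<le> \<tau> / 8 * (\<bar>s' - s\<bar> + \<bar>\<sigma>' - \<sigma>\<bar>)"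
    unfolding e using l(1) by simp
  have e: "(A n s' \<sigma>' - \<theta> * \<sigma>') - (A n s \<sigma> - \<theta> * \<sigma>) = (A n s' \<sigma>' - \<omega> - \<theta> * LC n) - (A n s \<sigma> - \<omega> - \<theta> * LC n) - \<theta> * ((\<sigma>' - LC n) - (\<sigma> - LC n))" by (simp add: algebra_simps)
  show "\<bar>(A n s' \<sigma>' - \<theta> * \<sigma>') - (A n s \<sigma> - \<theta> * \<sigma>)\<bar> \<le> \<theta> / 8 * (\<bar>s' - s\<bar> + \<bar>\<sigma>' - \<sigma>\<bar>)"
    unfolding e using l(2) unfolding layer_\<phi>_def by simp
qed

text \<open>Both elements restrict to the same \<open>edge_curve\<close>, so the radii agree and the
  angles differ by a multiple of 2 pi. Each angle is within pi / 2 of the centre of its element, and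
  these centres are at most \<theta> \<le> 1 apart, so the multiple is zero.\<close>

lemma layer_agree:
  assumes s: "0 \<le> s" "s \<le> 1"
  shows "P n s (LL (n + 1) s) = P (n + 1) s (LL (n + 1) s)" "A n s (LL (n + 1) s) = A (n + 1) s (LL (n + 1) s)"
proof -
  let ?l = "LL (n + 1)"
  have in1: "?l s \<in> {LL n s..LL (n + 1) s}" and in2: "?l s \<in> {LL (n + 1) s..LL (n + 1 + 1) s}"
    by (rule atLeastAtMost_iff[THEN iffD2], intro conjI order_refl layer_line_mono s)+
  have s': "s \<in> {0..1}" using s by simp
  have r: "?l s - LC n = strip_r (LE n) s" "?l s - LC (n + 1) = strip_l (LE (n + 1)) s" for s
    using layer_adjacent(1)[of cf n s] by (simp_all add: layer_line_def)
  have c: "(\<lambda>s. LC n + strip_r (LE n) s) = ?l" "(\<lambda>s. LC (n + 1) + strip_l (LE (n + 1)) s) = ?l"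
    by (auto simp: layer_adjacent(1)) (auto simp: layer_line_def)
  have "polar (P n s (?l s)) (A n s (?l s)) = edge_curve (\<lambda>s. t0 + \<tau> * s) \<omega> \<theta> ?l s"
    unfolding mesh_elem_polar(1)[OF s' in1, symmetric] r mesh_elem_def quad_map_edge(2)[OF layer_elem_elems] c by simp
  moreover have "polar (P (n + 1) s (?l s)) (A (n + 1) s (?l s)) = edge_curve (\<lambda>s. t0 + \<tau> * s) \<omega> \<theta> ?l s"
    unfolding mesh_elem_polar(1)[OF s' in2, symmetric] r mesh_elem_def quad_map_edge(1)[OF layer_elem_elems] c by simp
  ultimately have e: "polar (P n s (?l s)) (A n s (?l s)) = polar (P (n + 1) s (?l s)) (A (n + 1) s (?l s))" by simp
  have "\<bar>A n s (?l s) - A (n + 1) s (?l s)\<bar> < 2 * pi"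
  proof -
    define x where "x = A n s (?l s) - (\<omega> + \<theta> * LC n)"
    define y where "y = A (n + 1) s (?l s) - (\<omega> + \<theta> * LC (n + 1))"
    have "\<bar>x\<bar> < pi / 2" "\<bar>y\<bar> < pi / 2"
    proof -
      have "\<bar>arctan z\<bar> < pi / 2" for z using arctan_lbound[of z] arctan_ubound[of z] by linarith
      then show "\<bar>x\<bar> < pi / 2" "\<bar>y\<bar> < pi / 2" by (simp_all add: x_def y_def layer_\<phi>_def lift_\<phi>_def)
    qed
    moreover have "\<bar>\<theta> * (LC (n + 1) - LC n)\<bar> \<le> 1 * 1" using layer_adjacent(2)[of cf n] pos by (intro abs_mult_le) auto
    moreover have "A n s (?l s) - A (n + 1) s (?l s) = x - y - \<theta> * (LC (n + 1) - LC n)"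
      by (simp add: x_def y_def algebra_simps)
    ultimately show ?thesis using pi_gt3 by linarith
  qed
  from polar_lift_unique[OF mesh_elem_polar(2)[OF s' in1] mesh_elem_polar(2)[OF s' in2] e this]
  show "P n s (?l s) = P (n + 1) s (?l s)" "A n s (?l s) = A (n + 1) s (?l s)" by auto
qed

text \<open>\<open>chain_lipschitz\<close> applied to the deviations from the linear functions
  \<tau> s and \<theta> \<sigma>. They carry the small constants, and they agree on common edges
  because the linear parts are the same for all elements.\<close>

lemma layer_lipschitz:
  assumes s: "s \<in> {0..1}" "s' \<in> {0..1}" and \<sigma>: "\<sigma> \<in> {LL n s..LL (n + 1) s}" "\<sigma>' \<in> {LL n' s'..LL (n' + 1) s'}"
  shows "\<bar>(P n' s' \<sigma>' - \<tau> * s') - (P n s \<sigma> - \<tau> * s)\<bar> \<le> \<tau> / 8 * (\<bar>s' - s\<bar> + \<bar>\<sigma>' - \<sigma>\<bar>)"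
    "\<bar>(A n' s' \<sigma>' - \<theta> * \<sigma>') - (A n s \<sigma> - \<theta> * \<sigma>)\<bar> \<le> \<theta> / 8 * (\<bar>s' - s\<bar> + \<bar>\<sigma>' - \<sigma>\<bar>)"
proof -
  have main: "\<bar>(P n' s' \<sigma>' - \<tau> * s') - (P n s \<sigma> - \<tau> * s)\<bar> \<le> \<tau> / 8 * (\<bar>s' - s\<bar> + \<bar>\<sigma>' - \<sigma>\<bar>) \<and>
    \<bar>(A n' s' \<sigma>' - \<theta> * \<sigma>') - (A n s \<sigma> - \<theta> * \<sigma>)\<bar> \<le> \<theta> / 8 * (\<bar>s' - s\<bar> + \<bar>\<sigma>' - \<sigma>\<bar>)"
    if "n \<le> n'" and s: "s \<in> {0..1}" "s' \<in> {0..1}" and \<sigma>: "\<sigma> \<in> {LL n s..LL (n + 1) s}" "\<sigma>' \<in> {LL n' s'..LL (n' + 1) s'}"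
    for n n' s s' \<sigma> \<sigma>'
  proof -
    define k where "k = nat (n' - n)"
    have k: "n' = n + int k" using that(1) by (simp add: k_def)
    have 1: "\<bar>(P (n + int k) s' \<sigma>' - \<tau> * s') - (P n s \<sigma> - \<tau> * s)\<bar> \<le> \<tau> / 8 * (\<bar>s' - s\<bar> + \<bar>\<sigma>' - \<sigma>\<bar>)"
    proof (rule chain_lipschitz[where f = "\<lambda>n s \<sigma>. (P n s \<sigma> - \<tau> * s)" and l = LL and K = "\<tau> / 8", OF layer_line_affine _ _ _ s \<sigma>(1) \<sigma>(2)[unfolded k]])
      show "LL n s \<le> LL (n + 1) s" if "0 \<le> s" "s \<le> 1" for n s by (rule layer_line_mono[OF that])
      show "\<bar>(P n s' \<sigma>' - \<tau> * s') - (P n s \<sigma> - \<tau> * s)\<bar> \<le> \<tau> / 8 * (\<bar>s' - s\<bar> + \<bar>\<sigma>' - \<sigma>\<bar>)"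
        if "s \<in> {0..1}" "s' \<in> {0..1}" "\<sigma> \<in> {LL n s..LL (n + 1) s}" "\<sigma>' \<in> {LL n s'..LL (n + 1) s'}" for n s \<sigma> s' \<sigma>'
        by (rule layer_lipschitz_element(1)[OF that])
      show "(P n s (LL (n + 1) s) - \<tau> * s) = (P (n + 1) s (LL (n + 1) s) - \<tau> * s)" if "0 \<le> s" "s \<le> 1" for n s
        by (subst layer_agree(1)[OF that]) (rule refl)
    qed
    have 2: "\<bar>(A (n + int k) s' \<sigma>' - \<theta> * \<sigma>') - (A n s \<sigma> - \<theta> * \<sigma>)\<bar> \<le> \<theta> / 8 * (\<bar>s' - s\<bar> + \<bar>\<sigma>' - \<sigma>\<bar>)"
    proof (rule chain_lipschitz[where f = "\<lambda>n s \<sigma>. (A n s \<sigma> - \<theta> * \<sigma>)" and l = LL and K = "\<theta> / 8", OF layer_line_affine _ _ _ s \<sigma>(1) \<sigma>(2)[unfolded k]])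
      show "LL n s \<le> LL (n + 1) s" if "0 \<le> s" "s \<le> 1" for n s by (rule layer_line_mono[OF that])
      show "\<bar>(A n s' \<sigma>' - \<theta> * \<sigma>') - (A n s \<sigma> - \<theta> * \<sigma>)\<bar> \<le> \<theta> / 8 * (\<bar>s' - s\<bar> + \<bar>\<sigma>' - \<sigma>\<bar>)"
        if "s \<in> {0..1}" "s' \<in> {0..1}" "\<sigma> \<in> {LL n s..LL (n + 1) s}" "\<sigma>' \<in> {LL n s'..LL (n + 1) s'}" for n s \<sigma> s' \<sigma>'
        by (rule layer_lipschitz_element(2)[OF that])
      show "(A n s (LL (n + 1) s) - \<theta> * (LL (n + 1) s)) = (A (n + 1) s (LL (n + 1) s) - \<theta> * (LL (n + 1) s))" if "0 \<le> s" "s \<le> 1" for n s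
        by (subst layer_agree(2)[OF that]) (rule refl)
    qed
    show ?thesis unfolding k using 1 2 by (rule conjI)
  qed
  show "\<bar>(P n' s' \<sigma>' - \<tau> * s') - (P n s \<sigma> - \<tau> * s)\<bar> \<le> \<tau> / 8 * (\<bar>s' - s\<bar> + \<bar>\<sigma>' - \<sigma>\<bar>)"
    "\<bar>(A n' s' \<sigma>' - \<theta> * \<sigma>') - (A n s \<sigma> - \<theta> * \<sigma>)\<bar> \<le> \<theta> / 8 * (\<bar>s' - s\<bar> + \<bar>\<sigma>' - \<sigma>\<bar>)"
    using main[OF _ s \<sigma>] main[OF _ s(2,1) \<sigma>(2,1)] by (cases "n \<le> n'"; simp add: abs_minus_commute)+
qed

text \<open>Along a fixed polar angle the radius is strictly increasing in \<open>s\<close>.\<close>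

lemma layer_radial_order:
  assumes s: "s \<in> {0..1}" "s' \<in> {0..1}" and \<sigma>: "\<sigma> \<in> {LL n s..LL (n + 1) s}" "\<sigma>' \<in> {LL n' s'..LL (n' + 1) s'}"
    and eq: "A n s \<sigma> = A n' s' \<sigma>'" and le: "s \<le> s'"
  shows "P n s \<sigma> \<le> P n' s' \<sigma>'" "s < s' \<Longrightarrow> P n s \<sigma> < P n' s' \<sigma>'" "s = s' \<Longrightarrow> \<sigma> = \<sigma>'"
proof -
  note l = layer_lipschitz[OF s \<sigma>]
  \<comment> \<open>Equal angles confine |\<sigma>' - \<sigma>| to a seventh of s' - s. The radial
    increment \<tau> (s' - s) then dominates its error.\<close>
  have "\<theta> * \<bar>\<sigma>' - \<sigma>\<bar> = \<bar>(A n' s' \<sigma>' - \<theta> * \<sigma>') - (A n s \<sigma> - \<theta> * \<sigma>)\<bar>"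
  proof -
    have "(A n' s' \<sigma>' - \<theta> * \<sigma>') - (A n s \<sigma> - \<theta> * \<sigma>) = - (\<theta> * (\<sigma>' - \<sigma>))" unfolding eq by (simp add: algebra_simps)
    then show ?thesis using pos by (simp only: abs_minus_cancel abs_mult abs_of_pos)
  qed
  also have "\<dots> \<le> \<theta> / 8 * (\<bar>s' - s\<bar> + \<bar>\<sigma>' - \<sigma>\<bar>)" by (rule l(2))
  also have "\<dots> = \<theta> * ((s' - s) / 8 + \<bar>\<sigma>' - \<sigma>\<bar> / 8)" using le by (simp add: field_simps)
  finally have a: "\<bar>\<sigma>' - \<sigma>\<bar> \<le> (s' - s) / 8 + \<bar>\<sigma>' - \<sigma>\<bar> / 8" using pos by simp
  have "\<bar>(P n' s' \<sigma>' - P n s \<sigma>) - \<tau> * (s' - s)\<bar> \<le> \<tau> / 8 * ((s' - s) + \<bar>\<sigma>' - \<sigma>\<bar>)"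
    using l(1) le by (simp add: algebra_simps)
  also have "\<dots> \<le> \<tau> / 8 * (2 * (s' - s))"
  proof (rule mult_left_mono)
    show "s' - s + \<bar>\<sigma>' - \<sigma>\<bar> \<le> 2 * (s' - s)" using a le by argo
  qed (use pos in simp)
  also have "\<dots> = \<tau> * (s' - s) / 4" by simp
  finally have b: "\<tau> * (s' - s) * (3 / 4) \<le> P n' s' \<sigma>' - P n s \<sigma>"
    unfolding abs_le_iff by argo
  have "0 \<le> \<tau> * (s' - s)" using pos le by simp
  with b show "P n s \<sigma> \<le> P n' s' \<sigma>'" by linarith
  show "P n s \<sigma> < P n' s' \<sigma>'" if "s < s'"
  proof -
    have "0 < \<tau> * (s' - s)" using pos that by simp
    with b show ?thesis by linarith
  qed
  show "\<sigma> = \<sigma>'" if "s = s'" using a that by simp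
qed

lemma layer_unique:
  assumes s: "s \<in> {0..1}" "s' \<in> {0..1}" and \<sigma>: "LL n s < \<sigma>" "\<sigma> < LL (n + 1) s" "\<sigma>' \<in> {LL n' s'..LL (n' + 1) s'}"
    and eq: "A n s \<sigma> = A n' s' \<sigma>'" "P n s \<sigma> = P n' s' \<sigma>'"
  shows "n' = n" "s' = s" "\<sigma>' = \<sigma>"
proof -
  have \<sigma>0: "\<sigma> \<in> {LL n s..LL (n + 1) s}" using \<sigma> by simp
  show ss: "s' = s"
  proof (cases s s' rule: linorder_cases)
    case less
    from layer_radial_order(2)[OF s \<sigma>0 \<sigma>(3) eq(1) less_imp_le[OF less] less] eq(2) show ?thesis by simp
  next
    case greater
    from layer_radial_order(2)[OF s(2,1) \<sigma>(3) \<sigma>0 eq(1)[symmetric] less_imp_le[OF greater] greater] eq(2) show ?thesis by simp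
  qed simp
  show \<sigma>\<sigma>: "\<sigma>' = \<sigma>" by (rule layer_radial_order(3)[OF s \<sigma>0 \<sigma>(3) eq(1), symmetric]) (simp_all only: ss order_refl)
  show "n' = n"
  proof (rule ccontr)
    assume "n' \<noteq> n"
    then consider "n + 1 \<le> n'" | "n' + 1 \<le> n" by linarith
    then show False
    proof cases
      case 1
      have "LL (n + 1) s \<le> LL n' s" using s 1 by (intro layer_line_mono_less) auto
      then show False using \<sigma> \<sigma>\<sigma> ss by simp
    next
      case 2
      have "LL (n' + 1) s \<le> LL n s" using s 2 by (intro layer_line_mono_less) auto
      then show False using \<sigma> \<sigma>\<sigma> ss by simp
    qed
  qed
qed

end

section \<open>Boundary arcs of the layers and uniqueness on the whole mesh\<close>

text \<open>The quadratic arc through three points of the circle of radius t at angles - \<theta>,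
  0, \<theta> is v |-> t (1 - (1 - cos \<theta>) v^2, sin \<theta> v) for |v| \<le> 1. The relation
  says that the chain of its copies centred at \<omega> + 2 \<theta> k passes through radius \<rho>
  at the lifted angle \<psi>. In this form the outer boundary of a layer and the inner boundary of
  the next one can be compared directly.\<close>

definition arc_rel :: "real \<Rightarrow> real \<Rightarrow> real \<Rightarrow> real \<Rightarrow> real \<Rightarrow> bool" where
  "arc_rel t \<theta> \<omega> \<psi> \<rho> \<longleftrightarrow> (\<exists>k::int. \<exists>v. \<bar>v\<bar> \<le> 1 \<and>
     \<psi> = \<omega> + 2 * \<theta> * real_of_int k + arctan (t * sin \<theta> * v / (t * (1 - (1 - cos \<theta>) * v\<^sup>2))) \<and>
     \<rho> = sqrt ((t * (1 - (1 - cos \<theta>) * v\<^sup>2))\<^sup>2 + (t * sin \<theta> * v)\<^sup>2))"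

lemma arc_rel_shift: "arc_rel t \<theta> (\<omega> + 2 * \<theta> * real_of_int j) \<psi> \<rho> \<longleftrightarrow> arc_rel t \<theta> \<omega> \<psi> \<rho>"
proof -
  have dir: "arc_rel t \<theta> \<omega> \<psi> \<rho>" if "arc_rel t \<theta> (\<omega> + 2 * \<theta> * real_of_int j) \<psi> \<rho>" for \<omega> j
  proof -
    from that obtain k :: int and v where *: "\<bar>v\<bar> \<le> 1"
      "\<psi> = \<omega> + 2 * \<theta> * real_of_int j + 2 * \<theta> * real_of_int k + arctan (t * sin \<theta> * v / (t * (1 - (1 - cos \<theta>) * v\<^sup>2)))"
      "\<rho> = sqrt ((t * (1 - (1 - cos \<theta>) * v\<^sup>2))\<^sup>2 + (t * sin \<theta> * v)\<^sup>2)"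
      unfolding arc_rel_def by blast
    have "\<omega> + 2 * \<theta> * real_of_int j + 2 * \<theta> * real_of_int k = \<omega> + 2 * \<theta> * real_of_int (j + k)" by (simp add: algebra_simps)
    with * show ?thesis unfolding arc_rel_def by metis
  qed
  have "arc_rel t \<theta> (\<omega> + 2 * \<theta> * real_of_int j) \<psi> \<rho>" if "arc_rel t \<theta> \<omega> \<psi> \<rho>"
  proof (rule dir[where j = "- j"])
    have "\<omega> + 2 * \<theta> * real_of_int j + 2 * \<theta> * real_of_int (- j) = \<omega>" by simp
    then show "arc_rel t \<theta> (\<omega> + 2 * \<theta> * real_of_int j + 2 * \<theta> * real_of_int (- j)) \<psi> \<rho>" using that by (simp only:)
  qed
  with dir show ?thesis by blast
qed

text \<open>Rounding selects an arc whose centre is within \<theta> of \<psi>. The cross product of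
  the arc point with the direction of the ray has opposite signs at the two ends of the arc, so the
  intermediate value theorem yields a point on the ray.\<close>

lemma arc_rel_total:
  assumes "0 < t" "0 < \<theta>" "\<theta> \<le> 1"
  obtains \<rho> where "arc_rel t \<theta> \<omega> \<psi> \<rho>"
proof -
  define k where "k = round ((\<psi> - \<omega>) / (2 * \<theta>))"
  define \<beta> where "\<beta> = \<psi> - \<omega> - 2 * \<theta> * real_of_int k"
  have "\<bar>real_of_int k - (\<psi> - \<omega>) / (2 * \<theta>)\<bar> \<le> 1 / 2" unfolding k_def by (rule of_int_round_abs_le)
  then have "\<bar>real_of_int k - (\<psi> - \<omega>) / (2 * \<theta>)\<bar> * (2 * \<theta>) \<le> 1 / 2 * (2 * \<theta>)" using assms by (intro mult_right_mono) auto
  moreover have "\<bar>real_of_int k - (\<psi> - \<omega>) / (2 * \<theta>)\<bar> * (2 * \<theta>) = \<bar>\<beta>\<bar>"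
  proof -
    have "\<beta> = - ((real_of_int k - (\<psi> - \<omega>) / (2 * \<theta>)) * (2 * \<theta>))" using assms by (simp add: \<beta>_def field_simps)
    then show ?thesis using assms by (simp only: abs_minus_cancel abs_mult)
  qed
  ultimately have \<beta>: "\<bar>\<beta>\<bar> \<le> \<theta>" by simp
  have pi: "2 * \<theta> < pi" using assms pi_gt3 by linarith
  have c: "0 < cos \<theta>" "cos \<theta> \<le> 1" using assms pi by (auto intro: cos_gt_zero)
  have cb: "0 < cos \<beta>" using \<beta> pi by (intro cos_gt_zero_pi) auto
  let ?X = "\<lambda>v. t * (1 - (1 - cos \<theta>) * v\<^sup>2)" and ?Y = "\<lambda>v. t * sin \<theta> * v"
  let ?h = "\<lambda>v. ?Y v * cos \<beta> - ?X v * sin \<beta>"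
  have "\<exists>v. -1 \<le> v \<and> v \<le> 1 \<and> ?h v = 0"
  proof (rule IVT')
    have "?h (-1) = - (t * sin (\<theta> + \<beta>))" by (simp add: sin_add algebra_simps)
    moreover have "0 \<le> sin (\<theta> + \<beta>)" using \<beta> pi assms by (intro sin_ge_zero) auto
    ultimately show "?h (-1) \<le> 0" using assms by simp
    have "?h 1 = t * sin (\<theta> - \<beta>)" by (simp add: sin_diff algebra_simps)
    moreover have "0 \<le> sin (\<theta> - \<beta>)" using \<beta> pi assms by (intro sin_ge_zero) auto
    ultimately show "0 \<le> ?h 1" using assms by simp
    show "continuous_on {-1..1} ?h" by (intro continuous_intros)
  qed simp
  then obtain v where v: "-1 \<le> v" "v \<le> 1" "?h v = 0" by blast
  have "v\<^sup>2 \<le> 1" using v by (simp add: abs_square_le_1)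
  then have "(1 - cos \<theta>) * v\<^sup>2 \<le> (1 - cos \<theta>) * 1" using c by (intro mult_left_mono) auto
  then have X: "0 < ?X v" using c assms by (intro mult_pos_pos) auto
  have "?Y v / ?X v = tan \<beta>" using v(3) X cb 
  proof -
    have "?Y v * cos \<beta> = sin \<beta> * ?X v" using v(3) by (simp add: mult.commute)
    moreover have "?X v \<noteq> 0" "cos \<beta> \<noteq> 0" using X[THEN less_imp_neq] cb[THEN less_imp_neq] by (blast intro: sym)+
    ultimately show ?thesis unfolding tan_def by (metis frac_eq_eq)
  qed
  then have "arctan (?Y v / ?X v) = \<beta>" using \<beta> pi by (simp only:) (intro arctan_tan; linarith)
  then have "\<psi> = \<omega> + 2 * \<theta> * real_of_int k + arctan (?Y v / ?X v)" by (simp only: \<beta>_def)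
  then have "arc_rel t \<theta> \<omega> \<psi> (sqrt ((?X v)\<^sup>2 + (?Y v)\<^sup>2))"
    unfolding arc_rel_def using v by (intro exI[of _ k] exI[of _ v]) auto
  then show ?thesis by (rule that)
qed

lemma layer_arcs:
  fixes t0 \<tau> \<theta> v :: real
  defines "q \<equiv> \<lambda>s. t0 + \<tau> * s"
  shows "interp (polar_x q \<theta>) elem_A (strip_a elem_A 1 v) (strip_b elem_A 1 v) = (t0 + \<tau>) * (1 - (1 - cos \<theta>) * v\<^sup>2)"
    "interp (polar_y q \<theta>) elem_A (strip_a elem_A 1 v) (strip_b elem_A 1 v) = (t0 + \<tau>) * sin \<theta> * v"
    "interp (polar_x q \<theta>) elem_B (strip_a elem_B 0 v) (strip_b elem_B 0 v) = t0 * (1 - (1 - cos \<theta>) * v\<^sup>2)"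
    "interp (polar_y q \<theta>) elem_B (strip_a elem_B 0 v) (strip_b elem_B 0 v) = t0 * sin \<theta> * v"
    "interp (polar_x q \<theta>) elem_C (strip_a elem_C 0 (v / 2)) (strip_b elem_C 0 (v / 2)) = t0 * (1 - (1 - cos (\<theta> / 2)) * v\<^sup>2)"
    "interp (polar_y q \<theta>) elem_C (strip_a elem_C 0 (v / 2)) (strip_b elem_C 0 (v / 2)) = t0 * sin (\<theta> / 2) * v"
    "interp (polar_x q \<theta>) elem_D (strip_a elem_D 0 (v / 2)) (strip_b elem_D 0 (v / 2)) = t0 * (1 - (1 - cos (\<theta> / 2)) * v\<^sup>2)"
    "interp (polar_y q \<theta>) elem_D (strip_a elem_D 0 (v / 2)) (strip_b elem_D 0 (v / 2)) = t0 * sin (\<theta> / 2) * v"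
  unfolding interp_def strip_a_def strip_b_def polar_x_def polar_y_def q_def
  by (simp_all add: elem_defs field_simps power2_eq_square)

lemma layer_outer_arc:
  assumes "arc_rel (t0 + \<tau>) \<theta> \<omega> \<psi> \<rho>"
  obtains n \<sigma> where "\<sigma> \<in> {layer_line cf n 1..layer_line cf (n + 1) 1}" "layer_\<phi> cf t0 \<tau> \<theta> \<omega> n 1 \<sigma> = \<psi>" "layer_\<rho> cf t0 \<tau> \<theta> n 1 \<sigma> = \<rho>"
proof -
  obtain k v where kv: "\<bar>v\<bar> \<le> 1"
     "\<psi> = \<omega> + 2 * \<theta> * real_of_int k + arctan ((t0 + \<tau>) * sin \<theta> * v / ((t0 + \<tau>) * (1 - (1 - cos \<theta>) * v\<^sup>2)))"
     "\<rho> = sqrt (((t0 + \<tau>) * (1 - (1 - cos \<theta>) * v\<^sup>2))\<^sup>2 + ((t0 + \<tau>) * sin \<theta> * v)\<^sup>2)"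
    using assms unfolding arc_rel_def by blast
  define n where "n = (if cf then 3 * k else 2 * k)"
  have n: "layer_elem cf n = elem_A" "layer_center cf n = 2 * real_of_int k"
    by (cases cf; simp add: n_def)+
  have "2 * real_of_int k + v \<in> {layer_line cf n 1..layer_line cf (n + 1) 1}"
    unfolding layer_adjacent(1)[symmetric] unfolding layer_line_def n using kv(1) by (simp add: strip_l_def strip_r_def abs_le_iff)
  moreover have "layer_\<phi> cf t0 \<tau> \<theta> \<omega> n 1 (2 * real_of_int k + v) = \<psi>" "layer_\<rho> cf t0 \<tau> \<theta> n 1 (2 * real_of_int k + v) = \<rho>"
    unfolding layer_\<phi>_def layer_\<rho>_def n lift_\<rho>_def lift_\<phi>_def add_diff_cancel_left' layer_arcs kv by simp_all
  ultimately show ?thesis by (rule that)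
qed

text \<open>In a standard layer the inner arcs are the bases of the B elements. In a conforming
  layer the bases of D and C alternate, with half the opening, which explains the split by parity of
  the arc number.\<close>

lemma layer_inner_arc:
  assumes "arc_rel t0 (if cf then \<theta> / 2 else \<theta>) (\<omega> + (if cf then \<theta> / 2 else \<theta>)) \<psi> \<rho>"
  obtains n \<sigma> where "\<sigma> \<in> {layer_line cf n 0..layer_line cf (n + 1) 0}" "layer_\<phi> cf t0 \<tau> \<theta> \<omega> n 0 \<sigma> = \<psi>" "layer_\<rho> cf t0 \<tau> \<theta> n 0 \<sigma> = \<rho>"
proof (cases cf)
  case False
  obtain k v where kv: "\<bar>v\<bar> \<le> 1"
     "\<psi> = \<omega> + \<theta> + 2 * \<theta> * real_of_int k + arctan (t0 * sin \<theta> * v / (t0 * (1 - (1 - cos \<theta>) * v\<^sup>2)))"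
     "\<rho> = sqrt ((t0 * (1 - (1 - cos \<theta>) * v\<^sup>2))\<^sup>2 + (t0 * sin \<theta> * v)\<^sup>2)"
    using assms False unfolding arc_rel_def by auto
  define n where "n = 2 * k + 1"
  have n: "layer_elem cf n = elem_B" "layer_center cf n = 2 * real_of_int k + 1"
    using False by (simp_all add: n_def)
  have "2 * real_of_int k + 1 + v \<in> {layer_line cf n 0..layer_line cf (n + 1) 0}"
    unfolding layer_adjacent(1)[symmetric] unfolding layer_line_def n using kv(1) by (simp add: strip_l_def strip_r_def abs_le_iff)
  moreover have "layer_\<phi> cf t0 \<tau> \<theta> \<omega> n 0 (2 * real_of_int k + 1 + v) = \<psi>" "layer_\<rho> cf t0 \<tau> \<theta> n 0 (2 * real_of_int k + 1 + v) = \<rho>"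
    unfolding layer_\<phi>_def layer_\<rho>_def n lift_\<rho>_def lift_\<phi>_def add_diff_cancel_left' layer_arcs kv by (simp_all add: algebra_simps)
  ultimately show ?thesis by (rule that)
next
  case True
  obtain k v where kv: "\<bar>v\<bar> \<le> 1"
     "\<psi> = \<omega> + \<theta> / 2 + \<theta> * real_of_int k + arctan (t0 * sin (\<theta> / 2) * v / (t0 * (1 - (1 - cos (\<theta> / 2)) * v\<^sup>2)))"
     "\<rho> = sqrt ((t0 * (1 - (1 - cos (\<theta> / 2)) * v\<^sup>2))\<^sup>2 + (t0 * sin (\<theta> / 2) * v)\<^sup>2)"
    using assms True unfolding arc_rel_def by auto
  show ?thesis
  proof (cases "even k")
    case ev: True
    then obtain j where j: "k = 2 * j" by (rule evenE)
    define n where "n = 3 * j + 1"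
    have n: "layer_elem cf n = elem_D" "layer_center cf n = 2 * real_of_int j + 1 / 2"
      unfolding n_def using True by (simp_all only: layer_conf)
    have "2 * real_of_int j + 1 / 2 + v / 2 \<in> {layer_line cf n 0..layer_line cf (n + 1) 0}"
      unfolding layer_adjacent(1)[symmetric] unfolding layer_line_def n using kv(1) by (simp add: strip_l_def strip_r_def abs_le_iff)
    moreover have "layer_\<phi> cf t0 \<tau> \<theta> \<omega> n 0 (2 * real_of_int j + 1 / 2 + v / 2) = \<psi>" "layer_\<rho> cf t0 \<tau> \<theta> n 0 (2 * real_of_int j + 1 / 2 + v / 2) = \<rho>"
      unfolding layer_\<phi>_def layer_\<rho>_def n lift_\<rho>_def lift_\<phi>_def add_diff_cancel_left' layer_arcs kv j by (simp_all add: algebra_simps)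
    ultimately show ?thesis by (rule that)
  next
    case False
    then obtain j where j: "k = 2 * j + 1" by (rule oddE)
    define n where "n = 3 * j + 2"
    have n: "layer_elem cf n = elem_C" "layer_center cf n = 2 * real_of_int j + 3 / 2"
      unfolding n_def using True by (simp_all only: layer_conf)
    have "2 * real_of_int j + 3 / 2 + v / 2 \<in> {layer_line cf n 0..layer_line cf (n + 1) 0}"
      unfolding layer_adjacent(1)[symmetric] unfolding layer_line_def n using kv(1) by (simp add: strip_l_def strip_r_def abs_le_iff)
    moreover have "layer_\<phi> cf t0 \<tau> \<theta> \<omega> n 0 (2 * real_of_int j + 3 / 2 + v / 2) = \<psi>" "layer_\<rho> cf t0 \<tau> \<theta> n 0 (2 * real_of_int j + 3 / 2 + v / 2) = \<rho>"
      unfolding layer_\<phi>_def layer_\<rho>_def n lift_\<rho>_def lift_\<phi>_def add_diff_cancel_left' layer_arcs kv j by (simp_all add: algebra_simps)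
    ultimately show ?thesis by (rule that)
  qed
qed

lemma polar_periodic: "polar t (\<alpha> + 2 * pi * real_of_int k) = polar t \<alpha>"
proof -
  have "cos (\<alpha> + 2 * pi * real_of_int k) = cos \<alpha>" "sin (\<alpha> + 2 * pi * real_of_int k) = sin \<alpha>"
    using sin_cos_eq_iff[of "\<alpha> + 2 * pi * real_of_int k" \<alpha>] by (auto simp: mult_ac)
  then show ?thesis by (simp add: polar_def)
qed

text \<open>\<open>N\<close> periods of the numbering are one revolution. This renumbering absorbs
  the ambiguity of the polar angle.\<close>

lemma layer_revolution:
  fixes cf :: bool and k :: int and N :: nat
  assumes "0 < N" and \<theta>: "\<theta> = pi / real N"
  defines "d \<equiv> layer_period cf * (int N * k)"
  shows "mesh_elem cf t0 \<tau> \<theta> \<omega> (n + d) = mesh_elem cf t0 \<tau> \<theta> \<omega> n"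
    "layer_\<rho> cf t0 \<tau> \<theta> (n + d) s (\<sigma> + 2 * real_of_int (int N * k)) = layer_\<rho> cf t0 \<tau> \<theta> n s \<sigma>"
    "layer_\<phi> cf t0 \<tau> \<theta> \<omega> (n + d) s (\<sigma> + 2 * real_of_int (int N * k)) = layer_\<phi> cf t0 \<tau> \<theta> \<omega> n s \<sigma> + 2 * pi * real_of_int k"
    "layer_line cf (n + d) s = layer_line cf n s + 2 * real_of_int (int N * k)"
proof -
  have e: "layer_elem cf (n + d) = layer_elem cf n" and c: "layer_center cf (n + d) = layer_center cf n + 2 * real_of_int (int N * k)"
    unfolding d_def by (simp_all only: layer_shift)
  have \<theta>c: "\<theta> * (x + 2 * real_of_int (int N * k)) = \<theta> * x + 2 * pi * real_of_int k" for x
    using assms by (simp add: field_simps)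
  have "polar t (\<omega> + (\<theta> * x + 2 * pi * real_of_int k) + y) = polar t (\<omega> + \<theta> * x + y)" for t x y
    using polar_periodic[of t "\<omega> + \<theta> * x + y" k] by (simp add: ac_simps)
  then show "mesh_elem cf t0 \<tau> \<theta> \<omega> (n + d) = mesh_elem cf t0 \<tau> \<theta> \<omega> n"
    by (simp only: mesh_elem_def e c \<theta>c strip_elem_def)
  have r: "\<sigma> + 2 * real_of_int (int N * k) - (layer_center cf n + 2 * real_of_int (int N * k)) = \<sigma> - layer_center cf n" by simp
  show "layer_\<rho> cf t0 \<tau> \<theta> (n + d) s (\<sigma> + 2 * real_of_int (int N * k)) = layer_\<rho> cf t0 \<tau> \<theta> n s \<sigma>"
    by (simp only: layer_\<rho>_def e c r)
  show "layer_\<phi> cf t0 \<tau> \<theta> \<omega> (n + d) s (\<sigma> + 2 * real_of_int (int N * k)) = layer_\<phi> cf t0 \<tau> \<theta> \<omega> n s \<sigma> + 2 * pi * real_of_int k"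
    by (simp only: layer_\<phi>_def e c r \<theta>c)
  show "layer_line cf (n + d) s = layer_line cf n s + 2 * real_of_int (int N * k)"
    by (simp only: layer_line_def e c)
qed

lemma interior_ref_triangle:
  assumes "\<xi> \<in> interior ref_triangle"
  shows "0 < \<xi> $ 1" "0 < \<xi> $ 2" "\<xi> $ 1 + \<xi> $ 2 < 1"
proof -
  obtain e where e: "0 < e" "ball \<xi> e \<subseteq> ref_triangle" using assms by (auto simp: mem_interior)
  have "\<xi> + d *\<^sub>R axis i 1 \<in> ref_triangle" if "\<bar>d\<bar> < e" for i :: 2 and d
  proof -
    have "norm (axis i 1 :: real ^ 2) = 1" by (rule norm_Basis) simp
    then have "\<xi> + d *\<^sub>R axis i 1 \<in> ball \<xi> e" using that by (simp add: dist_norm)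
    then show ?thesis using e(2) by blast
  qed
  from this[of "- e / 2" 1] this[of "- e / 2" 2] this[of "e / 2" 1]
  show "0 < \<xi> $ 1" "0 < \<xi> $ 2" "\<xi> $ 1 + \<xi> $ 2 < 1"
    using e(1) by (auto simp: ref_triangle_def axis_def)
qed

lemma mesh_elem_coords:
  fixes cf :: bool and n :: int
  assumes fine: "fine_element \<kappa> t0 \<tau> \<theta>" "\<kappa> \<le> 1 / 30000" and \<xi>: "\<xi> \<in> ref_triangle"
  defines "s \<equiv> interp fst (layer_elem cf n) (\<xi> $ 1) (\<xi> $ 2)" and "\<sigma> \<equiv> layer_center cf n + interp snd (layer_elem cf n) (\<xi> $ 1) (\<xi> $ 2)"
  shows "s \<in> {0..1}" "\<sigma> \<in> {layer_line cf n s..layer_line cf (n + 1) s}"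
    "quad_map (mesh_elem cf t0 \<tau> \<theta> \<omega> n) \<xi> = polar (layer_\<rho> cf t0 \<tau> \<theta> n s \<sigma>) (layer_\<phi> cf t0 \<tau> \<theta> \<omega> n s \<sigma>)"
    "0 < layer_\<rho> cf t0 \<tau> \<theta> n s \<sigma>"
    "\<xi> = vector [strip_a (layer_elem cf n) s (\<sigma> - layer_center cf n), strip_b (layer_elem cf n) s (\<sigma> - layer_center cf n)]"
    "\<xi> \<in> interior ref_triangle \<Longrightarrow> 0 < s \<and> s < 1 \<and> layer_line cf n s < \<sigma> \<and> \<sigma> < layer_line cf (n + 1) s"
proof -
  have ab: "0 \<le> \<xi> $ 1" "0 \<le> \<xi> $ 2" "\<xi> $ 1 + \<xi> $ 2 \<le> 1" using \<xi> by (auto simp: ref_triangle_def)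
  note c = strip_coords[OF layer_elem_elems ab, of cf n, folded s_def]
  have \<sigma>: "\<sigma> - layer_center cf n = interp snd (layer_elem cf n) (\<xi> $ 1) (\<xi> $ 2)" by (simp add: \<sigma>_def)
  show s: "s \<in> {0..1}" using interp_range[OF layer_elem_elems ab] by (simp add: s_def)
  show \<sigma>2: "\<sigma> \<in> {layer_line cf n s..layer_line cf (n + 1) s}"
    unfolding layer_adjacent(1)[symmetric] unfolding layer_line_def \<sigma>_def using c(1,2) by simp
  show x: "\<xi> = vector [strip_a (layer_elem cf n) s (\<sigma> - layer_center cf n), strip_b (layer_elem cf n) s (\<sigma> - layer_center cf n)]"
    unfolding \<sigma> c(3,4) by (simp add: vec_eq_iff forall_2)
  show "quad_map (mesh_elem cf t0 \<tau> \<theta> \<omega> n) \<xi> = polar (layer_\<rho> cf t0 \<tau> \<theta> n s \<sigma>) (layer_\<phi> cf t0 \<tau> \<theta> \<omega> n s \<sigma>)"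
    by (subst x) (rule mesh_elem_polar(1)[OF fine s \<sigma>2])
  show "0 < layer_\<rho> cf t0 \<tau> \<theta> n s \<sigma>" by (rule mesh_elem_polar(2)[OF fine s \<sigma>2])
  show "0 < s \<and> s < 1 \<and> layer_line cf n s < \<sigma> \<and> \<sigma> < layer_line cf (n + 1) s" if "\<xi> \<in> interior ref_triangle"
    unfolding layer_adjacent(1)[symmetric] unfolding layer_line_def \<sigma>_def using c(5) interior_ref_triangle[OF that] by simp
qed

context
  fixes m :: nat and \<epsilon> \<tau> \<omega> :: "nat \<Rightarrow> real" and N :: "nat \<Rightarrow> nat" and \<kappa> :: real
    and \<theta> :: "nat \<Rightarrow> real" and cf :: "nat \<Rightarrow> bool" and T :: "nat \<Rightarrow> int \<Rightarrow> (real ^ 2) element"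
  assumes \<theta>: "\<And>i. \<theta> i = pi / real (N i)" and cf: "\<And>i. cf i \<longleftrightarrow> 0 < i \<and> N (i - 1) = 2 * N i"
    and T: "\<And>i n. T i n = mesh_elem (cf i) (\<epsilon> i) (\<tau> i) (\<theta> i) (\<omega> i) n"
    and N0: "\<And>i. i \<le> m \<Longrightarrow> 0 < N i"
    and fine: "\<And>i. i \<le> m \<Longrightarrow> fine_element \<kappa> (\<epsilon> i) (\<tau> i) (\<theta> i)" and \<kappa>: "\<kappa> \<le> 1 / 30000"
    and next_layer: "\<And>i. i < m \<Longrightarrow> \<epsilon> (Suc i) = \<epsilon> i + \<tau> i"
    and halve: "\<And>i. i < m \<Longrightarrow> N i = N (Suc i) \<or> N i = 2 * N (Suc i)"
    and matching: "\<And>i. i < m \<Longrightarrow> \<exists>j::int. \<omega> (Suc i) = \<omega> i + \<theta> i * (2 * real_of_int j + 1)"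
begin

definition inner_angle :: "nat \<Rightarrow> real" where "inner_angle i = (if cf i then \<theta> i / 2 else \<theta> i)"

text \<open>The radius at which the ray with lifted angle \<psi> meets the inner boundary curve of
  layer i. For i > 0 this curve is also the outer boundary of the layer before.\<close>

definition circle_radius :: "nat \<Rightarrow> real \<Rightarrow> real" where
  "circle_radius i \<psi> = (SOME \<rho>. arc_rel (\<epsilon> i) (inner_angle i) (\<omega> i + inner_angle i) \<psi> \<rho>)"

lemma mesh_pos: "i \<le> m \<Longrightarrow> 0 < \<epsilon> i \<and> 0 < \<tau> i \<and> 0 < \<theta> i \<and> \<theta> i \<le> 1"
  using pos[OF fine \<kappa>] by blast

lemma circle_radius_inner:
  assumes "i \<le> m"
  shows "arc_rel (\<epsilon> i) (inner_angle i) (\<omega> i + inner_angle i) \<psi> (circle_radius i \<psi>)"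
  unfolding circle_radius_def
  by (rule someI_ex) (rule arc_rel_total[of "\<epsilon> i" "inner_angle i" "\<omega> i + inner_angle i" \<psi>],
      use mesh_pos[OF assms] in \<open>auto simp: inner_angle_def\<close>)

text \<open>If N is halved, layer i + 1 is conforming and its inner arcs have half-angle \<theta> (i
  + 1) / 2 = \<theta> i; otherwise \<theta> is unchanged. In both cases the matching of vertices
  shifts the chain of arcs by a multiple of its period, which leaves \<open>arc_rel\<close>
  unchanged.\<close>

lemma circle_radius_outer:
  assumes "i < m"
  shows "arc_rel (\<epsilon> i + \<tau> i) (\<theta> i) (\<omega> i) \<psi> (circle_radius (Suc i) \<psi>)"
proof -
  have a: "inner_angle (Suc i) = \<theta> i"
    using halve[OF assms] N0[of i] N0[of "Suc i"] assms by (auto simp: inner_angle_def cf \<theta>)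
  obtain j :: int where j: "\<omega> (Suc i) = \<omega> i + \<theta> i * (2 * real_of_int j + 1)" using matching[OF assms] by blast
  have e: "\<omega> (Suc i) + \<theta> i = \<omega> i + 2 * \<theta> i * real_of_int (j + 1)" unfolding j by (simp add: algebra_simps)
  show ?thesis
    using circle_radius_inner[of "Suc i" \<psi>] assms unfolding a e arc_rel_shift next_layer[OF assms] by simp
qed

text \<open>The point is compared, by \<open>layer_radial_order\<close>, with the points of the
  inner arc (s = 0) and of the outer arc (s = 1) at the same lifted angle.\<close>

lemma layer_between:
  assumes i: "i \<le> m" and s: "s \<in> {0..1}" and \<sigma>: "\<sigma> \<in> {layer_line (cf i) n s..layer_line (cf i) (n + 1) s}"
    and \<psi>: "layer_\<phi> (cf i) (\<epsilon> i) (\<tau> i) (\<theta> i) (\<omega> i) n s \<sigma> = \<psi>"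
  defines "\<rho> \<equiv> layer_\<rho> (cf i) (\<epsilon> i) (\<tau> i) (\<theta> i) n s \<sigma>"
  shows "circle_radius i \<psi> \<le> \<rho>" "0 < s \<Longrightarrow> circle_radius i \<psi> < \<rho>"
    "i < m \<Longrightarrow> \<rho> \<le> circle_radius (Suc i) \<psi>" "i < m \<Longrightarrow> s < 1 \<Longrightarrow> \<rho> < circle_radius (Suc i) \<psi>"
proof -
  obtain n0 \<sigma>0 where 0: "\<sigma>0 \<in> {layer_line (cf i) n0 0..layer_line (cf i) (n0 + 1) 0}"
    "layer_\<phi> (cf i) (\<epsilon> i) (\<tau> i) (\<theta> i) (\<omega> i) n0 0 \<sigma>0 = \<psi>" "layer_\<rho> (cf i) (\<epsilon> i) (\<tau> i) (\<theta> i) n0 0 \<sigma>0 = circle_radius i \<psi>"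
    using layer_inner_arc[OF circle_radius_inner[OF i, unfolded inner_angle_def]] by metis
  have z: "(0::real) \<in> {0..1}" "(1::real) \<in> {0..1}" by auto
  have s01: "0 \<le> s" "s \<le> 1" using s by auto
  note o = layer_radial_order[OF fine[OF i] \<kappa> z(1) s 0(1) \<sigma> trans[OF 0(2) \<psi>[symmetric]] s01(1), unfolded 0(3)]
  show "circle_radius i \<psi> \<le> \<rho>" "0 < s \<Longrightarrow> circle_radius i \<psi> < \<rho>" unfolding \<rho>_def using o(1,2) by auto
  show "\<rho> \<le> circle_radius (Suc i) \<psi>" "s < 1 \<Longrightarrow> \<rho> < circle_radius (Suc i) \<psi>" if im: "i < m"
  proof -
    obtain n1 \<sigma>1 where 1: "\<sigma>1 \<in> {layer_line (cf i) n1 1..layer_line (cf i) (n1 + 1) 1}"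
      "layer_\<phi> (cf i) (\<epsilon> i) (\<tau> i) (\<theta> i) (\<omega> i) n1 1 \<sigma>1 = \<psi>" "layer_\<rho> (cf i) (\<epsilon> i) (\<tau> i) (\<theta> i) n1 1 \<sigma>1 = circle_radius (Suc i) \<psi>"
      using layer_outer_arc[OF circle_radius_outer[OF im], of "cf i"] by metis
    note o = layer_radial_order[OF fine[OF i] \<kappa> s z(2) \<sigma> 1(1) trans[OF \<psi> 1(2)[symmetric]] s01(2), unfolded 1(3)]
    show "\<rho> \<le> circle_radius (Suc i) \<psi>" "s < 1 \<Longrightarrow> \<rho> < circle_radius (Suc i) \<psi>" unfolding \<rho>_def using o(1,2) by auto
  qed
qed

lemma circle_radius_mono:
  assumes "i \<le> j" "j \<le> m"
  shows "circle_radius i \<psi> \<le> circle_radius j \<psi>"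
  using assms
proof (induction j rule: dec_induct)
  case (step j)
  obtain n0 \<sigma>0 where 0: "\<sigma>0 \<in> {layer_line (cf j) n0 0..layer_line (cf j) (n0 + 1) 0}"
    "layer_\<phi> (cf j) (\<epsilon> j) (\<tau> j) (\<theta> j) (\<omega> j) n0 0 \<sigma>0 = \<psi>" "layer_\<rho> (cf j) (\<epsilon> j) (\<tau> j) (\<theta> j) n0 0 \<sigma>0 = circle_radius j \<psi>"
    using layer_inner_arc[OF circle_radius_inner[of j \<psi>, unfolded inner_angle_def]] step by (metis Suc_leD)
  have "circle_radius j \<psi> \<le> circle_radius (Suc j) \<psi>"
    using layer_between(3)[OF _ _ 0(1,2)] 0(3) step by auto
  then show ?case using step by simp
qed simp

text \<open>Equal points have equal radii, and angles that agree up to full turns. In different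
  layers a boundary curve would separate the points strictly, since an interior point has 0 < s < 1;
  in the same layer \<open>layer_unique\<close> decides.\<close>

theorem mesh_unique:
  assumes ij: "i \<le> m" "j \<le> m" and \<xi>: "\<xi> \<in> interior ref_triangle" "\<xi>' \<in> ref_triangle"
    and eq: "quad_map (T i n) \<xi> = quad_map (T j n') \<xi>'"
  shows "j = i" "\<xi>' = \<xi>" "T j n' = T i n" "\<exists>k. n = n' + layer_period (cf i) * (int (N i) * k)"
proof -
  have \<xi>0: "\<xi> \<in> ref_triangle" using \<xi> interior_subset by blast
  define s where "s = interp fst (layer_elem (cf i) n) (\<xi> $ 1) (\<xi> $ 2)"
  define \<sigma> where "\<sigma> = layer_center (cf i) n + interp snd (layer_elem (cf i) n) (\<xi> $ 1) (\<xi> $ 2)"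
  note c = mesh_elem_coords[OF fine[OF ij(1)] \<kappa> \<xi>0, where cf = "cf i" and n = n, folded s_def \<sigma>_def]
  note c6 = c(6)[OF \<xi>(1)]
  define s' where "s' = interp fst (layer_elem (cf j) n') (\<xi>' $ 1) (\<xi>' $ 2)"
  define \<sigma>' where "\<sigma>' = layer_center (cf j) n' + interp snd (layer_elem (cf j) n') (\<xi>' $ 1) (\<xi>' $ 2)"
  note c' = mesh_elem_coords[OF fine[OF ij(2)] \<kappa> \<xi>(2), where cf = "cf j" and n = n', folded s'_def \<sigma>'_def]
  have p: "polar (layer_\<rho> (cf i) (\<epsilon> i) (\<tau> i) (\<theta> i) n s \<sigma>) (layer_\<phi> (cf i) (\<epsilon> i) (\<tau> i) (\<theta> i) (\<omega> i) n s \<sigma>) =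
    polar (layer_\<rho> (cf j) (\<epsilon> j) (\<tau> j) (\<theta> j) n' s' \<sigma>') (layer_\<phi> (cf j) (\<epsilon> j) (\<tau> j) (\<theta> j) (\<omega> j) n' s' \<sigma>')"
    using eq unfolding T c(3) c'(3) .
  obtain k :: int where k: "layer_\<phi> (cf i) (\<epsilon> i) (\<tau> i) (\<theta> i) (\<omega> i) n s \<sigma> = layer_\<phi> (cf j) (\<epsilon> j) (\<tau> j) (\<theta> j) (\<omega> j) n' s' \<sigma>' + 2 * pi * real_of_int k"
    using polar_inj(2)[OF c(4) c'(4) p] by blast
  note \<rho>\<rho> = polar_inj(1)[OF c(4) c'(4) p]
  \<comment> \<open>Renumbering the second element by k revolutions makes the two lifted angles
    equal.\<close>
  define d where "d = layer_period (cf j) * (int (N j) * k)"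
  define \<sigma>'' where "\<sigma>'' = \<sigma>' + 2 * real_of_int (int (N j) * k)"
  note rev = layer_revolution[where cf = "cf j" and k = k, OF N0[OF ij(2)] \<theta>, folded d_def]
  have \<phi>'': "layer_\<phi> (cf i) (\<epsilon> i) (\<tau> i) (\<theta> i) (\<omega> i) n s \<sigma> = layer_\<phi> (cf j) (\<epsilon> j) (\<tau> j) (\<theta> j) (\<omega> j) (n' + d) s' \<sigma>''"
    unfolding k \<sigma>''_def rev ..
  have \<rho>'': "layer_\<rho> (cf i) (\<epsilon> i) (\<tau> i) (\<theta> i) n s \<sigma> = layer_\<rho> (cf j) (\<epsilon> j) (\<tau> j) (\<theta> j) (n' + d) s' \<sigma>''"
    unfolding \<rho>\<rho> \<sigma>''_def rev ..
  have "n' + d + 1 = (n' + 1) + d" by simp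
  then have line: "\<sigma>'' \<in> {layer_line (cf j) (n' + d) s'..layer_line (cf j) (n' + d + 1) s'}"
    using c'(2) unfolding \<sigma>''_def by (simp only: rev) simp
  note b = layer_between[OF ij(1) c(1,2) refl] and b' = layer_between[OF ij(2) c'(1) line refl, folded \<phi>'' \<rho>'']
  show ji: "j = i"
  proof (cases i j rule: linorder_cases)
    case less
    then have "i < m" using ij by simp
    have "layer_\<rho> (cf i) (\<epsilon> i) (\<tau> i) (\<theta> i) n s \<sigma> < circle_radius (Suc i) (layer_\<phi> (cf i) (\<epsilon> i) (\<tau> i) (\<theta> i) (\<omega> i) n s \<sigma>)"
      using b(4)[OF \<open>i < m\<close>] c6 by simp
    also have "\<dots> \<le> circle_radius j (layer_\<phi> (cf i) (\<epsilon> i) (\<tau> i) (\<theta> i) (\<omega> i) n s \<sigma>)"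
      using less ij by (intro circle_radius_mono) auto
    also have "\<dots> \<le> layer_\<rho> (cf i) (\<epsilon> i) (\<tau> i) (\<theta> i) n s \<sigma>" by (rule b'(1))
    finally show ?thesis by simp
  next
    case greater
    then have "j < m" using ij by simp
    have "layer_\<rho> (cf i) (\<epsilon> i) (\<tau> i) (\<theta> i) n s \<sigma> \<le> circle_radius (Suc j) (layer_\<phi> (cf i) (\<epsilon> i) (\<tau> i) (\<theta> i) (\<omega> i) n s \<sigma>)"
      by (rule b'(3)[OF \<open>j < m\<close>])
    also have "\<dots> \<le> circle_radius i (layer_\<phi> (cf i) (\<epsilon> i) (\<tau> i) (\<theta> i) (\<omega> i) n s \<sigma>)"
      using greater ij by (intro circle_radius_mono) auto
    also have "\<dots> < layer_\<rho> (cf i) (\<epsilon> i) (\<tau> i) (\<theta> i) n s \<sigma>" using b(2) c6 by simp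
    finally show ?thesis by simp
  qed simp
  note u = layer_unique[OF fine[OF ij(1)] \<kappa> c(1) c'(1) conjunct1[OF conjunct2[OF conjunct2[OF c6]]] conjunct2[OF conjunct2[OF conjunct2[OF c6]]]
      line[unfolded ji] \<phi>''[unfolded ji] \<rho>''[unfolded ji]]
  show tt: "T j n' = T i n" using rev(1)[of "\<epsilon> j" "\<tau> j" "\<omega> j" n'] u(1) unfolding T ji by simp
  show "\<exists>k. n = n' + layer_period (cf i) * (int (N i) * k)" using u(1) unfolding d_def ji by (intro exI[of _ k]) simp
  have e: "layer_elem (cf j) n' = layer_elem (cf i) n" and ce: "layer_center (cf i) n = layer_center (cf j) n' + 2 * real_of_int (int (N j) * k)"
  proof -
    have n: "n' + layer_period (cf j) * (int (N j) * k) = n" using u(1) unfolding d_def ji .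
    show "layer_elem (cf j) n' = layer_elem (cf i) n"
      using layer_shift(1)[of "cf j" n' "int (N j) * k"] unfolding n unfolding ji by (rule sym)
    show "layer_center (cf i) n = layer_center (cf j) n' + 2 * real_of_int (int (N j) * k)"
      using layer_shift(2)[of "cf j" n' "int (N j) * k"] unfolding n unfolding ji by simp
  qed
  have "\<sigma>' - layer_center (cf j) n' = \<sigma> - layer_center (cf i) n" using u(3) ce unfolding \<sigma>''_def by linarith
  then show "\<xi>' = \<xi>" by (subst c(5), subst c'(5)) (simp only: e u(2))
qed

end

section \<open>Layers as one period of the integer numbering\<close>

lemma period_intervals:
  "{0..<2 * int N} = (\<Union>j<N. {2 * int j, 2 * int j + 1})"
  "{0..<3 * int N} = (\<Union>j<N. {3 * int j, 3 * int j + 1, 3 * int j + 2})"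
proof -
  have *: "\<exists>j<N. d * int j \<le> x \<and> x < d * int j + d" if "0 \<le> x" "x < d * int N" "0 < d" for x d :: int
  proof (intro exI conjI)
    have q: "x = d * (x div d) + x mod d" "0 \<le> x mod d" "x mod d < d" using that by simp_all
    have "x div d < int N"
    proof (rule ccontr)
      assume "\<not> x div d < int N"
      then have "d * int N \<le> d * (x div d)" using that by simp
      then show False using q that by linarith
    qed
    moreover have n: "int (nat (x div d)) = x div d" using that by (simp add: pos_imp_zdiv_nonneg_iff)
    ultimately show "nat (x div d) < N" by linarith
    show "d * int (nat (x div d)) \<le> x" "x < d * int (nat (x div d)) + d" unfolding n using q by linarith+
  qed
  show "{0..<2 * int N} = (\<Union>j<N. {2 * int j, 2 * int j + 1})"
  proof (intro equalityI subsetI)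
    fix x assume "x \<in> {0..<2 * int N}"
    then obtain j where j: "j < N" "2 * int j \<le> x" "x < 2 * int j + 2" using *[of x 2] by auto
    then have "x = 2 * int j \<or> x = 2 * int j + 1" by linarith
    then show "x \<in> (\<Union>j<N. {2 * int j, 2 * int j + 1})" using j by blast
  qed auto
  show "{0..<3 * int N} = (\<Union>j<N. {3 * int j, 3 * int j + 1, 3 * int j + 2})"
  proof (intro equalityI subsetI)
    fix x assume "x \<in> {0..<3 * int N}"
    then obtain j where j: "j < N" "3 * int j \<le> x" "x < 3 * int j + 3" using *[of x 3] by auto
    then have "x = 3 * int j \<or> x = 3 * int j + 1 \<or> x = 3 * int j + 2" by linarith
    then show "x \<in> (\<Union>j<N. {3 * int j, 3 * int j + 1, 3 * int j + 2})" using j by blast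
  qed auto
qed

lemma mesh_layer_elems:
  fixes N :: "nat \<Rightarrow> nat" and i :: nat
  assumes N: "0 < N i"
  defines "cf \<equiv> 0 < i \<and> N (i - 1) = 2 * N i"
  shows "mesh_layer \<epsilon> \<tau> N \<omega> i =
    mesh_elem cf (\<epsilon> i) (\<tau> i) (pi / real (N i)) (\<omega> i) ` {0..<layer_period cf * int (N i)}"
proof -
  have a: "\<omega> i + 2 * pi * real j / real (N i) = \<omega> i + pi / real (N i) * (2 * real j)"
    "\<omega> i + pi / real (N i) + 2 * pi * real j / real (N i) = \<omega> i + pi / real (N i) * (2 * real j + 1)"
    "\<omega> i + pi / real (N i) * (2 * real j + 1) + pi / real (N i) / 2 = \<omega> i + pi / real (N i) * (2 * real j + 3 / 2)"
    "\<omega> i + pi / real (N i) * (2 * real j + 1) - pi / real (N i) / 2 = \<omega> i + pi / real (N i) * (2 * real j + 1 / 2)" for j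
    using N by (simp_all add: field_simps)
  have std: "mesh_elem False e t h w (2 * int j) = strip_elem (\<lambda>s. e + t * s) (w + h * (2 * real j)) h elem_A"
    "mesh_elem False e t h w (2 * int j + 1) = strip_elem (\<lambda>s. e + t * s) (w + h * (2 * real j + 1)) h elem_B"
    "mesh_elem True e t h w (3 * int j) = strip_elem (\<lambda>s. e + t * s) (w + h * (2 * real j)) h elem_A"
    "mesh_elem True e t h w (3 * int j + 1) = strip_elem (\<lambda>s. e + t * s) (w + h * (2 * real j + 1 / 2)) h elem_D"
    "mesh_elem True e t h w (3 * int j + 2) = strip_elem (\<lambda>s. e + t * s) (w + h * (2 * real j + 3 / 2)) h elem_C" for e t h w j
    by (simp_all add: mesh_elem_def)
  show ?thesis
  proof (cases cf)
    case True
    then show ?thesis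
      unfolding mesh_layer_def conforming_layer_def cf_def[symmetric] rotate_types a layer_period_def
      by (simp add: period_intervals image_UN std insert_commute)
  next
    case False
    then show ?thesis
      unfolding mesh_layer_def standard_layer_def cf_def[symmetric] rotate_types a layer_period_def
      by (simp add: period_intervals image_UN std)
  qed
qed

lemma layer_sum:
  fixes g :: "(real \<times> real) element \<Rightarrow> real"
  shows "(\<Sum>n\<in>{0..<layer_period cf * int N}. g (layer_elem cf n)) =
    real N * (g elem_A + (if cf then g elem_D + g elem_C else g elem_B))"
proof (cases cf)
  case True
  have "(\<Sum>n\<in>{0..<3 * int N}. g (layer_elem True n)) = (\<Sum>j<N. \<Sum>n\<in>{3 * int j, 3 * int j + 1, 3 * int j + 2}. g (layer_elem True n))"
    unfolding period_intervals by (rule sum.UNION_disjoint) (auto; presburger)+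
  then show ?thesis using True by (simp add: layer_period_def)
next
  case False
  have "(\<Sum>n\<in>{0..<2 * int N}. g (layer_elem False n)) = (\<Sum>j<N. \<Sum>n\<in>{2 * int j, 2 * int j + 1}. g (layer_elem False n))"
    unfolding period_intervals by (rule sum.UNION_disjoint) (auto; presburger)+
  then show ?thesis using False by (simp add: layer_period_def)
qed

lemma strip_elem_vertices:
  "a1 (strip_elem q \<phi> \<theta> E) = polar (q (fst (a1 E))) (\<phi> + \<theta> * snd (a1 E))"
  "a2 (strip_elem q \<phi> \<theta> E) = polar (q (fst (a2 E))) (\<phi> + \<theta> * snd (a2 E))"
  "a3 (strip_elem q \<phi> \<theta> E) = polar (q (fst (a3 E))) (\<phi> + \<theta> * snd (a3 E))"
  by (cases E; simp add: strip_elem_def case_prod_beta)+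

lemma layer_vertex:
  assumes "T \<in> mesh_elem cf t0 \<tau> \<theta> \<omega> ` I" "0 < t0" "0 < \<tau>" "x \<in> {a1 T, a2 T, a3 T}" "norm x = t0 + \<tau>"
  obtains j :: int where "x = polar (t0 + \<tau>) (\<omega> + \<theta> * (2 * real_of_int j + 1))"
proof -
  obtain n where T: "T = mesh_elem cf t0 \<tau> \<theta> \<omega> n" using assms(1) by auto
  define w where "w j = polar (t0 + \<tau>) (\<omega> + \<theta> * (2 * real_of_int j + 1))" for j
  have v: "polar (t0 + \<tau>) (\<omega> + \<theta> * (2 * real_of_int j) - \<theta>) = w (j - 1)"
    "polar (t0 + \<tau>) (\<omega> + \<theta> * (2 * real_of_int j) + \<theta>) = w j"
    "polar (t0 + \<tau>) (\<omega> + \<theta> * (2 * real_of_int j + 1)) = w j"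
    "polar (t0 + \<tau>) (\<omega> + \<theta> * (2 * real_of_int j + 1 / 2) + \<theta> / 2) = w j"
    "polar (t0 + \<tau>) (\<omega> + \<theta> * (2 * real_of_int j + 3 / 2) - \<theta> / 2) = w j" for j
    unfolding w_def by (simp_all add: algebra_simps)
  have n: "\<bar>t0 + \<tau> * s\<bar> = t0 + \<tau> \<Longrightarrow> s \<noteq> 0" for s using assms by auto
  have nx: "norm x = t0 + \<tau>" by fact
  have "\<exists>j. x = w j"
  proof (cases cf)
    case True
    obtain j where j: "n = 3 * j \<or> n = 3 * j + 1 \<or> n = 3 * j + 2" using mod3_cases by metis
    show ?thesis using j assms(4) nx assms(2,3) True
      unfolding T mesh_elem_def strip_elem_vertices
      by (elim disjE) (auto simp: elem_defs v)
  next
    case False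
    have "n = 2 * (n div 2) \<or> n = 2 * (n div 2) + 1" by presburger
    then obtain j where j: "n = 2 * j \<or> n = 2 * j + 1" by blast
    show ?thesis using j assms(4) nx assms(2,3) False
      unfolding T mesh_elem_def strip_elem_vertices
      by (elim disjE) (auto simp: elem_defs v)
  qed
  then show ?thesis using that unfolding w_def by blast
qed

section \<open>Consequences of the meshing strategy for the mesh parameters\<close>

text \<open>With q = 2 - p in (0, 1) and a = C h, the derivative in x is ((x^q + a) / x^q)^(1/q - 1)
  - 1, which is nonnegative.\<close>

lemma far_step_mono:
  assumes p: "1 < p" "p < 2" and a: "0 < C * h" and x: "0 < x" "x \<le> y"
  shows "far_step p C x h \<le> far_step p C y h"
proof -
  define q where "q = 2 - p"
  have q: "0 < q" "q < 1" using p by (auto simp: q_def)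
  define a where "a = C * h"
  have "(\<lambda>x. (x powr q + a) powr (1 / q) - x) x \<le> (\<lambda>x. (x powr q + a) powr (1 / q) - x) y"
  proof (rule DERIV_nonneg_imp_nondecreasing[OF x(2)])
    fix z assume "x \<le> z"
    then have z: "0 < z" using x by simp
    have b: "0 < z powr q + a" using z a by (simp add: a_def add_pos_pos)
    define d where "d = (1 / q * (z powr q + a) powr (1 / q - 1)) * (q * z powr (q - 1)) - 1"
    have "((\<lambda>x. (x powr q + a) powr (1 / q) - x) has_real_derivative d) (at z)"
      unfolding d_def using z b q by (auto intro!: derivative_eq_intros)
    moreover have "0 \<le> d"
    proof -
      have "(z powr q) powr (1 / q - 1) \<le> (z powr q + a) powr (1 / q - 1)"
        using z q a by (intro powr_mono2) (auto simp: a_def)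
      then have "(z powr q) powr (1 / q - 1) * z powr (q - 1) \<le> (z powr q + a) powr (1 / q - 1) * z powr (q - 1)"
        by (rule mult_right_mono) simp
      moreover have "(z powr q) powr (1 / q - 1) * z powr (q - 1) = 1"
        using z q by (simp add: powr_powr powr_add[symmetric] right_diff_distrib)
      ultimately show ?thesis using q by (simp add: d_def mult_ac)
    qed
    ultimately show "\<exists>d. ((\<lambda>x. (x powr q + a) powr (1 / q) - x) has_real_derivative d) (at z) \<and> 0 \<le> d" by blast
  qed
  then show ?thesis by (simp add: far_step_def q_def a_def)
qed

lemma angular_bound_mono:
  assumes "0 \<le> C2" "0 \<le> \<epsilon>" "\<epsilon> \<le> \<epsilon>'" "0 \<le> \<tau>" "\<tau> \<le> \<tau>'"
  shows "angular_bound C C2 h \<epsilon> \<tau> \<le> angular_bound C C2 h \<epsilon>' \<tau>'"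
proof -
  have a: "\<epsilon> * \<tau> \<le> \<epsilon>' * \<tau>'" "0 \<le> \<epsilon> * \<tau>" using assms by (auto intro: mult_mono)
  have b: "C\<^sup>2 * \<tau> * h\<^sup>2 \<le> C\<^sup>2 * \<tau>' * h\<^sup>2" "0 \<le> C\<^sup>2 * \<tau> * h\<^sup>2" using assms by (auto intro!: mult_right_mono mult_left_mono)
  show ?thesis unfolding angular_bound_def
    by (intro min.mono mult_left_mono powr_mono2 a b assms(1)) simp_all
qed

text \<open>The outcome of the strategy without the bookkeeping of the halvings.
  \<open>tested\<close> is the part of the angular bound that controls \<theta>^4 / \<tau>. A
  truncated last layer with inherited N may satisfy it only with the \<tau> of its
  predecessor.\<close>

locale strategy =
  fixes p C C1 C2 A2 h :: real and m :: nat and \<epsilon> \<tau> :: "nat \<Rightarrow> real" and N :: "nat \<Rightarrow> nat"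
  assumes p: "1 < p" "p < 2" and pos: "0 < C" "0 < C1" "0 < C2" "0 < h" "0 < \<epsilon> 0"
    and step: "i \<le> m \<Longrightarrow> 0 < \<epsilon> i \<and> 0 < \<tau> i \<and> \<tau> i \<le> C1 * sqrt (\<epsilon> i) \<and> \<tau> i \<le> far_step p C (\<epsilon> i) h"
    and next_layer: "i < m \<Longrightarrow> \<epsilon> (Suc i) = \<epsilon> i + \<tau> i"
    and last_layer: "\<epsilon> m + \<tau> m = 1"
    and N_bound: "i \<le> m \<Longrightarrow> 0 < N i \<and> 1 / real (N i) \<le> A2 * h \<and> 1 / real (N i) \<le> C2 * (\<epsilon> i * \<tau> i) powr (1 / 4)"
    and N_halve: "i < m \<Longrightarrow> N i = N (Suc i) \<or> N i = 2 * N (Suc i)"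
    and tested: "i \<le> m \<Longrightarrow> 1 / real (N i) \<le> (C\<^sup>2 * \<tau> i * h\<^sup>2) powr (1 / 4) \<or>
      (i = m \<and> 0 < m \<and> 1 / real (N m) \<le> (C\<^sup>2 * \<tau> (m - 1) * h\<^sup>2) powr (1 / 4))"

text \<open>The angular bound is checked at the start and at each halving. Between checks N is
  constant while \<epsilon> and \<tau> grow, so the bound persists by monotonicity in all layers
  before the last, where \<tau> may be truncated.\<close>

lemma strategy_parameters_locale:
  assumes sp: "strategy_parameters p C C1 C2 A1 A2 h \<epsilon>0 m \<epsilon> \<tau> N"
    and p: "1 < p" "p < 2" and pos: "0 < C" "0 < C1" "0 < C2" "0 < h" "0 < \<epsilon>0" "0 < A1" "0 < A2"
  shows "strategy p C C1 C2 A2 h m \<epsilon> \<tau> N" "\<epsilon> 0 = \<epsilon>0"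
proof -
  obtain Nm k and \<kappa> :: "nat \<Rightarrow> nat" where e0: "\<epsilon> 0 = \<epsilon>0" and t0: "\<tau> 0 = min (C1 * sqrt \<epsilon>0) (far_step p C \<epsilon>0 h)"
    and Nm: "0 < Nm" "real Nm \<in> {1 / (A2 * h)..1 / (A1 * h)}"
    and k: "k = (LEAST j. (LEAST n. 0 < n \<and> 1 / real n \<le> angular_bound C C2 h \<epsilon>0 (\<tau> 0)) \<le> 2 ^ j * Nm)"
    and N0: "N 0 = 2 ^ k * Nm" and \<kappa>0: "\<kappa> 0 = 0"
    and all: "\<forall>i\<in>{1..m}.
           \<epsilon> i = \<epsilon> (i - 1) + \<tau> (i - 1) \<and>
           \<tau> i = min (1 - \<epsilon> i) (min (C1 * sqrt (\<epsilon> i)) (far_step p C (\<epsilon> i) h)) \<and>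
           (if \<kappa> (i - 1) < k \<and>
               1 / real (N (i - 1) div 2) \<le> angular_bound C C2 h (\<epsilon> i) (\<tau> i)
            then \<kappa> i = \<kappa> (i - 1) + 1 \<and> N i = N (i - 1) div 2
            else \<kappa> i = \<kappa> (i - 1) \<and> N i = N (i - 1))"
    and notlast: "\<forall>i<m. \<tau> i \<noteq> 1 - \<epsilon> i" and last: "\<tau> m = 1 - \<epsilon> m"
    and \<tau>: "\<forall>i\<le>m. 0 < \<tau> i" and Nlast: "1 / real (N m) \<le> C2 * (\<epsilon> m * \<tau> m) powr (1 / 4)"
    using sp unfolding strategy_parameters_def by (elim exE conjE) (rule that; assumption)
  have S: "\<epsilon> (Suc i) = \<epsilon> i + \<tau> i" "\<tau> (Suc i) = min (1 - \<epsilon> (Suc i)) (min (C1 * sqrt (\<epsilon> (Suc i))) (far_step p C (\<epsilon> (Suc i)) h))"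
    "if \<kappa> i < k \<and> 1 / real (N i div 2) \<le> angular_bound C C2 h (\<epsilon> (Suc i)) (\<tau> (Suc i))
            then \<kappa> (Suc i) = \<kappa> i + 1 \<and> N (Suc i) = N i div 2
            else \<kappa> (Suc i) = \<kappa> i \<and> N (Suc i) = N i" if "i < m" for i
  proof -
    have "Suc i \<in> {1..m}" using that by simp
    note b = bspec[OF all this, unfolded diff_Suc_1]
    show "\<epsilon> (Suc i) = \<epsilon> i + \<tau> i" by (rule conjunct1[OF b])
    show "\<tau> (Suc i) = min (1 - \<epsilon> (Suc i)) (min (C1 * sqrt (\<epsilon> (Suc i))) (far_step p C (\<epsilon> (Suc i)) h))"
      by (rule conjunct1[OF conjunct2[OF b]])
    show "if \<kappa> i < k \<and> 1 / real (N i div 2) \<le> angular_bound C C2 h (\<epsilon> (Suc i)) (\<tau> (Suc i))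
            then \<kappa> (Suc i) = \<kappa> i + 1 \<and> N (Suc i) = N i div 2
            else \<kappa> (Suc i) = \<kappa> i \<and> N (Suc i) = N i"
      by (rule conjunct2[OF conjunct2[OF b]])
  qed
  have \<epsilon>: "0 < \<epsilon> i" if "i \<le> m" for i
    using that
  proof (induction i)
    case (Suc i)
    then show ?case using S(1)[of i] \<tau>[rule_format, of i] by simp
  qed (use e0 pos in simp)
  have \<tau>_le: "\<tau> i \<le> C1 * sqrt (\<epsilon> i) \<and> \<tau> i \<le> far_step p C (\<epsilon> i) h" if "i \<le> m" for i
    proof (cases i)
      case 0
      then show ?thesis using t0 e0 by simp
    next
      case (Suc j)
      then show ?thesis using that S(2)[of j] by (auto simp: min_le_iff_disj)
    qed
  have N_pow: "\<kappa> i \<le> k \<and> N i = 2 ^ (k - \<kappa> i) * Nm" if "i \<le> m" for i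
    using that
  proof (induction i)
    case (Suc i)
    have IH: "\<kappa> i \<le> k" "N i = 2 ^ (k - \<kappa> i) * Nm" using Suc by auto
    show ?case
    proof (cases "\<kappa> (Suc i) = \<kappa> i + 1")
      case True
      then have c: "\<kappa> i < k" "N (Suc i) = N i div 2" using S(3)[of i] Suc.prems by (auto split: if_splits)
      then have "k - \<kappa> i = Suc (k - \<kappa> (Suc i))" using True by simp
      then show ?thesis using c IH True by simp
    next
      case False
      then show ?thesis using S(3)[of i] Suc.prems IH by (auto split: if_splits)
    qed
  qed (use N0 \<kappa>0 in simp)
  have N_pos: "0 < N i" if "i \<le> m" for i using N_pow[OF that] Nm by simp
  have N_far: "1 / real (N i) \<le> A2 * h" if "i \<le> m" for i
  proof -
    have "(1::nat) * Nm \<le> 2 ^ (k - \<kappa> i) * Nm" by (rule mult_right_mono) simp_all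
    then have "1 / (A2 * h) \<le> real (N i)" using N_pow[OF that] Nm(2) by (metis atLeastAtMost_iff of_nat_le_iff mult_1 order_trans)
    then show ?thesis using pos N_pos[OF that] by (simp add: field_simps)
  qed
  have N_halve: "N i = N (Suc i) \<or> N i = 2 * N (Suc i)" if "i < m" for i
  proof (cases "\<kappa> (Suc i) = \<kappa> i + 1")
    case True
    then have c: "\<kappa> i < k" "N (Suc i) = N i div 2" using S(3)[OF that] by (auto split: if_splits)
    then obtain j where "k - \<kappa> i = Suc j" by (metis Suc_diff_Suc)
    then show ?thesis using c N_pow[of i] that by simp
  next
    case False
    then show ?thesis using S(3)[OF that] by (auto split: if_splits)
  qed
  \<comment> \<open>Before the last layer the minimum defining \<tau> is not attained by 1 -
    \<epsilon>, and its other two terms increase with \<epsilon>.\<close>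
  have \<tau>_mono: "\<tau> i \<le> \<tau> (Suc i)" if "Suc i < m" for i
  proof -
    have "\<tau> (Suc i) = min (C1 * sqrt (\<epsilon> (Suc i))) (far_step p C (\<epsilon> (Suc i)) h)"
      using S(2)[of i] notlast that by (auto simp: min_def split: if_splits)
    moreover have "\<epsilon> i \<le> \<epsilon> (Suc i)" using S(1)[of i] \<tau> that by (simp add: less_imp_le)
    then have "C1 * sqrt (\<epsilon> i) \<le> C1 * sqrt (\<epsilon> (Suc i))" "far_step p C (\<epsilon> i) h \<le> far_step p C (\<epsilon> (Suc i)) h"
      using pos \<epsilon>[of i] that by (auto intro!: mult_left_mono far_step_mono p)
    ultimately show ?thesis using \<tau>_le[of i] that by auto
  qed
  have bound0: "1 / real (N 0) \<le> angular_bound C C2 h (\<epsilon> 0) (\<tau> 0)"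
  proof -
    define B where "B = angular_bound C C2 h \<epsilon>0 (\<tau> 0)"
    have "0 < \<tau> 0" using \<tau> by simp
    then have B: "0 < B" using pos by (simp add: B_def angular_bound_def)
    obtain n where "inverse (real (Suc n)) < B" using reals_Archimedean[OF B] by blast
    then have "0 < Suc n \<and> 1 / real (Suc n) \<le> B" by (simp add: inverse_eq_divide)
    then have L: "0 < (LEAST n. 0 < n \<and> 1 / real n \<le> B) \<and> 1 / real (LEAST n. 0 < n \<and> 1 / real n \<le> B) \<le> B"
      by (rule LeastI)
    define M where "M = (LEAST n. 0 < n \<and> 1 / real n \<le> B)"
    \<comment> \<open>The exponent \<open>M\<close> itself is admissible in the choice of
      \<open>k\<close>, so the least one exists and \<open>N 0\<close> reaches
      \<open>M\<close>.\<close>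
    have "M \<le> 2 ^ M * 1" by (simp add: less_imp_le)
    also have "\<dots> \<le> 2 ^ M * Nm" using Nm by (intro mult_left_mono) auto
    finally have "M \<le> 2 ^ k * Nm" unfolding k B_def[symmetric] M_def[symmetric] by (rule LeastI)
    then have "M \<le> N 0" "0 < M" using N0 L by (auto simp: M_def)
    then have "1 / real (N 0) \<le> 1 / real M" by (intro divide_left_mono) auto
    then show ?thesis using L by (simp add: M_def B_def e0)
  qed
  have bound_cases: "1 / real (N (Suc i)) \<le> angular_bound C C2 h (\<epsilon> (Suc i)) (\<tau> (Suc i)) \<or> N (Suc i) = N i" if "i < m" for i
    using S(3)[OF that] by (auto split: if_splits)
  have bound: "1 / real (N i) \<le> angular_bound C C2 h (\<epsilon> i) (\<tau> i)" if "i < m" for i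
    using that
  proof (induction i)
    case (Suc i)
    have "angular_bound C C2 h (\<epsilon> i) (\<tau> i) \<le> angular_bound C C2 h (\<epsilon> (Suc i)) (\<tau> (Suc i))"
      using Suc.prems S(1)[of i] \<epsilon>[of i] \<tau>[rule_format, of i] \<tau>_mono[of i] pos by (intro angular_bound_mono) auto
    then show ?case using bound_cases[of i] Suc by force
  qed (rule bound0)
  have tested: "1 / real (N i) \<le> (C\<^sup>2 * \<tau> i * h\<^sup>2) powr (1 / 4) \<or>
      (i = m \<and> 0 < m \<and> 1 / real (N m) \<le> (C\<^sup>2 * \<tau> (m - 1) * h\<^sup>2) powr (1 / 4))" if "i \<le> m" for i
  proof (cases "i < m")
    case True
    then show ?thesis using bound[of i] by (simp add: angular_bound_def)
  next
    case False
    then have i: "i = m" using that by simp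
    show ?thesis
    proof (cases m)
      case 0
      then show ?thesis using i bound0 by (simp add: angular_bound_def)
    next
      case (Suc j)
      then show ?thesis using i bound_cases[of j] bound[of j] by (auto simp: angular_bound_def)
    qed
  qed
  have C2: "1 / real (N i) \<le> C2 * (\<epsilon> i * \<tau> i) powr (1 / 4)" if "i \<le> m" for i
  proof (cases "i < m")
    case True
    then show ?thesis using bound[of i] by (simp add: angular_bound_def)
  next
    case False
    then show ?thesis using that Nlast by simp
  qed
  show "\<epsilon> 0 = \<epsilon>0" by (rule e0)
  show "strategy p C C1 C2 A2 h m \<epsilon> \<tau> N"
    by unfold_locales (use p pos e0 \<epsilon> \<tau> \<tau>_le S last N_pos N_far C2 N_halve tested in auto)
qed

context strategy
begin

definition "\<theta> i = pi / real (N i)"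

lemma \<epsilon>_le: "i \<le> j \<Longrightarrow> j \<le> m \<Longrightarrow> \<epsilon> i \<le> \<epsilon> j"
proof (induction j rule: dec_induct)
  case (step j)
  then show ?case using next_layer[of j] strategy.step[OF strategy_axioms, of j] by simp
qed simp

lemma outer_le: "i \<le> m \<Longrightarrow> \<epsilon> i + \<tau> i \<le> 1"
  using last_layer \<epsilon>_le[of "Suc i" m] next_layer[of i] step[of m] by (cases "i = m") auto

lemma pi_bounds: "pi\<^sup>2 \<le> 10" "pi ^ 4 \<le> 100"
proof -
  have "pi \<le> 315 / 100" using pi_approx by simp
  then have "pi * pi \<le> 315 / 100 * (315 / 100)" by (intro mult_mono) (auto simp: pi_ge_zero)
  then show "pi\<^sup>2 \<le> 10" by (simp add: power2_eq_square)
  then have "pi\<^sup>2 * pi\<^sup>2 \<le> 10 * 10" by (intro mult_mono) auto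
  then show "pi ^ 4 \<le> 100" by (simp add: power4_eq_xxxx power2_eq_square)
qed

text \<open>The bounds on 1 / N are raised to the second and fourth power; 10 and 100 are upper
  bounds of pi^2 and pi^4.\<close>

lemma \<theta>_bounds:
  assumes i: "i \<le> m"
  shows "0 < \<theta> i" "(\<theta> i)\<^sup>2 \<le> 10 * A2\<^sup>2 * h\<^sup>2" "\<theta> i ^ 4 \<le> 100 * C2 ^ 4 * (\<epsilon> i * \<tau> i)"
    "(\<theta> i)\<^sup>2 \<le> 10 * C2\<^sup>2 * sqrt (\<epsilon> i * \<tau> i)"
    "\<theta> i ^ 4 \<le> 100 * C\<^sup>2 * h\<^sup>2 * \<tau> i \<or> (i = m \<and> 0 < m \<and> \<theta> m ^ 4 \<le> 100 * C\<^sup>2 * h\<^sup>2 * \<tau> (m - 1))"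
proof -
  define x where "x = 1 / real (N i)"
  have x: "0 < x" "x \<le> A2 * h" "x \<le> C2 * (\<epsilon> i * \<tau> i) powr (1 / 4)" using N_bound[OF i] by (auto simp: x_def)
  have \<theta>: "\<theta> i = pi * x" by (simp add: \<theta>_def x_def)
  show "0 < \<theta> i" using x by (simp add: \<theta>)
  have et: "0 < \<epsilon> i * \<tau> i" using step[OF i] by simp
  have pw: "(y powr (1 / 4)) ^ 4 = y" "(y powr (1 / 4))\<^sup>2 = sqrt y" if "0 < y" for y :: real
    using that by (auto simp: powr_realpow[symmetric] powr_powr powr_half_sqrt[symmetric] simp del: powr_realpow)
  have sq: "(\<theta> i)\<^sup>2 \<le> 10 * y\<^sup>2" "\<theta> i ^ 4 \<le> 100 * y ^ 4" if "x \<le> y" for y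
    unfolding \<theta> power_mult_distrib using that x pi_bounds by (auto intro!: mult_mono power_mono)
  show "(\<theta> i)\<^sup>2 \<le> 10 * A2\<^sup>2 * h\<^sup>2" using sq(1)[OF x(2)] by (simp add: power_mult_distrib)
  show "\<theta> i ^ 4 \<le> 100 * C2 ^ 4 * (\<epsilon> i * \<tau> i)" "(\<theta> i)\<^sup>2 \<le> 10 * C2\<^sup>2 * sqrt (\<epsilon> i * \<tau> i)"
    using sq[OF x(3)] pw[OF et] by (simp_all add: power_mult_distrib)
  have t: "\<theta> i ^ 4 \<le> 100 * C\<^sup>2 * h\<^sup>2 * \<tau> j" if "x \<le> (C\<^sup>2 * \<tau> j * h\<^sup>2) powr (1 / 4)" "j \<le> m" for j
    using sq(2)[OF that(1)] pw(1)[of "C\<^sup>2 * \<tau> j * h\<^sup>2"] pos step[OF that(2)] by (simp add: mult_ac)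
  show "\<theta> i ^ 4 \<le> 100 * C\<^sup>2 * h\<^sup>2 * \<tau> i \<or> (i = m \<and> 0 < m \<and> \<theta> m ^ 4 \<le> 100 * C\<^sup>2 * h\<^sup>2 * \<tau> (m - 1))"
    using tested[OF i] t[of i] t[of "m - 1"] i unfolding x_def by auto
qed

text \<open>The condition on \<tau>^2 comes from \<tau> \<le> C1 sqrt \<epsilon>. The choice C2
  \<le> \<kappa> / 10 beats the factors 10 and 100 of \<open>\<theta>_bounds\<close> and leaves a
  factor \<kappa> / 10 in \<theta>^2, which pays for the sum \<epsilon> \<theta>^2 + \<tau>
  \<theta>^2.\<close>

lemma fine:
  assumes i: "i \<le> m" and \<kappa>: "C1 \<le> \<kappa>" "C2 \<le> \<kappa> / 10" "0 < \<kappa>" "\<kappa> \<le> 1"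
  shows "fine_element \<kappa> (\<epsilon> i) (\<tau> i) (\<theta> i)"
proof -
  note \<theta> = \<theta>_bounds[OF i] and s = step[OF i] and o = outer_le[OF i]
  have e1: "\<epsilon> i \<le> 1" "\<tau> i \<le> 1" using s o by auto
  have "\<epsilon> i * \<tau> i \<le> \<epsilon> i * 1" using s e1 by (intro mult_left_mono) auto
  then have et: "\<epsilon> i * \<tau> i \<le> \<epsilon> i" by simp
  have "C2\<^sup>2 \<le> (\<kappa> / 10)\<^sup>2" "C2 ^ 4 \<le> (\<kappa> / 10) ^ 4" using \<kappa> pos by (intro power_mono; simp)+
  moreover have k2: "\<kappa>\<^sup>2 \<le> \<kappa>" "\<kappa> ^ 4 \<le> \<kappa>" using \<kappa> power_decreasing[of 1 2 \<kappa>] power_decreasing[of 1 4 \<kappa>] by auto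
  ultimately have c: "10 * C2\<^sup>2 \<le> \<kappa> / 10" "100 * C2 ^ 4 \<le> \<kappa>" using \<kappa> by (auto simp: power_divide)
  have sq: "sqrt (\<epsilon> i * \<tau> i) \<le> sqrt (\<epsilon> i)" using et by simp
  have s1: "sqrt (\<epsilon> i) \<le> 1" "0 < sqrt (\<epsilon> i)" "sqrt (\<epsilon> i) * sqrt (\<epsilon> i) = \<epsilon> i" using s e1 by auto
  have "10 * C2\<^sup>2 * sqrt (\<epsilon> i * \<tau> i) \<le> \<kappa> / 10 * sqrt (\<epsilon> i)"
    using c sq \<kappa> s by (intro mult_mono) auto
  then have th: "(\<theta> i)\<^sup>2 \<le> \<kappa> / 10 * sqrt (\<epsilon> i)" using \<theta>(4) by simp
  have "\<kappa> / 10 * sqrt (\<epsilon> i) \<le> \<kappa> / 10 * 1" using s1 \<kappa> by (intro mult_left_mono) auto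
  then have th1: "(\<theta> i)\<^sup>2 \<le> \<kappa> / 10" using th by simp
  have \<tau>: "\<tau> i \<le> \<kappa> * sqrt (\<epsilon> i)"
  proof -
    have "C1 * sqrt (\<epsilon> i) \<le> \<kappa> * sqrt (\<epsilon> i)" using \<kappa> s1 by (intro mult_right_mono) auto
    then show ?thesis using s by linarith
  qed
  have "\<epsilon> i * (\<theta> i)\<^sup>2 \<le> \<epsilon> i * (\<kappa> / 10)" using th1 s by (intro mult_left_mono) auto
  then have X1: "\<epsilon> i * (\<theta> i)\<^sup>2 \<le> \<kappa> / 10 * \<epsilon> i" by (simp only: mult.commute)
  have "\<tau> i * (\<theta> i)\<^sup>2 \<le> (\<kappa> * sqrt (\<epsilon> i)) * (\<kappa> / 10 * sqrt (\<epsilon> i))" using th \<tau> \<kappa> s s1 by (intro mult_mono) auto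
  also have "\<dots> = \<kappa>\<^sup>2 / 10 * (sqrt (\<epsilon> i) * sqrt (\<epsilon> i))" by (simp add: power2_eq_square)
  also have "\<dots> = \<kappa>\<^sup>2 / 10 * \<epsilon> i" by (simp only: s1(3))
  also have "\<dots> \<le> \<kappa> / 10 * \<epsilon> i" using k2 s by (intro mult_right_mono) auto
  finally have X2: "\<tau> i * (\<theta> i)\<^sup>2 \<le> \<kappa> / 10 * \<epsilon> i" .
  have "0 \<le> \<kappa> / 10 * \<epsilon> i" "\<kappa> * \<epsilon> i = 10 * (\<kappa> / 10 * \<epsilon> i)" using \<kappa> s by simp_all
  then have 1: "(\<epsilon> i + \<tau> i) * (\<theta> i)\<^sup>2 \<le> \<kappa> * \<epsilon> i" unfolding distrib_right using X1 X2 by linarith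
  have "100 * C2 ^ 4 * (\<epsilon> i * \<tau> i) \<le> \<kappa> * (\<epsilon> i * \<tau> i)" using c s by (intro mult_right_mono) auto
  then have 2: "\<theta> i ^ 4 \<le> \<kappa> * (\<epsilon> i * \<tau> i)" using \<theta>(3) by simp
  have "\<tau> i * \<tau> i \<le> (\<kappa> * sqrt (\<epsilon> i)) * (\<kappa> * sqrt (\<epsilon> i))" using \<tau> s \<kappa> s1 by (intro mult_mono) auto
  also have "\<dots> = \<kappa>\<^sup>2 * \<epsilon> i" using s1(3) by (simp add: power2_eq_square)
  also have "\<dots> \<le> \<kappa> * \<epsilon> i" using k2 s by (intro mult_right_mono) auto
  finally have 3: "(\<tau> i)\<^sup>2 \<le> \<kappa> * \<epsilon> i" by (simp add: power2_eq_square)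
  show ?thesis unfolding fine_element_def using s o \<theta>(1) th1 1 2 3 \<kappa> by simp
qed

end

section \<open>Pointwise comparison of the energy densities\<close>

text \<open>For an exponent in (0, 1] the power of w lies between 1 and w.\<close>

lemma powr_minus_one_le:
  fixes w a :: real
  assumes "0 \<le> w" "0 < a" "a \<le> 1"
  shows "\<bar>w powr a - 1\<bar> \<le> \<bar>w - 1\<bar>"
proof (cases "1 \<le> w")
  case True
  then have "1 \<le> w powr a" "w powr a \<le> w" using assms powr_mono[of a 1 w] by (auto intro: ge_one_powr_ge_zero)
  then show ?thesis using True by simp
next
  case False
  then have "w powr a \<le> 1" using assms powr_mono2[of a w 1] by simp
  moreover have "w \<le> w powr a" using False assms powr_mono'[of a 1 w] by (cases "w = 0") auto
  ultimately show ?thesis using False by simp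
qed

text \<open>The term equals j^(1-p) Q^(p/2). The exponents p / 2 and p - 1 are in (0, 1], so
  \<open>powr_minus_one_le\<close> bounds the change of each factor linearly. The product rule then
  brings in the weights t^(1-p) for the error of Q and t^(-p) for that of j.\<close>

lemma gradient_density_estimate:
  fixes j t Q Q0 p c M :: real
  assumes p: "1 < p" "p < 2" and t: "0 < t" "t / 2 \<le> j" and Q: "0 \<le> Q" "0 < c" "c\<^sup>2 \<le> Q0" "Q0 \<le> M" "1 \<le> M"
  shows "\<bar>j * (sqrt Q / j) powr p - t * (sqrt Q0 / t) powr p\<bar> \<le>
    2 * c powr (p - 2) * (t powr (1 - p) * \<bar>Q - Q0\<bar>) + 2 * M * (t powr (- p) * \<bar>j - t\<bar>)"
proof -
  have j: "0 < j" using t by simp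
  have Q0: "0 < Q0" using Q by (meson less_le_trans zero_less_power)
  have split: "x * (sqrt S / x) powr p = x powr (1 - p) * S powr (p / 2)" if "0 < x" "0 \<le> S" for x S
    using that by (simp add: powr_divide powr_diff powr_half_sqrt[symmetric] powr_powr)
  have 1: "\<bar>Q powr (p / 2) - Q0 powr (p / 2)\<bar> \<le> c powr (p - 2) * \<bar>Q - Q0\<bar>"
  proof -
    have "\<bar>Q powr (p / 2) - Q0 powr (p / 2)\<bar> = Q0 powr (p / 2) * \<bar>(Q / Q0) powr (p / 2) - 1\<bar>"
      using Q Q0 by (simp add: powr_divide abs_mult[symmetric, of "Q0 powr (p / 2)", simplified] field_simps abs_divide)
    also have "\<dots> \<le> Q0 powr (p / 2) * \<bar>Q / Q0 - 1\<bar>"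
      using Q Q0 p by (intro mult_left_mono powr_minus_one_le) auto
    also have "\<dots> = Q0 powr (p / 2 - 1) * \<bar>Q - Q0\<bar>"
    proof -
      have "\<bar>Q / Q0 - 1\<bar> = \<bar>Q - Q0\<bar> / Q0" using Q0 by (simp add: diff_divide_distrib[symmetric] field_simps abs_divide)
      then show ?thesis using Q0 by (simp add: powr_diff)
    qed
    also have "\<dots> \<le> (c\<^sup>2) powr (p / 2 - 1) * \<bar>Q - Q0\<bar>"
      using Q Q0 p by (intro mult_right_mono powr_mono2') auto
    also have "(c\<^sup>2) powr (p / 2 - 1) = c powr (p - 2)"
      using Q by (simp add: powr_realpow[symmetric] powr_powr right_diff_distrib del: powr_realpow powr_numeral)
    finally show ?thesis .
  qed
  have 2: "\<bar>j powr (1 - p) - t powr (1 - p)\<bar> \<le> 2 * (t powr (- p) * \<bar>j - t\<bar>)"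
  proof -
    have "\<bar>j powr (1 - p) - t powr (1 - p)\<bar> = t powr (1 - p) * \<bar>(t / j) powr (p - 1) - 1\<bar>"
    proof -
      have "j powr (1 - p) = t powr (1 - p) * (t / j) powr (p - 1)"
        using t j by (simp add: powr_divide powr_diff)
      then have "j powr (1 - p) - t powr (1 - p) = t powr (1 - p) * ((t / j) powr (p - 1) - 1)"
        by (simp add: right_diff_distrib)
      then show ?thesis by (simp add: abs_mult)
    qed
    also have "\<dots> \<le> t powr (1 - p) * \<bar>t / j - 1\<bar>"
      using t j p by (intro mult_left_mono powr_minus_one_le) auto
    also have "\<bar>t / j - 1\<bar> = \<bar>j - t\<bar> / j" using j by (simp add: diff_divide_distrib[symmetric] field_simps abs_divide abs_minus_commute)
    also have "\<bar>j - t\<bar> / j \<le> \<bar>j - t\<bar> / (t / 2)" using t by (intro divide_left_mono) auto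
    also have "t powr (1 - p) * (\<bar>j - t\<bar> / (t / 2)) = 2 * (t powr (- p) * \<bar>j - t\<bar>)"
      using t by (simp add: powr_diff powr_minus field_simps)
    finally show ?thesis using t by (simp add: mult_left_mono)
  qed
  have 3: "j powr (1 - p) \<le> 2 * t powr (1 - p)"
  proof -
    have "j powr (1 - p) \<le> (t / 2) powr (1 - p)" using t p by (intro powr_mono2') auto
    also have "\<dots> = t powr (1 - p) * 2 powr (p - 1)" using t by (simp add: powr_divide powr_diff)
    also have "\<dots> \<le> t powr (1 - p) * 2 powr 1" using p by (intro mult_left_mono powr_mono) auto
    finally show ?thesis by simp
  qed
  have 4: "Q0 powr (p / 2) \<le> M"
  proof -
    have "Q0 powr (p / 2) \<le> M powr (p / 2)" using Q Q0 p by (intro powr_mono2) auto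
    also have "\<dots> \<le> M powr 1" using Q p by (intro powr_mono) auto
    finally show ?thesis using Q by simp
  qed
  have "\<bar>j * (sqrt Q / j) powr p - t * (sqrt Q0 / t) powr p\<bar> =
    \<bar>j powr (1 - p) * (Q powr (p / 2) - Q0 powr (p / 2)) + Q0 powr (p / 2) * (j powr (1 - p) - t powr (1 - p))\<bar>"
    using split[OF j Q(1)] split[OF t(1), of Q0] Q0 by (simp add: algebra_simps)
  also have "\<dots> \<le> j powr (1 - p) * \<bar>Q powr (p / 2) - Q0 powr (p / 2)\<bar> + Q0 powr (p / 2) * \<bar>j powr (1 - p) - t powr (1 - p)\<bar>"
    by (rule order_trans[OF abs_triangle_ineq]) (simp add: abs_mult)
  also have "\<dots> \<le> (2 * t powr (1 - p)) * (c powr (p - 2) * \<bar>Q - Q0\<bar>) + M * (2 * (t powr (- p) * \<bar>j - t\<bar>))"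
    using 1 2 3 4 Q by (intro add_mono mult_mono) auto
  also have "\<dots> = 2 * c powr (p - 2) * (t powr (1 - p) * \<bar>Q - Q0\<bar>) + 2 * M * (t powr (- p) * \<bar>j - t\<bar>)"
    by (simp only: mult_ac)
  finally show ?thesis .
qed

lemma volume_density_estimate:
  fixes j t d d0 L G D :: real
  assumes t: "0 < t" "0 < j" and lip: "\<bar>g (d / j) - g (d0 / t)\<bar> \<le> L * \<bar>d / j - d0 / t\<bar>" "\<bar>g (d0 / t)\<bar> \<le> G"
    and D: "0 \<le> d0" "d0 \<le> D * t" "0 \<le> L"
  shows "\<bar>j * g (d / j) - t * g (d0 / t)\<bar> \<le> (G + L * D) * \<bar>j - t\<bar> + L * \<bar>d - d0\<bar>"
proof -
  have "j * \<bar>d / j - d0 / t\<bar> = \<bar>(d - d0) + d0 / t * (t - j)\<bar>"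
  proof -
    have "j * (d / j - d0 / t) = (d - d0) + d0 / t * (t - j)" using t by (simp add: field_simps)
    then show ?thesis using t by (metis abs_mult abs_of_pos)
  qed
  also have "\<dots> \<le> \<bar>d - d0\<bar> + \<bar>d0 / t * (t - j)\<bar>" by (rule abs_triangle_ineq)
  also have "\<bar>d0 / t * (t - j)\<bar> = d0 / t * \<bar>j - t\<bar>" using t D by (simp add: abs_mult abs_minus_commute)
  also have "\<dots> \<le> D * \<bar>j - t\<bar>" using t D by (intro mult_right_mono) (simp_all add: pos_divide_le_eq)
  finally have 1: "j * \<bar>d / j - d0 / t\<bar> \<le> \<bar>d - d0\<bar> + D * \<bar>j - t\<bar>" by simp
  have "\<bar>j * g (d / j) - t * g (d0 / t)\<bar> = \<bar>j * (g (d / j) - g (d0 / t)) + (j - t) * g (d0 / t)\<bar>"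
    by (simp add: algebra_simps)
  also have "\<dots> \<le> j * \<bar>g (d / j) - g (d0 / t)\<bar> + \<bar>j - t\<bar> * \<bar>g (d0 / t)\<bar>"
    by (rule order_trans[OF abs_triangle_ineq]) (use t in \<open>simp add: abs_mult\<close>)
  also have "\<dots> \<le> j * (L * \<bar>d / j - d0 / t\<bar>) + \<bar>j - t\<bar> * G"
    using t lip by (intro add_mono mult_left_mono) auto
  also have "\<dots> = L * (j * \<bar>d / j - d0 / t\<bar>) + \<bar>j - t\<bar> * G" by simp
  also have "\<dots> \<le> L * (\<bar>d - d0\<bar> + D * \<bar>j - t\<bar>) + \<bar>j - t\<bar> * G"
    using 1 D by (intro add_right_mono mult_left_mono) auto
  finally show ?thesis by (simp add: algebra_simps)
qed

text \<open>The energy of the exact deformation per unit of radius and angle. Its gradient at radius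
  t has the singular values r'(t) and r(t) / t, and the leading factor t is the Jacobian of polar
  coordinates.\<close>

definition radial_density :: "real \<Rightarrow> real \<Rightarrow> (real \<Rightarrow> real) \<Rightarrow> (real \<Rightarrow> real) \<Rightarrow> (real \<Rightarrow> real) \<Rightarrow> real \<Rightarrow> real" where
  "radial_density p \<omega> g r r' t = t * (\<omega> * (sqrt ((t * r' t)\<^sup>2 + (r t)\<^sup>2) / t) powr p + g (r' t * r t / t))"

text \<open>The size of the local error, up to a constant. The last term stems from the error of the
  element Jacobian, which scales with t0 + \<tau>, and this may be much larger than t in a layer
  that is thick compared with its inner radius.\<close>

definition layer_error :: "real \<Rightarrow> real \<Rightarrow> real \<Rightarrow> real \<Rightarrow> real" where
  "layer_error p \<tau> \<theta> t = t powr (1 - p) * (\<tau>\<^sup>2 + \<theta>\<^sup>2 + \<theta> ^ 4 / \<tau>) + t powr (- p) * (\<tau> * \<theta>\<^sup>2)"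

text \<open>The two determinants are \<open>area2 E * (\<tau> * \<theta>)\<close> times j and d,
  where |j - t| \<le> 42000 \<kappa> t and |d - r' r| \<le> 330000 B^2 \<kappa> t. The two bounds on
  \<kappa> make these errors at most t / 2 and c m t / 2, half of the lower bounds t and c m t. The
  quotient d / j then stays in a compact part of the positive axis, where g is bounded and
  Lipschitz.\<close>

lemma density_estimate:
  fixes r r' g :: "real \<Rightarrow> real" and E :: "(real \<times> real) element" and \<xi> :: "real ^ 2" and B c m \<kappa> t0 \<tau> \<theta> \<phi> p \<omega> L G :: real
  assumes r: "profile_bounds r r' B c m" and fine: "fine_element \<kappa> t0 \<tau> \<theta>"
    and \<kappa>: "\<kappa> \<le> 1 / 84000" "\<kappa> \<le> c * m / (660000 * B\<^sup>2)" and E: "E \<in> elems" and \<xi>: "\<xi> \<in> ref_triangle"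
  defines "T \<equiv> strip_elem (\<lambda>s. t0 + \<tau> * s) \<phi> \<theta> E" and "u \<equiv> cavity_deformation r" and "t \<equiv> t0 + \<tau> * interp fst E (\<xi> $ 1) (\<xi> $ 2)"
  shows "0 < quad_det T \<xi>" "0 < quad_det (map_element u T) \<xi>"
    and "1 < p \<Longrightarrow> p < 2 \<Longrightarrow> 0 < \<omega> \<Longrightarrow> 0 \<le> L \<Longrightarrow>
      (\<And>x y. x \<in> {c * m / 3..2 * B\<^sup>2 + c * m} \<Longrightarrow> y \<in> {c * m / 3..2 * B\<^sup>2 + c * m} \<Longrightarrow> \<bar>g x - g y\<bar> \<le> L * \<bar>x - y\<bar>) \<Longrightarrow>
      (\<And>x. x \<in> {c * m / 3..2 * B\<^sup>2 + c * m} \<Longrightarrow> \<bar>g x\<bar> \<le> G) \<Longrightarrow>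
      \<bar>ref_density u T p \<omega> g \<xi> - area2 E * (\<tau> * \<theta>) * radial_density p \<omega> g r r' t\<bar> \<le>
        area2 E * (\<tau> * \<theta>) * ((\<omega> * (80000000000 * c powr (p - 2) * B\<^sup>2 + 84000 * B\<^sup>2) +
          21000 * (G + L * B\<^sup>2) + 110000 * L * B\<^sup>2) * layer_error p \<tau> \<theta> t)"
proof -
  have f: "0 < t0" "0 < \<tau>" "t0 + \<tau> \<le> 1" "0 < \<theta>" "(t0 + \<tau>) * \<theta>\<^sup>2 \<le> \<kappa> * t0" "\<theta> ^ 4 \<le> \<kappa> * (t0 * \<tau>)" "\<tau>\<^sup>2 \<le> \<kappa> * t0"
    using fine by (auto simp: fine_element_def)
  have ab: "0 \<le> \<xi> $ 1" "0 \<le> \<xi> $ 2" "\<xi> $ 1 + \<xi> $ 2 \<le> 1" using \<xi> by (auto simp: ref_triangle_def)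
  have \<kappa>1: "\<kappa> \<le> 1" using \<kappa> by simp
  define e where "e = interp fst E (\<xi> $ 1) (\<xi> $ 2)"
  have e: "0 \<le> e" "e \<le> 1" using interp_range[OF E ab] by (auto simp: e_def)
  have "\<tau> * e \<le> \<tau>" "0 \<le> \<tau> * e" using e f by (auto simp: mult_left_le)
  then have t: "t0 \<le> t" "0 < t" "t \<le> 1" "t0 + \<tau> \<le> t + \<tau>" using f unfolding t_def e_def by linarith+
  have rt: "c \<le> r t" "r t \<le> B" "m * t \<le> r' t" "r' t \<le> B * t" and Bc: "1 \<le> B" "0 < c" "0 < m"
    using r t by (auto simp: profile_bounds_def)
  define x where "x = polar_x (\<lambda>s. t0 + \<tau> * s) \<theta>"
  define y where "y = polar_y (\<lambda>s. t0 + \<tau> * s) \<theta>"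
  define X where "X = polar_x (\<lambda>s. r (t0 + \<tau> * s)) \<theta>"
  define Y where "Y = polar_y (\<lambda>s. r (t0 + \<tau> * s)) \<theta>"
  define S where "S = (\<lambda>f g. strip_det f g E (\<xi> $ 1) (\<xi> $ 2))"
  define w where "w = \<tau> * \<theta>"
  define j where "j = S x y / w"
  define d where "d = S X Y / w"
  define Q where "Q = ((S X y)\<^sup>2 + (S x X)\<^sup>2 + (S Y y)\<^sup>2 + (S x Y)\<^sup>2) / w\<^sup>2"
  have w: "0 < w" using f by (simp add: w_def)
  define a where "a = area2 E"
  have a: "0 < a" using area2_elems[OF E] by (auto simp: a_def)
  note est = element_estimates[OF fine_element_data[OF fine \<kappa>1] r E ab, folded t_def x_def y_def X_def Y_def w_def]
  define e1 where "e1 = (t0 + \<tau>) * (\<theta>\<^sup>2 + t0 * \<theta> ^ 4 / \<tau>)"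
  define e2 where "e2 = \<tau>\<^sup>2 + \<theta> ^ 4 / \<tau> + (t0 + \<tau>) * \<theta>\<^sup>2"
  define Q0 where "Q0 = (t * r' t)\<^sup>2 + (r t)\<^sup>2"
  have E1: "\<bar>j - t\<bar> \<le> 21000 * e1" using est(1) by (simp add: j_def S_def e1_def)
  have E2: "\<bar>d - r' t * r t\<bar> \<le> 110000 * B\<^sup>2 * e2" using est(2) by (simp add: d_def S_def e2_def)
  have E3: "\<bar>Q - Q0\<bar> \<le> 40000000000 * B\<^sup>2 * (\<tau>\<^sup>2 + \<theta>\<^sup>2 + \<theta> ^ 4 / \<tau>)" using est(3) by (simp add: Q_def Q0_def S_def)
  have h4: "\<theta> ^ 4 / \<tau> \<le> \<kappa> * t0" "0 \<le> \<theta> ^ 4 / \<tau>" using f by (simp_all add: pos_divide_le_eq mult.assoc)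
  have \<kappa>t: "\<kappa> * t0 \<le> \<kappa> * t" "0 \<le> \<kappa> * t0"
  proof -
    show "0 \<le> \<kappa> * t0" using h4 by linarith
    then have "0 \<le> \<kappa>" using f by (simp add: zero_le_mult_iff)
    then show "\<kappa> * t0 \<le> \<kappa> * t" using t by (intro mult_left_mono)
  qed
  have e1: "e1 \<le> 2 * (\<kappa> * t)"
  proof -
    have "(t0 + \<tau>) * (t0 * \<theta> ^ 4 / \<tau>) \<le> 1 * (1 * (\<theta> ^ 4 / \<tau>))"
      unfolding times_divide_eq_right[symmetric] using f h4 by (intro mult_mono) auto
    then show ?thesis unfolding e1_def distrib_left using f h4 \<kappa>t by linarith
  qed
  have e2: "e2 \<le> 3 * (\<kappa> * t)" unfolding e2_def using f h4 \<kappa>t by linarith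
  have j: "t / 2 \<le> j" "j \<le> 3 * t / 2"
  proof -
    have "\<kappa> * t \<le> 1 / 84000 * t" using \<kappa> t by (intro mult_right_mono) auto
    then have "\<bar>j - t\<bar> \<le> t / 2" using E1 e1 by linarith
    then show "t / 2 \<le> j" "j \<le> 3 * t / 2" by linarith+
  qed
  have B2: "0 < B\<^sup>2" using Bc by simp
  have dd: "\<bar>d - r' t * r t\<bar> \<le> c * m * t / 2"
  proof -
    have "110000 * B\<^sup>2 * e2 \<le> 110000 * B\<^sup>2 * (3 * (\<kappa> * t))" using e2 Bc by (intro mult_left_mono) auto
    also have "\<dots> = 330000 * B\<^sup>2 * t * \<kappa>" by simp
    also have "\<dots> \<le> 330000 * B\<^sup>2 * t * (c * m / (660000 * B\<^sup>2))" using \<kappa> t Bc by (intro mult_left_mono) auto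
    also have "\<dots> = c * m * t / 2" using B2 by (simp add: field_simps)
    finally show ?thesis using E2 by simp
  qed
  have d0: "c * m * t \<le> r' t * r t" "r' t * r t \<le> B\<^sup>2 * t"
  proof -
    have "0 \<le> m * t" using Bc t by simp
    then have "(m * t) * c \<le> r' t * r t" "r' t * r t \<le> (B * t) * B" using rt Bc t by (intro mult_mono; linarith)+
    then show "c * m * t \<le> r' t * r t" "r' t * r t \<le> B\<^sup>2 * t" by (simp_all add: mult_ac power2_eq_square)
  qed
  have cmt: "0 < c * m * t" using Bc t by simp
  have d: "c * m * t / 2 \<le> d" "d \<le> B\<^sup>2 * t + c * m * t / 2" using dd d0 by linarith+
  have qd: "quad_det T \<xi> = a * w * j" "quad_det (map_element u T) \<xi> = a * w * d"
    unfolding T_def u_def cavity_strip_elem[OF E f(1,2)] quad_det_strip_elem[OF E] j_def d_def a_def S_def x_def y_def X_def Y_def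
    using w by simp_all
  show q1: "0 < quad_det T \<xi>" "0 < quad_det (map_element u T) \<xi>"
    unfolding qd using a w j d t cmt by (auto intro!: mult_pos_pos)
  assume p: "1 < p" "p < 2" and \<omega>: "0 < \<omega>" and L: "0 \<le> L"
    and lip: "\<And>x y. x \<in> {c * m / 3..2 * B\<^sup>2 + c * m} \<Longrightarrow> y \<in> {c * m / 3..2 * B\<^sup>2 + c * m} \<Longrightarrow> \<bar>g x - g y\<bar> \<le> L * \<bar>x - y\<bar>"
    and G: "\<And>x. x \<in> {c * m / 3..2 * B\<^sup>2 + c * m} \<Longrightarrow> \<bar>g x\<bar> \<le> G"
  have qn: "sqrt (quad_num T (map_element u T) \<xi>) = a * w * sqrt Q"
  proof -
    have "quad_num T (map_element u T) \<xi> = (a * w)\<^sup>2 * Q"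
      unfolding T_def u_def cavity_strip_elem[OF E f(1,2)] quad_num_strip_elem[OF E] Q_def a_def S_def x_def y_def X_def Y_def
      using w by (simp add: power_mult_distrib)
    then show ?thesis using a w by (simp add: real_sqrt_mult)
  qed
  have r1: "a * w * sqrt Q / (a * w * j) = sqrt Q / j" "a * w * d / (a * w * j) = d / j" using a w by simp_all
  have dens: "ref_density u T p \<omega> g \<xi> = a * w * (\<omega> * (j * (sqrt Q / j) powr p) + j * g (d / j))"
    unfolding ref_density_def qn qd r1 by (simp add: algebra_simps)
  have j0: "0 < j" using j t by linarith
  \<comment> \<open>The ends of the interval arise from d \<ge> c m t / 2 over j \<le> 3 t / 2, and
    from d \<le> B^2 t + c m t / 2 over j \<ge> t / 2.\<close>
  have dj: "d / j \<in> {c * m / 3..2 * B\<^sup>2 + c * m}"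
  proof -
    have "c * m / 3 * j \<le> c * m / 3 * (3 * t / 2)" using j Bc by (intro mult_left_mono) auto
    then have 1: "c * m / 3 * j \<le> d" using d by simp
    have "(2 * B\<^sup>2 + c * m) * (t / 2) \<le> (2 * B\<^sup>2 + c * m) * j" using j Bc by (intro mult_left_mono) auto
    moreover have "(2 * B\<^sup>2 + c * m) * (t / 2) = B\<^sup>2 * t + c * m * t / 2" by (simp add: field_simps)
    ultimately have 2: "d \<le> (2 * B\<^sup>2 + c * m) * j" using d by linarith
    show ?thesis using 1 2 j0 by (simp add: pos_le_divide_eq pos_divide_le_eq)
  qed
  have d0t: "r' t * r t / t \<in> {c * m / 3..2 * B\<^sup>2 + c * m}"
  proof -
    have "c * m \<le> r' t * r t / t" "r' t * r t / t \<le> B\<^sup>2" using d0 t by (simp_all add: pos_le_divide_eq pos_divide_le_eq)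
    moreover have "0 < c * m" using Bc by simp
    ultimately show ?thesis unfolding atLeastAtMost_iff using B2 by (intro conjI; linarith)
  qed
  have Q0: "c\<^sup>2 \<le> Q0" "Q0 \<le> 2 * B\<^sup>2"
  proof -
    have rr: "0 \<le> r' t" "0 \<le> r t" using d0 rt Bc t by (meson less_imp_le mult_pos_pos order_trans)+
    have "c\<^sup>2 \<le> (r t)\<^sup>2" "(r t)\<^sup>2 \<le> B\<^sup>2" using rt Bc rr by (intro power_mono; simp)+
    moreover have "t * r' t \<le> 1 * (B * 1)"
      using rt t rr Bc by (intro mult_mono order_trans[OF rt(4)]) auto
    then have "(t * r' t)\<^sup>2 \<le> B\<^sup>2" using rr t by (intro power_mono) auto
    ultimately show "c\<^sup>2 \<le> Q0" "Q0 \<le> 2 * B\<^sup>2" by (simp_all add: Q0_def add_increasing)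
  qed
  have Q: "0 \<le> Q" by (simp add: Q_def)
  have B1: "1 \<le> 2 * B\<^sup>2" using one_le_power[OF Bc(1), of 2] by linarith
  define t1p where "t1p = t powr (1 - p)"
  define tp where "tp = t powr (- p)"
  define err where "err = layer_error p \<tau> \<theta> t"
  have tp: "t1p = t * tp" "1 \<le> t1p" "1 \<le> tp"
  proof -
    show "t1p = t * tp" using t by (simp add: t1p_def tp_def powr_diff powr_minus divide_inverse)
    show "1 \<le> t1p" "1 \<le> tp" unfolding t1p_def tp_def using t p powr_mono2'[of "1 - p" t 1] powr_mono2'[of "- p" t 1] by simp_all
  qed
  have err: "err = t1p * (\<tau>\<^sup>2 + \<theta>\<^sup>2 + \<theta> ^ 4 / \<tau>) + tp * (\<tau> * \<theta>\<^sup>2)" by (simp add: err_def layer_error_def t1p_def tp_def)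
  have nn: "0 \<le> tp * (\<tau> * \<theta>\<^sup>2)" "0 \<le> t1p * \<tau>\<^sup>2" "0 \<le> t1p * \<theta>\<^sup>2" "0 \<le> t1p * (\<theta> ^ 4 / \<tau>)"
    using tp f h4 by (auto intro!: mult_nonneg_nonneg)
  \<comment> \<open>In \<open>e1\<close> the outer radius t0 + \<tau> is replaced by t + \<tau>: the
    part t turns t^(-p) into t^(1-p), and the part \<tau> produces the last term of
    \<open>layer_error\<close>.\<close>
  have A1: "tp * e1 \<le> err"
  proof -
    have "(t0 + \<tau>) * \<theta>\<^sup>2 \<le> (t + \<tau>) * \<theta>\<^sup>2" using t by (intro mult_right_mono) auto
    moreover have "(t0 + \<tau>) * (t0 * \<theta> ^ 4 / \<tau>) \<le> 1 * (t * (\<theta> ^ 4 / \<tau>))"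
      unfolding times_divide_eq_right[symmetric] using f h4 t by (intro mult_mono) auto
    ultimately have "e1 \<le> (t + \<tau>) * \<theta>\<^sup>2 + t * (\<theta> ^ 4 / \<tau>)" unfolding e1_def distrib_left by linarith
    then have "tp * e1 \<le> tp * ((t + \<tau>) * \<theta>\<^sup>2 + t * (\<theta> ^ 4 / \<tau>))" using tp by (intro mult_left_mono) auto
    also have "\<dots> = t1p * \<theta>\<^sup>2 + t1p * (\<theta> ^ 4 / \<tau>) + tp * (\<tau> * \<theta>\<^sup>2)" unfolding tp(1) by (simp add: algebra_simps)
    finally show ?thesis unfolding err using nn by (simp only: distrib_left)
  qed
  have A2: "e2 \<le> err"
  proof -
    have "(t0 + \<tau>) * \<theta>\<^sup>2 \<le> 1 * \<theta>\<^sup>2" using f by (intro mult_right_mono) auto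
    then have e: "e2 \<le> \<tau>\<^sup>2 + \<theta>\<^sup>2 + \<theta> ^ 4 / \<tau>" unfolding e2_def by linarith
    have "1 * (\<tau>\<^sup>2 + \<theta>\<^sup>2 + \<theta> ^ 4 / \<tau>) \<le> t1p * (\<tau>\<^sup>2 + \<theta>\<^sup>2 + \<theta> ^ 4 / \<tau>)" using tp h4 by (intro mult_right_mono) auto
    then have "e2 \<le> t1p * (\<tau>\<^sup>2 + \<theta>\<^sup>2 + \<theta> ^ 4 / \<tau>)" unfolding mult_1_left by (rule order_trans[OF e])
    then show ?thesis unfolding err by (rule add_increasing2[OF nn(1)])
  qed
  have A3: "t1p * \<bar>Q - Q0\<bar> \<le> 40000000000 * B\<^sup>2 * err"
  proof -
    have "t1p * \<bar>Q - Q0\<bar> \<le> t1p * (40000000000 * B\<^sup>2 * (\<tau>\<^sup>2 + \<theta>\<^sup>2 + \<theta> ^ 4 / \<tau>))" using E3 tp by (intro mult_left_mono) auto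
    also have "\<dots> = 40000000000 * B\<^sup>2 * (t1p * (\<tau>\<^sup>2 + \<theta>\<^sup>2 + \<theta> ^ 4 / \<tau>))" by (simp only: mult_ac)
    also have "\<dots> \<le> 40000000000 * B\<^sup>2 * err" unfolding err using nn B2 by (intro mult_left_mono) auto
    finally show ?thesis .
  qed
  have A4: "tp * \<bar>j - t\<bar> \<le> 21000 * err"
  proof -
    have "tp * \<bar>j - t\<bar> \<le> tp * (21000 * e1)" using E1 tp by (intro mult_left_mono) auto
    then show ?thesis using A1 by linarith
  qed
  have A5: "\<bar>j - t\<bar> \<le> 21000 * err"
  proof -
    have "1 * \<bar>j - t\<bar> \<le> tp * \<bar>j - t\<bar>" using tp by (intro mult_right_mono) auto
    then show ?thesis using A4 by simp
  qed
  have A6: "\<bar>d - r' t * r t\<bar> \<le> 110000 * B\<^sup>2 * err"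
    using E2 mult_left_mono[OF A2, of "110000 * B\<^sup>2"] by simp
  have V1: "\<bar>j * (sqrt Q / j) powr p - t * (sqrt Q0 / t) powr p\<bar> \<le>
      2 * c powr (p - 2) * (40000000000 * B\<^sup>2 * err) + 2 * (2 * B\<^sup>2) * (21000 * err)"
    by (rule order_trans[OF gradient_density_estimate[OF p t(2) j(1) Q Bc(2) Q0 B1, folded t1p_def tp_def]
      add_mono[OF mult_left_mono[OF A3] mult_left_mono[OF A4]]]) simp_all
  have G0: "0 \<le> G" using G[OF dj] by simp
  have V2: "\<bar>j * g (d / j) - t * g (r' t * r t / t)\<bar> \<le> (G + L * B\<^sup>2) * (21000 * err) + L * (110000 * B\<^sup>2 * err)"
  proof -
    have "0 \<le> r' t * r t" using d0 cmt by linarith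
    from volume_density_estimate[OF t(2) j0 lip[OF dj d0t] G[OF d0t] this d0(2) L]
    have "\<bar>j * g (d / j) - t * g (r' t * r t / t)\<bar> \<le> (G + L * B\<^sup>2) * \<bar>j - t\<bar> + L * \<bar>d - r' t * r t\<bar>" .
    also have "\<dots> \<le> (G + L * B\<^sup>2) * (21000 * err) + L * (110000 * B\<^sup>2 * err)"
      using A5 A6 G0 L by (intro add_mono mult_left_mono) auto
    finally show ?thesis .
  qed
  define R where "R = \<omega> * (80000000000 * c powr (p - 2) * B\<^sup>2 + 84000 * B\<^sup>2) + 21000 * (G + L * B\<^sup>2) + 110000 * L * B\<^sup>2"
  have "\<bar>(\<omega> * (j * (sqrt Q / j) powr p) + j * g (d / j)) - radial_density p \<omega> g r r' t\<bar> =
    \<bar>\<omega> * (j * (sqrt Q / j) powr p - t * (sqrt Q0 / t) powr p) + (j * g (d / j) - t * g (r' t * r t / t))\<bar>"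
    unfolding radial_density_def Q0_def by (simp add: algebra_simps)
  also have "\<dots> \<le> \<omega> * \<bar>j * (sqrt Q / j) powr p - t * (sqrt Q0 / t) powr p\<bar> + \<bar>j * g (d / j) - t * g (r' t * r t / t)\<bar>"
    by (rule order_trans[OF abs_triangle_ineq]) (use \<omega> in \<open>simp add: abs_mult\<close>)
  also have "\<dots> \<le> \<omega> * (2 * c powr (p - 2) * (40000000000 * B\<^sup>2 * err) + 2 * (2 * B\<^sup>2) * (21000 * err)) +
      ((G + L * B\<^sup>2) * (21000 * err) + L * (110000 * B\<^sup>2 * err))"
    using V1 V2 \<omega> by (intro add_mono mult_left_mono) auto
  also have "\<dots> = R * err" by (simp add: R_def algebra_simps)
  finally have fin: "\<bar>(\<omega> * (j * (sqrt Q / j) powr p) + j * g (d / j)) - radial_density p \<omega> g r r' t\<bar> \<le> R * err" .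
  have "\<bar>ref_density u T p \<omega> g \<xi> - a * w * radial_density p \<omega> g r r' t\<bar> =
    a * w * \<bar>(\<omega> * (j * (sqrt Q / j) powr p) + j * g (d / j)) - radial_density p \<omega> g r r' t\<bar>"
    unfolding dens right_diff_distrib[symmetric] using a w by (simp add: abs_mult)
  also have "\<dots> \<le> a * w * (R * err)" using fin a w by (intro mult_left_mono) auto
  finally show "\<bar>ref_density u T p \<omega> g \<xi> - area2 E * (\<tau> * \<theta>) * radial_density p \<omega> g r r' t\<bar> \<le>
        area2 E * (\<tau> * \<theta>) * ((\<omega> * (80000000000 * c powr (p - 2) * B\<^sup>2 + 84000 * B\<^sup>2) +
          21000 * (G + L * B\<^sup>2) + 110000 * L * B\<^sup>2) * layer_error p \<tau> \<theta> t)"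
    unfolding a_def w_def R_def err_def .
qed

section \<open>Summation of the local errors over the layers\<close>

lemma has_integral_powr_interval:
  fixes a b k :: real
  assumes "0 < a" "a \<le> b" "k \<noteq> 0"
  shows "((\<lambda>t. t powr (k - 1)) has_integral (b powr k - a powr k) / k) {a..b}"
proof -
  have "((\<lambda>t. t powr (k - 1)) has_integral (b powr k / k - a powr k / k)) {a..b}"
  proof (rule fundamental_theorem_of_calculus[OF assms(2)])
    fix x assume "x \<in> {a..b}"
    then have x: "0 < x" using assms by simp
    have "((\<lambda>t. t powr k / k) has_real_derivative x powr (k - 1)) (at x)"
      using x assms(3) by (auto intro!: derivative_eq_intros)
    then show "((\<lambda>t. t powr k / k) has_vector_derivative x powr (k - 1)) (at x within {a..b})"
      by (simp add: has_real_derivative_iff_has_vector_derivative has_vector_derivative_at_within)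
  qed
  then show ?thesis by (simp add: diff_divide_distrib)
qed

context strategy
begin

definition layer_int :: "(real \<Rightarrow> real) \<Rightarrow> nat \<Rightarrow> real" where
  "layer_int f i = integral {\<epsilon> i..\<epsilon> i + \<tau> i} f"

lemma layer_int_sum:
  assumes f: "continuous_on {0<..1} f"
  shows "(\<Sum>i\<le>m. layer_int f i) = integral {\<epsilon> 0..1} f"
proof -
  have "(\<Sum>i\<le>j. layer_int f i) = integral {\<epsilon> 0..\<epsilon> j + \<tau> j} f" if "j \<le> m" for j
    using that
  proof (induction j)
    case (Suc j)
    have o: "\<epsilon> 0 \<le> \<epsilon> (Suc j)" "\<epsilon> (Suc j) \<le> \<epsilon> (Suc j) + \<tau> (Suc j)" "\<epsilon> (Suc j) + \<tau> (Suc j) \<le> 1" "\<epsilon> j + \<tau> j = \<epsilon> (Suc j)"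
      using \<epsilon>_le[of 0 "Suc j"] step[of "Suc j"] outer_le[of "Suc j"] next_layer[of j] Suc.prems by auto
    have "f integrable_on {\<epsilon> 0..\<epsilon> (Suc j) + \<tau> (Suc j)}"
      by (intro integrable_continuous_real continuous_on_subset[OF f]) (use o pos in auto)
    then show ?case using Suc Henstock_Kurzweil_Integration.integral_combine[OF o(1,2), of f] o(4) by (simp add: layer_int_def)
  qed (simp add: layer_int_def)
  from this[of m] show ?thesis by (simp add: last_layer)
qed

lemma layer_interval: "i \<le> m \<Longrightarrow> {\<epsilon> i..\<epsilon> i + \<tau> i} \<subseteq> {0<..1}"
  using step[of i] outer_le[of i] by auto

text \<open>The layers add up to the integral of t^(s-1) from \<epsilon> 0 to 1, which is (1 -
  (\<epsilon> 0)^s) / s \<le> (1 - \<epsilon> 0) / s as s \<le> 1. The factor 1 - \<epsilon> 0 is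
  what makes the relative error uniform in the inner radius. For single layers the lower bound holds
  because t^(s-1) decreases.\<close>

lemma layer_int_powr:
  assumes "0 < s" "s \<le> 1"
  shows "(\<Sum>i\<le>m. layer_int (\<lambda>t. t powr (s - 1)) i) \<le> (1 - \<epsilon> 0) / s"
    and "i \<le> m \<Longrightarrow> \<tau> i * (\<epsilon> i + \<tau> i) powr (s - 1) \<le> layer_int (\<lambda>t. t powr (s - 1)) i"
    and "i \<le> m \<Longrightarrow> 0 \<le> layer_int (\<lambda>t. t powr (s - 1)) i"
proof -
  have c: "continuous_on {0<..1} (\<lambda>t :: real. t powr (s - 1))" by (intro continuous_intros) auto
  have e: "0 < \<epsilon> 0" "\<epsilon> 0 \<le> 1" using outer_le[of 0] step[of 0] by auto
  have "\<epsilon> 0 powr 1 \<le> \<epsilon> 0 powr s" using e assms by (intro powr_mono') auto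
  then show "(\<Sum>i\<le>m. layer_int (\<lambda>t. t powr (s - 1)) i) \<le> (1 - \<epsilon> 0) / s"
    unfolding layer_int_sum[OF c] using integral_unique[OF has_integral_powr_interval[of "\<epsilon> 0" 1 s]] e assms
    by (simp add: divide_right_mono)
  show "\<tau> i * (\<epsilon> i + \<tau> i) powr (s - 1) \<le> layer_int (\<lambda>t. t powr (s - 1)) i" if i: "i \<le> m"
  proof -
    have "integral {\<epsilon> i..\<epsilon> i + \<tau> i} (\<lambda>t. (\<epsilon> i + \<tau> i) powr (s - 1)) \<le> layer_int (\<lambda>t. t powr (s - 1)) i"
      unfolding layer_int_def
    proof (rule integral_le)
      show "(\<lambda>t. t powr (s - 1)) integrable_on {\<epsilon> i..\<epsilon> i + \<tau> i}"
        by (intro integrable_continuous_real continuous_on_subset[OF c] layer_interval i)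
      show "(\<epsilon> i + \<tau> i) powr (s - 1) \<le> t powr (s - 1)" if "t \<in> {\<epsilon> i..\<epsilon> i + \<tau> i}" for t
        using that step[OF i] assms by (intro powr_mono2') auto
    qed (auto intro!: integrable_continuous_real continuous_intros)
    then show ?thesis using step[OF i] by simp
  qed
  moreover have "0 \<le> \<tau> i * (\<epsilon> i + \<tau> i) powr (s - 1)" if "i \<le> m" for i using step[OF that] by simp
  ultimately show "0 \<le> layer_int (\<lambda>t. t powr (s - 1)) i" if "i \<le> m" using that by (meson order_trans)
qed

text \<open>The mean value theorem for z^(1 / (2 - p)) between \<epsilon>^(2-p) and \<epsilon>^(2-p)
  + C h, where z stays below 2.\<close>

lemma \<tau>_far:
  assumes i: "i \<le> m" and Ch: "C * h \<le> 1"
  shows "\<tau> i \<le> C / (2 - p) * 2 powr (1 / (2 - p)) * h"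
proof -
  define q where "q = 2 - p"
  have q: "0 < q" "q < 1" using p by (auto simp: q_def)
  define x where "x = \<epsilon> i"
  have x: "0 < x" "x \<le> 1" using outer_le[OF i] step[OF i] by (auto simp: x_def)
  define a where "a = x powr q"
  have a: "0 < a" "a \<le> 1" "a powr (1 / q) = x" using x q powr_mono2[of q x 1] by (auto simp: a_def powr_powr)
  have Ch0: "0 < C * h" using pos by simp
  have "\<exists>z. a < z \<and> z < a + C * h \<and> (a + C * h) powr (1 / q) - a powr (1 / q) = (a + C * h - a) * (1 / q * z powr (1 / q - 1))"
  proof (rule MVT2)
    show "a < a + C * h" using Ch0 by simp
    fix z assume "a \<le> z"
    then show "((\<lambda>z. z powr (1 / q)) has_real_derivative 1 / q * z powr (1 / q - 1)) (at z)"
      using a by (auto intro!: derivative_eq_intros)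
  qed
  then obtain z where z: "a < z" "z < a + C * h" "(a + C * h) powr (1 / q) - x = C * h * (1 / q * z powr (1 / q - 1))"
    using a(3) by auto
  have "z powr (1 / q - 1) \<le> 2 powr (1 / q - 1)" using z a Ch q by (intro powr_mono2) auto
  also have "\<dots> \<le> 2 powr (1 / q)" by (intro powr_mono) auto
  finally have "C * h * (1 / q * z powr (1 / q - 1)) \<le> C * h * (1 / q * 2 powr (1 / q))"
    using Ch0 q by (intro mult_left_mono) auto
  moreover have "\<tau> i \<le> (a + C * h) powr (1 / q) - x" using step[OF i] by (simp add: far_step_def a_def q_def x_def)
  ultimately show ?thesis using z(3) unfolding q_def[symmetric] by (simp add: mult_ac)
qed

text \<open>With y = \<epsilon> + \<tau> the step rule says y^(2-p) \<le> \<epsilon>^(2-p) + C h.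
  Since \<epsilon> < y / 2, the first term is absorbed at the price of the factor 1 -
  2^(p-2).\<close>

lemma thick_layer:
  assumes i: "i \<le> m" and thick: "\<epsilon> i < \<tau> i"
  shows "\<tau> i powr (2 - p) \<le> C / (1 - 2 powr (p - 2)) * h"
proof -
  define q where "q = 2 - p"
  have q: "0 < q" using p by (auto simp: q_def)
  define x where "x = \<epsilon> i"
  define y where "y = x + \<tau> i"
  have x: "0 < x" "0 < \<tau> i" "x < \<tau> i" using step[OF i] thick by (auto simp: x_def)
  have "y \<le> (x powr q + C * h) powr (1 / q)" using step[OF i] by (simp add: far_step_def q_def x_def y_def)
  then have "y powr q \<le> ((x powr q + C * h) powr (1 / q)) powr q" using x q by (intro powr_mono2) (auto simp: y_def)
  also have "\<dots> = x powr q + C * h" using q pos by (simp add: powr_powr add_nonneg_nonneg)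
  also have "x powr q \<le> (y / 2) powr q" using x q by (intro powr_mono2) (auto simp: y_def)
  also have "\<dots> = y powr q * 2 powr (p - 2)"
  proof -
    have "(y / 2) powr q = y powr q / 2 powr q" using x by (simp add: powr_divide y_def)
    moreover have "p - 2 = - q" by (simp add: q_def)
    ultimately show ?thesis by (simp only: powr_minus divide_inverse)
  qed
  finally have *: "y powr q * (1 - 2 powr (p - 2)) \<le> C * h" by (simp add: right_diff_distrib)
  have "2 powr (p - 2) < (2::real) powr 0" using p by (intro powr_less_mono) auto
  then have "y powr q \<le> C / (1 - 2 powr (p - 2)) * h" using * by (simp add: pos_le_divide_eq)
  moreover have "\<tau> i powr q \<le> y powr q" using x q by (intro powr_mono2) (auto simp: y_def)
  ultimately show ?thesis by (simp add: q_def)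
qed

text \<open>From \<theta>^2 \<le> 10 sqrt (\<epsilon> \<tau>), and since t^(-p) has integral at most
  \<epsilon>^(1-p) / (p - 1), the left-hand side is of order \<tau>^(3/2) \<epsilon>^(3/2 - p). If p
  \<le> 3/2, use \<epsilon> < \<tau>; otherwise use \<epsilon> \<ge> \<tau>^2, a consequence of
  \<tau> \<le> C1 sqrt \<epsilon>. Both lead to \<tau>^(2 (2 - p) + s) with s = min (p - 1) (1/2).
  By \<open>thick_layer\<close> the power 2 (2 - p) is O(h^2), and \<tau>^s is at most twice the
  integral of t^(s-1) over the layer, which can be summed.\<close>

lemma thick_layer_error:
  assumes i: "i \<le> m" and thick: "\<epsilon> i < \<tau> i" and C12: "C1 \<le> 1" "C2 \<le> 1"
  defines "s \<equiv> min (p - 1) (1 / 2)"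
  shows "\<tau> i * (\<theta> i)\<^sup>2 * layer_int (\<lambda>t. t powr (- p)) i \<le>
    20 / (p - 1) * (C / (1 - 2 powr (p - 2)))\<^sup>2 * h\<^sup>2 * layer_int (\<lambda>t. t powr (s - 1)) i"
proof -
  define e where "e = \<epsilon> i"
  define t where "t = \<tau> i"
  have et: "0 < e" "0 < t" "e < t" "t \<le> C1 * sqrt e" "t \<le> 1" using step[OF i] outer_le[OF i] thick by (auto simp: e_def t_def)
  have s: "0 < s" "s \<le> 1" using p by (auto simp: s_def)
  have "t \<le> 1 * sqrt e" by (rule order_trans[OF et(4) mult_right_mono]) (use C12 et in auto)
  then have "t * t \<le> sqrt e * sqrt e" using et by (intro mult_mono) auto
  then have t2: "t powr 2 \<le> e" using et by (simp add: power2_eq_square)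
  have *: "t * sqrt (e * t) * e powr (1 - p) \<le> (t powr (2 - p))\<^sup>2 * t powr s"
  proof -
    have "t * sqrt (e * t) * e powr (1 - p) = t powr (3 / 2) * e powr (3 / 2 - p)"
    proof -
      have "t * sqrt (e * t) * e powr (1 - p) = (t powr 1 * t powr (1 / 2)) * (e powr (1 / 2) * e powr (1 - p))"
        using et by (simp add: real_sqrt_mult powr_half_sqrt)
      then show ?thesis unfolding powr_add[symmetric] by simp
    qed
    also have "\<dots> \<le> t powr (3 / 2) * t powr (if p - 1 \<le> 1 / 2 then 3 / 2 - p else 2 * (3 / 2 - p))"
    proof (intro mult_left_mono)
      show "e powr (3 / 2 - p) \<le> t powr (if p - 1 \<le> 1 / 2 then 3 / 2 - p else 2 * (3 / 2 - p))"
      proof (cases "p - 1 \<le> 1 / 2")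
        case True
        then show ?thesis using et by (auto intro: powr_mono2)
      next
        case False
        then have "e powr (3 / 2 - p) \<le> (t powr 2) powr (3 / 2 - p)" using et t2 by (intro powr_mono2') auto
        then show ?thesis using False by (simp only: powr_powr if_False)
      qed
    qed simp
    also have "\<dots> = t powr (2 * (2 - p) + s)"
      unfolding powr_add[symmetric] s_def by (rule arg_cong[where f = "\<lambda>z. t powr z"]) (auto simp: min_def field_simps)
    also have "\<dots> = (t powr (2 - p))\<^sup>2 * t powr s"
    proof -
      have "2 * (2 - p) + s = (2 - p) + (2 - p) + s" by simp
      then show ?thesis by (simp only: powr_add power2_eq_square)
    qed
    finally show ?thesis .
  qed
  have J: "t powr s \<le> 2 * layer_int (\<lambda>t. t powr (s - 1)) i"
  proof -
    have "(2 * t) powr (s - 1) \<le> (e + t) powr (s - 1)" using et s by (intro powr_mono2') auto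
    then have "t * (2 * t) powr (s - 1) \<le> layer_int (\<lambda>t. t powr (s - 1)) i"
      using layer_int_powr(2)[OF s i] et unfolding e_def t_def by (meson less_imp_le mult_left_mono order_trans)
    moreover have "t * (2 * t) powr (s - 1) = t powr s * 2 powr (s - 1)"
      using et by (simp add: powr_mult powr_diff)
    moreover have "t powr s * 2 powr (- 1) \<le> t powr s * 2 powr (s - 1)" using s by (intro mult_left_mono powr_mono) auto
    ultimately show ?thesis by (simp add: powr_minus)
  qed
  define Kq where "Kq = C / (1 - 2 powr (p - 2))"
  have tq: "(t powr (2 - p))\<^sup>2 \<le> (Kq * h)\<^sup>2"
    using thick_layer[OF i thick] by (intro power_mono) (auto simp: Kq_def t_def)
  have I: "layer_int (\<lambda>t. t powr (- p)) i \<le> e powr (1 - p) / (p - 1)"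
  proof -
    have "layer_int (\<lambda>t. t powr (- p)) i = ((e + t) powr (1 - p) - e powr (1 - p)) / (1 - p)"
      using integral_unique[OF has_integral_powr_interval[of e "e + t" "1 - p"]] et p
      by (simp add: layer_int_def e_def t_def)
    also have "\<dots> = (e powr (1 - p) - (e + t) powr (1 - p)) / (p - 1)" using p by (simp add: field_simps)
    also have "\<dots> \<le> e powr (1 - p) / (p - 1)" using p by (intro divide_right_mono) auto
    finally show ?thesis .
  qed
  have I0: "0 \<le> layer_int (\<lambda>t. t powr (- p)) i" unfolding layer_int_def by (rule Henstock_Kurzweil_Integration.integral_nonneg)
      (use et in \<open>auto intro!: integrable_continuous_real continuous_intros simp: e_def[symmetric] t_def[symmetric]\<close>)
  have th: "(\<theta> i)\<^sup>2 \<le> 10 * sqrt (e * t)"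
  proof -
    have "C2\<^sup>2 \<le> 1\<^sup>2" using C12 pos by (intro power_mono) auto
    then have "10 * C2\<^sup>2 * sqrt (e * t) \<le> 10 * 1 * sqrt (e * t)" using et by (intro mult_right_mono mult_left_mono) auto
    then show ?thesis using \<theta>_bounds(4)[OF i] by (simp add: e_def t_def)
  qed
  have "t * (\<theta> i)\<^sup>2 * layer_int (\<lambda>t. t powr (- p)) i \<le> t * (10 * sqrt (e * t)) * (e powr (1 - p) / (p - 1))"
    using th I I0 et p by (intro mult_mono) auto
  also have "\<dots> = 10 / (p - 1) * (t * sqrt (e * t) * e powr (1 - p))" by simp
  also have "\<dots> \<le> 10 / (p - 1) * ((Kq * h)\<^sup>2 * (2 * layer_int (\<lambda>t. t powr (s - 1)) i))"
    using p by (intro mult_left_mono order_trans[OF * mult_mono[OF tq J]]) auto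
  also have "\<dots> = 20 / (p - 1) * Kq\<^sup>2 * h\<^sup>2 * layer_int (\<lambda>t. t powr (s - 1)) i" by (simp add: power_mult_distrib)
  finally show ?thesis by (simp add: Kq_def t_def)
qed

lemma layer_error_bound:
  assumes i: "i \<le> m" and Ch: "C * h \<le> 1" and C12: "C1 \<le> 1" "C2 \<le> 1"
  defines "s \<equiv> min (p - 1) (1 / 2)"
    and "J \<equiv> \<lambda>k. layer_int (\<lambda>t. t powr (k - 1))"
    and "Kf \<equiv> C / (2 - p) * 2 powr (1 / (2 - p))" and "Kb \<equiv> 20 / (p - 1) * (C / (1 - 2 powr (p - 2)))\<^sup>2"
  shows "layer_int (layer_error p (\<tau> i) (\<theta> i)) i \<le>
    (Kf\<^sup>2 + 20 * A2\<^sup>2 + 100 * C\<^sup>2) * h\<^sup>2 * J (2 - p) i + Kb * h\<^sup>2 * J s i +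
    (if i = m \<and> 0 < m then 100 * C\<^sup>2 * h\<^sup>2 * J (2 - p) (m - 1) else 0)"
proof -
  have q: "0 < 2 - p" "2 - p \<le> 1" and s: "0 < s" "s \<le> 1" using p by (auto simp: s_def)
  have et: "0 < \<epsilon> i" "0 < \<tau> i" using step[OF i] by auto
  note \<theta> = \<theta>_bounds[OF i]
  have c1: "(\<lambda>t. t powr (1 - p)) integrable_on {\<epsilon> i..\<epsilon> i + \<tau> i}" "(\<lambda>t. t powr (- p)) integrable_on {\<epsilon> i..\<epsilon> i + \<tau> i}"
    using et by (auto intro!: integrable_continuous_real continuous_intros)
  have J1: "J (2 - p) k = layer_int (\<lambda>t. t powr (1 - p)) k" for k by (simp add: J_def)
  have J0: "0 \<le> J (2 - p) k" "0 \<le> J s k" if "k \<le> m" for k unfolding J_def by (rule layer_int_powr(3)[OF q that], rule layer_int_powr(3)[OF s that])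
  have main: "layer_int (layer_error p (\<tau> i) (\<theta> i)) i =
      J (2 - p) i * ((\<tau> i)\<^sup>2 + (\<theta> i)\<^sup>2 + \<theta> i ^ 4 / \<tau> i) + layer_int (\<lambda>t. t powr (- p)) i * (\<tau> i * (\<theta> i)\<^sup>2)"
    unfolding J1 layer_int_def layer_error_def using c1
    by (subst Henstock_Kurzweil_Integration.integral_add) (auto intro!: integrable_on_mult_left)
  have T1: "J (2 - p) i * (\<tau> i)\<^sup>2 \<le> Kf\<^sup>2 * h\<^sup>2 * J (2 - p) i"
  proof -
    have "(\<tau> i)\<^sup>2 \<le> (Kf * h)\<^sup>2" using \<tau>_far[OF i Ch] et by (intro power_mono) (auto simp: Kf_def)
    then have "(\<tau> i)\<^sup>2 * J (2 - p) i \<le> (Kf * h)\<^sup>2 * J (2 - p) i" using J0[OF i] by (intro mult_right_mono)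
    then show ?thesis by (simp add: power_mult_distrib mult.commute)
  qed
  have T2: "J (2 - p) i * (\<theta> i)\<^sup>2 \<le> 10 * A2\<^sup>2 * h\<^sup>2 * J (2 - p) i"
    using mult_right_mono[OF \<theta>(2) J0(1)[OF i]] by (simp only: mult.commute)
  have T3: "J (2 - p) i * (\<theta> i ^ 4 / \<tau> i) \<le> 100 * C\<^sup>2 * h\<^sup>2 * J (2 - p) i +
    (if i = m \<and> 0 < m then 100 * C\<^sup>2 * h\<^sup>2 * J (2 - p) (m - 1) else 0)"
    using \<theta>(5)
  proof (elim disjE conjE)
    assume "\<theta> i ^ 4 \<le> 100 * C\<^sup>2 * h\<^sup>2 * \<tau> i"
    then have "\<theta> i ^ 4 / \<tau> i \<le> 100 * C\<^sup>2 * h\<^sup>2" using et by (simp add: pos_divide_le_eq)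
    from mult_right_mono[OF this J0(1)[OF i]]
    have "J (2 - p) i * (\<theta> i ^ 4 / \<tau> i) \<le> 100 * C\<^sup>2 * h\<^sup>2 * J (2 - p) i" by (simp only: mult.commute)
    moreover have "0 \<le> (if i = m \<and> 0 < m then 100 * C\<^sup>2 * h\<^sup>2 * J (2 - p) (m - 1) else 0)" using J0(1)[of "m - 1"] by simp
    ultimately show ?thesis by linarith
  next
    \<comment> \<open>The last layer with inherited N: the integral of t^(1-p) over it is at most
      \<tau> m (\<epsilon> m)^(1-p), so the small divisor \<tau> m cancels. The remaining \<tau> (m
      - 1) (\<epsilon> m)^(1-p) is charged to layer m - 1, whose outer radius is \<epsilon>
      m.\<close>
    assume m: "i = m" "0 < m" and th: "\<theta> m ^ 4 \<le> 100 * C\<^sup>2 * h\<^sup>2 * \<tau> (m - 1)"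
    have em: "\<epsilon> (m - 1) + \<tau> (m - 1) = \<epsilon> m" using next_layer[of "m - 1"] m by simp
    have "J (2 - p) m \<le> \<tau> m * \<epsilon> m powr (1 - p)"
    proof -
      have "layer_int (\<lambda>t. t powr (1 - p)) m \<le> integral {\<epsilon> m..\<epsilon> m + \<tau> m} (\<lambda>t. \<epsilon> m powr (1 - p))"
        unfolding layer_int_def
      proof (rule integral_le)
        show "(\<lambda>t. t powr (1 - p)) integrable_on {\<epsilon> m..\<epsilon> m + \<tau> m}" using c1 m by simp
        show "t powr (1 - p) \<le> \<epsilon> m powr (1 - p)" if "t \<in> {\<epsilon> m..\<epsilon> m + \<tau> m}" for t
          using that et m p by (intro powr_mono2') auto
      qed (auto intro!: integrable_continuous_real continuous_intros)
      then show ?thesis unfolding J1 using et m by simp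
    qed
    then have "J (2 - p) m * (\<theta> m ^ 4 / \<tau> m) \<le> \<tau> m * \<epsilon> m powr (1 - p) * (\<theta> m ^ 4 / \<tau> m)"
      using et m \<theta>(1) by (intro mult_right_mono) auto
    also have "\<dots> = \<epsilon> m powr (1 - p) * \<theta> m ^ 4" using et m by simp
    also have "\<dots> \<le> \<epsilon> m powr (1 - p) * (100 * C\<^sup>2 * h\<^sup>2 * \<tau> (m - 1))" using th by (intro mult_left_mono) auto
    also have "\<dots> = 100 * C\<^sup>2 * h\<^sup>2 * (\<tau> (m - 1) * (\<epsilon> (m - 1) + \<tau> (m - 1)) powr ((2 - p) - 1))" unfolding em by simp
    also have "\<dots> \<le> 100 * C\<^sup>2 * h\<^sup>2 * J (2 - p) (m - 1)"
      unfolding J_def by (intro mult_left_mono layer_int_powr(2) q) auto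
    also have "\<dots> \<le> 100 * C\<^sup>2 * h\<^sup>2 * J (2 - p) i + 100 * C\<^sup>2 * h\<^sup>2 * J (2 - p) (m - 1)" using J0(1)[OF i] by simp
    finally show ?thesis using m by simp
  qed
  \<comment> \<open>If \<tau> \<le> \<epsilon>, then \<tau> \<le> t throughout the layer and t^(-p)
    \<tau> \<le> t^(1-p); the other layers are the thick ones.\<close>
  have T4: "layer_int (\<lambda>t. t powr (- p)) i * (\<tau> i * (\<theta> i)\<^sup>2) \<le> 10 * A2\<^sup>2 * h\<^sup>2 * J (2 - p) i + Kb * h\<^sup>2 * J s i"
  proof (cases "\<epsilon> i < \<tau> i")
    case True
    have "layer_int (\<lambda>t. t powr (- p)) i * (\<tau> i * (\<theta> i)\<^sup>2) \<le> Kb * h\<^sup>2 * J s i"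
      using thick_layer_error[OF i True C12, folded s_def Kb_def] unfolding J_def by (simp only: mult.commute)
    moreover have "0 \<le> 10 * A2\<^sup>2 * h\<^sup>2 * J (2 - p) i" using J0[OF i] by simp
    ultimately show ?thesis by linarith
  next
    case False
    have "layer_int (\<lambda>t. t powr (- p)) i * \<tau> i = integral {\<epsilon> i..\<epsilon> i + \<tau> i} (\<lambda>t. t powr (- p) * \<tau> i)"
      unfolding layer_int_def by simp
    also have "\<dots> \<le> J (2 - p) i"
      unfolding J1 layer_int_def
    proof (rule integral_le[OF integrable_on_mult_left[OF c1(2)] c1(1)])
      fix t assume t: "t \<in> {\<epsilon> i..\<epsilon> i + \<tau> i}"
      then have t0: "0 < t" "\<tau> i \<le> t" using False et by auto
      then have "t powr (- p) * \<tau> i \<le> t powr (- p) * t" by (intro mult_left_mono) auto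
      also have "\<dots> = t powr (1 - p)" using t0 by (simp add: powr_diff powr_minus divide_inverse mult.commute)
      finally show "t powr (- p) * \<tau> i \<le> t powr (1 - p)" .
    qed
    finally have "layer_int (\<lambda>t. t powr (- p)) i * \<tau> i * (\<theta> i)\<^sup>2 \<le> J (2 - p) i * (\<theta> i)\<^sup>2" by (intro mult_right_mono) auto
    moreover have "0 \<le> Kb * h\<^sup>2 * J s i" using J0[OF i] p by (simp add: Kb_def)
    ultimately show ?thesis using T2 unfolding mult.assoc by linarith
  qed
  show ?thesis unfolding main distrib_left using T1 T2 T3 T4 by (simp only: distrib_right)
qed

lemma layer_error_sum:
  assumes Ch: "C * h \<le> 1" and C12: "C1 \<le> 1" "C2 \<le> 1"
  defines "s \<equiv> min (p - 1) (1 / 2)"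
    and "Kf \<equiv> C / (2 - p) * 2 powr (1 / (2 - p))" and "Kb \<equiv> 20 / (p - 1) * (C / (1 - 2 powr (p - 2)))\<^sup>2"
  shows "(\<Sum>i\<le>m. layer_int (layer_error p (\<tau> i) (\<theta> i)) i) \<le>
    ((Kf\<^sup>2 + 20 * A2\<^sup>2 + 200 * C\<^sup>2) / (2 - p) + Kb / s) * (h\<^sup>2 * (1 - \<epsilon> 0))"
proof -
  define J where "J = (\<lambda>k. layer_int (\<lambda>t. t powr (k - 1)))"
  have q: "0 < 2 - p" "2 - p \<le> 1" and s: "0 < s" "s \<le> 1" using p by (auto simp: s_def)
  have J0: "0 \<le> J (2 - p) k" if "k \<le> m" for k unfolding J_def by (rule layer_int_powr(3)[OF q that])
  have Jq: "(\<Sum>i\<le>m. J (2 - p) i) \<le> (1 - \<epsilon> 0) / (2 - p)" "(\<Sum>i\<le>m. J s i) \<le> (1 - \<epsilon> 0) / s"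
    unfolding J_def by (intro layer_int_powr q s)+
  \<comment> \<open>The extra charge of the last layer is at most one more copy of the sum, which
    turns 100 C^2 into 200 C^2.\<close>
  have last: "(\<Sum>i\<le>m. if i = m \<and> 0 < m then 100 * C\<^sup>2 * h\<^sup>2 * J (2 - p) (m - 1) else 0) \<le> 100 * C\<^sup>2 * h\<^sup>2 * (\<Sum>i\<le>m. J (2 - p) i)"
  proof (cases "0 < m")
    case True
    have "J (2 - p) (m - 1) \<le> (\<Sum>i\<le>m. J (2 - p) i)" using J0 by (intro member_le_sum) auto
    then show ?thesis using True by (simp add: mult_left_mono)
  next
    case False
    then show ?thesis using J0[of 0] by simp
  qed
  have "(\<Sum>i\<le>m. layer_int (layer_error p (\<tau> i) (\<theta> i)) i) \<le>
    (\<Sum>i\<le>m. (Kf\<^sup>2 + 20 * A2\<^sup>2 + 100 * C\<^sup>2) * h\<^sup>2 * J (2 - p) i + Kb * h\<^sup>2 * J s i +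
    (if i = m \<and> 0 < m then 100 * C\<^sup>2 * h\<^sup>2 * J (2 - p) (m - 1) else 0))"
    unfolding J_def s_def Kf_def Kb_def by (intro sum_mono layer_error_bound Ch C12) simp
  also have "\<dots> \<le> (Kf\<^sup>2 + 20 * A2\<^sup>2 + 100 * C\<^sup>2) * h\<^sup>2 * (\<Sum>i\<le>m. J (2 - p) i) + Kb * h\<^sup>2 * (\<Sum>i\<le>m. J s i) + 100 * C\<^sup>2 * h\<^sup>2 * (\<Sum>i\<le>m. J (2 - p) i)"
    unfolding sum.distrib sum_distrib_left[symmetric] using last by simp
  also have "\<dots> \<le> (Kf\<^sup>2 + 20 * A2\<^sup>2 + 100 * C\<^sup>2) * h\<^sup>2 * ((1 - \<epsilon> 0) / (2 - p)) + Kb * h\<^sup>2 * ((1 - \<epsilon> 0) / s) + 100 * C\<^sup>2 * h\<^sup>2 * ((1 - \<epsilon> 0) / (2 - p))"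
    using Jq p by (intro add_mono mult_left_mono) (auto simp: Kb_def)
  also have "\<dots> = ((Kf\<^sup>2 + 20 * A2\<^sup>2 + 200 * C\<^sup>2) / (2 - p) + Kb / s) * (h\<^sup>2 * (1 - \<epsilon> 0))"
    by (simp add: divide_inverse algebra_simps)
  finally show ?thesis .
qed

end

section \<open>Radial functions integrated over the triangles of a layer\<close>

lemma ref_triangle_integrable:
  fixes f :: "real ^ 2 \<Rightarrow> real"
  assumes "continuous_on ref_triangle f"
  shows "f integrable_on ref_triangle" "(LINT \<xi>:ref_triangle|lebesgue. f \<xi>) = integral ref_triangle f"
proof -
  have "integrable lborel (\<lambda>x. indicator ref_triangle x *\<^sub>R f x)"
    by (intro borel_integrable_compact ref_triangle_compact assms)
  then have "f absolutely_integrable_on ref_triangle"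
    unfolding set_integrable_def by (subst integrable_completion) auto
  then show "f integrable_on ref_triangle" "(LINT \<xi>:ref_triangle|lebesgue. f \<xi>) = integral ref_triangle f"
    by (auto simp: set_lebesgue_integral_eq_integral)
qed

lemma ref_triangle_symmetric:
  fixes f :: "real ^ 2 \<Rightarrow> real" and S :: "real ^ 2 \<Rightarrow> real ^ 2"
  assumes f: "continuous_on UNIV f" and S: "bounded_linear L" "\<And>x. S x = v + L x" "\<bar>det (matrix L)\<bar> = 1" "\<And>x. S (S x) = x"
    and inv: "\<And>x. x \<in> ref_triangle \<Longrightarrow> S x \<in> ref_triangle"
  shows "integral ref_triangle f = integral ref_triangle (\<lambda>x. f (S x))"
proof -
  have im: "S ` ref_triangle = ref_triangle" using inv S(4) by (metis image_subset_iff subsetI subset_antisym rev_image_eqI)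
  have der: "(S has_derivative L) (at x within A)" for x A
    unfolding S(2)[abs_def] by (auto intro!: derivative_eq_intros bounded_linear_imp_has_derivative S(1))
  have cS: "continuous_on A S" for A using der by (meson differentiableI differentiable_imp_continuous_on differentiable_on_def)
  have c: "continuous_on ref_triangle (\<lambda>x. f (S x))" by (rule continuous_on_compose2[OF f cS]) auto
  have "(\<lambda>x. f (S x)) absolutely_integrable_on ref_triangle"
    by (rule set_integrable_lebesgue_continuous(1)) (use compact_imp_bounded[OF ref_triangle_compact] continuous_on_compose2[OF f cS] in auto)
  then have i: "set_integrable lebesgue ref_triangle (\<lambda>x. \<bar>det (matrix L)\<bar> * f (S x))" by (simp add: S(3))
  have inj: "inj_on S ref_triangle" using S(4) by (metis inj_onI)
  have "(LINT x:S ` ref_triangle|lebesgue. f x) = (LINT x:ref_triangle|lebesgue. \<bar>det (matrix L)\<bar> * f (S x))"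
    by (rule has_absolute_integral_change_of_variables_real(2)[OF _ der inj i]) (simp add: ref_triangle_borel)
  then show ?thesis
    unfolding im S(3) using ref_triangle_integrable(2)[OF c] ref_triangle_integrable(2)[OF continuous_on_subset[OF f]] by simp
qed

text \<open>Affine symmetries of the triangle permute its barycentric coordinates and preserve area,
  so all three cases reduce to the first coordinate, where the slice at s has length 1 - s.\<close>

lemma integral_ref_triangle:
  fixes f :: "real \<Rightarrow> real"
  assumes f: "continuous_on UNIV f"
  shows "integral ref_triangle (\<lambda>\<xi>. f (\<xi> $ 1)) = integral {0..1} (\<lambda>s. (1 - s) * f s)" (is ?A)
    and "integral ref_triangle (\<lambda>\<xi>. f (\<xi> $ 2)) = integral {0..1} (\<lambda>s. (1 - s) * f s)" (is ?B)
    and "integral ref_triangle (\<lambda>\<xi>. f (1 - \<xi> $ 1 - \<xi> $ 2)) = integral {0..1} (\<lambda>s. (1 - s) * f s)" (is ?C)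
proof -
  have c: "continuous_on UNIV (\<lambda>\<xi> :: real ^ 2. f (\<xi> $ 1))" by (intro continuous_on_compose2[OF f] continuous_intros) auto
  have "set_integrable lborel {0..1} (\<lambda>s. (1 - s) * f s)"
    unfolding set_integrable_def by (intro borel_integrable_compact continuous_intros continuous_on_subset[OF f]) auto
  then show ?A
    using set_integral_ref_triangle[OF f] ref_triangle_integrable(2)[OF continuous_on_subset[OF c]]
    by (simp add: set_borel_integral_eq_integral)
  moreover have "integral ref_triangle (\<lambda>\<xi>. f (\<xi> $ 1)) = integral ref_triangle (\<lambda>\<xi>. f ((vector [\<xi> $ 2, \<xi> $ 1] :: real ^ 2) $ 1))"
  proof (rule ref_triangle_symmetric[OF c, where v = 0 and S = "\<lambda>\<xi>. vector [\<xi> $ 2, \<xi> $ 1]" and L = "\<lambda>\<xi>. vector [\<xi> $ 2, \<xi> $ 1]"])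
    have *: "(vector [\<xi> $ 2, \<xi> $ 1] :: real ^ 2) = \<xi> $ 2 *\<^sub>R axis 1 1 + \<xi> $ 1 *\<^sub>R axis 2 1" for \<xi> :: "real ^ 2"
      by (simp add: vec_eq_iff forall_2 axis_def)
    show "bounded_linear (\<lambda>\<xi> :: real ^ 2. vector [\<xi> $ 2, \<xi> $ 1] :: real ^ 2)"
      unfolding * by (intro bounded_linear_intros bounded_linear_vec_nth)
  qed (auto simp: det_matrix_2 axis_def vec_eq_iff forall_2 ref_triangle_def add.commute)
  ultimately show ?B by simp
  have "integral ref_triangle (\<lambda>\<xi>. f (\<xi> $ 1)) = integral ref_triangle (\<lambda>\<xi>. f ((vector [1 - \<xi> $ 1 - \<xi> $ 2, \<xi> $ 2] :: real ^ 2) $ 1))"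
  proof (rule ref_triangle_symmetric[OF c, where v = "axis 1 1" and S = "\<lambda>\<xi>. vector [1 - \<xi> $ 1 - \<xi> $ 2, \<xi> $ 2]" and L = "\<lambda>\<xi>. vector [- \<xi> $ 1 - \<xi> $ 2, \<xi> $ 2]"])
    have *: "(vector [- \<xi> $ 1 - \<xi> $ 2, \<xi> $ 2] :: real ^ 2) = (- (\<xi> $ 1 *\<^sub>R axis 1 1) - \<xi> $ 2 *\<^sub>R axis 1 1) + \<xi> $ 2 *\<^sub>R axis 2 1" for \<xi> :: "real ^ 2"
      by (simp add: vec_eq_iff forall_2 axis_def)
    show "bounded_linear (\<lambda>\<xi> :: real ^ 2. vector [- \<xi> $ 1 - \<xi> $ 2, \<xi> $ 2] :: real ^ 2)"
      unfolding * by (intro bounded_linear_intros bounded_linear_vec_nth bounded_linear_add bounded_linear_sub bounded_linear_minus)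
  qed (auto simp: det_matrix_2 axis_def vec_eq_iff forall_2 ref_triangle_def)
  with \<open>?A\<close> show ?C by simp
qed

lemma has_integral_affine_real:
  fixes f :: "real \<Rightarrow> real" and A :: "real set"
  assumes "(f has_integral I) {a..b}" "k \<noteq> 0" "\<And>x. x \<in> A \<longleftrightarrow> k * x + c \<in> {a..b}"
  shows "((\<lambda>x. f (k * x + c)) has_integral I / \<bar>k\<bar>) A"
proof -
  have "((\<lambda>x. f (k *\<^sub>R x + c)) has_integral (1 / \<bar>k\<bar> ^ DIM(real)) *\<^sub>R I) ((\<lambda>x. (1 / k) *\<^sub>R x + - ((1 / k) *\<^sub>R c)) ` cbox a b)"
    by (rule has_integral_affinity) (use assms in auto)
  moreover have "(\<lambda>x. (1 / k) *\<^sub>R x + - ((1 / k) *\<^sub>R c)) ` cbox a b = A"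
  proof (intro equalityI subsetI)
    fix x assume "x \<in> A"
    then have "k * x + c \<in> cbox a b" "x = (1 / k) *\<^sub>R (k * x + c) + - ((1 / k) *\<^sub>R c)" using assms by (auto simp: field_simps)
    then show "x \<in> (\<lambda>x. (1 / k) *\<^sub>R x + - ((1 / k) *\<^sub>R c)) ` cbox a b" by blast
  qed (use assms(2) in \<open>auto simp: assms(3) field_simps\<close>)
  ultimately show ?thesis by (simp add: divide_inverse mult.commute)
qed

text \<open>For functions of s alone, A contributes the weight 2 s, and B contributes 2 (1 - s), as
  do C and D together. The sum is the constant weight 2, the width of one period of the strip, so
  radial integrals are obtained without quadrature error.\<close>

lemma element_integral:
  fixes f :: "real \<Rightarrow> real"
  assumes f: "continuous_on {0..1} f"
  defines "J \<equiv> \<lambda>E. area2 E * integral ref_triangle (\<lambda>\<xi>. f (interp fst E (\<xi> $ 1) (\<xi> $ 2)))"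
  shows "J elem_A + (if cf then J elem_D + J elem_C else J elem_B) = 2 * integral {0..1} f"
proof -
  \<comment> \<open>A continuous extension to the real line, which is where
    \<open>integral_ref_triangle\<close> asks for continuity.\<close>
  define g where "g = (\<lambda>s. f (max 0 (min 1 s)))"
  have g: "continuous_on UNIV g" unfolding g_def by (intro continuous_on_compose2[OF f] continuous_intros) auto
  have g1: "continuous_on UNIV (\<lambda>s. g (1 - s))" by (intro continuous_on_compose2[OF g] continuous_intros) auto
  have gf: "s \<in> {0..1} \<Longrightarrow> g s = f s" for s by (simp add: g_def)
  have J: "J E = area2 E * integral ref_triangle (\<lambda>\<xi>. g (interp fst E (\<xi> $ 1) (\<xi> $ 2)))" if "E \<in> elems" for E
    unfolding J_def by (intro arg_cong2[where f = "(*)"] refl integral_cong gf[symmetric])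
      (use interp_range[OF that] in \<open>auto simp: ref_triangle_def\<close>)
  have i: "(\<lambda>s. (1 - s) * g s) integrable_on {0..1}" "(\<lambda>s. s * g s) integrable_on {0..1}"
    by (intro integrable_continuous_real continuous_intros continuous_on_subset[OF g]; simp)+
  have A0: "integral {0..1} (\<lambda>s. (1 - s) * g (1 - s)) = integral {0..1} (\<lambda>s. s * g s)"
    using has_integral_affine_real[OF integrable_integral[OF i(2)], of "-1" "{0..1}" 1] by (auto intro!: integral_unique)
  have s: "interp fst elem_A a b = 1 - (1 - a - b)" "interp fst elem_B a b = 1 - a - b" "interp fst elem_C a b = a" "interp fst elem_D a b = b" for a b
    by (simp_all add: interp_def elem_defs field_simps)
  have a2: "area2 elem_A = 2" "area2 elem_B = 2" "area2 elem_C = 1" "area2 elem_D = 1" by (simp_all add: area2_def elem_defs)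
  have m: "elem_A \<in> elems" "elem_B \<in> elems" "elem_C \<in> elems" "elem_D \<in> elems" by (simp_all add: elems_def)
  have JA: "J elem_A = 2 * integral {0..1} (\<lambda>s. s * g s)"
  proof -
    have "integral ref_triangle (\<lambda>\<xi>. g (1 - (1 - \<xi> $ 1 - \<xi> $ 2))) = integral {0..1} (\<lambda>s. (1 - s) * g (1 - s))"
      by (rule integral_ref_triangle(3)[OF g1])
    then show ?thesis unfolding J[OF m(1)] s a2 A0 by simp
  qed
  have JB: "J elem_B = 2 * integral {0..1} (\<lambda>s. (1 - s) * g s)" "J elem_D + J elem_C = 2 * integral {0..1} (\<lambda>s. (1 - s) * g s)"
    unfolding J[OF m(2)] J[OF m(3)] J[OF m(4)] s a2 using integral_ref_triangle[OF g] by simp_all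
  have "integral {0..1} (\<lambda>s. s * g s) + integral {0..1} (\<lambda>s. (1 - s) * g s) = integral {0..1} f"
    unfolding Henstock_Kurzweil_Integration.integral_add[OF i(2,1), symmetric]
    by (rule integral_cong) (simp add: gf algebra_simps)
  then show ?thesis unfolding JA JB(2) using JB(1) by (simp add: distrib_left[symmetric])
qed

lemma continuous_interp_fst:
  assumes "continuous_on {0..1} f" "E \<in> elems"
  shows "continuous_on ref_triangle (\<lambda>\<xi>. f (interp fst E (\<xi> $ 1) (\<xi> $ 2)) :: real)"
proof (rule continuous_on_compose2[OF assms(1)])
  show "continuous_on ref_triangle (\<lambda>\<xi> :: real ^ 2. interp fst E (\<xi> $ 1) (\<xi> $ 2))"
    unfolding interp_def by (intro continuous_intros)
qed (use interp_range[OF assms(2)] in \<open>auto simp: ref_triangle_def\<close>)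

text \<open>Both the main term \<open>h\<close> and the error bound \<open>e\<close> are functions
  of the radius, so \<open>element_integral\<close> sums each of them exactly. The N periods, the
  width 2 and the angle pi / N combine to 2 pi.\<close>

lemma layer_sum_estimate:
  fixes F :: "int \<Rightarrow> real ^ 2 \<Rightarrow> real" and h e :: "real \<Rightarrow> real"
  assumes F: "\<And>n. continuous_on ref_triangle (F n)" and he: "continuous_on {t0..t0 + \<tau>} h" "continuous_on {t0..t0 + \<tau>} e" and \<tau>: "0 < \<tau>" and N: "0 < N"
    and est: "\<And>n \<xi>. \<xi> \<in> ref_triangle \<Longrightarrow> \<bar>F n \<xi> - area2 (layer_elem cf n) * (\<tau> * (pi / real N)) * h (t0 + \<tau> * interp fst (layer_elem cf n) (\<xi> $ 1) (\<xi> $ 2))\<bar> \<le>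
      area2 (layer_elem cf n) * (\<tau> * (pi / real N)) * e (t0 + \<tau> * interp fst (layer_elem cf n) (\<xi> $ 1) (\<xi> $ 2))"
  shows "\<bar>(\<Sum>n\<in>{0..<layer_period cf * int N}. LINT \<xi>:ref_triangle|lebesgue. F n \<xi>) - 2 * pi * integral {t0..t0 + \<tau>} h\<bar> \<le> 2 * pi * integral {t0..t0 + \<tau>} e"
proof -
  define w where "w = \<tau> * (pi / real N)"
  define s where "s = (\<lambda>n (\<xi> :: real ^ 2). interp fst (layer_elem cf n) (\<xi> $ 1) (\<xi> $ 2))"
  have sub: "s \<in> {0..1} \<Longrightarrow> t0 + \<tau> * s \<in> {t0..t0 + \<tau>}" for s using \<tau> by (auto simp: mult_left_le)
  have c01: "continuous_on {0..1} (\<lambda>s. f (t0 + \<tau> * s) :: real)" if "continuous_on {t0..t0 + \<tau>} f" for f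
    by (rule continuous_on_compose2[OF that]) (use sub in \<open>auto intro!: continuous_intros\<close>)
  have total: "(\<Sum>n\<in>{0..<layer_period cf * int N}. area2 (layer_elem cf n) * w * integral ref_triangle (\<lambda>\<xi>. f (t0 + \<tau> * s n \<xi>))) = 2 * pi * integral {t0..t0 + \<tau>} f"
    if f: "continuous_on {t0..t0 + \<tau>} f" for f
  proof -
    have "(\<Sum>n\<in>{0..<layer_period cf * int N}. area2 (layer_elem cf n) * w * integral ref_triangle (\<lambda>\<xi>. f (t0 + \<tau> * s n \<xi>))) =
      w * (\<Sum>n\<in>{0..<layer_period cf * int N}. area2 (layer_elem cf n) * integral ref_triangle (\<lambda>\<xi>. f (t0 + \<tau> * s n \<xi>)))"
      unfolding sum_distrib_left by (simp add: mult_ac)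
    also have "\<dots> = w * (real N * (2 * integral {0..1} (\<lambda>s. f (t0 + \<tau> * s))))"
      unfolding s_def element_integral[OF c01[OF f], of cf, symmetric]
      by (subst layer_sum[where g = "\<lambda>E. area2 E * integral ref_triangle (\<lambda>\<xi>. f (t0 + \<tau> * interp fst E (\<xi> $ 1) (\<xi> $ 2)))"]) simp
    also have "integral {0..1} (\<lambda>s. f (t0 + \<tau> * s)) = integral {t0..t0 + \<tau>} f / \<tau>"
    proof (rule integral_unique)
      have "f integrable_on {t0..t0 + \<tau>}" using f by (rule integrable_continuous_real)
      from has_integral_affine_real[OF integrable_integral[OF this], of \<tau> "{0..1}" t0]
      show "((\<lambda>s. f (t0 + \<tau> * s)) has_integral integral {t0..t0 + \<tau>} f / \<tau>) {0..1}"
        using \<tau> by (auto simp: add.commute mult_le_cancel_left1 zero_le_mult_iff)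
    qed
    finally show ?thesis using \<tau> N by (simp add: w_def)
  qed
  have w: "0 \<le> w" using \<tau> by (simp add: w_def)
  have one: "\<bar>(LINT \<xi>:ref_triangle|lebesgue. F n \<xi>) - area2 (layer_elem cf n) * w * integral ref_triangle (\<lambda>\<xi>. h (t0 + \<tau> * s n \<xi>))\<bar> \<le>
    area2 (layer_elem cf n) * w * integral ref_triangle (\<lambda>\<xi>. e (t0 + \<tau> * s n \<xi>))" for n
  proof -
    define a where "a = area2 (layer_elem cf n) * w"
    have ch: "(\<lambda>\<xi>. a * f (t0 + \<tau> * s n \<xi>)) integrable_on ref_triangle" if "continuous_on {t0..t0 + \<tau>} f" for f
      unfolding s_def by (intro ref_triangle_integrable(1) continuous_intros continuous_interp_fst[OF c01[OF that]]) simp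
    note Fi = ref_triangle_integrable[OF F[of n]]
    have "norm (integral ref_triangle (\<lambda>\<xi>. F n \<xi> - a * h (t0 + \<tau> * s n \<xi>))) \<le> integral ref_triangle (\<lambda>\<xi>. a * e (t0 + \<tau> * s n \<xi>))"
      by (intro integral_norm_bound_integral integrable_diff Fi(1) ch he) (use est[of _ n] in \<open>simp add: s_def a_def w_def\<close>)
    then show ?thesis
      unfolding Henstock_Kurzweil_Integration.integral_diff[OF Fi(1) ch[OF he(1)]] Fi(2) by (simp add: a_def)
  qed
  have "(\<Sum>n\<in>{0..<layer_period cf * int N}. LINT \<xi>:ref_triangle|lebesgue. F n \<xi>) - 2 * pi * integral {t0..t0 + \<tau>} h =
    (\<Sum>n\<in>{0..<layer_period cf * int N}. (LINT \<xi>:ref_triangle|lebesgue. F n \<xi>) - area2 (layer_elem cf n) * w * integral ref_triangle (\<lambda>\<xi>. h (t0 + \<tau> * s n \<xi>)))"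
    unfolding total[OF he(1), symmetric] sum_subtractf ..
  also have "\<bar>\<dots>\<bar> \<le> (\<Sum>n\<in>{0..<layer_period cf * int N}. area2 (layer_elem cf n) * w * integral ref_triangle (\<lambda>\<xi>. e (t0 + \<tau> * s n \<xi>)))"
    by (rule order_trans[OF sum_abs sum_mono[OF one]])
  finally show ?thesis unfolding total[OF he(2)] .
qed

section \<open>Energy of the exact deformation\<close>

lemma locally_lipschitz_deriv:
  fixes g g' :: "real \<Rightarrow> real"
  assumes "\<And>d. 0 < d \<Longrightarrow> (g has_real_derivative g' d) (at d)" "continuous_on {0<..} g'" "0 < a" "a \<le> b"
  obtains L G where "0 \<le> L" "\<And>x y. x \<in> {a..b} \<Longrightarrow> y \<in> {a..b} \<Longrightarrow> \<bar>g x - g y\<bar> \<le> L * \<bar>x - y\<bar>" "\<And>x. x \<in> {a..b} \<Longrightarrow> \<bar>g x\<bar> \<le> G"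
proof -
  have "compact (g' ` {a..b})"
    by (intro compact_continuous_image continuous_on_subset[OF assms(2)]) (use assms in auto)
  then obtain L where L: "0 < L" "\<And>x. x \<in> {a..b} \<Longrightarrow> \<bar>g' x\<bar> \<le> L"
    using compact_imp_bounded bounded_pos by (metis image_eqI real_norm_def)
  have "continuous_on {a..b} g"
    by (intro continuous_at_imp_continuous_on ballI DERIV_isCont[OF assms(1)]) (use assms in auto)
  then have "compact (g ` {a..b})" by (intro compact_continuous_image) auto
  then obtain G where G: "\<And>x. x \<in> {a..b} \<Longrightarrow> \<bar>g x\<bar> \<le> G"
    using compact_imp_bounded bounded_iff by (metis image_eqI real_norm_def)
  have "norm (g x - g y) \<le> L * norm (x - y)" if "x \<in> {a..b}" "y \<in> {a..b}" for x y
    by (rule field_differentiable_bound[where S = "{a..b}" and f' = g'])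
       (use that assms L in \<open>auto intro: has_field_derivative_at_within\<close>)
  then have lip: "\<bar>g x - g y\<bar> \<le> L * \<bar>x - y\<bar>" if "x \<in> {a..b}" "y \<in> {a..b}" for x y using that by simp
  show ?thesis by (rule that[OF less_imp_le[OF L(1)] lip G])
qed

lemma vector_2_square_norm: "(norm x)\<^sup>2 = (x $ 1)\<^sup>2 + (x $ 2)\<^sup>2" for x :: "real ^ 2"
  unfolding power2_norm_eq_inner inner_vec_def sum_2 inner_real_def by (simp add: power2_eq_square)

text \<open>The gradient is a I + b x x^T. It is symmetric, with the eigenvalue a = r / t in the
  tangential direction and a + b t^2 = r' in the radial one.\<close>

lemma jacobian_cavity_deformation:
  fixes r :: "real \<Rightarrow> real" and x :: "real ^ 2"
  defines "t \<equiv> norm x"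
  assumes der: "(r has_real_derivative d) (at t)" and x: "x \<noteq> 0" and r: "0 \<le> r t" "0 \<le> d"
  shows "det (jacobian (cavity_deformation r) (at x)) = d * r t / t"
    and "norm (jacobian (cavity_deformation r) (at x)) = sqrt ((t * d)\<^sup>2 + (r t)\<^sup>2) / t"
proof -
  have t: "0 < t" using x by (simp add: t_def)
  define a where "a = r t / t"
  define b where "b = (d / t - r t / t\<^sup>2) / t"
  have n: "(norm has_derivative (\<lambda>k. (x \<bullet> k) / t)) (at x)"
    using has_derivative_norm[OF x] by (simp add: t_def sgn_div_norm divide_inverse mult.commute inner_commute)
  have "((\<lambda>t. r t / t) has_real_derivative (d / t - r t / t\<^sup>2)) (at (norm x))"
    using der t unfolding t_def by (auto intro!: derivative_eq_intros simp: diff_divide_distrib power2_eq_square)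
  from has_derivative_compose[OF n this[unfolded has_field_derivative_def]]
  have "((\<lambda>y. r (norm y) / norm y) has_derivative (\<lambda>k. b * (x \<bullet> k))) (at x)"
    by (simp add: b_def)
  from has_derivative_scaleR[OF this has_derivative_ident]
  have D: "(cavity_deformation r has_derivative (\<lambda>k. a *\<^sub>R k + (b * (x \<bullet> k)) *\<^sub>R x)) (at x)"
    by (simp add: cavity_deformation_def[abs_def] a_def t_def)
  define J where "J = jacobian (cavity_deformation r) (at x)"
  have J: "J $ i $ j = a * (if i = j then 1 else 0) + b * x $ i * x $ j" for i j
    unfolding J_def jacobian_def frechet_derivative_at[OF D, symmetric]
    by (simp add: matrix_def inner_axis mult_ac) (simp add: axis_def)
  have t2: "t\<^sup>2 = (x $ 1)\<^sup>2 + (x $ 2)\<^sup>2" by (simp add: t_def vector_2_square_norm)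
  have ab: "a + b * t\<^sup>2 = d" using t by (simp add: a_def b_def field_simps power2_eq_square)
  have "det J = a * (a + b * ((x $ 1)\<^sup>2 + (x $ 2)\<^sup>2))"
    by (simp add: det_2 J algebra_simps power2_eq_square)
  then show "det (jacobian (cavity_deformation r) (at x)) = d * r t / t"
    unfolding t2[symmetric] ab by (simp add: J_def a_def)
  have "norm J = sqrt ((norm (J $ 1))\<^sup>2 + (norm (J $ 2))\<^sup>2)"
    by (simp add: norm_vec_def[of J] L2_set_def sum_2)
  also have "(norm (J $ 1))\<^sup>2 + (norm (J $ 2))\<^sup>2 = a\<^sup>2 + (a + b * ((x $ 1)\<^sup>2 + (x $ 2)\<^sup>2))\<^sup>2"
    unfolding vector_2_square_norm by (simp add: J power2_eq_square algebra_simps)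
  also have "\<dots> = ((t * d)\<^sup>2 + (r t)\<^sup>2) / t\<^sup>2"
    unfolding t2[symmetric] ab using t by (simp add: a_def field_simps)
  finally show "norm (jacobian (cavity_deformation r) (at x)) = sqrt ((t * d)\<^sup>2 + (r t)\<^sup>2) / t"
    using t by (simp add: J_def real_sqrt_divide)
qed

context
  fixes r r' g :: "real \<Rightarrow> real" and B c m p \<omega> :: real
  assumes r: "profile_bounds r r' B c m" and g: "continuous_on {0<..} g" "\<And>d. 0 < d \<Longrightarrow> 0 < g d"
    and p: "1 < p" and \<omega>: "0 < \<omega>"
begin

lemma profile_facts:
  assumes "0 < t" "t \<le> 1"
  shows "(r has_real_derivative r' t) (at t within {0<..1})" "0 < r t" "0 < r' t" "c \<le> r t" "0 < c"
proof -
  have t: "t \<in> {0<..1}" using assms by simp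
  have b: "(r has_real_derivative r' t) (at t within {0<..1})" "c \<le> r t" "m * t \<le> r' t" "0 < c" "0 < m"
    using r t by (auto simp: profile_bounds_def)
  then have "0 < m * t" using assms by simp
  then show "(r has_real_derivative r' t) (at t within {0<..1})" "0 < r t" "0 < r' t" "c \<le> r t" "0 < c"
    using b by simp_all
qed

lemma continuous_radial_density: "continuous_on {0<..1} (radial_density p \<omega> g r r')"
proof -
  have cr: "continuous_on {0<..1} r" using profile_facts(1) by (intro DERIV_continuous_on) auto
  have cr': "continuous_on {0<..1} r'" using r by (simp add: profile_bounds_def)
  show ?thesis unfolding radial_density_def
    by (intro continuous_intros cr cr' continuous_on_powr' continuous_on_compose2[OF g(1)])
       (use p profile_facts in \<open>auto intro!: divide_nonneg_pos mult_pos_pos\<close>)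
qed

text \<open>The tangential stretch alone suffices: t (c / t)^p = c^p t^(1-p) \<ge> c^p for t \<le>
  1.\<close>

lemma radial_density_lower:
  assumes t: "0 < t" "t \<le> 1"
  shows "\<omega> * c powr p \<le> radial_density p \<omega> g r r' t"
proof -
  note f = profile_facts[OF t]
  have "c \<le> sqrt ((r t)\<^sup>2)" using f by simp
  also have "\<dots> \<le> sqrt ((t * r' t)\<^sup>2 + (r t)\<^sup>2)" by (intro real_sqrt_le_mono) simp
  finally have "c powr p \<le> (sqrt ((t * r' t)\<^sup>2 + (r t)\<^sup>2)) powr p" using f p by (intro powr_mono2) auto
  then have "c powr p * 1 \<le> (sqrt ((t * r' t)\<^sup>2 + (r t)\<^sup>2)) powr p * t powr (1 - p)"
    using t p powr_mono2'[of "1 - p" t 1] by (intro mult_mono) auto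
  also have "\<dots> = t * (sqrt ((t * r' t)\<^sup>2 + (r t)\<^sup>2) / t) powr p"
    using t by (simp add: powr_divide powr_diff)
  finally have "\<omega> * c powr p \<le> \<omega> * (t * (sqrt ((t * r' t)\<^sup>2 + (r t)\<^sup>2) / t) powr p)" using \<omega> by simp
  moreover have "0 \<le> t * g (r' t * r t / t)" using t f g(2) by (simp add: less_imp_le)
  ultimately show ?thesis by (simp add: radial_density_def algebra_simps)
qed

lemma cavity_energy:
  assumes e: "0 < \<epsilon>" "\<epsilon> < 1"
  shows "finite_energy p \<omega> g (cavity_deformation r) (annulus \<epsilon>)"
    and "energy p \<omega> g (cavity_deformation r) (annulus \<epsilon>) = 2 * pi * integral {\<epsilon>..1} (radial_density p \<omega> g r r')"
    and "2 * pi * (\<omega> * c powr p * (1 - \<epsilon>)) \<le> energy p \<omega> g (cavity_deformation r) (annulus \<epsilon>)"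
proof -
  \<comment> \<open>The density per unit area, with its argument clamped to [\<epsilon>, 1] to be
    continuous on the whole line.\<close>
  define f where "f = (\<lambda>t. let s = max \<epsilon> (min 1 t) in radial_density p \<omega> g r r' s / s)"
  have f: "continuous_on UNIV f"
    unfolding f_def Let_def
    by (intro continuous_intros continuous_on_compose2[OF continuous_radial_density]) (use e in auto)
  have ft: "f t = radial_density p \<omega> g r r' t / t" if "\<epsilon> \<le> t" "t \<le> 1" for t using that by (simp add: f_def)
  have eq: "energy_density p \<omega> g (cavity_deformation r) x = f (norm x)" if "x \<in> annulus \<epsilon>" for x
  proof -
    have t: "\<epsilon> \<le> norm x" "norm x < 1" using that by (auto simp: annulus_def)
    then have t': "0 < norm x" "norm x \<le> 1" "x \<noteq> 0" using e by auto
    note p = profile_facts[OF t'(1,2)]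
    \<comment> \<open>The derivative of r is given within (0, 1]. Points of the annulus have norm
      less than 1, where it is two-sided.\<close>
    have "(r has_real_derivative r' (norm x)) (at (norm x))"
    proof -
      have "(r has_real_derivative r' (norm x)) (at (norm x) within {0<..<1})" by (rule DERIV_subset[OF p(1)]) auto
      then show ?thesis using t t' at_within_open[of "norm x" "{0<..<1}"] by simp
    qed
    note j = jacobian_cavity_deformation[OF this t'(3)]
    show ?thesis unfolding ft[OF t(1) t'(2)] energy_density_def radial_density_def using j p t' by simp
  qed
  have annb: "annulus \<epsilon> \<in> sets lebesgue" by (simp add: annulus_def)
  note ann = set_integral_annulus[OF f e]
  show fin: "finite_energy p \<omega> g (cavity_deformation r) (annulus \<epsilon>)"
    unfolding finite_energy_def by (rule set_integrable_cong[THEN iffD1, OF refl _ _ ann(1)]) (use eq in auto)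
  have "energy p \<omega> g (cavity_deformation r) (annulus \<epsilon>) = (LINT x:annulus \<epsilon>|lebesgue. f (norm x))"
    unfolding energy_def by (rule set_lebesgue_integral_cong[OF annb]) (use eq in auto)
  also have "\<dots> = 2 * pi * (LINT t:{\<epsilon>..1}|lborel. t * f t)" by (rule ann(2))
  also have "(LINT t:{\<epsilon>..1}|lborel. t * f t) = (LINT t:{\<epsilon>..1}|lborel. radial_density p \<omega> g r r' t)"
    by (rule set_lebesgue_integral_cong) (use ft e in auto)
  also have "\<dots> = integral {\<epsilon>..1} (radial_density p \<omega> g r r')"
  proof -
    have "set_integrable lborel {\<epsilon>..1} (radial_density p \<omega> g r r')"
      unfolding set_integrable_def by (intro borel_integrable_compact continuous_on_subset[OF continuous_radial_density]) (use e in auto)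
    then show ?thesis by (simp add: set_borel_integral_eq_integral)
  qed
  finally show E: "energy p \<omega> g (cavity_deformation r) (annulus \<epsilon>) = 2 * pi * integral {\<epsilon>..1} (radial_density p \<omega> g r r')" .
  have "integral {\<epsilon>..1} (\<lambda>t. \<omega> * c powr p) \<le> integral {\<epsilon>..1} (radial_density p \<omega> g r r')"
    by (intro integral_le integrable_continuous_real continuous_on_subset[OF continuous_radial_density] radial_density_lower continuous_intros) (use e in auto)
  then show "2 * pi * (\<omega> * c powr p * (1 - \<epsilon>)) \<le> energy p \<omega> g (cavity_deformation r) (annulus \<epsilon>)"
    unfolding E using e by (simp add: mult_ac)
qed

end

section \<open>Additivity over the mesh and the global energy estimate\<close>

context
  fixes \<T> :: "(real ^ 2) element set" and u :: "real ^ 2 \<Rightarrow> real ^ 2"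
  assumes unique: "\<And>T T' \<xi> \<xi>'. T \<in> \<T> \<Longrightarrow> T' \<in> \<T> \<Longrightarrow> \<xi> \<in> interior ref_triangle \<Longrightarrow> \<xi>' \<in> ref_triangle \<Longrightarrow>
      quad_map T \<xi> = quad_map T' \<xi>' \<Longrightarrow> T' = T \<and> \<xi>' = \<xi>"
    and det_nz: "\<And>T \<xi>. T \<in> \<T> \<Longrightarrow> \<xi> \<in> ref_triangle \<Longrightarrow> quad_det T \<xi> > 0"
    and det_pos: "\<And>T \<xi>. T \<in> \<T> \<Longrightarrow> \<xi> \<in> ref_triangle \<Longrightarrow> quad_det (map_element u T) \<xi> > 0"
begin

lemma element_region_sets: "element_region T \<in> sets lebesgue"
proof -
  have "compact (element_region T)" unfolding element_region_def
    by (intro compact_continuous_image continuous_on_quad_map ref_triangle_compact)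
  then show ?thesis by (simp add: borel_compact)
qed

lemma region_sets: "finite \<U> \<Longrightarrow> region \<U> \<in> sets lebesgue"
  unfolding region_def by (intro sets.finite_UN element_region_sets)

text \<open>By uniqueness a common point cannot come from the interior of the reference triangle, so
  the overlap lies in the null image of its boundary.\<close>

lemma element_overlap:
  assumes "T \<in> \<T>" "T' \<in> \<T>" "T' \<noteq> T"
  shows "element_region T \<inter> element_region T' \<in> null_sets lebesgue"
proof -
  have "element_region T \<inter> element_region T' \<subseteq> quad_map T ` (ref_triangle - interior ref_triangle)"
    using unique[OF assms(1,2)] assms(3) by (auto simp: element_region_def)
  then show ?thesis
    using negligible_quad_map_boundary negligible_subset by (auto simp: negligible_iff_null_sets[symmetric])
qed

lemma AE_mesh:
  assumes "finite \<U>" "\<U> \<subseteq> \<T>"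
  shows "AE x in lebesgue. x \<in> region \<U> \<longrightarrow> iso_interp \<T> u differentiable (at x) \<and> 0 < det (jacobian (iso_interp \<T> u) (at x))"
proof -
  have "AE x in lebesgue. x \<in> element_region T \<longrightarrow> iso_interp \<T> u differentiable (at x) \<and> 0 < det (jacobian (iso_interp \<T> u) (at x))"
    if "T \<in> \<U>" for T
    using that assms(2) by (intro AE_iso_interp unique det_nz det_pos) auto
  then have "AE x in lebesgue. \<forall>T\<in>\<U>. x \<in> element_region T \<longrightarrow> iso_interp \<T> u differentiable (at x) \<and> 0 < det (jacobian (iso_interp \<T> u) (at x))"
    by (intro AE_finite_allI assms(1))
  then show ?thesis by (rule AE_mp) (auto simp: region_def)
qed

lemma energy_mesh:
  assumes g: "continuous_on {0<..} g" "0 < p" and U: "finite \<U>" "\<U> \<subseteq> \<T>"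
  shows "finite_energy p \<omega> g (iso_interp \<T> u) (region \<U>) \<and>
    energy p \<omega> g (iso_interp \<T> u) (region \<U>) = (\<Sum>T\<in>\<U>. LINT \<xi>:ref_triangle|lebesgue. ref_density u T p \<omega> g \<xi>)"
  using U
proof (induction \<U> rule: finite_induct)
  case empty
  then show ?case by (simp add: region_def finite_energy_def energy_def set_integrable_def set_lebesgue_integral_def)
next
  case (insert T \<U>)
  have T: "T \<in> \<T>" "\<U> \<subseteq> \<T>" using insert by auto
  have e: "finite_energy p \<omega> g (iso_interp \<T> u) (element_region T)"
    "energy p \<omega> g (iso_interp \<T> u) (element_region T) = (LINT \<xi>:ref_triangle|lebesgue. ref_density u T p \<omega> g \<xi>)"
    by ((rule energy_element(2) energy_element(3);
      (rule T(1) g | use unique[OF T(1)] det_nz[OF T(1)] det_pos[OF T(1)] in blast)))+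
  have R: "region (insert T \<U>) = element_region T \<union> region \<U>" by (simp add: region_def)
  have "(\<Union>T'\<in>\<U>. element_region T \<inter> element_region T') \<in> null_sets lebesgue"
    using insert T by (intro null_sets.finite_UN element_overlap) auto
  then have ae: "AE x in lebesgue. \<not> (x \<in> element_region T \<and> x \<in> region \<U>)"
    by (rule AE_I'[rotated 0]) (auto simp: region_def)
  show ?case
    using insert.IH[OF T(2)] e insert.hyps unfolding R finite_energy_def energy_def
    by (auto simp: set_integral_Un_AE[OF ae element_region_sets region_sets] set_integrable_Un element_region_sets region_sets)
qed

end

lemma interior_ref_triangle_nonempty: "vector [1 / 4, 1 / 4] \<in> interior ref_triangle"
proof -
  have "open {\<xi> :: real ^ 2. 0 < \<xi> $ 1 \<and> 0 < \<xi> $ 2 \<and> \<xi> $ 1 + \<xi> $ 2 < 1}"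
    by (intro open_Collect_conj open_Collect_less continuous_intros)
  then have "{\<xi> :: real ^ 2. 0 < \<xi> $ 1 \<and> 0 < \<xi> $ 2 \<and> \<xi> $ 1 + \<xi> $ 2 < 1} \<subseteq> interior ref_triangle"
    by (rule interior_maximal[rotated]) (auto simp: ref_triangle_def)
  then show ?thesis by (rule subsetD) simp
qed

text \<open>The element with number 0 of layer i + 1 has an inner vertex at the angle \<omega> (i +
  1). Matching makes it an outer vertex of layer i, and those lie at odd multiples of \<theta> i
  from \<omega> i; full turns are even multiples and are absorbed into \<open>j\<close>.\<close>

lemma mesh_matching:
  fixes \<epsilon> \<tau> \<omega> :: "nat \<Rightarrow> real" and N :: "nat \<Rightarrow> nat"
  assumes pos: "0 < \<epsilon> i" "0 < \<tau> i" "0 < N i" "0 < N (Suc i)" and next_layer: "\<epsilon> (Suc i) = \<epsilon> i + \<tau> i"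
    and match: "vertices_on_circle (mesh_layer \<epsilon> \<tau> N \<omega> i) (\<epsilon> (Suc i)) = vertices_on_circle (mesh_layer \<epsilon> \<tau> N \<omega> (Suc i)) (\<epsilon> (Suc i))"
  obtains j :: int where "\<omega> (Suc i) = \<omega> i + pi / real (N i) * (2 * real_of_int j + 1)"
proof -
  define cf where "cf = (0 < Suc i \<and> N (Suc i - 1) = 2 * N (Suc i))"
  define T where "T = mesh_elem cf (\<epsilon> (Suc i)) (\<tau> (Suc i)) (pi / real (N (Suc i))) (\<omega> (Suc i)) 0"
  have "T \<in> mesh_layer \<epsilon> \<tau> N \<omega> (Suc i)"
    unfolding mesh_layer_elems[where \<epsilon> = \<epsilon> and \<tau> = \<tau> and \<omega> = \<omega> and N = N, OF pos(4)] cf_def[symmetric] T_def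
    by (rule imageI) (use pos in \<open>simp add: layer_period_def\<close>)
  moreover have a: "a1 T = polar (\<epsilon> (Suc i)) (\<omega> (Suc i))"
    unfolding T_def mesh_elem_def strip_elem_vertices by (simp add: layer_elem_def layer_center_def elem_defs)
  ultimately have "polar (\<epsilon> (Suc i)) (\<omega> (Suc i)) \<in> vertices_on_circle (mesh_layer \<epsilon> \<tau> N \<omega> (Suc i)) (\<epsilon> (Suc i))"
    unfolding vertices_on_circle_def using pos next_layer by (auto intro!: bexI[of _ T])
  then obtain T' where T': "T' \<in> mesh_layer \<epsilon> \<tau> N \<omega> i" "polar (\<epsilon> (Suc i)) (\<omega> (Suc i)) \<in> {a1 T', a2 T', a3 T'}"
    unfolding match[symmetric] unfolding vertices_on_circle_def by blast
  have "norm (polar (\<epsilon> (Suc i)) (\<omega> (Suc i))) = \<epsilon> i + \<tau> i" using pos next_layer by simp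
  then obtain j :: int where "polar (\<epsilon> (Suc i)) (\<omega> (Suc i)) = polar (\<epsilon> i + \<tau> i) (\<omega> i + pi / real (N i) * (2 * real_of_int j + 1))"
    by (rule layer_vertex[OF T'(1)[unfolded mesh_layer_elems[where \<epsilon> = \<epsilon> and \<tau> = \<tau> and \<omega> = \<omega> and N = N, OF pos(3)]] pos(1,2) T'(2)])
  then obtain k :: int where k: "\<omega> (Suc i) = \<omega> i + pi / real (N i) * (2 * real_of_int j + 1) + 2 * pi * real_of_int k"
    using polar_inj(2) pos next_layer by (metis add_pos_pos)
  have "2 * pi * real_of_int k = pi / real (N i) * (2 * real_of_int (int (N i) * k))" using pos by simp
  then have "\<omega> (Suc i) = \<omega> i + pi / real (N i) * (2 * real_of_int (j + int (N i) * k) + 1)"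
    unfolding k by (simp add: algebra_simps)
  then show ?thesis by (rule that)
qed

text \<open>Here C1 = \<kappa> and C2 = \<kappa> / 10, so every layer is fine with parameter
  \<kappa>, and both uniqueness and positivity hold on the whole mesh. The energy is then summed
  over elements, layer by layer, and each layer is compared with its radial integral.\<close>

lemma mesh_energy_estimate:
  fixes r r' g g' :: "real \<Rightarrow> real" and \<epsilon> \<tau> \<omega> :: "nat \<Rightarrow> real" and N :: "nat \<Rightarrow> nat" and p w B c b \<kappa> :: real and m :: nat
  assumes r: "profile_bounds r r' B c b" and \<kappa>: "0 < \<kappa>" "\<kappa> \<le> 1 / 84000" "\<kappa> \<le> c * b / (660000 * B\<^sup>2)"
    and g: "\<And>d. 0 < d \<Longrightarrow> (g has_real_derivative g' d) (at d)" "continuous_on {0<..} g'" "\<And>d. 0 < d \<Longrightarrow> 0 < g d"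
    and w: "0 < w" and S: "strategy p C \<kappa> (\<kappa> / 10) A2 h m \<epsilon> \<tau> N"
    and L: "0 \<le> L" "\<And>x y. x \<in> {c * b / 3..2 * B\<^sup>2 + c * b} \<Longrightarrow> y \<in> {c * b / 3..2 * B\<^sup>2 + c * b} \<Longrightarrow> \<bar>g x - g y\<bar> \<le> L * \<bar>x - y\<bar>"
    and G: "\<And>x. x \<in> {c * b / 3..2 * B\<^sup>2 + c * b} \<Longrightarrow> \<bar>g x\<bar> \<le> G"
    and Ch: "C * h \<le> 1"
    and match: "\<And>i. i < m \<Longrightarrow> vertices_on_circle (mesh_layer \<epsilon> \<tau> N \<omega> i) (\<epsilon> (Suc i)) = vertices_on_circle (mesh_layer \<epsilon> \<tau> N \<omega> (Suc i)) (\<epsilon> (Suc i))"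
  defines "u \<equiv> cavity_deformation r" and "\<T> \<equiv> (\<Union>i\<le>m. mesh_layer \<epsilon> \<tau> N \<omega> i)" and "\<Omega>h \<equiv> (\<Union>i\<le>m. region (mesh_layer \<epsilon> \<tau> N \<omega> i))"
    and "R \<equiv> w * (80000000000 * c powr (p - 2) * B\<^sup>2 + 84000 * B\<^sup>2) + 21000 * (G + L * B\<^sup>2) + 110000 * L * B\<^sup>2"
    and "K \<equiv> (((C / (2 - p) * 2 powr (1 / (2 - p)))\<^sup>2 + 20 * A2\<^sup>2 + 200 * C\<^sup>2) / (2 - p) +
      20 / (p - 1) * (C / (1 - 2 powr (p - 2)))\<^sup>2 / min (p - 1) (1 / 2))"
  shows "AE x in lebesgue. x \<in> \<Omega>h \<longrightarrow> iso_interp \<T> u differentiable (at x) \<and> 0 < det (jacobian (iso_interp \<T> u) (at x))"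
    and "finite_energy p w g (iso_interp \<T> u) \<Omega>h"
    and "energy p w g (iso_interp \<T> u) \<Omega>h = (\<Sum>i\<le>m. energy p w g (iso_interp \<T> u) (region (mesh_layer \<epsilon> \<tau> N \<omega> i)))"
    and "\<bar>energy p w g (iso_interp \<T> u) \<Omega>h - 2 * pi * integral {\<epsilon> 0..1} (radial_density p w g r r')\<bar> \<le> 2 * pi * R * (K * (h\<^sup>2 * (1 - \<epsilon> 0)))"
proof -
  interpret strategy p C \<kappa> "\<kappa> / 10" A2 h m \<epsilon> \<tau> N by (rule S)
  define cf where "cf = (\<lambda>i. 0 < i \<and> N (i - 1) = 2 * N i)"
  define T where "T = (\<lambda>i. mesh_elem (cf i) (\<epsilon> i) (\<tau> i) (\<theta> i) (\<omega> i))"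
  define I where "I = (\<lambda>i. {0..<layer_period (cf i) * int (N i)})"
  define M where "M = mesh_layer \<epsilon> \<tau> N \<omega>"
  have N0: "0 < N i" if "i \<le> m" for i using N_bound[OF that] by simp
  have \<kappa>1: "\<kappa> \<le> 1 / 30000" "\<kappa> \<le> 1" using \<kappa> by auto
  have f: "fine_element \<kappa> (\<epsilon> i) (\<tau> i) (\<theta> i)" if "i \<le> m" for i
    using fine[OF that _ _ \<kappa>(1) \<kappa>1(2)] by simp
  have M: "M i = T i ` I i" if "i \<le> m" for i
    unfolding M_def mesh_layer_elems[where \<epsilon> = \<epsilon> and \<tau> = \<tau> and \<omega> = \<omega> and N = N, OF N0[OF that]] T_def I_def cf_def \<theta>_def ..
  have matching: "\<exists>j::int. \<omega> (Suc i) = \<omega> i + \<theta> i * (2 * real_of_int j + 1)" if "i < m" for i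
    unfolding \<theta>_def by (rule mesh_matching[OF _ _ N0 N0 next_layer[OF that] match[OF that]]) (use that step[of i] in auto)
  have U: "j = i \<and> \<xi>' = \<xi> \<and> T j n' = T i n \<and> (\<exists>k. n = n' + layer_period (cf i) * (int (N i) * k))"
    if "i \<le> m" "j \<le> m" "\<xi> \<in> interior ref_triangle" "\<xi>' \<in> ref_triangle" "quad_map (T i n) \<xi> = quad_map (T j n') \<xi>'" for i j n n' \<xi> \<xi>'
    by (intro conjI mesh_unique[where \<theta> = \<theta> and N = N and cf = cf and T = T and \<epsilon> = \<epsilon> and \<tau> = \<tau> and \<omega> = \<omega> and m = m and \<kappa> = \<kappa>, OF _ _ _ N0 f \<kappa>1(1) next_layer N_halve matching that])
      (simp_all add: \<theta>_def cf_def T_def)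
  have mem: "\<exists>i n. i \<le> m \<and> T0 = T i n" if T0: "T0 \<in> \<T>" for T0
  proof -
    obtain i where i: "i \<le> m" "T0 \<in> M i" using T0 by (auto simp: \<T>_def M_def)
    then show ?thesis unfolding M[OF i(1)] by blast
  qed
  have unique: "T' = T0 \<and> \<xi>' = \<xi>" if T0: "T0 \<in> \<T>" "T' \<in> \<T>" and \<xi>: "\<xi> \<in> interior ref_triangle" "\<xi>' \<in> ref_triangle" "quad_map T0 \<xi> = quad_map T' \<xi>'" for T0 T' \<xi> \<xi>'
  proof -
    obtain i n where i: "i \<le> m" "T0 = T i n" using mem[OF T0(1)] by blast
    obtain j n' where j: "j \<le> m" "T' = T j n'" using mem[OF T0(2)] by blast
    show ?thesis using U[OF i(1) j(1) \<xi>(1,2), of n n'] \<xi>(3) unfolding i(2) j(2) by blast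
  qed
  have elems: "T i n = strip_elem (\<lambda>s. \<epsilon> i + \<tau> i * s) (\<omega> i + \<theta> i * layer_center (cf i) n) (\<theta> i) (layer_elem (cf i) n)" for i n
    by (simp add: T_def mesh_elem_def)
  have det: "0 < quad_det T0 \<xi>" "0 < quad_det (map_element u T0) \<xi>" if T0: "T0 \<in> \<T>" "\<xi> \<in> ref_triangle" for T0 \<xi>
  proof -
    obtain i n where i: "i \<le> m" "T0 = T i n" using mem[OF T0(1)] by blast
    show "0 < quad_det T0 \<xi>" "0 < quad_det (map_element u T0) \<xi>"
      unfolding i(2) elems u_def by (rule density_estimate(1,2)[OF r f[OF i(1)] \<kappa>(2,3) layer_elem_elems that(2)])+
  qed
  have gc: "continuous_on {0<..} g"
    by (intro continuous_at_imp_continuous_on ballI DERIV_isCont[OF g(1)]) simp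
  have p0: "0 < p" using p by simp
  have fin: "finite (M i)" if "i \<le> m" for i using M[OF that] by (simp add: I_def)
  have sub: "M i \<subseteq> \<T>" if "i \<le> m" for i using that by (auto simp: \<T>_def M_def)
  have finT: "finite \<T>" unfolding \<T>_def M_def[symmetric] using fin by auto
  have \<Omega>: "\<Omega>h = region \<T>" by (auto simp: \<Omega>h_def \<T>_def region_def)
  show "AE x in lebesgue. x \<in> \<Omega>h \<longrightarrow> iso_interp \<T> u differentiable (at x) \<and> 0 < det (jacobian (iso_interp \<T> u) (at x))"
    unfolding \<Omega> by (rule AE_mesh[OF unique det finT subset_refl])
  have em: "finite_energy p w g (iso_interp \<T> u) (region \<U>) \<and>
    energy p w g (iso_interp \<T> u) (region \<U>) = (\<Sum>T\<in>\<U>. LINT \<xi>:ref_triangle|lebesgue. ref_density u T p w g \<xi>)"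
    if "finite \<U>" "\<U> \<subseteq> \<T>" for \<U>
    by (rule energy_mesh[OF unique det gc p0 that])
  show "finite_energy p w g (iso_interp \<T> u) \<Omega>h" using em[OF finT] by (simp add: \<Omega>)
  \<comment> \<open>An interior point at which \<open>mesh_unique\<close> is evaluated: equal
    elements have equal images of \<open>v\<close>. Hence different layers have no element in
    common, and within one period the numbering is injective.\<close>
  define v :: "real ^ 2" where "v = vector [1 / 4, 1 / 4]"
  have v: "v \<in> interior ref_triangle" "v \<in> ref_triangle"
    using interior_ref_triangle_nonempty interior_subset by (auto simp: v_def)
  have disj: "M i \<inter> M j = {}" if ij: "i \<le> m" "j \<le> m" "i \<noteq> j" for i j
  proof (rule ccontr)
    assume "M i \<inter> M j \<noteq> {}"
    then obtain n n' where "T i n = T j n'" unfolding M[OF ij(1)] M[OF ij(2)] by auto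
    then show False using U[OF ij(1,2) v, of n n'] ij by simp
  qed
  have "energy p w g (iso_interp \<T> u) \<Omega>h = (\<Sum>T\<in>(\<Union>i\<in>{..m}. M i). LINT \<xi>:ref_triangle|lebesgue. ref_density u T p w g \<xi>)"
    using em[OF finT subset_refl] by (simp add: \<Omega> \<T>_def M_def)
  also have "\<dots> = (\<Sum>i\<le>m. \<Sum>T\<in>M i. LINT \<xi>:ref_triangle|lebesgue. ref_density u T p w g \<xi>)"
    by (rule sum.UNION_disjoint) (use fin disj in auto)
  also have "\<dots> = (\<Sum>i\<le>m. energy p w g (iso_interp \<T> u) (region (M i)))"
    by (rule sum.cong) (use em[OF fin sub] in auto)
  finally show sum: "energy p w g (iso_interp \<T> u) \<Omega>h = (\<Sum>i\<le>m. energy p w g (iso_interp \<T> u) (region (mesh_layer \<epsilon> \<tau> N \<omega> i)))"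
    unfolding M_def .
  have inj: "inj_on (T i) (I i)" if im: "i \<le> m" for i
  proof (rule inj_onI)
    fix n n' assume n: "n \<in> I i" "n' \<in> I i" and eq: "T i n = T i n'"
    obtain k where k: "n = n' + layer_period (cf i) * (int (N i) * k)" using U[OF im im v, of n n'] eq by auto
    define P where "P = layer_period (cf i) * int (N i)"
    have P: "n = n' + P * k" "0 \<le> n" "n < P" "0 \<le> n'" "n' < P" using n k by (auto simp: P_def I_def)
    have "k < 1"
    proof (rule ccontr)
      assume "\<not> k < 1"
      then have "P * 1 \<le> P * k" using P by (intro mult_left_mono) auto
      then show False using P by linarith
    qed
    moreover have "-1 < k"
    proof (rule ccontr)
      assume "\<not> -1 < k"
      then have "P * k \<le> P * (-1)" using P by (intro mult_left_mono) auto
      then show False using P by linarith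
    qed
    ultimately have "k = 0" by simp
    then show "n = n'" using P by simp
  qed
  have gp: "\<And>d. 0 < d \<Longrightarrow> 0 < g d" by (rule g(3))
  have cr: "continuous_on {0<..1} (radial_density p w g r r')" by (rule continuous_radial_density[OF r gc gp p(1) w])
  have layer: "\<bar>energy p w g (iso_interp \<T> u) (region (M i)) - 2 * pi * layer_int (radial_density p w g r r') i\<bar> \<le>
      2 * pi * (R * layer_int (layer_error p (\<tau> i) (\<theta> i)) i)" if i: "i \<le> m" for i
  proof -
    have "energy p w g (iso_interp \<T> u) (region (M i)) = (\<Sum>T\<in>M i. LINT \<xi>:ref_triangle|lebesgue. ref_density u T p w g \<xi>)"
      using em[OF fin[OF i] sub[OF i]] by simp
    also have "\<dots> = (\<Sum>n\<in>I i. LINT \<xi>:ref_triangle|lebesgue. ref_density u (T i n) p w g \<xi>)"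
      unfolding M[OF i] by (subst sum.reindex[OF inj[OF i]]) simp
    finally have E: "energy p w g (iso_interp \<T> u) (region (M i)) = (\<Sum>n\<in>I i. LINT \<xi>:ref_triangle|lebesgue. ref_density u (T i n) p w g \<xi>)" .
    have et: "0 < \<epsilon> i" "0 < \<tau> i" using step[OF i] by auto
    have cl: "continuous_on {\<epsilon> i..\<epsilon> i + \<tau> i} (radial_density p w g r r')"
      by (rule continuous_on_subset[OF cr layer_interval[OF i]])
    have ce: "continuous_on {\<epsilon> i..\<epsilon> i + \<tau> i} (\<lambda>t. R * layer_error p (\<tau> i) (\<theta> i) t)"
      unfolding layer_error_def by (intro continuous_intros) (use et in auto)
    \<comment> \<open>\<open>layer_sum_estimate\<close> asks for all integers n; reduction modulo
      one revolution finds the same element inside the mesh.\<close>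
    have cF: "continuous_on ref_triangle (ref_density u (T i n) p w g)" for n
    proof -
      define d where "d = n mod (layer_period (cf i) * int (N i))"
      have "layer_period (cf i) * int (N i) > 0" using N0[OF i] by (simp add: layer_period_def)
      then have "d \<in> I i" by (simp add: d_def I_def)
      moreover have "n = d + layer_period (cf i) * (int (N i) * (n div (layer_period (cf i) * int (N i))))"
        unfolding d_def by (simp add: mult.assoc[symmetric])
      then have "T i n = T i d"
        unfolding T_def using layer_revolution(1)[OF N0[OF i], of "\<theta> i" "cf i" "\<epsilon> i" "\<tau> i" "\<omega> i" d "n div (layer_period (cf i) * int (N i))"]
        by (simp add: \<theta>_def)
      ultimately have "T i n \<in> \<T>" using M[OF i] sub[OF i] by auto
      then show ?thesis
        by (intro energy_element(1)[OF _ _ _ _ gc p0]) (use unique det in blast)+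
    qed
    have "\<bar>(\<Sum>n\<in>{0..<layer_period (cf i) * int (N i)}. LINT \<xi>:ref_triangle|lebesgue. ref_density u (T i n) p w g \<xi>) -
      2 * pi * integral {\<epsilon> i..\<epsilon> i + \<tau> i} (radial_density p w g r r')\<bar> \<le> 2 * pi * integral {\<epsilon> i..\<epsilon> i + \<tau> i} (\<lambda>t. R * layer_error p (\<tau> i) (\<theta> i) t)"
    proof (rule layer_sum_estimate[OF cF cl ce et(2) N0[OF i]])
      fix n and \<xi> :: "real ^ 2" assume \<xi>: "\<xi> \<in> ref_triangle"
      show "\<bar>ref_density u (T i n) p w g \<xi> - area2 (layer_elem (cf i) n) * (\<tau> i * (pi / real (N i))) * radial_density p w g r r' (\<epsilon> i + \<tau> i * interp fst (layer_elem (cf i) n) (\<xi> $ 1) (\<xi> $ 2))\<bar>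
        \<le> area2 (layer_elem (cf i) n) * (\<tau> i * (pi / real (N i))) * (R * layer_error p (\<tau> i) (\<theta> i) (\<epsilon> i + \<tau> i * interp fst (layer_elem (cf i) n) (\<xi> $ 1) (\<xi> $ 2)))"
        unfolding elems u_def R_def \<theta>_def[symmetric]
        by (rule density_estimate(3)[OF r f[OF i] \<kappa>(2,3) layer_elem_elems \<xi> p w L G])
    qed
    then show ?thesis unfolding E I_def layer_int_def by simp
  qed
  have R: "0 \<le> R"
  proof -
    have "0 < c * b" using r by (simp add: profile_bounds_def)
    then have "c * b / 3 \<in> {c * b / 3..2 * B\<^sup>2 + c * b}"
      unfolding atLeastAtMost_iff using zero_le_power2[of B] by (intro conjI; linarith)
    then have "0 \<le> G" using G by force
    then show ?thesis using w L(1) by (simp add: R_def)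
  qed
  have total: "energy p w g (iso_interp \<T> u) \<Omega>h - 2 * pi * integral {\<epsilon> 0..1} (radial_density p w g r r') =
    (\<Sum>i\<le>m. energy p w g (iso_interp \<T> u) (region (M i)) - 2 * pi * layer_int (radial_density p w g r r') i)"
    using sum layer_int_sum[OF cr] by (simp only: M_def sum_subtractf sum_distrib_left[symmetric])
  have "\<bar>energy p w g (iso_interp \<T> u) \<Omega>h - 2 * pi * integral {\<epsilon> 0..1} (radial_density p w g r r')\<bar> \<le>
    (\<Sum>i\<le>m. 2 * pi * (R * layer_int (layer_error p (\<tau> i) (\<theta> i)) i))"
    unfolding total by (rule order_trans[OF sum_abs sum_mono]) (rule layer, simp)
  also have "\<dots> = 2 * pi * R * (\<Sum>i\<le>m. layer_int (layer_error p (\<tau> i) (\<theta> i)) i)"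
    by (simp only: mult.assoc sum_distrib_left[symmetric])
  also have "\<dots> \<le> 2 * pi * R * (K * (h\<^sup>2 * (1 - \<epsilon> 0)))"
    unfolding K_def by (rule mult_left_mono[OF layer_error_sum[OF Ch]]) (use R \<kappa>1 \<kappa> in auto)
  finally show "\<bar>energy p w g (iso_interp \<T> u) \<Omega>h - 2 * pi * integral {\<epsilon> 0..1} (radial_density p w g r r')\<bar> \<le> 2 * pi * R * (K * (h\<^sup>2 * (1 - \<epsilon> 0)))" .
qed

theorem theorem4p2:
  fixes r :: "real \<Rightarrow> real"
  assumes "cavity_profile r"
  shows "\<exists>C1>0. \<exists>C2>0.
    \<forall>p \<omega> g C A1 A2.
      1 < p \<and> p < 2 \<and> 0 < \<omega> \<and> stored_energy_function g \<and>
      (2 - p) * 2 powr (p - 1) \<le> C \<and> 0 < A1 \<and> A1 < A2 \<longrightarrow>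
      (\<exists>K>0. \<forall>\<epsilon>0 h m \<epsilon> \<tau> N \<rho>.
         0 < \<epsilon>0 \<and> \<epsilon>0 < 1 \<and>
         0 < h \<and> h \<le> min ((2 - p) / (2 powr (2 - p) * C)) ((2 - p) / (2 powr (p - 1) * C)) \<and>
         strategy_mesh p C C1 C2 A1 A2 h \<epsilon>0 m \<epsilon> \<tau> N \<rho> \<longrightarrow>
         (let u = cavity_deformation r;
              L = mesh_layer \<epsilon> \<tau> N \<rho>;
              \<T> = (\<Union>i\<le>m. L i);
              \<Omega>h = (\<Union>i\<le>m. region (L i));
              \<Pi>u = iso_interp \<T> u
          in (AE x in lebesgue. x \<in> \<Omega>h \<longrightarrow>
                \<Pi>u differentiable (at x) \<and> 0 < det (jacobian \<Pi>u (at x))) \<and>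
             finite_energy p \<omega> g u (annulus \<epsilon>0) \<and>
             finite_energy p \<omega> g \<Pi>u \<Omega>h \<and>
             energy p \<omega> g \<Pi>u \<Omega>h = (\<Sum>i\<le>m. energy p \<omega> g \<Pi>u (region (L i))) \<and>
             (\<exists>\<delta>. \<bar>\<delta>\<bar> \<le> K * h\<^sup>2 \<and>
                  energy p \<omega> g \<Pi>u \<Omega>h = energy p \<omega> g u (annulus \<epsilon>0) * (1 + \<delta>))))"
proof -
  obtain r' B c b where r: "profile_bounds r r' B c b" using assms by (rule cavity_profile_bounds)
  have Bcb: "1 \<le> B" "0 < c" "0 < b" using r by (auto simp: profile_bounds_def)
  \<comment> \<open>The thresholds of \<open>density_estimate\<close>, which depend on the profile
    only. They also imply the bound 1 / 30000 that is required for injectivity.\<close>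
  define \<kappa> where "\<kappa> = min (1 / 84000) (c * b / (660000 * B\<^sup>2))"
  have \<kappa>: "0 < \<kappa>" "\<kappa> \<le> 1 / 84000" "\<kappa> \<le> c * b / (660000 * B\<^sup>2)" using Bcb by (auto simp: \<kappa>_def)
  then have \<kappa>10: "0 < \<kappa> / 10" by simp
  show ?thesis
  proof (rule exI[of _ \<kappa>], rule conjI[OF \<kappa>(1)], rule exI[of _ "\<kappa> / 10"], rule conjI[OF \<kappa>10], intro allI impI)
    fix p w C A1 A2 :: real and g :: "real \<Rightarrow> real"
    assume "1 < p \<and> p < 2 \<and> 0 < w \<and> stored_energy_function g \<and> (2 - p) * 2 powr (p - 1) \<le> C \<and> 0 < A1 \<and> A1 < A2"
    then have p: "1 < p" "p < 2" and w: "0 < w" and se: "stored_energy_function g" and C: "(2 - p) * 2 powr (p - 1) \<le> C"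
      and A12: "0 < A1" "A1 < A2" by auto
    have C0: "0 < C" by (rule less_le_trans[OF _ C]) (use p in simp)
    obtain g' where g: "\<And>d. 0 < d \<Longrightarrow> (g has_real_derivative g' d) (at d)" "continuous_on {0<..} g'" "\<And>d. 0 < d \<Longrightarrow> 0 < g d"
      using se unfolding stored_energy_function_def by blast
    have cb: "0 < c * b / 3" "c * b / 3 \<le> 2 * B\<^sup>2 + c * b" using Bcb by (auto simp: add_increasing)
    obtain L G where L: "0 \<le> L" "\<And>x y. x \<in> {c * b / 3..2 * B\<^sup>2 + c * b} \<Longrightarrow> y \<in> {c * b / 3..2 * B\<^sup>2 + c * b} \<Longrightarrow> \<bar>g x - g y\<bar> \<le> L * \<bar>x - y\<bar>"
      and G: "\<And>x. x \<in> {c * b / 3..2 * B\<^sup>2 + c * b} \<Longrightarrow> \<bar>g x\<bar> \<le> G"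
      using locally_lipschitz_deriv[OF g(1,2) cb] by metis
    \<comment> \<open>\<open>L\<close> and \<open>G\<close> depend on g and the profile only. Thus
      \<open>R\<close>, \<open>K\<close> and \<open>V\<close> are fixed before the inner radius, h
      and the mesh.\<close>
    define R where "R = w * (80000000000 * c powr (p - 2) * B\<^sup>2 + 84000 * B\<^sup>2) + 21000 * (G + L * B\<^sup>2) + 110000 * L * B\<^sup>2"
    define K where "K = (((C / (2 - p) * 2 powr (1 / (2 - p)))\<^sup>2 + 20 * A2\<^sup>2 + 200 * C\<^sup>2) / (2 - p) +
      20 / (p - 1) * (C / (1 - 2 powr (p - 2)))\<^sup>2 / min (p - 1) (1 / 2))"
    have G0: "0 \<le> G" using G[of "c * b / 3"] cb by simp
    have R: "0 < R"
    proof -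
      have "0 < w * (80000000000 * c powr (p - 2) * B\<^sup>2 + 84000 * B\<^sup>2)" using w Bcb by (intro mult_pos_pos add_pos_pos) auto
      moreover have "0 \<le> 21000 * (G + L * B\<^sup>2) + 110000 * L * B\<^sup>2" using G0 L(1) by simp
      ultimately show ?thesis unfolding R_def by linarith
    qed
    have K: "0 < K"
    proof -
      have "0 < ((C / (2 - p) * 2 powr (1 / (2 - p)))\<^sup>2 + 20 * A2\<^sup>2 + 200 * C\<^sup>2) / (2 - p)"
        using p C0 by (intro divide_pos_pos add_nonneg_pos) auto
      moreover have "0 \<le> 20 / (p - 1) * (C / (1 - 2 powr (p - 2)))\<^sup>2 / min (p - 1) (1 / 2)" using p by simp
      ultimately show ?thesis unfolding K_def by linarith
    qed
    define V where "V = w * c powr p"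
    have V: "0 < V" using w Bcb by (simp add: V_def)
    show "\<exists>K>0. \<forall>\<epsilon>0 h m \<epsilon> \<tau> N \<rho>.
         0 < \<epsilon>0 \<and> \<epsilon>0 < 1 \<and>
         0 < h \<and> h \<le> min ((2 - p) / (2 powr (2 - p) * C)) ((2 - p) / (2 powr (p - 1) * C)) \<and>
         strategy_mesh p C \<kappa> (\<kappa> / 10) A1 A2 h \<epsilon>0 m \<epsilon> \<tau> N \<rho> \<longrightarrow>
         (let u = cavity_deformation r;
              L = mesh_layer \<epsilon> \<tau> N \<rho>;
              \<T> = (\<Union>i\<le>m. L i);
              \<Omega>h = (\<Union>i\<le>m. region (L i));
              \<Pi>u = iso_interp \<T> u
          in (AE x in lebesgue. x \<in> \<Omega>h \<longrightarrow>
                \<Pi>u differentiable (at x) \<and> 0 < det (jacobian \<Pi>u (at x))) \<and>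
             finite_energy p w g u (annulus \<epsilon>0) \<and>
             finite_energy p w g \<Pi>u \<Omega>h \<and>
             energy p w g \<Pi>u \<Omega>h = (\<Sum>i\<le>m. energy p w g \<Pi>u (region (L i))) \<and>
             (\<exists>\<delta>. \<bar>\<delta>\<bar> \<le> K * h\<^sup>2 \<and>
                  energy p w g \<Pi>u \<Omega>h = energy p w g u (annulus \<epsilon>0) * (1 + \<delta>)))"
    proof (intro exI[of _ "R * K / V"] conjI allI impI)
      show "0 < R * K / V" using R K V by simp
      fix \<epsilon>0 h :: real and m :: nat and \<epsilon> \<tau> \<rho> :: "nat \<Rightarrow> real" and N :: "nat \<Rightarrow> nat"
      assume "0 < \<epsilon>0 \<and> \<epsilon>0 < 1 \<and>
         0 < h \<and> h \<le> min ((2 - p) / (2 powr (2 - p) * C)) ((2 - p) / (2 powr (p - 1) * C)) \<and>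
         strategy_mesh p C \<kappa> (\<kappa> / 10) A1 A2 h \<epsilon>0 m \<epsilon> \<tau> N \<rho>"
      then have e0: "0 < \<epsilon>0" "\<epsilon>0 < 1" and h: "0 < h" "h \<le> (2 - p) / (2 powr (2 - p) * C)"
        and sp: "strategy_parameters p C \<kappa> (\<kappa> / 10) A1 A2 h \<epsilon>0 m \<epsilon> \<tau> N"
        and match: "\<And>i. i < m \<Longrightarrow> vertices_on_circle (mesh_layer \<epsilon> \<tau> N \<rho> i) (\<epsilon> (Suc i)) = vertices_on_circle (mesh_layer \<epsilon> \<tau> N \<rho> (Suc i)) (\<epsilon> (Suc i))"
        by (auto simp: strategy_mesh_def)
      have Ch: "C * h \<le> 1"
      proof -
        have "C * h \<le> C * ((2 - p) / (2 powr (2 - p) * C))" using h C0 by (intro mult_left_mono) auto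
        also have "\<dots> = (2 - p) / 2 powr (2 - p)" using C0 by simp
        also have "\<dots> \<le> 1" using p ge_one_powr_ge_zero[of 2 "2 - p"] by (simp add: divide_le_eq)
        finally show ?thesis .
      qed
      note s = strategy_parameters_locale[OF sp p C0 _ _ h(1) e0(1) A12(1)]
      have S: "strategy p C \<kappa> (\<kappa> / 10) A2 h m \<epsilon> \<tau> N" and \<epsilon>0: "\<epsilon> 0 = \<epsilon>0"
        using s \<kappa> A12 by auto
      note me = mesh_energy_estimate[OF r \<kappa> g w S L G Ch match, folded R_def K_def, unfolded \<epsilon>0]
      have gc: "continuous_on {0<..} g"
        by (intro continuous_at_imp_continuous_on ballI DERIV_isCont[OF g(1)]) simp
      note ce = cavity_energy[OF r gc g(3) p(1) w e0]
      define Eh where "Eh = energy p w g (iso_interp (\<Union>i\<le>m. mesh_layer \<epsilon> \<tau> N \<rho> i) (cavity_deformation r)) (\<Union>i\<le>m. region (mesh_layer \<epsilon> \<tau> N \<rho> i))"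
      define E where "E = energy p w g (cavity_deformation r) (annulus \<epsilon>0)"
      have E: "2 * pi * (V * (1 - \<epsilon>0)) \<le> E" unfolding E_def V_def by (rule ce(3))
      then have E0: "0 < E" using V e0 by (smt (verit) mult_pos_pos pi_gt_zero)
      \<comment> \<open>The error bound and the lower bound \<open>E\<close> of the exact energy
        both carry the factor 1 - \<epsilon>0, so the estimate relative to the energy does not
        degenerate as \<epsilon>0 tends to 1.\<close>
      have diff: "\<bar>Eh - E\<bar> \<le> R * K / V * h\<^sup>2 * E"
      proof -
        have "E = 2 * pi * integral {\<epsilon>0..1} (radial_density p w g r r')" unfolding E_def by (rule ce(2))
        then have "\<bar>Eh - E\<bar> \<le> 2 * pi * R * (K * (h\<^sup>2 * (1 - \<epsilon>0)))" unfolding Eh_def by (simp only:) (rule me(4))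
        also have "\<dots> = R * K / V * h\<^sup>2 * (2 * pi * (V * (1 - \<epsilon>0)))" using V by simp
        also have "\<dots> \<le> R * K / V * h\<^sup>2 * E" using E R K V by (intro mult_left_mono) auto
        finally show ?thesis .
      qed
      have \<delta>: "\<exists>\<delta>. \<bar>\<delta>\<bar> \<le> R * K / V * h\<^sup>2 \<and> Eh = E * (1 + \<delta>)"
      proof (intro exI[of _ "(Eh - E) / E"] conjI)
        show "\<bar>(Eh - E) / E\<bar> \<le> R * K / V * h\<^sup>2" using diff E0 by (simp add: abs_divide pos_divide_le_eq)
        show "Eh = E * (1 + (Eh - E) / E)" using E0 by (simp add: field_simps)
      qed
      show "let u = cavity_deformation r;
              L = mesh_layer \<epsilon> \<tau> N \<rho>;
              \<T> = (\<Union>i\<le>m. L i);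
              \<Omega>h = (\<Union>i\<le>m. region (L i));
              \<Pi>u = iso_interp \<T> u
          in (AE x in lebesgue. x \<in> \<Omega>h \<longrightarrow>
                \<Pi>u differentiable (at x) \<and> 0 < det (jacobian \<Pi>u (at x))) \<and>
             finite_energy p w g u (annulus \<epsilon>0) \<and>
             finite_energy p w g \<Pi>u \<Omega>h \<and>
             energy p w g \<Pi>u \<Omega>h = (\<Sum>i\<le>m. energy p w g \<Pi>u (region (L i))) \<and>
             (\<exists>\<delta>. \<bar>\<delta>\<bar> \<le> R * K / V * h\<^sup>2 \<and>
                  energy p w g \<Pi>u \<Omega>h = energy p w g u (annulus \<epsilon>0) * (1 + \<delta>))"
        unfolding Let_def by (intro conjI me(1,2,3) ce(1) \<delta>[unfolded Eh_def E_def])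
    qed
  qed
qed

end
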